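(* Let $q\ge 8$ be a prime power. Let $\mathrm{PG}(6,q)$ have hyperplane at infinity $\Sigma_\infty$ and let $\mathcal S$ be a regular 2-spread in $\Sigma_\infty$. An $r$-dimensional normal rational curve $\mathcal N_r$ of $\mathrm{PG}(6,q)$, $r\le 6$, corresponds via the Bruck-Bose representation to an $\mathbb F_q$-conic of $\mathrm{PG}(2,q^3)$ if and only if $\mathcal N_r$ is 3-special with respect to $\mathcal S$.
   Context: **Normal rational curves.** An $r$-dimensional normal rational curve ($r$-dim nrc) in $\mathrm{PG}(n,q)$ is a set of points lying in an $r$-space and projectively equivalent to $\{(1,\theta,\dots,\theta^r):\theta\in\mathbb F_q\}\cup\{(0,\dots,0,1)\}$. It has a unique natural extension to an $r$-dim nrc over any extension field of $\mathbb F_q$. An $r$-dim nrc not contained in a hyperplane meets that hyperplane in $r$ points, counted with multiplicity and over an extension field. **$\mathbb F_q$-conics.** An $\mathbb F_q$-subplane of $\mathrm{PG}(2,q^3)$ is a subplane of order $q$; an $\mathbb F_q$-conic is a non-degenerate conic of an $\mathbb F_q$-subplane. **Regular 2-spread.** For a point $X$ with coordinates in an extension of $\mathbb F_q$, $X^q$ is obtained by raising coordinates to the $q$-th power. Let $\Sigma_\infty\cong\mathrm{PG}(5,q)$ be embedded in $\mathrm{PG}(5,q^3)$ and $\mathrm{PG}(5,q^6)$. A regular 2-spread $\mathcal S$ of $\Sigma_\infty$ is obtained from a line $g$ of $\mathrm{PG}(5,q^3)$ disjoint from $\Sigma_\infty$ such that $g,g^q,g^{q^2}$ span $\mathrm{PG}(5,q^3)$: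 its elements are the planes $\langle X,X^q,X^{q^2}\rangle\cap\Sigma_\infty$, $X\in g$, and they partition the points of $\Sigma_\infty$. The lines $g,g^q,g^{q^2}$ are the transversal lines of $\mathcal S$; their extensions to $\mathrm{PG}(5,q^6)$ are the extended transversal lines, and the extensions of the planes of $\mathcal S$ to $\mathrm{PG}(5,q^6)$ are the extended planes of $\mathcal S$. **Bruck-Bose representation.** Consider the incidence structure whose points are the points of $\mathrm{PG}(6,q)\setminus\Sigma_\infty$ (affine points) and the planes of $\mathcal S$; whose lines are the 3-spaces of $\mathrm{PG}(6,q)$ not contained in $\Sigma_\infty$ that contain a plane of $\mathcal S$, together with the line at infinity $\ell_\infty$ (the set of planes of $\mathcal S$); incidence is induced by $\mathrm{PG}(6,q)$. It is isomorphic to $\mathrm{PG}(2,q^3)$. A curve $\mathcal N_r$ corresponds via the Bruck-Bose representation to an $\mathbb F_q$-conic $\bar{\mathcal C}$ if the affine points of $\mathcal N_r$ are exactly the points of $\mathrm{PG}(6,q)\setminus\Sigma_\infty$ representing the points of $\bar{\mathcal C}\setminus\ell_\infty$ (linear components contained in $\Sigma_\infty$ are ignored). **$\mathcal S$-good points.** For a point $P$ of $\mathrm{PG}(5,q^6)$: the weight is $w(P)=1$ if $P$ lies on an extended transversal line of $\mathcal S$; $w(P)=2$ if $w(P)\ne1$ and $P$ lies on a line meeting two of the extended transversal lines; $w(P)=3$ otherwise. $o(P)$ is the size of the orbit of $P$ under the collineation $X\mapsto X^q$. $s(P)=1$ if $P$ lies in an extended plane of $\mathcal S$, and $s(P)=2$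 otherwise. $P$ is $\mathcal S$-good if $w(P)\times o(P)=3s(P)$. **3-special.** Let $\mathcal N_r$, $r\le6$, be an $r$-dim nrc of $\mathrm{PG}(6,q)$ not contained in $\Sigma_\infty$, meeting $\Sigma_\infty$ in the $r$ points $P_1,\dots,P_r$ (possibly repeated, possibly in an extension). $\mathcal N_r$ is 3-special with respect to $\mathcal S$ if $w(P_1)+\cdots+w(P_r)=6$ and each $P_i$ is $\mathcal S$-good.
   Formalization: The "if" direction leaves out two cases where it fails: r=2 with N_r inside a 3-space about a plane of S, and r=6 with a repeated point at infinity on a transversal line that is not the tangent of N_r there. The "only if" direction is unrestricted. *)

theory Defs
  imports "HOL-Analysis.Analysis" "HOL-Computational_Algebra.Computational_Algebra"
begin

text \<open>
  All fields live inside one algebraically closed field of characteristic \<open>p\<close>, where \<open>q\<close> is a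
  power of \<open>p\<close>: the field with \<open>q\<^sup>m\<close> elements is the set of roots of \<open>x\<^bsup>q^m\<^esup> = x\<close>.

  A subspace of \<open>PG(n, q\<^sup>m)\<close> of projective dimension \<open>k\<close> is represented by the vector subspace, of
  dimension \<open>k + 1\<close> over the algebraically closed field, that its points span. A subspace and its
  extensions to larger fields are thus the same object; what depends on the field is the set
  \<open>pg_points\<close> of its points. A point is a one-dimensional vector subspace, and lies on a subspace
  iff it is contained in it.
\<close>

definition GFq :: "nat \<Rightarrow> nat \<Rightarrow> 'a::field set" where
  "GFq q m = {x. x ^ (q ^ m) = x}"

definition rat_vecs :: "nat \<Rightarrow> nat \<Rightarrow> ('a::field ^ 'n) set" where
  "rat_vecs q m = {v. \<forall>i. v $ i \<in> GFq q m}"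

definition rat_subspace :: "nat \<Rightarrow> nat \<Rightarrow> ('a::field ^ 'n) set \<Rightarrow> bool" where
  "rat_subspace q m U \<longleftrightarrow> (\<exists>B \<subseteq> rat_vecs q m. U = vec.span B)"

definition pg_points :: "nat \<Rightarrow> nat \<Rightarrow> ('a::field ^ 'n) set \<Rightarrow> ('a ^ 'n) set set" where
  "pg_points q m U = {vec.span {v} | v. v \<in> U \<and> v \<in> rat_vecs q m \<and> v \<noteq> 0}"

definition pg_lines :: "nat \<Rightarrow> nat \<Rightarrow> ('a::field ^ 'n) set set set" where
  "pg_lines q m = {pg_points q m U | U. rat_subspace q m U \<and> vec.dim U = 2}"

definition frob :: "nat \<Rightarrow> 'a::field ^ 'n \<Rightarrow> 'a ^ 'n" where
  "frob q v = (\<chi> i. (v $ i) ^ q)"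

definition conj_space :: "nat \<Rightarrow> ('a::field ^ 'n) set \<Rightarrow> ('a ^ 'n) set" where
  "conj_space q U = frob q ` U"


section \<open>Incidence structures, subplanes and conics\<close>

definition incidence_iso ::
  "('p \<Rightarrow> 'r) \<Rightarrow> 'p set \<Rightarrow> 'p set set \<Rightarrow> 'r set \<Rightarrow> 'r set set \<Rightarrow> bool" where
  "incidence_iso f Pts Lns Pts' Lns' \<longleftrightarrow> bij_betw f Pts Pts' \<and> (\<lambda>l. f ` l) ` Lns = Lns'"

definition proj_plane :: "nat \<Rightarrow> 'p set \<Rightarrow> 'p set set \<Rightarrow> bool" where
  "proj_plane k Pts Lns \<longleftrightarrow>
     (\<forall>l\<in>Lns. l \<subseteq> Pts \<and> card l = k + 1) \<and>
     (\<forall>P\<in>Pts. \<forall>Q\<in>Pts. P \<noteq> Q \<longrightarrow> (\<exists>!l. l \<in> Lns \<and> P \<in> l \<and> Q \<in> l)) \<and>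
     (\<forall>l\<in>Lns. \<forall>m\<in>Lns. l \<noteq> m \<longrightarrow> (\<exists>!P. P \<in> l \<and> P \<in> m)) \<and>
     (\<exists>Q\<subseteq>Pts. card Q = 4 \<and> (\<forall>l\<in>Lns. card (l \<inter> Q) \<le> 2))"

definition induced_lines :: "'p set \<Rightarrow> 'p set set \<Rightarrow> 'p set set" where
  "induced_lines B Lns = {l \<inter> B | l. l \<in> Lns \<and> card (l \<inter> B) \<ge> 2}"

definition Fq_subplane :: "nat \<Rightarrow> ('a::field ^ 3) set set \<Rightarrow> bool" where
  "Fq_subplane q B \<longleftrightarrow>
     B \<subseteq> pg_points q 3 UNIV \<and> proj_plane q B (induced_lines B (pg_lines q 3))"

definition quad_form :: "'a::field ^ 3 ^ 3 \<Rightarrow> 'a ^ 3 \<Rightarrow> 'a" where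
  "quad_form A x = (\<Sum>i\<in>UNIV. \<Sum>j\<in>UNIV. A $ i $ j * (x $ i) * (x $ j))"

text \<open>
  A quadratic form is non-degenerate if its zero set has no singular point, that is, no zero of
  the form that also lies in the radical of the polar form. Unlike the condition \<open>det A \<noteq> 0\<close>,
  this is correct in characteristic two and does not require \<open>A\<close> to be symmetric.
\<close>

definition nondegenerate_form :: "'a::field ^ 3 ^ 3 \<Rightarrow> bool" where
  "nondegenerate_form A \<longleftrightarrow>
     (\<forall>x. quad_form A x = 0 \<and> (\<forall>y. quad_form A (x + y) = quad_form A x + quad_form A y)
        \<longrightarrow> x = 0)"

definition nondegenerate_conic :: "nat \<Rightarrow> ('a::field ^ 3) set set \<Rightarrow> bool" where
  "nondegenerate_conic q C \<longleftrightarrow>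
     (\<exists>A. (\<forall>i j. A $ i $ j \<in> GFq q 1) \<and> nondegenerate_form A \<and>
          C = {vec.span {v} | v. v \<in> rat_vecs q 1 \<and> v \<noteq> 0 \<and> quad_form A v = 0})"

text \<open>
  A conic of a subplane \<open>B\<close> of order \<open>q\<close> is defined through an isomorphism of \<open>PG(2,q)\<close> with \<open>B\<close>.
\<close>

definition Fq_conic :: "nat \<Rightarrow> ('a::field ^ 3) set set \<Rightarrow> bool" where
  "Fq_conic q C \<longleftrightarrow>
     (\<exists>B \<psi> C\<^sub>0. Fq_subplane q B \<and>
        incidence_iso \<psi> (pg_points q 1 UNIV) (pg_lines q 1) B (induced_lines B (pg_lines q 3)) \<and>
        nondegenerate_conic q (C\<^sub>0 :: ('a ^ 3) set set) \<and> C = \<psi> ` C\<^sub>0)"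


section \<open>Regular 2-spreads and the Bruck-Bose representation\<close>

text \<open>The hyperplane at infinity is given by its coordinate vector \<open>h\<close>.\<close>

definition hyperplane :: "'a::field ^ 7 \<Rightarrow> ('a ^ 7) set" where
  "hyperplane h = {v. (\<Sum>i\<in>UNIV. h $ i * v $ i) = 0}"

definition spread_line :: "nat \<Rightarrow> 'a::field ^ 7 \<Rightarrow> ('a ^ 7) set \<Rightarrow> bool" where
  "spread_line q h g \<longleftrightarrow>
     rat_subspace q 3 g \<and> vec.dim g = 2 \<and> g \<subseteq> hyperplane h \<and>
     pg_points q 1 g = {} \<and>
     vec.span (g \<union> conj_space q g \<union> conj_space q (conj_space q g)) = hyperplane h"

definition regular_spread :: "nat \<Rightarrow> ('a::field ^ 7) set \<Rightarrow> ('a ^ 7) set set" where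
  "regular_spread q g =
     {vec.span (X \<union> conj_space q X \<union> conj_space q (conj_space q X)) | X. X \<in> pg_points q 3 g}"

definition transversals :: "nat \<Rightarrow> ('a::field ^ 7) set \<Rightarrow> ('a ^ 7) set set" where
  "transversals q g = {g, conj_space q g, conj_space q (conj_space q g)}"

definition affine_points :: "nat \<Rightarrow> 'a::field ^ 7 \<Rightarrow> ('a ^ 7) set set" where
  "affine_points q h = {P \<in> pg_points q 1 UNIV. \<not> P \<subseteq> hyperplane h}"

definition bb_points :: "nat \<Rightarrow> 'a::field ^ 7 \<Rightarrow> ('a ^ 7) set \<Rightarrow> ('a ^ 7) set set" where
  "bb_points q h g = affine_points q h \<union> regular_spread q g"

text \<open>The 3-spaces of \<open>PG(6,q)\<close> that represent the affine lines.\<close>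

definition bb_solid :: "nat \<Rightarrow> 'a::field ^ 7 \<Rightarrow> ('a ^ 7) set \<Rightarrow> ('a ^ 7) set \<Rightarrow> bool" where
  "bb_solid q h g T \<longleftrightarrow>
     rat_subspace q 1 T \<and> vec.dim T = 4 \<and> \<not> T \<subseteq> hyperplane h \<and>
     (\<exists>\<pi>\<in>regular_spread q g. \<pi> \<subseteq> T)"

definition bb_lines :: "nat \<Rightarrow> 'a::field ^ 7 \<Rightarrow> ('a ^ 7) set \<Rightarrow> ('a ^ 7) set set set" where
  "bb_lines q h g =
     insert (regular_spread q g) {{P \<in> bb_points q h g. P \<subseteq> T} | T. bb_solid q h g T}"

definition bb_iso ::
  "nat \<Rightarrow> 'a::field ^ 7 \<Rightarrow> ('a ^ 7) set \<Rightarrow> (('a ^ 7) set \<Rightarrow> ('a ^ 3) set) \<Rightarrow> bool" where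
  "bb_iso q h g \<phi> \<longleftrightarrow>
     incidence_iso \<phi> (bb_points q h g) (bb_lines q h g) (pg_points q 3 UNIV) (pg_lines q 3)"

text \<open>
  The affine point \<open>P\<close> of \<open>PG(6,q)\<close> represents the point \<open>\<phi> P\<close> of \<open>PG(2,q\<^sup>3)\<close>, and the line at
  infinity of \<open>PG(2,q\<^sup>3)\<close> is \<open>\<phi> ` regular_spread q g\<close>.
\<close>

definition corresponds_to_Fq_conic ::
  "nat \<Rightarrow> 'a::field ^ 7 \<Rightarrow> ('a ^ 7) set \<Rightarrow> (('a ^ 7) set \<Rightarrow> ('a ^ 3) set) \<Rightarrow> ('a ^ 7) set set \<Rightarrow> bool"
where
  "corresponds_to_Fq_conic q h g \<phi> N \<longleftrightarrow>
     (\<exists>C. Fq_conic q C \<and>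
        {P \<in> N. \<not> P \<subseteq> hyperplane h} =
        {P \<in> affine_points q h. \<phi> P \<in> C - \<phi> ` regular_spread q g})"


section \<open>Normal rational curves\<close>

text \<open>
  Vectors \<open>b 0, \<dots>, b r\<close> spanning an \<open>r\<close>-space fix the projectivity that carries the standard curve
  \<open>{(1, \<theta>, \<dots>, \<theta>\<^sup>r)} \<union> {(0, \<dots>, 0, 1)}\<close> of \<open>PG(r,q)\<close> to a curve in that \<open>r\<close>-space.
\<close>

definition nrc_frame :: "nat \<Rightarrow> nat \<Rightarrow> (nat \<Rightarrow> 'a::field ^ 'n) \<Rightarrow> bool" where
  "nrc_frame q r b \<longleftrightarrow>
     (\<forall>i\<le>r. b i \<in> rat_vecs q 1) \<and> inj_on b {..r} \<and> vec.independent (b ` {..r})"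

definition nrc_point :: "nat \<Rightarrow> (nat \<Rightarrow> 'a::field ^ 'n) \<Rightarrow> 'a \<Rightarrow> ('a ^ 'n) set" where
  "nrc_point r b \<theta> = vec.span {\<Sum>i\<le>r. \<theta> ^ i *s b i}"

definition nrc_points :: "nat \<Rightarrow> nat \<Rightarrow> (nat \<Rightarrow> 'a::field ^ 'n) \<Rightarrow> ('a ^ 'n) set set" where
  "nrc_points q r b = nrc_point r b ` GFq q 1 \<union> {vec.span {b r}}"

definition is_nrc :: "nat \<Rightarrow> nat \<Rightarrow> ('a::field ^ 'n) set set \<Rightarrow> bool" where
  "is_nrc q r N \<longleftrightarrow> (\<exists>b. nrc_frame q r b \<and> N = nrc_points q r b)"

text \<open>
  The points in which the extended curve meets a hyperplane, with multiplicities: the point with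
  parameter \<open>\<theta>\<close> lies on the hyperplane iff \<open>\<theta>\<close> is a root of the polynomial below, and the point
  \<open>b r\<close> (parameter infinity) takes up the difference between \<open>r\<close> and the degree.
\<close>

definition nrc_poly :: "nat \<Rightarrow> (nat \<Rightarrow> 'a::field ^ 7) \<Rightarrow> 'a ^ 7 \<Rightarrow> 'a poly" where
  "nrc_poly r b h = (\<Sum>k\<le>r. monom (\<Sum>i\<in>UNIV. h $ i * b k $ i) k)"

definition nrc_at_infinity ::
  "nat \<Rightarrow> (nat \<Rightarrow> 'a::field ^ 7) \<Rightarrow> 'a ^ 7 \<Rightarrow> ('a ^ 7) set multiset" where
  "nrc_at_infinity r b h =
     image_mset (nrc_point r b) (proots (nrc_poly r b h)) +
     replicate_mset (r - degree (nrc_poly r b h)) (vec.span {b r})"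


section \<open>Weights, good points and 3-special curves\<close>

definition weight :: "nat \<Rightarrow> ('a::field ^ 7) set \<Rightarrow> ('a ^ 7) set \<Rightarrow> nat" where
  "weight q g P =
     (if \<exists>t\<in>transversals q g. P \<subseteq> t then 1
      else if \<exists>l. rat_subspace q 6 l \<and> vec.dim l = 2 \<and> P \<subseteq> l \<and>
                  (\<exists>t\<in>transversals q g. \<exists>t'\<in>transversals q g. t \<noteq> t' \<and>
                     pg_points q 6 (l \<inter> t) \<noteq> {} \<and> pg_points q 6 (l \<inter> t') \<noteq> {}) then 2
      else 3)"

definition orbit_size :: "nat \<Rightarrow> ('a::field ^ 7) set \<Rightarrow> nat" where
  "orbit_size q P = card (range (\<lambda>k. (conj_space q ^^ k) P))"

definition spread_index :: "nat \<Rightarrow> ('a::field ^ 7) set \<Rightarrow> ('a ^ 7) set \<Rightarrow> nat" where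
  "spread_index q g P = (if \<exists>\<pi>\<in>regular_spread q g. P \<subseteq> \<pi> then 1 else 2)"

definition good_point :: "nat \<Rightarrow> 'a::field ^ 7 \<Rightarrow> ('a ^ 7) set \<Rightarrow> ('a ^ 7) set \<Rightarrow> bool" where
  "good_point q h g P \<longleftrightarrow>
     P \<in> pg_points q 6 (hyperplane h) \<and>
     weight q g P * orbit_size q P = 3 * spread_index q g P"

text \<open>
  The frame \<open>b\<close> of a curve \<open>N\<close> is not unique, but the extension of \<open>N\<close> is, and with it the multiset
  of points at infinity.
\<close>

definition three_special ::
  "nat \<Rightarrow> 'a::field ^ 7 \<Rightarrow> ('a ^ 7) set \<Rightarrow> nat \<Rightarrow> ('a ^ 7) set set \<Rightarrow> bool" where
  "three_special q h g r N \<longleftrightarrow>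
     \<not> \<Union>N \<subseteq> hyperplane h \<and>
     (\<exists>b. nrc_frame q r b \<and> N = nrc_points q r b \<and>
        (\<Sum>P\<in>#nrc_at_infinity r b h. weight q g P) = 6 \<and>
        (\<forall>P\<in>#nrc_at_infinity r b h. good_point q h g P))"


section \<open>Exceptional curves\<close>

text \<open>
  Two kinds of 3-special curves do not correspond to an \<open>F\<^sub>q\<close>-conic.

  \<^item> A conic in a solid \<open>T\<close> with \<open>bb_solid q h g T\<close> that meets the spread plane in \<open>T\<close> in two points
    of \<open>PG(6,q)\<close>, or touches it at one. These points have weight 3 and orbit size 1 and lie in a
    spread plane, but the affine points of the curve represent collinear points of \<open>PG(2,q\<^sup>3)\<close>.

  \<^item> A 6-dimensional curve with three double points at infinity, conjugate points of the three
    transversal lines, whose tangents there are not the transversal lines. All weights are 1, all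
    orbits have size 3 and all points lie in a spread plane; but for the curve of a conic that is
    tangent to the line at infinity, the transversal lines are the tangents.
\<close>

definition lies_in_bb_solid ::
  "nat \<Rightarrow> 'a::field ^ 7 \<Rightarrow> ('a ^ 7) set \<Rightarrow> ('a ^ 7) set set \<Rightarrow> bool" where
  "lies_in_bb_solid q h g N \<longleftrightarrow> (\<exists>T. bb_solid q h g T \<and> \<Union>N \<subseteq> T)"

definition nrc_tangent :: "nat \<Rightarrow> (nat \<Rightarrow> 'a::field ^ 'n) \<Rightarrow> 'a \<Rightarrow> ('a ^ 'n) set" where
  "nrc_tangent r b \<theta> =
     vec.span {\<Sum>i\<le>r. \<theta> ^ i *s b i, \<Sum>i\<le>r. (of_nat i * \<theta> ^ (i - 1)) *s b i}"

text \<open>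
  The parameter infinity needs no attention here: its point is one of \<open>PG(6,q)\<close> and so lies on no
  transversal line.
\<close>

definition improper_tangent ::
  "nat \<Rightarrow> 'a::field ^ 7 \<Rightarrow> ('a ^ 7) set \<Rightarrow> nat \<Rightarrow> ('a ^ 7) set set \<Rightarrow> bool" where
  "improper_tangent q h g r N \<longleftrightarrow>
     (\<exists>b \<theta>. nrc_frame q r b \<and> N = nrc_points q r b \<and>
        count (proots (nrc_poly r b h)) \<theta> \<ge> 2 \<and>
        (\<exists>t\<in>transversals q g. nrc_point r b \<theta> \<subseteq> t \<and> nrc_tangent r b \<theta> \<noteq> t))"

end

theory Submission
  imports Defs
begin

text \<open>
  Vectors of \<open>PG(6,q)\<close> are identified with vectors \<open>(x\<^sub>1, x\<^sub>2, x\<^sub>3)\<close> over the field of order \<open>q\<^sup>3\<close> with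
  \<open>x\<^sub>1\<close> in the field of order \<open>q\<close>, the hyperplane at infinity being \<open>x\<^sub>1 = 0\<close> and the spread planes the
  lines over the cubic field in it. Over the algebraic closure this becomes a linear map \<open>c\<close> together
  with its two conjugates \<open>c1\<close> and \<open>c2\<close>; two of them vanish on each transversal line, so the weight of a
  point at infinity is the number of them that do not vanish. The Bruck-Bose plane is \<open>PG(2,q\<^sup>3)\<close> via
  \<open>c\<close>, and by the fundamental theorem the \<open>F\<^sub>q\<close>-conics are the images of \<open>(s\<^sup>2, st, t\<^sup>2)\<close> under invertible
  matrices over the cubic field.

  A 3-special curve has coordinates \<open>c\<close> with a common factor of degree \<open>r - 2\<close>, since exactly two of its
  points at infinity (with multiplicity) are not in the kernel of \<open>c\<close>; what remains is a quadratic
  parametrization, that is, a conic, unless its three coordinates are dependent, and then the curve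
  lies in a solid. The tangent condition is what makes a double point on a kernel line of \<open>c\<close> a double
  root of the common factor. Conversely, if \<open>f\<close> is the first coordinate of the conic, with roots \<open>x\<close> and \<open>y\<close>,
  multiplying all coordinates by the product \<open>G\<close> of the conjugates of \<open>f\<close>, after removal of common
  factors, gives a rational curve in \<open>PG(6,q)\<close> through all affine points of the conic. A normal
  rational curve is determined by these, so this is the given one, and its points at infinity have the
  parameters \<open>x\<close>, \<open>y\<close> and the roots of \<open>G\<close>.
\<close>

text \<open>Frobenius cycles \<open>c\<close>, \<open>c1\<close>, \<open>c2\<close> and permutes the
  parameters at infinity. So each map is nonzero at equally many of them, and a weight sum of 6
  leaves 6 / 3 = 2 for \<open>c\<close>. Goodness of the points enters by parity: if the coordinates
  are dependent and r = 3, the three points lie in one spread plane, where good points have weight 1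
  or 3, and three odd numbers do not add up to 6. The obstacle in the converse is that a curve is
  given only as a set of points and has to be recognized from its affine ones. A curve of dimension
  d is determined by d + 3 points. The curve built from \<open>G\<close> has d = deg G + 2, and at
  most 4 - deg G rational parameters are lost at infinity, so q - 3 + deg G common points are
  certain; this bound reaches d + 3 exactly when q is at least 8. The shape of \<open>G\<close>
  depends on how Frobenius moves the two roots, whence a case distinction.\<close>

no_notation fps_nth (infixl \<open>$\<close> 75)

section \<open>Finite fields inside an algebraically closed field\<close>

locale frobenius_field =
  fixes q :: nat and K :: "'a::alg_closed_field itself"
  assumes prime_char: "prime CHAR('a)" and q_power: "\<exists>e>0. q = CHAR('a) ^ e" and q_ge: "q \<ge> 8"
begin

lemma q_pos [simp]: "q > 0" "q \<noteq> 0"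
  using q_ge by auto

lemma pow_q_char: "\<exists>e. q ^ m = CHAR('a) ^ e"
  using q_power by (metis power_mult)

lemma pow_add: "(x + y :: 'a) ^ (q ^ m) = x ^ (q ^ m) + y ^ (q ^ m)"
  using freshmans_dream'[OF prime_char] pow_q_char by blast

lemma pow_sum: "(\<Sum>i\<in>A. f i :: 'a) ^ (q ^ m) = (\<Sum>i\<in>A. f i ^ (q ^ m))"
  by (induction A rule: infinite_finite_induct) (auto simp: pow_add power_0_left)

lemma pow_minus: "(- x :: 'a) ^ (q ^ m) = - (x ^ (q ^ m))"
  using pow_add[of x "-x" m] by (simp add: power_0_left eq_neg_iff_add_eq_0 add.commute)

lemma pow_diff: "(x - y :: 'a) ^ (q ^ m) = x ^ (q ^ m) - y ^ (q ^ m)"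
  using pow_add[of x "-y" m] by (simp add: pow_minus)

lemmas q_add = pow_add[of _ _ 1, simplified]
  and q_sum = pow_sum[of _ _ 1, simplified]
  and q_minus = pow_minus[of _ 1, simplified]
  and q_diff = pow_diff[of _ _ 1, simplified]

lemma pow_inj: "(x :: 'a) ^ (q ^ m) = y ^ (q ^ m) \<longleftrightarrow> x = y"
  using pow_diff[of x y m] by auto

lemmas q_inj = pow_inj[of _ 1, simplified]

lemma pow_surj: "\<exists>y. (y :: 'a) ^ (q ^ m) = x"
  by (rule nth_root_exists) simp

lemmas q_surj = pow_surj[of 1, simplified]

lemma GFq_iff: "x \<in> GFq q m \<longleftrightarrow> x ^ (q ^ m) = (x :: 'a)"
  by (simp add: GFq_def)

lemma GFq_closed:
  fixes x y :: 'a
  shows "0 \<in> (GFq q m :: 'a set)" "1 \<in> (GFq q m :: 'a set)"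
    "x \<in> GFq q m \<Longrightarrow> y \<in> GFq q m \<Longrightarrow> x + y \<in> GFq q m"
    "x \<in> GFq q m \<Longrightarrow> y \<in> GFq q m \<Longrightarrow> x - y \<in> GFq q m"
    "x \<in> GFq q m \<Longrightarrow> y \<in> GFq q m \<Longrightarrow> x * y \<in> GFq q m"
    "x \<in> GFq q m \<Longrightarrow> y \<in> GFq q m \<Longrightarrow> x / y \<in> GFq q m"
    "x \<in> GFq q m \<Longrightarrow> - x \<in> GFq q m"
    "x \<in> GFq q m \<Longrightarrow> inverse x \<in> GFq q m"
    "x \<in> GFq q m \<Longrightarrow> x ^ n \<in> GFq q m"
  by (auto simp: GFq_iff power_0_left pow_add pow_diff pow_minus power_mult_distrib power_divide
      power_inverse) (metis power_commutes power_mult mult.commute)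

lemma GFq_sum: "(\<And>i. i \<in> A \<Longrightarrow> f i \<in> GFq q m) \<Longrightarrow> (\<Sum>i\<in>A. f i :: 'a) \<in> GFq q m"
  by (induction A rule: infinite_finite_induct) (auto intro: GFq_closed)

lemma GFq_of_nat: "(of_nat n :: 'a) \<in> GFq q m"
  by (induction n) (auto intro: GFq_closed)

lemma GFq_numeral: "(numeral n :: 'a) \<in> GFq q m"
  using GFq_of_nat[of "numeral n" m] by simp

lemma GFq_mono:
  assumes "m dvd n"
  shows "(GFq q m :: 'a set) \<subseteq> GFq q n"
proof -
  obtain k where n: "n = m * k"
    using assms by blast
  have "x ^ (q ^ (m * k)) = x" if "x ^ (q ^ m) = x" for x :: 'a
    using that by (induction k) (auto simp: power_add power_mult)
  then show ?thesis
    unfolding n by (auto simp: GFq_iff)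
qed

lemma GFq_1_subset: "x \<in> GFq q 1 \<Longrightarrow> (x :: 'a) \<in> GFq q m"
  using GFq_mono[of 1 m] by auto

text \<open>The polynomial x^(q^m) - x has derivative -1, so all its roots are simple and there are
  as many of them as its degree.\<close>

lemma card_GFq:
  assumes "m > 0"
  shows "card (GFq q m :: 'a set) = q ^ m" "finite (GFq q m :: 'a set)"
proof -
  define p :: "'a poly" where "p = monom 1 (q ^ m) - monom 1 1"
  have q1: "q ^ m > 1"
    using assms q_ge by (intro one_less_power) auto
  have coeff_q: "coeff p (q ^ m) = 1"
    using q1 by (simp add: p_def)
  have "degree p \<le> q ^ m"
    unfolding p_def by (intro degree_diff_le) (use q1 in \<open>auto simp: degree_monom_eq\<close>)
  then have deg: "degree p = q ^ m"
    using coeff_q by (metis le_antisym le_degree zero_neq_one)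
  have p0: "p \<noteq> 0"
    using coeff_q by auto
  obtain A where A: "size A = degree p" "p = smult (lead_coeff p) (\<Prod>x\<in>#A. [:-x, 1:])"
    using alg_closed_imp_factorization[OF p0] by blast
  have rts: "poly p x = 0 \<longleftrightarrow> x \<in> GFq q m" for x
    by (simp add: p_def poly_monom GFq_iff)
  have p_root: "poly p x = 0 \<longleftrightarrow> x \<in># A" for x
    using p0 by (subst A(2)) (auto simp: poly_prod_mset)
  have "(of_nat (q ^ m) :: 'a) = 0"
    using pow_q_char[of m] q1 of_nat_CHAR[where 'a = 'a]
    by (metis nat_less_le of_nat_power power_0 power_eq_0_iff zero_less_iff_neq_zero)
  then have pd: "pderiv p = -1"
    using q1 unfolding p_def
    by (simp add: pderiv_diff pderiv_monom monom_0 flip: one_pCons)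
  have "count A x \<le> 1" for x
  proof (rule ccontr)
    assume "\<not> count A x \<le> 1"
    then have "replicate_mset 2 x \<subseteq># A"
      by (simp flip: count_le_replicate_mset_subset_eq)
    then obtain B where "A = replicate_mset 2 x + B"
      using mset_subset_eq_exists_conv by blast
    then have "A = {#x, x#} + B"
      by (simp add: numeral_2_eq_2)
    then have p_eq: "p = [:-x, 1:] * ([:-x, 1:] * smult (lead_coeff p) (\<Prod>x\<in>#B. [:-x, 1:]))"
      using A(2) by (metis (no_types, lifting) image_mset_add_mset image_mset_union mult.assoc
          mult_smult_right prod_mset.add_mset prod_mset.union add_mset_add_single union_mset_add_mset_left
          add_0)
    define r where "r = smult (lead_coeff p) (\<Prod>x\<in>#B. [:-x, 1:])"
    have "p = [:-x, 1:] * ([:-x, 1:] * r)"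
      using p_eq unfolding r_def .
    then have "pderiv p = [:-x, 1:] * (pderiv ([:-x, 1:] * r) + r * pderiv [:-x, 1:])"
      by (simp only: pderiv_mult[of "[:-x, 1:]" "[:-x, 1:] * r"] distrib_left mult.assoc)
    then have "poly (pderiv p) x = 0"
      by (simp only: poly_mult) simp
    then show False
      by (simp add: pd)
  qed
  then have "count A x = count (mset_set (set_mset A)) x" for x
    by (cases "x \<in># A") (auto simp: le_antisym Suc_le_eq not_in_iff)
  then have "A = mset_set (set_mset A)"
    by (rule multiset_eqI)
  then have "size A = card (set_mset A)"
    by (metis size_mset_set)
  moreover have "set_mset A = GFq q m"
    using rts p_root by auto
  ultimately show "card (GFq q m :: 'a set) = q ^ m" "finite (GFq q m :: 'a set)"
    using A(1) deg by (metis, metis finite_set_mset)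
qed

lemmas finite_F = card_GFq(2)[of 1, simplified]
  and card_F = card_GFq(1)[of 1, simplified]

lemma ex_GFq_diff: "\<exists>\<gamma> :: 'a. \<gamma> \<in> GFq q 3 \<and> \<gamma> \<notin> GFq q 1"
proof (rule ccontr)
  assume "\<not> ?thesis"
  then have "(GFq q 3 :: 'a set) \<subseteq> GFq q 1"
    by auto
  then have "q ^ 3 \<le> q ^ 1"
    using card_GFq[of 3] card_GFq[of 1] card_mono[of "GFq q 1 :: 'a set" "GFq q 3"] by simp
  then show False
    using q_ge power_strict_increasing[of 1 3 q] by simp
qed

section \<open>Frobenius on vectors and subspaces\<close>

lemma frob_nth [simp]: "frob q v $ i = (v $ i) ^ q"
  by (simp add: frob_def)

lemma frob_add: "frob q (u + v :: 'a ^ 'n) = frob q u + frob q v"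
  by (simp add: vec_eq_iff q_add)

lemma frob_scale: "frob q (k *s v :: 'a ^ 'n) = k ^ q *s frob q v"
  by (simp add: vec_eq_iff power_mult_distrib)

lemma frob_0 [simp]: "frob q (0 :: 'a ^ 'n) = 0"
  by (simp add: vec_eq_iff power_0_left)

lemma frob_sum: "frob q (\<Sum>i\<in>A. f i :: 'a ^ 'n) = (\<Sum>i\<in>A. frob q (f i))"
  by (induction A rule: infinite_finite_induct) (auto simp: frob_add)

lemma frob_inj: "frob q (u :: 'a ^ 'n) = frob q v \<longleftrightarrow> u = v"
  by (simp add: vec_eq_iff q_inj)

lemma frob_eq_0 [simp]: "frob q (u :: 'a ^ 'n) = 0 \<longleftrightarrow> u = 0"
  using frob_inj[of u 0] by simp

lemma frob_surj: "\<exists>v :: 'a ^ 'n. frob q v = u"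
proof -
  have "\<forall>i. \<exists>x. x ^ q = u $ i"
    using q_surj by blast
  then obtain f where "\<And>i. f i ^ q = u $ i"
    by metis
  then have "frob q (\<chi> i. f i) = u"
    by (simp add: vec_eq_iff)
  then show ?thesis ..
qed

lemma funpow_frob_nth: "(frob q ^^ k) v $ i = (v $ i :: 'a) ^ (q ^ k)"
  by (induction k arbitrary: v) (auto simp: power_mult mult.commute simp flip: power_mult)

lemma rat_vecs_iff: "v \<in> rat_vecs q m \<longleftrightarrow> (frob q ^^ m) v = (v :: 'a ^ 'n)"
  by (auto simp: rat_vecs_def GFq_iff vec_eq_iff funpow_frob_nth)

lemma rat_vecs_1: "v \<in> rat_vecs q 1 \<longleftrightarrow> frob q v = (v :: 'a ^ 'n)"
  using rat_vecs_iff[of v 1] by simp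

lemma rat_vecs_3: "v \<in> rat_vecs q 3 \<longleftrightarrow> frob q (frob q (frob q v)) = (v :: 'a ^ 'n)"
  using rat_vecs_iff[of v 3] by (simp add: eval_nat_numeral)

lemma rat_vecs_mono: "m dvd n \<Longrightarrow> v \<in> rat_vecs q m \<Longrightarrow> (v :: 'a ^ 'n) \<in> rat_vecs q n"
  using GFq_mono unfolding rat_vecs_def by blast

lemma rat_vecs_add: "u \<in> rat_vecs q m \<Longrightarrow> v \<in> rat_vecs q m \<Longrightarrow> (u + v :: 'a ^ 'n) \<in> rat_vecs q m"
  by (auto simp: rat_vecs_def intro: GFq_closed)

lemma rat_vecs_diff: "u \<in> rat_vecs q m \<Longrightarrow> v \<in> rat_vecs q m \<Longrightarrow> (u - v :: 'a ^ 'n) \<in> rat_vecs q m"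
  by (auto simp: rat_vecs_def intro: GFq_closed)

lemma rat_vecs_scale: "k \<in> GFq q m \<Longrightarrow> v \<in> rat_vecs q m \<Longrightarrow> (k *s v :: 'a ^ 'n) \<in> rat_vecs q m"
  by (auto simp: rat_vecs_def intro: GFq_closed)

lemma rat_vecs_0: "(0 :: 'a ^ 'n) \<in> rat_vecs q m"
  by (auto simp: rat_vecs_def intro: GFq_closed)

lemma rat_vecs_sum: "(\<And>i. i \<in> A \<Longrightarrow> f i \<in> rat_vecs q m) \<Longrightarrow> (\<Sum>i\<in>A. f i :: 'a ^ 'n) \<in> rat_vecs q m"
  by (induction A rule: infinite_finite_induct) (auto intro: rat_vecs_0 rat_vecs_add)

text \<open>Frobenius is only semilinear; a scalar is carried through it by a q-th root, which
  exists in an algebraically closed field.\<close>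

lemma conj_space_span: "conj_space q (vec.span S) = vec.span (frob q ` S :: ('a ^ 'n) set)"
proof (intro equalityI subsetI)
  fix y assume "y \<in> conj_space q (vec.span S)"
  then obtain x where x: "x \<in> vec.span S" "y = frob q x"
    by (auto simp: conj_space_def)
  from x(1) have "frob q x \<in> vec.span (frob q ` S)"
    by (induction rule: vec.span_induct_alt)
      (auto simp: frob_add frob_scale intro: vec.span_add vec.span_scale vec.span_base vec.span_zero)
  then show "y \<in> vec.span (frob q ` S)"
    by (simp add: x)
next
  fix y assume "y \<in> vec.span (frob q ` S)"
  then show "y \<in> conj_space q (vec.span S)"
  proof (induction rule: vec.span_induct_alt)
    case base
    show ?case
      unfolding conj_space_def by (rule image_eqI[of _ _ 0]) (auto intro: vec.span_zero)
  next
    case (step k x y)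
    obtain k' where k': "k' ^ q = k"
      using q_surj by blast
    obtain x' where "x' \<in> S" "x = frob q x'"
      using step by auto
    moreover obtain y' where "y' \<in> vec.span S" "y = frob q y'"
      using step by (auto simp: conj_space_def)
    ultimately show ?case
      unfolding conj_space_def using k'
      by (intro image_eqI[of _ _ "k' *s x' + y'"])
        (auto simp: frob_add frob_scale intro: vec.span_add vec.span_scale vec.span_base)
  qed
qed

end

section \<open>Points, lines and collineations\<close>

lemma span2_iff: "x \<in> vec.span {u, v} \<longleftrightarrow> (\<exists>a b. x = a *s u + b *s (v :: 'a::field ^ 'n))"
proof
  assume "x \<in> vec.span {u, v}"
  then obtain a where "x - a *s u \<in> vec.span {v}"
    by (auto simp: vec.span_breakdown_eq)
  then obtain b where "x - a *s u = b *s v"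
    by (auto simp: vec.span_singleton)
  then have "x = a *s u + b *s v"
    by (simp add: algebra_simps)
  then show "\<exists>a b. x = a *s u + b *s v"
    by blast
qed (auto intro: vec.span_add vec.span_scale vec.span_base)

lemma in_span1_iff: "x \<in> vec.span {u} \<longleftrightarrow> (\<exists>a. x = a *s (u :: 'a::field ^ 'n))"
  by (auto simp: vec.span_singleton)

lemma span1_eqI: "x \<in> vec.span {u} \<Longrightarrow> x \<noteq> 0 \<Longrightarrow> vec.span {x} = vec.span {u :: 'a::field ^ 'n}"
  unfolding vec.span_eq by (auto simp: in_span1_iff) (metis vector_smult_assoc left_inverse vector_smult_lid vector_smult_lzero)

lemma span1_eq_iff:
  "u \<noteq> 0 \<Longrightarrow> vec.span {u} = vec.span {v} \<longleftrightarrow> (\<exists>k. k \<noteq> 0 \<and> u = k *s (v :: 'a::field ^ 'n))"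
  by (metis in_span1_iff span1_eqI vec.span_base singletonI vector_smult_lzero)

lemma span1_scale: "k \<noteq> 0 \<Longrightarrow> vec.span {k *s v} = vec.span {v :: 'a::field ^ 'n}"
  by (cases "v = 0") (auto simp: span1_eq_iff)

lemma span_subset_iff: "vec.span {v} \<subseteq> U \<longleftrightarrow> v \<in> U" if "vec.subspace U" for v :: "'a::field ^ 'n"
  using that by (meson empty_subsetI insert_subset vec.span_base vec.span_minimal singletonI subset_iff)

lemma dim_span2: "vec.dim (vec.span {u, v}) = 2 \<longleftrightarrow> u \<noteq> 0 \<and> v \<notin> vec.span {u :: 'a::field ^ 'n}"
proof
  assume *: "vec.dim (vec.span {u, v}) = 2"
  have False if "u = 0"
    using * vec.dim_le_card[of "vec.span {u, v}" "{v}"] that by simp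
  moreover have False if "v \<in> vec.span {u}"
  proof -
    have "vec.span {u, v} = vec.span {u}"
      using vec.span_redundant[OF that] by (simp add: insert_commute)
    then have "vec.dim (vec.span {u, v}) \<le> 1"
      using vec.dim_le_card[of "vec.span {u, v}" "{u}"] by simp
    then show False
      using * by simp
  qed
  ultimately show "u \<noteq> 0 \<and> v \<notin> vec.span {u}"
    by blast
next
  assume *: "u \<noteq> 0 \<and> v \<notin> vec.span {u}"
  then have "u \<noteq> v"
    by (auto intro: vec.span_base)
  moreover have "vec.independent {v, u}"
    using * by (intro vec.independent_insertI) (auto simp: vec.independent_empty)
  then have "vec.dim (vec.span {v, u}) = card {v, u}"
    by (rule vec.dim_span_eq_card_independent)
  ultimately show "vec.dim (vec.span {u, v}) = 2"
    by (simp add: card_insert_if insert_commute[of v u])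
qed

lemma line_eq_span2:
  fixes u v :: "'a::field ^ 'n"
  assumes "vec.subspace U" "vec.dim U = 2" "u \<in> U" "v \<in> U" "u \<noteq> 0" "v \<notin> vec.span {u}"
  shows "U = vec.span {u, v}"
proof -
  have "vec.span {u, v} \<subseteq> U"
    using assms by (intro vec.span_minimal) auto
  moreover have "vec.dim (vec.span {u, v}) = 2"
    using assms dim_span2 by blast
  ultimately show ?thesis
    using vec.subspace_dim_equal[of "vec.span {u, v}" U] assms by auto
qed

lemma rat_lineE:
  fixes U :: "('a::field ^ 'n) set"
  assumes "rat_subspace q m U" "vec.dim U = 2"
  obtains u v where "u \<in> rat_vecs q m" "v \<in> rat_vecs q m" "U = vec.span {u, v}" "u \<noteq> 0" "v \<notin> vec.span {u}"
proof -
  obtain B where B: "B \<subseteq> rat_vecs q m" "U = vec.span B"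
    using assms by (auto simp: rat_subspace_def)
  obtain B' where B': "B' \<subseteq> B" "vec.independent B'" "B \<subseteq> vec.span B'"
    using vec.maximal_independent_subset by blast
  then have sp: "U = vec.span B'"
    using B by (metis vec.span_mono vec.span_span subset_antisym)
  then have "card B' = 2"
    using assms B' by (simp add: vec.dim_eq_card_independent)
  then obtain u v where uv: "B' = {u, v}" "u \<noteq> v"
    by (meson card_2_iff)
  have "u \<noteq> 0 \<and> v \<notin> vec.span {u}"
    using dim_span2 sp assms uv by blast
  then show ?thesis
    using that uv sp B B' by blast
qed

lemma rat_lineI:
  "u \<in> rat_vecs q m \<Longrightarrow> v \<in> rat_vecs q m \<Longrightarrow> rat_subspace q m (vec.span {u, v :: 'a::field ^ 'n})"
  unfolding rat_subspace_def by (intro exI[of _ "{u, v}"]) simp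

lemma subspace_rat: "rat_subspace q m U \<Longrightarrow> vec.subspace (U :: ('a::field ^ 'n) set)"
  by (auto simp: rat_subspace_def)

lemma pg_pointsE:
  assumes "P \<in> pg_points q m U"
  obtains v where "P = vec.span {v}" "v \<in> U" "v \<in> rat_vecs q m" "v \<noteq> 0"
  using assms by (auto simp: pg_points_def)

lemma pg_pointsI: "v \<in> U \<Longrightarrow> v \<in> rat_vecs q m \<Longrightarrow> v \<noteq> 0 \<Longrightarrow> vec.span {v} \<in> pg_points q m U"
  by (auto simp: pg_points_def)

lemma pg_lines_subset: "l \<in> pg_lines q m \<Longrightarrow> l \<subseteq> pg_points q m UNIV"
  by (auto simp: pg_lines_def pg_points_def)

lemma pg_points_span_mem:
  assumes "vec.subspace U" "vec.span {v} \<in> pg_points q m U" 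
  shows "v \<in> (U :: ('a::field ^ 'n) set)"
proof -
  obtain w where "vec.span {v} = vec.span {w}" "w \<in> U"
    using assms by (elim pg_pointsE)
  then show ?thesis
    using assms by (metis span_subset_iff subset_refl)
qed

section \<open>Collineations acting on subplanes and conics\<close>

lemma proj_plane_image:
  assumes "proj_plane k P L" "inj_on f P"
  shows "proj_plane k (f ` P) ((\<lambda>l. f ` l) ` L)"
proof -
  have PP: "\<forall>l\<in>L. l \<subseteq> P \<and> card l = k + 1"
    "\<And>a b. a \<in> P \<Longrightarrow> b \<in> P \<Longrightarrow> a \<noteq> b \<Longrightarrow> \<exists>!l. l \<in> L \<and> a \<in> l \<and> b \<in> l"
    "\<And>l m. l \<in> L \<Longrightarrow> m \<in> L \<Longrightarrow> l \<noteq> m \<Longrightarrow> \<exists>!x. x \<in> l \<and> x \<in> m"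
    "\<exists>Q\<subseteq>P. card Q = 4 \<and> (\<forall>l\<in>L. card (l \<inter> Q) \<le> 2)"
    using assms(1) by (simp_all add: proj_plane_def)
  have sub: "l \<subseteq> P" if "l \<in> L" for l
    using PP(1) that by blast
  have mem: "f x \<in> f ` l \<longleftrightarrow> x \<in> l" if "l \<in> L" "x \<in> P" for l x
    using sub that assms(2) by (meson inj_on_image_mem_iff)
  have c: "card (f ` l) = card l" if "l \<subseteq> P" for l
    using that assms(2) by (meson card_image inj_on_subset)
  have 1: "\<exists>!l. l \<in> (\<lambda>l. f ` l) ` L \<and> x \<in> l \<and> y \<in> l" if xy: "x \<in> f ` P" "y \<in> f ` P" "x \<noteq> y" for x y
  proof -
    obtain a b where ab: "x = f a" "y = f b" "a \<in> P" "b \<in> P" "a \<noteq> b"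
      using xy by auto
    then obtain l where l: "l \<in> L" "a \<in> l" "b \<in> l" "\<And>l'. l' \<in> L \<and> a \<in> l' \<and> b \<in> l' \<Longrightarrow> l' = l"
      using PP(2)[OF ab(3-5)] by blast
    show ?thesis
    proof (rule ex1I[of _ "f ` l"])
      fix l' assume l': "l' \<in> (\<lambda>l. f ` l) ` L \<and> x \<in> l' \<and> y \<in> l'"
      then obtain l2 where l2: "l2 \<in> L" "l' = f ` l2"
        by blast
      then have "a \<in> l2" "b \<in> l2"
        using l' l2(2) mem[OF l2(1) ab(3)] mem[OF l2(1) ab(4)] unfolding ab(1,2) by simp_all
      then show "l' = f ` l"
        using l(4)[of l2] l2 by simp
    qed (use l(1-3) ab(1,2) in simp)
  qed
  have 2: "\<exists>!x. x \<in> l \<and> x \<in> m" if lm: "l \<in> (\<lambda>l. f ` l) ` L" "m \<in> (\<lambda>l. f ` l) ` L" "l \<noteq> m" for l m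
  proof -
    obtain a b where "l = f ` a" "m = f ` b" "a \<in> L" "b \<in> L"
      using lm by blast
    then have ab: "l = f ` a" "m = f ` b" "a \<in> L" "b \<in> L" "a \<noteq> b"
      using lm by auto
    then obtain x where x: "x \<in> a" "x \<in> b" "\<And>y. y \<in> a \<and> y \<in> b \<Longrightarrow> y = x"
      using PP(3)[OF ab(3-5)] by blast
    show ?thesis
    proof (rule ex1I[of _ "f x"])
      fix y assume y: "y \<in> l \<and> y \<in> m"
      then obtain z where z: "y = f z" "z \<in> a"
        using ab by auto
      then have "z \<in> b"
        using y z(1) mem[OF ab(4), of z] sub[OF ab(3)] unfolding ab(2) by auto
      then show "y = f x"
        using x(3)[of z] z by simp
    qed (use x(1,2) ab(1,2) in simp)
  qed
  obtain Q where Q: "Q \<subseteq> P" "card Q = 4" "\<And>l. l \<in> L \<Longrightarrow> card (l \<inter> Q) \<le> 2"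
    using PP(4) by blast
  have "card (f ` l \<inter> f ` Q) \<le> 2" if "l \<in> L" for l
  proof -
    have "f ` l \<inter> f ` Q = f ` (l \<inter> Q)"
      using sub[OF that] Q(1) assms(2) by (simp add: inj_on_image_Int)
    then show ?thesis
      using c[of "l \<inter> Q"] Q(1) Q(3)[OF that] by (simp add: le_infI2)
  qed
  then have 3: "\<exists>Q\<subseteq>f ` P. card Q = 4 \<and> (\<forall>l\<in>(\<lambda>l. f ` l) ` L. card (l \<inter> Q) \<le> 2)"
    using Q c by (intro exI[of _ "f ` Q"]) auto
  show ?thesis
    unfolding proj_plane_def
  proof (intro conjI ballI impI)
    fix l assume "l \<in> (\<lambda>l. f ` l) ` L"
    then obtain l' where "l' \<in> L" "l = f ` l'"
      by blast
    then show "l \<subseteq> f ` P" "card l = k + 1"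
      using sub c PP(1) by auto
  qed (use 1 2 3 in auto)
qed

lemma induced_lines_image:
  assumes "inj_on f P" "B \<subseteq> P" "\<And>l. l \<in> L \<Longrightarrow> l \<subseteq> P"
  shows "induced_lines (f ` B) ((\<lambda>l. f ` l) ` L) = (\<lambda>l. f ` l) ` induced_lines B L"
proof -
  have *: "f ` l \<inter> f ` B = f ` (l \<inter> B)" if "l \<in> L" for l
    using assms that by (metis inj_on_image_Int)
  have c: "card (f ` (l \<inter> B)) = card (l \<inter> B)" for l
    using assms by (meson card_image inf.coboundedI2 inj_on_subset)
  show ?thesis
    unfolding induced_lines_def
    by (auto simp: * c image_iff) (metis * c)+
qed

lemma incidence_iso_trans:
  assumes "incidence_iso f P L P' L'" "incidence_iso g P' L' P'' L''"
  shows "incidence_iso (g \<circ> f) P L P'' L''"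
proof -
  have "(\<lambda>l. (\<lambda>x. g (f x)) ` l) ` L = (\<lambda>l. g ` l) ` (\<lambda>l. f ` l) ` L"
    by (simp add: image_image)
  then show ?thesis
    using assms bij_betw_trans[of f P P' g P''] unfolding incidence_iso_def comp_def by simp
qed

lemma incidence_iso_inv:
  assumes "incidence_iso f P L P' L'" "\<And>l. l \<in> L \<Longrightarrow> l \<subseteq> P"
  shows "incidence_iso (inv_into P f) P' L' P L"
proof -
  have b: "bij_betw f P P'" "L' = (\<lambda>l. f ` l) ` L"
    using assms by (auto simp: incidence_iso_def)
  have "inv_into P f ` f ` l = l" if "l \<in> L" for l
    using b assms(2)[OF that] by (simp add: bij_betw_def inv_into_image_cancel)
  then have "(\<lambda>l. inv_into P f ` l) ` L' = L"
    unfolding b(2) by (simp add: image_image)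
  then show ?thesis
    using b by (simp add: incidence_iso_def bij_betw_inv_into)
qed

text \<open>Subplanes and their conics are defined by incidence alone, so any incidence automorphism
  can be composed with \<open>\<psi>\<close>; it need not be known to be semilinear. This is what
  frees the result from the choice of the Bruck-Bose isomorphism.\<close>

lemma Fq_conic_image:
  fixes C :: "('a::field ^ 3) set set" and \<kappa> :: "('a ^ 3) set \<Rightarrow> ('a ^ 3) set"
  assumes "Fq_conic q C"
    and \<kappa>: "incidence_iso \<kappa> (pg_points q 3 UNIV) (pg_lines q 3) (pg_points q 3 UNIV) (pg_lines q 3)"
  shows "Fq_conic q (\<kappa> ` C)"
proof -
  obtain B :: "('a ^ 3) set set" and \<psi> and C0 :: "('a ^ 3) set set" where B: "Fq_subplane q B"
    and \<psi>: "incidence_iso \<psi> (pg_points q 1 UNIV) (pg_lines q 1) B (induced_lines B (pg_lines q 3))"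
    and C0: "nondegenerate_conic q C0" "C = \<psi> ` C0"
    using assms(1) unfolding Fq_conic_def by blast
  have inj: "inj_on \<kappa> (pg_points q 3 UNIV)" and surj: "\<kappa> ` pg_points q 3 UNIV = pg_points q 3 UNIV"
    and lns: "(\<lambda>l. \<kappa> ` l) ` pg_lines q 3 = pg_lines q 3"
    using \<kappa> by (auto simp: incidence_iso_def bij_betw_def)
  have Bsub: "B \<subseteq> pg_points q 3 UNIV"
    using B by (simp add: Fq_subplane_def)
  have ind: "induced_lines (\<kappa> ` B) (pg_lines q 3) = (\<lambda>l. \<kappa> ` l) ` induced_lines B (pg_lines q 3)"
    using induced_lines_image[OF inj Bsub, of "pg_lines q 3"] lns pg_lines_subset by metis
  have "proj_plane q (\<kappa> ` B) (induced_lines (\<kappa> ` B) (pg_lines q 3))"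
    unfolding ind using B inj Bsub
    by (intro proj_plane_image) (auto simp: Fq_subplane_def intro: inj_on_subset)
  then have 1: "Fq_subplane q (\<kappa> ` B)"
    using Bsub surj by (auto simp: Fq_subplane_def)
  have "incidence_iso \<kappa> B (induced_lines B (pg_lines q 3)) (\<kappa> ` B) (induced_lines (\<kappa> ` B) (pg_lines q 3))"
    unfolding incidence_iso_def ind using inj Bsub by (auto intro: inj_on_subset inj_on_imp_bij_betw)
  note iso = incidence_iso_trans[OF \<psi> this]
  have "\<kappa> ` C = (\<kappa> \<circ> \<psi>) ` C0"
    by (simp only: C0 image_comp)
  note C_eq = this
  show ?thesis
    unfolding Fq_conic_def
    by (rule exI[of _ "\<kappa> ` B"], rule exI[of _ "\<kappa> \<circ> \<psi>"], rule exI[of _ C0], intro conjI)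
      (fact 1, fact iso, fact C0(1), fact C_eq)
qed

context frobenius_field begin

text \<open>Raising the combination to the power q^m and subtracting gives a linear relation between
  the independent \<open>u\<close> and \<open>v\<close> with coefficients a^(q^m) - a and b^(q^m) -
  b, which must vanish.\<close>

lemma rat_coords2:
  fixes u v :: "'a ^ 'n"
  assumes "u \<in> rat_vecs q m" "v \<in> rat_vecs q m" "a *s u + b *s v \<in> rat_vecs q m"
    and "u \<noteq> 0" "v \<notin> vec.span {u}"
  shows "a \<in> GFq q m" "b \<in> GFq q m"
proof -
  define A B where "A = a ^ (q ^ m) - a" and "B = b ^ (q ^ m) - b"
  have comp: "A * u $ i + B * v $ i = 0" for i
  proof -
    have "(a * u $ i + b * v $ i) ^ (q ^ m) = a * u $ i + b * v $ i" "(u $ i) ^ (q ^ m) = u $ i" "(v $ i) ^ (q ^ m) = v $ i"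
      using assms(1-3) by (auto simp: rat_vecs_def GFq_iff)
    then have "a ^ (q ^ m) * u $ i + b ^ (q ^ m) * v $ i = a * u $ i + b * v $ i"
      by (simp add: pow_add power_mult_distrib)
    moreover have "A * u $ i + B * v $ i = (a ^ (q ^ m) * u $ i + b ^ (q ^ m) * v $ i) - (a * u $ i + b * v $ i)"
      by (simp add: A_def B_def algebra_simps)
    ultimately show ?thesis
      by simp
  qed
  have b: "B = 0"
  proof (rule ccontr)
    assume c: "B \<noteq> 0"
    have "v $ i = (- A / B) * u $ i" for i
    proof -
      have "B * v $ i = - (A * u $ i)"
        using comp[of i] by (simp add: eq_neg_iff_add_eq_0 add.commute)
      then show ?thesis
        using c by (simp add: field_simps)
    qed
    then have "v = (- A / B) *s u"
      by (simp add: vec_eq_iff)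
    then show False
      using assms(5) in_span1_iff by blast
  qed
  then have "A = 0"
    using comp assms(4) by (auto simp: vec_eq_iff)
  then show "a \<in> GFq q m" "b \<in> GFq q m"
    using b by (auto simp: GFq_iff A_def B_def)
qed

lemma pg_line_points:
  fixes u v :: "'a ^ 'n"
  assumes uv: "u \<in> rat_vecs q m" "v \<in> rat_vecs q m" "u \<noteq> 0" "v \<notin> vec.span {u}"
  shows "pg_points q m (vec.span {u, v}) = insert (vec.span {v}) ((\<lambda>x. vec.span {u + x *s v}) ` GFq q m)"
proof (intro equalityI subsetI)
  fix P assume "P \<in> pg_points q m (vec.span {u, v})"
  then obtain w where w: "P = vec.span {w}" "w \<in> vec.span {u, v}" "w \<in> rat_vecs q m" "w \<noteq> 0"
    by (elim pg_pointsE)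
  then obtain a b where ab: "w = a *s u + b *s v"
    by (auto simp: span2_iff)
  then have abG: "a \<in> GFq q m" "b \<in> GFq q m"
    using rat_coords2 uv w by blast+
  show "P \<in> insert (vec.span {v}) ((\<lambda>x. vec.span {u + x *s v}) ` GFq q m)"
  proof (cases "a = 0")
    case True
    then show ?thesis
      using w ab by (auto simp: span1_scale)
  next
    case False
    then have weq: "w = a *s (u + (b / a) *s v)"
      by (simp add: ab vec_eq_iff field_simps)
    then have "P = vec.span {u + (b / a) *s v}"
      by (simp only: w(1) weq span1_scale[OF False])
    then show ?thesis
      using abG by (auto intro: GFq_closed)
  qed
next
  fix P assume "P \<in> insert (vec.span {v}) ((\<lambda>x. vec.span {u + x *s v}) ` GFq q m)"
  moreover have "v \<noteq> 0"
    using uv by (auto intro: vec.span_zero)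
  moreover have "u + x *s v \<noteq> 0" for x
  proof
    assume eq: "u + x *s v = 0"
    then have "x \<noteq> 0"
      using uv by auto
    moreover have "u = x *s (- v)"
      using eq by (simp add: eq_neg_iff_add_eq_0)
    ultimately have "v = (- inverse x) *s u"
      by (simp add: vec_eq_iff)
    then show False
      using uv in_span1_iff by blast
  qed
  moreover have "u \<in> vec.span {u, v}" "v \<in> vec.span {u, v}"
    by (auto intro: vec.span_base)
  ultimately show "P \<in> pg_points q m (vec.span {u, v})"
    using uv by (auto intro!: pg_pointsI rat_vecs_add rat_vecs_scale vec.span_add vec.span_scale)
qed

lemma card_pg_line:
  fixes U :: "('a ^ 'n) set"
  assumes "rat_subspace q m U" "vec.dim U = 2" "m > 0"
  shows "card (pg_points q m U) = q ^ m + 1" "finite (pg_points q m U)"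
proof -
  obtain u v where uv: "u \<in> rat_vecs q m" "v \<in> rat_vecs q m" "U = vec.span {u, v}" "u \<noteq> 0" "v \<notin> vec.span {u}"
    using rat_lineE assms by blast
  have eq: "pg_points q m U = insert (vec.span {v}) ((\<lambda>x. vec.span {u + x *s v}) ` GFq q m)"
    unfolding uv(3) using uv by (intro pg_line_points)
  have indep: "a = 0 \<and> b = 0" if "a *s u = b *s v" for a b
  proof -
    have "b = 0"
    proof (rule ccontr)
      assume "b \<noteq> 0"
      then have "v = (a / b) *s u"
        using that by (metis divide_inverse left_inverse mult.commute vector_smult_assoc vector_smult_lid)
      then show False
        using uv in_span1_iff by blast
    qed
    then show ?thesis
      using that uv by auto
  qed
  have "inj_on (\<lambda>x. vec.span {u + x *s v}) (GFq q m)"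
  proof (rule inj_onI)
    fix x y assume "vec.span {u + x *s v} = vec.span {u + y *s v}"
    then obtain k where "u + x *s v = k *s (u + y *s v)"
      by (metis in_span1_iff vec.span_base singletonI)
    then have "(1 - k) *s u = (k * y - x) *s v"
      by (simp add: vec_eq_iff algebra_simps)
    from indep[OF this] show "x = y"
      by auto
  qed
  moreover have "vec.span {v} \<notin> (\<lambda>x. vec.span {u + x *s v}) ` GFq q m"
  proof
    assume "vec.span {v} \<in> (\<lambda>x. vec.span {u + x *s v}) ` GFq q m"
    then obtain x where "vec.span {v} = vec.span {u + x *s v}"
      by blast
    then have "u + x *s v \<in> vec.span {v}"
      using vec.span_base[of "u + x *s v" "{u + x *s v}"] by simp
    then obtain k where "u + x *s v = k *s v"
      using in_span1_iff by blast
    then have "1 *s u = (k - x) *s v"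
      by (simp add: vec_eq_iff algebra_simps)
    from indep[OF this] show False
      by auto
  qed
  ultimately show "card (pg_points q m U) = q ^ m + 1" "finite (pg_points q m U)"
    unfolding eq using card_GFq[OF assms(3)] by (auto simp: card_image)
qed

lemma pow_mv:
  fixes M :: "'a ^ 'n ^ 'k"
  assumes "\<And>i j. M $ i $ j \<in> GFq q m"
  shows "(frob q ^^ m) (M *v v) = M *v (frob q ^^ m) v"
  using assms by (simp add: vec_eq_iff funpow_frob_nth matrix_vector_mult_def pow_sum power_mult_distrib GFq_iff)

lemma rat_vecs_mv:
  fixes M :: "'a ^ 'n ^ 'k"
  assumes "\<And>i j. M $ i $ j \<in> GFq q m" "v \<in> rat_vecs q m"
  shows "M *v v \<in> rat_vecs q m"
  using assms pow_mv[of M m v] by (simp add: rat_vecs_iff)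

text \<open>\<open>M\<close> commutes with the m-th Frobenius power, so the difference of
  \<open>v\<close> and its conjugate lies in the kernel of \<open>M\<close>.\<close>

lemma rat_vecs_mvD:
  fixes M :: "'a ^ 'n ^ 'k"
  assumes "\<And>i j. M $ i $ j \<in> GFq q m" "\<And>v. M *v v = 0 \<Longrightarrow> v = 0" "M *v v \<in> rat_vecs q m"
  shows "v \<in> rat_vecs q m"
proof -
  have "M *v ((frob q ^^ m) v - v) = 0"
    using assms(3) pow_mv[of M m v] assms(1) by (simp add: rat_vecs_iff matrix_vector_mult_diff_distrib)
  then show ?thesis
    using assms(2) by (fastforce simp: rat_vecs_iff)
qed

lemma mv_span: "(\<lambda>v. M *v v) ` vec.span S = vec.span ((\<lambda>v. M *v v) ` S)" for M :: "'a ^ 'n ^ 'k"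
  by (rule vec.linear_span_image[symmetric]) simp

lemma mv_surj:
  fixes M :: "'a ^ 'n ^ 'n"
  assumes "\<And>v. M *v v = 0 \<Longrightarrow> v = 0"
  shows "\<exists>v. M *v v = w"
proof -
  have "\<exists>B. B ** M = mat 1"
    using assms matrix_left_invertible_ker by blast
  then obtain B where "M ** B = mat 1"
    using matrix_left_right_inverse by blast
  then have "M *v (B *v w) = w"
    by (simp add: matrix_vector_mul_assoc)
  then show ?thesis ..
qed

lemma linear_collineation:
  fixes M :: "'a ^ 'n ^ 'n"
  assumes M: "\<And>i j. M $ i $ j \<in> GFq q m" and ker: "\<And>v. M *v v = 0 \<Longrightarrow> v = 0"
  shows "incidence_iso (\<lambda>P. (\<lambda>v. M *v v) ` P) (pg_points q m UNIV) (pg_lines q m) (pg_points q m UNIV) (pg_lines q m)"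
proof -
  have inj: "inj (\<lambda>v. M *v v)"
    using ker by (intro injI) (metis matrix_vector_mult_diff_distrib eq_iff_diff_eq_0)
  have pts: "(\<lambda>P. (\<lambda>v. M *v v) ` P) ` pg_points q m U = pg_points q m ((\<lambda>v. M *v v) ` U)" for U
  proof (intro equalityI subsetI)
    fix P assume "P \<in> (\<lambda>P. (\<lambda>v. M *v v) ` P) ` pg_points q m U"
    then obtain v where "v \<in> U" "v \<in> rat_vecs q m" "v \<noteq> 0" "P = vec.span {M *v v}"
      by (auto simp: mv_span elim!: pg_pointsE)
    then show "P \<in> pg_points q m ((\<lambda>v. M *v v) ` U)"
      using rat_vecs_mv[OF M] ker by (auto intro!: pg_pointsI)
  next
    fix P assume "P \<in> pg_points q m ((\<lambda>v. M *v v) ` U)"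
    then obtain v where v: "P = vec.span {M *v v}" "v \<in> U" "M *v v \<in> rat_vecs q m" "M *v v \<noteq> 0"
      by (auto elim!: pg_pointsE)
    then have "v \<in> rat_vecs q m" "v \<noteq> 0"
      using rat_vecs_mvD[OF M ker] by auto
    then have "vec.span {v} \<in> pg_points q m U"
      using v by (auto intro: pg_pointsI)
    moreover have "P = (\<lambda>v. M *v v) ` vec.span {v}"
      using v by (simp add: mv_span)
    ultimately show "P \<in> (\<lambda>P. (\<lambda>v. M *v v) ` P) ` pg_points q m U"
      by blast
  qed
  have surj: "range (\<lambda>v. M *v v) = UNIV"
    using mv_surj[OF ker] by (metis surj_def)
  have "bij_betw (\<lambda>P. (\<lambda>v. M *v v) ` P) (pg_points q m UNIV) (pg_points q m UNIV)"
    unfolding bij_betw_def using pts[of UNIV] surj inj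
    by (auto intro!: inj_onI simp: inj_image_eq_iff)
  moreover have "(\<lambda>l. (\<lambda>P. (\<lambda>v. M *v v) ` P) ` l) ` pg_lines q m = pg_lines q m"
  proof (intro equalityI subsetI)
    fix l assume "l \<in> (\<lambda>l. (\<lambda>P. (\<lambda>v. M *v v) ` P) ` l) ` pg_lines q m"
    then obtain U where U: "rat_subspace q m U" "vec.dim U = 2" "l = pg_points q m ((\<lambda>v. M *v v) ` U)"
      by (auto simp: pg_lines_def pts)
    have "rat_subspace q m ((\<lambda>v. M *v v) ` U)"
    proof -
      obtain B where "B \<subseteq> rat_vecs q m" "U = vec.span B"
        using U(1) by (auto simp: rat_subspace_def)
      then show ?thesis
        unfolding rat_subspace_def using rat_vecs_mv[OF M]
        by (intro exI[of _ "(\<lambda>v. M *v v) ` B"]) (auto simp: mv_span)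
    qed
    moreover have "vec.dim ((\<lambda>v. M *v v) ` U) = 2"
      using U(2) inj by (subst vec.dim_image_eq) (auto intro: inj_on_subset)
    ultimately show "l \<in> pg_lines q m"
      unfolding pg_lines_def using U by blast
  next
    fix l :: "('a ^ 'n) set set" assume "l \<in> pg_lines q m"
    then obtain U where U: "rat_subspace q m U" "vec.dim U = 2" "l = pg_points q m U"
      by (auto simp: pg_lines_def)
    then obtain u v where uv: "u \<in> rat_vecs q m" "v \<in> rat_vecs q m" "U = vec.span {u, v}"
      using rat_lineE[OF U(1,2)] by blast
    obtain u' v' where uv': "M *v u' = u" "M *v v' = v"
      using mv_surj[OF ker] by metis
    have im: "(\<lambda>v. M *v v) ` vec.span {u', v'} = U"
      by (simp add: mv_span uv' uv)
    have "vec.dim (vec.span {u', v'}) = vec.dim ((\<lambda>v. M *v v) ` vec.span {u', v'})"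
      using inj by (subst vec.dim_image_eq) (auto intro: inj_on_subset)
    then have "vec.dim (vec.span {u', v'}) = 2"
      using U(2) im by simp
    moreover have "rat_subspace q m (vec.span {u', v'})"
      using uv uv' rat_vecs_mvD[OF M ker] by (intro rat_lineI) auto
    ultimately have "pg_points q m (vec.span {u', v'}) \<in> pg_lines q m"
      unfolding pg_lines_def by blast
    moreover have "l = (\<lambda>P. (\<lambda>v. M *v v) ` P) ` pg_points q m (vec.span {u', v'})"
      by (simp only: pts im U)
    ultimately show "l \<in> (\<lambda>l. (\<lambda>P. (\<lambda>v. M *v v) ` P) ` l) ` pg_lines q m"
      by blast
  qed
  ultimately show ?thesis
    by (simp add: incidence_iso_def)
qed

end

section \<open>The plane over the small field\<close>

text \<open>The determinant with rows \<open>u\<close>, \<open>v\<close>, \<open>w\<close>,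
  multiplied out; it vanishes iff the three points are collinear.\<close>

definition tri :: "'a::field ^ 3 \<Rightarrow> 'a ^ 3 \<Rightarrow> 'a ^ 3 \<Rightarrow> 'a" where
  "tri u v w = u $ 1 * (v $ 2 * w $ 3 - v $ 3 * w $ 2) - u $ 2 * (v $ 1 * w $ 3 - v $ 3 * w $ 1)
     + u $ 3 * (v $ 1 * w $ 2 - v $ 2 * w $ 1)"

lemma vec3_eq_iff: "u = v \<longleftrightarrow> u $ 1 = v $ 1 \<and> u $ 2 = v $ 2 \<and> u $ 3 = v $ 3" for u v :: "'a ^ 3"
  by (auto simp: vec_eq_iff forall_3)

lemma tri_span1: "v \<in> vec.span {u} \<Longrightarrow> tri u v w = 0"
  by (auto simp: in_span1_iff tri_def algebra_simps)

lemma tri_span2: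
  assumes "w \<in> vec.span {u, v}"
  shows "tri u v w = 0"
proof -
  obtain a b where "w = a *s u + b *s v"
    using assms span2_iff by blast
  then show ?thesis
    by (simp add: tri_def algebra_simps)
qed

text \<open>Cramer's rule: as \<open>u\<close> and \<open>v\<close> are independent, some 2x2 minor
  is nonzero, and two coordinates of \<open>w\<close> give the coefficients. The third coordinate
  then agrees because the determinant vanishes.\<close>

lemma tri_zeroD:
  assumes "tri u v w = 0" "u \<noteq> 0" "v \<notin> vec.span {u}"
  shows "w \<in> vec.span {u, v}"
proof -
  have D: "u $ 1 * v $ 2 - u $ 2 * v $ 1 \<noteq> 0 \<or> u $ 1 * v $ 3 - u $ 3 * v $ 1 \<noteq> 0 \<or> u $ 2 * v $ 3 - u $ 3 * v $ 2 \<noteq> 0"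
  proof (rule ccontr)
    assume "\<not> ?thesis"
    then have *: "u $ 1 * v $ 2 = u $ 2 * v $ 1" "u $ 1 * v $ 3 = u $ 3 * v $ 1" "u $ 2 * v $ 3 = u $ 3 * v $ 2"
      by auto
    have "\<exists>k. v = k *s u"
    proof -
      consider "u $ 1 \<noteq> 0" | "u $ 2 \<noteq> 0" | "u $ 3 \<noteq> 0"
        using assms(2) by (auto simp: vec3_eq_iff)
      then show ?thesis
      proof cases
        case 1
        then have "v = (v $ 1 / u $ 1) *s u"
          using * by (simp add: vec3_eq_iff field_simps)
        then show ?thesis ..
      next
        case 2
        then have "v = (v $ 2 / u $ 2) *s u"
          using * by (simp add: vec3_eq_iff field_simps)
        then show ?thesis ..
      next
        case 3
        then have "v = (v $ 3 / u $ 3) *s u"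
          using * by (simp add: vec3_eq_iff field_simps)
        then show ?thesis ..
      qed
    qed
    then show False
      using assms(3) in_span1_iff by blast
  qed
  have t: "tri u v w = 0"
    by (fact assms)
  have "\<exists>a b. w = a *s u + b *s v"
    using D
  proof (elim disjE)
    define d where "d = u $ 1 * v $ 2 - u $ 2 * v $ 1"
    assume "u $ 1 * v $ 2 - u $ 2 * v $ 1 \<noteq> 0"
    then have d: "d \<noteq> 0"
      by (simp add: d_def)
    define a b where "a = w $ 1 * v $ 2 - w $ 2 * v $ 1" and "b = u $ 1 * w $ 2 - u $ 2 * w $ 1"
    have "d * w $ 1 = a * u $ 1 + b * v $ 1" "d * w $ 2 = a * u $ 2 + b * v $ 2"
      by (auto simp: d_def a_def b_def algebra_simps)
    moreover have "d * w $ 3 - (a * u $ 3 + b * v $ 3) = tri u v w"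
      by (simp add: d_def a_def b_def tri_def algebra_simps)
    ultimately have "w = (a / d) *s u + (b / d) *s v"
      using d t by (simp add: vec3_eq_iff field_simps)
    then show ?thesis
      by blast
  next
    define d where "d = u $ 1 * v $ 3 - u $ 3 * v $ 1"
    assume "u $ 1 * v $ 3 - u $ 3 * v $ 1 \<noteq> 0"
    then have d: "d \<noteq> 0"
      by (simp add: d_def)
    define a b where "a = w $ 1 * v $ 3 - w $ 3 * v $ 1" and "b = u $ 1 * w $ 3 - u $ 3 * w $ 1"
    have "d * w $ 1 = a * u $ 1 + b * v $ 1" "d * w $ 3 = a * u $ 3 + b * v $ 3"
      by (auto simp: d_def a_def b_def algebra_simps)
    moreover have "(a * u $ 2 + b * v $ 2) - d * w $ 2 = tri u v w"
      by (simp add: d_def a_def b_def tri_def algebra_simps)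
    ultimately have "w = (a / d) *s u + (b / d) *s v"
      using d t by (simp add: vec3_eq_iff field_simps)
    then show ?thesis
      by blast
  next
    define d where "d = u $ 2 * v $ 3 - u $ 3 * v $ 2"
    assume "u $ 2 * v $ 3 - u $ 3 * v $ 2 \<noteq> 0"
    then have d: "d \<noteq> 0"
      by (simp add: d_def)
    define a b where "a = w $ 2 * v $ 3 - w $ 3 * v $ 2" and "b = u $ 2 * w $ 3 - u $ 3 * w $ 2"
    have "d * w $ 2 = a * u $ 2 + b * v $ 2" "d * w $ 3 = a * u $ 3 + b * v $ 3"
      by (auto simp: d_def a_def b_def algebra_simps)
    moreover have "d * w $ 1 - (a * u $ 1 + b * v $ 1) = tri u v w"
      by (simp add: d_def a_def b_def tri_def algebra_simps)
    ultimately have "w = (a / d) *s u + (b / d) *s v"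
      using d t by (simp add: vec3_eq_iff field_simps)
    then show ?thesis
      by blast
  qed
  then show ?thesis
    by (simp add: span2_iff)
qed

lemma tri_in_line:
  assumes "vec.subspace U" "vec.dim U = 2" "u \<in> U" "v \<in> U" "w \<in> U"
  shows "tri u v w = 0"
proof (cases "u = 0 \<or> v \<in> vec.span {u}")
  case True
  then show ?thesis
    using tri_span1[of v u w] by (auto simp: tri_def)
next
  case False
  then have "U = vec.span {u, v}"
    using assms by (intro line_eq_span2) auto
  then show ?thesis
    using assms(5) by (simp add: tri_span2)
qed

text \<open>The quadratic Veronese map of the projective line, whose image is the conic y^2 =
  xz.\<close>

definition ver :: "'a::field \<Rightarrow> 'a \<Rightarrow> 'a ^ 3" where
  "ver s t = vector [s\<^sup>2, s * t, t\<^sup>2]"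

definition param_conic :: "nat \<Rightarrow> 'a::field ^ 3 ^ 3 \<Rightarrow> ('a ^ 3) set set" where
  "param_conic q M = {vec.span {M *v ver s t} | s t. s \<in> GFq q 1 \<and> t \<in> GFq q 1 \<and> (s \<noteq> 0 \<or> t \<noteq> 0)}"

lemma ver_nth [simp]: "ver s t $ 1 = s\<^sup>2" "ver s t $ 2 = s * t" "ver s t $ 3 = t\<^sup>2"
  by (simp_all add: ver_def)

lemma ver_eq_0_iff: "ver s t = 0 \<longleftrightarrow> s = 0 \<and> t = 0"
  by (auto simp: vec3_eq_iff)

context frobenius_field begin

lemma frob_rat_subspace:
  assumes "rat_subspace q 1 U" "w \<in> (U :: ('a ^ 'n) set)"
  shows "frob q w \<in> U"
proof -
  obtain B where B: "B \<subseteq> rat_vecs q 1" "U = vec.span B"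
    using assms by (auto simp: rat_subspace_def)
  then have "frob q ` B = (\<lambda>x. x) ` B"
    by (intro image_cong) (auto simp del: One_nat_def simp: rat_vecs_1)
  then have "conj_space q U = U"
    by (simp add: B conj_space_span)
  then show ?thesis
    using assms by (auto simp: conj_space_def)
qed

text \<open>Scaling a nonzero coordinate to 1 forces the factor \<open>k\<close> to become
  1.\<close>

lemma frob_eigen_point:
  fixes w :: "'a ^ 'n"
  assumes "frob q w = k *s w" "w \<noteq> 0"
  obtains c where "c \<noteq> 0" "c *s w \<in> rat_vecs q 1"
proof -
  obtain i where i: "w $ i \<noteq> 0"
    using assms(2) by (auto simp: vec_eq_iff)
  have "(w $ i) ^ q = k * w $ i"
    using assms(1) by (metis frob_nth vector_smult_component)
  then have k: "k = (w $ i) ^ q / w $ i"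
    using i by (simp add: field_simps)
  have "frob q (inverse (w $ i) *s w) = inverse (w $ i) *s w"
    using i by (simp add: frob_scale assms(1) vec_eq_iff k power_inverse field_simps)
  then show ?thesis
    using that[of "inverse (w $ i)"] i by (simp only: rat_vecs_1) simp
qed

text \<open>The dimension formula gives a common vector over the algebraic closure. If it were not
  proportional to its conjugate, the two would span both lines; so it is proportional and can be
  scaled into the small field.\<close>

lemma rat_lines_meet:
  fixes U W :: "('a ^ 3) set"
  assumes U: "rat_subspace q 1 U" "vec.dim U = 2" and W: "rat_subspace q 1 W" "vec.dim W = 2" and "U \<noteq> W"
  obtains w where "w \<in> U" "w \<in> W" "w \<in> rat_vecs q 1" "w \<noteq> 0"
proof -
  have sub: "vec.subspace U" "vec.subspace W"
    using U W subspace_rat by auto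
  have "vec.dim {x + y |x y. x \<in> U \<and> y \<in> W} + vec.dim (U \<inter> W) = 4"
    using vec.dim_sums_Int[OF sub] U W by simp
  moreover have "vec.dim {x + y |x y. x \<in> U \<and> y \<in> W} \<le> 3"
    using dim_subset_UNIV_cart_gen[of "{x + y |x y. x \<in> U \<and> y \<in> W}"] by simp
  ultimately have "vec.dim (U \<inter> W) \<noteq> 0"
    by linarith
  then have "\<not> U \<inter> W \<subseteq> {0}"
    by (simp add: vec.dim_eq_0)
  then obtain w where w: "w \<in> U" "w \<in> W" "w \<noteq> 0"
    by blast
  have "frob q w \<in> vec.span {w}"
  proof (rule ccontr)
    assume *: "frob q w \<notin> vec.span {w}"
    have "U = vec.span {w, frob q w}"
      by (rule line_eq_span2[OF sub(1) U(2) w(1) frob_rat_subspace[OF U(1) w(1)] w(3) *])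
    moreover have "W = vec.span {w, frob q w}"
      by (rule line_eq_span2[OF sub(2) W(2) w(2) frob_rat_subspace[OF W(1) w(2)] w(3) *])
    ultimately show False
      using \<open>U \<noteq> W\<close> by simp
  qed
  then obtain k where "frob q w = k *s w"
    using in_span1_iff by blast
  then obtain c where "c \<noteq> 0" "c *s w \<in> rat_vecs q 1"
    using frob_eigen_point w(3) by blast
  then show ?thesis
    using that[of "c *s w"] w sub by (simp add: vec.subspace_scale)
qed

lemma pg_points_line_eqD:
  fixes U :: "('a ^ 'n) set"
  assumes U: "rat_subspace q m U" "vec.dim U = 2"
    and uv: "vec.span {u} \<in> pg_points q m U" "vec.span {v} \<in> pg_points q m U" "u \<noteq> 0" "vec.span {u} \<noteq> vec.span {v}" "v \<noteq> 0"
  shows "U = vec.span {u, v}"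
proof -
  have "v \<notin> vec.span {u}"
    using span1_eqI[of v u] uv by auto
  then show ?thesis
    using uv U by (intro line_eq_span2) (auto intro: subspace_rat pg_points_span_mem)
qed

lemma pg_line_unique:
  fixes l :: "('a ^ 'n) set set"
  assumes "P \<in> pg_points q m UNIV" "Q \<in> pg_points q m UNIV" "P \<noteq> Q"
  shows "\<exists>!l. l \<in> pg_lines q m \<and> P \<in> l \<and> Q \<in> (l :: ('a ^ 'n) set set)"
proof -
  obtain u where u: "P = vec.span {u}" "u \<in> rat_vecs q m" "u \<noteq> 0"
    using assms(1) by (elim pg_pointsE)
  obtain v where v: "Q = vec.span {v}" "v \<in> rat_vecs q m" "v \<noteq> 0"
    using assms(2) by (elim pg_pointsE)
  have nv: "v \<notin> vec.span {u}"
    using span1_eqI[of v u] u v assms(3) by auto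
  show ?thesis
  proof (rule ex1I[of _ "pg_points q m (vec.span {u, v})"])
    show "pg_points q m (vec.span {u, v}) \<in> pg_lines q m \<and>
          P \<in> pg_points q m (vec.span {u, v}) \<and> Q \<in> pg_points q m (vec.span {u, v})"
      using u v nv dim_span2[of u v] rat_lineI[of u q m v]
      by (auto simp: pg_lines_def intro!: pg_pointsI vec.span_base)
  next
    fix l :: "('a ^ 'n) set set" assume l: "l \<in> pg_lines q m \<and> P \<in> l \<and> Q \<in> l"
    then obtain U where U: "rat_subspace q m U" "vec.dim U = 2" "l = pg_points q m U"
      by (auto simp: pg_lines_def)
    have "U = vec.span {u, v}"
      using l u v assms(3) by (intro pg_points_line_eqD[OF U(1,2)]) (auto simp: U(3))
    then show "l = pg_points q m (vec.span {u, v})"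
      by (simp add: U)
  qed
qed

lemma axis_rat: "(vector [x, y, z] :: 'a ^ 3) \<in> rat_vecs q m \<longleftrightarrow> x \<in> GFq q m \<and> y \<in> GFq q m \<and> (z :: 'a) \<in> GFq q m"
  by (simp add: rat_vecs_def forall_3)

lemma rat3_iff: "v \<in> rat_vecs q m \<longleftrightarrow> v $ 1 \<in> GFq q m \<and> v $ 2 \<in> GFq q m \<and> v $ 3 \<in> GFq q m" for v :: "'a ^ 3"
  by (simp add: rat_vecs_def forall_3)

lemma proj_plane_small: "proj_plane q (pg_points q 1 UNIV) (pg_lines q 1 :: ('a ^ 3) set set set)"
proof -
  have 1: "\<forall>l\<in>pg_lines q 1. l \<subseteq> (pg_points q 1 UNIV :: ('a ^ 3) set set) \<and> card l = q + 1"
  proof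
    fix l :: "('a ^ 3) set set" assume l: "l \<in> pg_lines q 1"
    then obtain U where U: "rat_subspace q 1 U" "vec.dim U = 2" "l = pg_points q 1 U"
      by (auto simp: pg_lines_def)
    then show "l \<subseteq> pg_points q 1 UNIV \<and> card l = q + 1"
      using card_pg_line(1)[OF U(1,2)] pg_lines_subset[OF l] by simp
  qed
  have 2: "\<exists>!P. P \<in> l \<and> P \<in> m" if lm: "l \<in> pg_lines q 1" "m \<in> pg_lines q 1" "l \<noteq> m" for l m :: "('a ^ 3) set set"
  proof -
    obtain U where U: "rat_subspace q 1 U" "vec.dim U = 2" "l = pg_points q 1 U"
      using lm(1) by (auto simp: pg_lines_def)
    obtain W where W: "rat_subspace q 1 W" "vec.dim W = 2" "m = pg_points q 1 W"
      using lm(2) by (auto simp: pg_lines_def)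
    have "U \<noteq> W"
      using U W lm(3) by auto
    then obtain w where w: "w \<in> U" "w \<in> W" "w \<in> rat_vecs q 1" "w \<noteq> 0"
      using rat_lines_meet U W by blast
    show ?thesis
    proof (rule ex1I[of _ "vec.span {w}"])
      show "vec.span {w} \<in> l \<and> vec.span {w} \<in> m"
        using w U W by (auto intro: pg_pointsI)
    next
      fix P assume P: "P \<in> l \<and> P \<in> m"
      show "P = vec.span {w}"
      proof (rule ccontr)
        assume ne: "P \<noteq> vec.span {w}"
        have "vec.span {w} \<in> l" "vec.span {w} \<in> m"
          using w U W by (auto intro: pg_pointsI)
        moreover have "P \<in> pg_points q 1 UNIV" "vec.span {w} \<in> pg_points q 1 UNIV"
          using P pg_lines_subset[OF lm(1)] w by (auto intro: pg_pointsI)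
        ultimately show False
          using pg_line_unique[of P 1 "vec.span {w}"] P lm ne by blast
      qed
    qed
  qed
  \<comment> \<open>The standard frame serves as quadrangle; its four determinants are
    nonzero.\<close>
  define a b c d where "a = (vector [1, 0, 0] :: 'a ^ 3)" and "b = (vector [0, 1, 0] :: 'a ^ 3)"
    and "c = (vector [0, 0, 1] :: 'a ^ 3)" and "d = (vector [1, 1, 1] :: 'a ^ 3)"
  note abcd = a_def b_def c_def d_def
  have nz: "a \<noteq> 0" "b \<noteq> 0" "c \<noteq> 0" "d \<noteq> 0"
    by (simp_all add: abcd vec3_eq_iff)
  have ne: "vec.span {a} \<noteq> vec.span {b}" "vec.span {a} \<noteq> vec.span {c}" "vec.span {a} \<noteq> vec.span {d}"
    "vec.span {b} \<noteq> vec.span {c}" "vec.span {b} \<noteq> vec.span {d}" "vec.span {c} \<noteq> vec.span {d}"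
    using nz by (auto simp: span1_eq_iff) (auto simp: abcd vec3_eq_iff)
  have rat: "a \<in> rat_vecs q 1" "b \<in> rat_vecs q 1" "c \<in> rat_vecs q 1" "d \<in> rat_vecs q 1"
    unfolding abcd axis_rat by (auto intro: GFq_closed)
  define Q where "Q = {vec.span {a}, vec.span {b}, vec.span {c}, vec.span {d}}"
  have Q: "Q \<subseteq> pg_points q 1 UNIV" "card Q = 4"
    unfolding Q_def using nz rat ne by (auto intro: pg_pointsI)
  have Q2: "card (l \<inter> Q) \<le> 2" if "l \<in> pg_lines q 1" for l
  proof -
    obtain U where U: "rat_subspace q 1 U" "vec.dim U = 2" "l = pg_points q 1 U"
      using \<open>l \<in> pg_lines q 1\<close> by (auto simp: pg_lines_def)
    have mem: "x \<in> U" if "vec.span {x} \<in> l" for x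
      using that U subspace_rat pg_points_span_mem by blast
    have tri0: "tri x y z = 0" if "vec.span {x} \<in> l" "vec.span {y} \<in> l" "vec.span {z} \<in> l" for x y z
      using that U by (intro tri_in_line[of U] mem) (auto intro: subspace_rat)
    have "tri a b c \<noteq> 0" "tri a b d \<noteq> 0" "tri a c d \<noteq> 0" "tri b c d \<noteq> 0"
      by (simp_all add: abcd tri_def)
    then have "\<not> (vec.span {a} \<in> l \<and> vec.span {b} \<in> l \<and> vec.span {c} \<in> l)"
      "\<not> (vec.span {a} \<in> l \<and> vec.span {b} \<in> l \<and> vec.span {d} \<in> l)"
      "\<not> (vec.span {a} \<in> l \<and> vec.span {c} \<in> l \<and> vec.span {d} \<in> l)"
      "\<not> (vec.span {b} \<in> l \<and> vec.span {c} \<in> l \<and> vec.span {d} \<in> l)"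
      using tri0 by blast+
    then show ?thesis
      unfolding Q_def
      by (cases "vec.span {a} \<in> l"; cases "vec.span {b} \<in> l"; cases "vec.span {c} \<in> l"; cases "vec.span {d} \<in> l")
        (simp_all add: Int_insert_right card_insert_if)
  qed
  show ?thesis
    unfolding proj_plane_def
  proof (intro conjI)
    show "\<exists>Q\<subseteq>pg_points q 1 UNIV. card Q = 4 \<and> (\<forall>l\<in>pg_lines q 1. card (l \<inter> (Q :: ('a ^ 3) set set)) \<le> 2)"
      by (rule exI[of _ Q]) (use Q Q2 in blast)
  qed (use 1 in blast, intro ballI impI pg_line_unique, assumption+, intro ballI impI 2, assumption+)
qed

text \<open>A line over the cubic field with two points over the small field is spanned by them and
  so is defined over the small field; a line with fewer induces nothing.\<close>

lemma induced_lines_small: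
  "induced_lines (pg_points q 1 UNIV) (pg_lines q 3) = (pg_lines q 1 :: ('a ^ 3) set set set)"
proof (intro equalityI subsetI)
  have meet: "pg_points q 3 U \<inter> pg_points q 1 UNIV = pg_points q 1 U" if "vec.subspace U" for U :: "('a ^ 3) set"
  proof (intro equalityI subsetI)
    fix P assume P: "P \<in> pg_points q 3 U \<inter> pg_points q 1 UNIV"
    then obtain v where v: "P = vec.span {v}" "v \<in> rat_vecs q 1" "v \<noteq> 0"
      by (auto elim: pg_pointsE)
    then show "P \<in> pg_points q 1 U"
      using P pg_points_span_mem[OF that, of v] by (auto intro: pg_pointsI)
  next
    fix P assume "P \<in> pg_points q 1 U"
    then show "P \<in> pg_points q 3 U \<inter> pg_points q 1 UNIV"
      using rat_vecs_mono[of 1 3] by (auto elim!: pg_pointsE intro!: pg_pointsI)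
  qed
  {
    fix l :: "('a ^ 3) set set" assume "l \<in> induced_lines (pg_points q 1 UNIV) (pg_lines q 3)"
    then obtain U where U: "rat_subspace q 3 U" "vec.dim U = 2" "l = pg_points q 3 U \<inter> pg_points q 1 UNIV" "card l \<ge> 2"
      by (auto simp: induced_lines_def pg_lines_def)
    have l: "l = pg_points q 1 U"
      using meet U subspace_rat by blast
    obtain P Q where PQ: "P \<in> l" "Q \<in> l" "P \<noteq> Q"
      using U(4) by (metis card_le_Suc0_iff_eq card.infinite not_less_eq_eq numeral_2_eq_2 zero_le)
    obtain u where u: "P = vec.span {u}" "u \<in> U" "u \<in> rat_vecs q 1" "u \<noteq> 0"
      using PQ(1) unfolding l by (elim pg_pointsE)
    obtain v where v: "Q = vec.span {v}" "v \<in> U" "v \<in> rat_vecs q 1" "v \<noteq> 0"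
      using PQ(2) unfolding l by (elim pg_pointsE)
    have "v \<notin> vec.span {u}"
      using span1_eqI[of v u] PQ u v by auto
    then have "U = vec.span {u, v}"
      using U u v by (intro line_eq_span2) (auto intro: subspace_rat)
    then have "rat_subspace q 1 U"
      using rat_lineI u v by blast
    then show "l \<in> pg_lines q 1"
      unfolding pg_lines_def using U l by blast
  }
  {
    fix l :: "('a ^ 3) set set" assume "l \<in> pg_lines q 1"
    then obtain U where U: "rat_subspace q 1 U" "vec.dim U = 2" "l = pg_points q 1 U"
      by (auto simp: pg_lines_def)
    then have "rat_subspace q 3 U"
      using rat_vecs_mono[of 1 3] unfolding rat_subspace_def by (metis one_dvd subset_iff)
    then have "pg_points q 3 U \<in> pg_lines q 3"
      unfolding pg_lines_def using U by blast
    moreover have "l = pg_points q 3 U \<inter> pg_points q 1 UNIV"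
      using meet[of U] U subspace_rat by blast
    moreover have "card l \<ge> 2"
      using card_pg_line(1)[OF U(1,2)] U(3) q_ge by simp
    ultimately show "l \<in> induced_lines (pg_points q 1 UNIV) (pg_lines q 3)"
      unfolding induced_lines_def by blast
  }
qed

text \<open>If the first coordinate is nonzero, the first two coordinates of \<open>v\<close> are
  themselves the parameters, because v_2^2 = v_1 v_3. The only other point is (0,0,1).\<close>

lemma rat_param_conic_point:
  fixes v :: "'a ^ 3"
  assumes "v \<in> rat_vecs q 1" "v \<noteq> 0" "(v $ 2)\<^sup>2 = v $ 1 * v $ 3"
  obtains s t k where "s \<in> GFq q 1" "t \<in> GFq q 1" "s \<noteq> 0 \<or> t \<noteq> 0" "k \<noteq> 0" "ver s t = k *s v"
proof (cases "v $ 1 = 0")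
  case True
  then have "v $ 2 = 0"
    using assms(3) by simp
  then have "v $ 3 \<noteq> 0" "ver 0 1 = (1 / v $ 3) *s v"
    using True assms(2) by (auto simp: vec3_eq_iff)
  then show ?thesis
    using that[of 0 1 "1 / v $ 3"] by (auto intro: GFq_closed)
next
  case False
  then have "ver (v $ 1) (v $ 2) = v $ 1 *s v"
    using assms(3) by (simp add: vec3_eq_iff power2_eq_square)
  then show ?thesis
    using that[of "v $ 1" "v $ 2" "v $ 1"] assms(1) False by (simp add: rat3_iff)
qed

lemma ver_rat: "s \<in> GFq q m \<Longrightarrow> t \<in> GFq q m \<Longrightarrow> ver s t \<in> (rat_vecs q m :: ('a ^ 3) set)"
  by (simp add: rat3_iff GFq_closed)

lemma Fq_conic_standard: "Fq_conic q (param_conic q (mat 1 :: 'a ^ 3 ^ 3))"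
proof -
  \<comment> \<open>The form y^2 - xz; the matrix is not symmetric, so no halves are needed in
    characteristic two.\<close>
  define A :: "'a ^ 3 ^ 3" where "A = (\<chi> i j. if i = 2 \<and> j = 2 then 1 else if i = 1 \<and> j = 3 then - 1 else 0)"
  have Q: "quad_form A x = (x $ 2)\<^sup>2 - x $ 1 * x $ 3" for x
    by (simp add: quad_form_def sum_3 A_def power2_eq_square)
  have "nondegenerate_form A"
    unfolding nondegenerate_form_def
  proof (intro allI impI, elim conjE)
    fix x assume 0: "quad_form A x = 0" and p: "\<forall>y. quad_form A (x + y) = quad_form A x + quad_form A y"
    \<comment> \<open>The polar form is 2 x_2 y_2 - x_1 y_3 - x_3 y_1, so a unit vector isolates one
      outer coordinate of \<open>x\<close>. The middle one then vanishes by the form itself, in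
      every characteristic.\<close>
    have "x $ 3 = 0"
      using p[rule_format, of "vector [1, 0, 0]"] by (simp add: Q power2_eq_square algebra_simps)
    moreover have "x $ 1 = 0"
      using p[rule_format, of "vector [0, 0, 1]"] by (simp add: Q power2_eq_square algebra_simps)
    ultimately show "x = 0"
      using 0 by (simp add: Q vec3_eq_iff)
  qed
  moreover have "A $ i $ j \<in> GFq q 1" for i j
    by (simp add: A_def GFq_closed)
  moreover have "param_conic q (mat 1) = {vec.span {v} | v. v \<in> rat_vecs q 1 \<and> v \<noteq> 0 \<and> quad_form A v = 0}"
  proof (intro equalityI subsetI)
    fix P :: "('a ^ 3) set" assume "P \<in> param_conic q (mat 1)"
    then obtain s t where st: "P = vec.span {ver s t}" "s \<in> GFq q 1" "t \<in> GFq q 1" "s \<noteq> 0 \<or> t \<noteq> 0"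
      by (auto simp: param_conic_def)
    then have "ver s t \<in> rat_vecs q 1" "ver s t \<noteq> 0" "quad_form A (ver s t) = 0"
      using ver_rat by (auto simp: ver_eq_0_iff Q power_mult_distrib)
    then show "P \<in> {vec.span {v} | v. v \<in> rat_vecs q 1 \<and> v \<noteq> 0 \<and> quad_form A v = 0}"
      using st by blast
  next
    fix P assume "P \<in> {vec.span {v} | v. v \<in> rat_vecs q 1 \<and> v \<noteq> 0 \<and> quad_form A v = 0}"
    then obtain v where v: "P = vec.span {v}" "v \<in> rat_vecs q 1" "v \<noteq> 0" "quad_form A v = 0"
      by blast
    then obtain s t k where st: "s \<in> GFq q 1" "t \<in> GFq q 1" "s \<noteq> 0 \<or> t \<noteq> 0" "k \<noteq> 0" "ver s t = k *s v"
      using rat_param_conic_point[of v] by (auto simp: Q)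
    then have "P = vec.span {mat 1 *v ver s t}"
      using v(1) span1_scale[of k v] by simp
    then show "P \<in> param_conic q (mat 1)"
      unfolding param_conic_def using st(1-3) by blast
  qed
  ultimately have 1: "nondegenerate_conic q (param_conic q (mat 1 :: 'a ^ 3 ^ 3))"
    unfolding nondegenerate_conic_def by blast
  have "pg_points q 1 UNIV \<subseteq> (pg_points q 3 UNIV :: ('a ^ 3) set set)"
    using rat_vecs_mono[of 1 3] by (auto elim!: pg_pointsE intro!: pg_pointsI)
  then have 2: "Fq_subplane q (pg_points q 1 (UNIV :: ('a ^ 3) set))"
    unfolding Fq_subplane_def induced_lines_small using proj_plane_small by blast
  have 3: "incidence_iso id (pg_points q 1 UNIV) (pg_lines q 1) (pg_points q 1 (UNIV :: ('a ^ 3) set))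
      (induced_lines (pg_points q 1 UNIV) (pg_lines q 3))"
    unfolding induced_lines_small incidence_iso_def by simp
  show ?thesis
    unfolding Fq_conic_def
    by (rule exI[of _ "pg_points q 1 UNIV"], rule exI[of _ id], rule exI[of _ "param_conic q (mat 1)"])
      (use 1 2 3 in simp)
qed

lemma Fq_conic_param:
  fixes M :: "'a ^ 3 ^ 3"
  assumes "\<And>i j. M $ i $ j \<in> GFq q 3" "\<And>v. M *v v = 0 \<Longrightarrow> v = 0"
  shows "Fq_conic q (param_conic q M)"
proof -
  have "(\<lambda>P. (\<lambda>v. M *v v) ` P) ` param_conic q (mat 1) = param_conic q M"
  proof (intro equalityI subsetI)
    fix P assume "P \<in> (\<lambda>P. (\<lambda>v. M *v v) ` P) ` param_conic q (mat 1)"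
    then obtain s t where "s \<in> GFq q 1" "t \<in> GFq q 1" "s \<noteq> 0 \<or> t \<noteq> 0" "P = (\<lambda>v. M *v v) ` vec.span {ver s t}"
      by (auto simp: param_conic_def)
    then show "P \<in> param_conic q M"
      by (auto simp: param_conic_def mv_span)
  next
    fix P assume "P \<in> param_conic q M"
    then obtain s t where st: "s \<in> GFq q 1" "t \<in> GFq q 1" "s \<noteq> 0 \<or> t \<noteq> 0" "P = (\<lambda>v. M *v v) ` vec.span {ver s t}"
      by (auto simp: param_conic_def mv_span)
    then have "vec.span {ver s t} \<in> param_conic q (mat 1)"
      by (auto simp: param_conic_def)
    then show "P \<in> (\<lambda>P. (\<lambda>v. M *v v) ` P) ` param_conic q (mat 1)"
      using st by blast
  qed
  then show ?thesis
    using Fq_conic_image[OF Fq_conic_standard linear_collineation[OF assms]] by simp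
qed

end

declare One_nat_def [simp del]

lemma ker_iff_det: "(\<forall>v. M *v v = 0 \<longrightarrow> v = 0) \<longleftrightarrow> det M \<noteq> 0" for M :: "'a::field ^ 'n ^ 'n"
  by (metis invertible_det_nz invertible_left_inverse matrix_left_invertible_ker)

lemma tri_same: "tri x x y = 0" "tri x y x = 0" "tri y x x = 0"
  by (simp_all add: tri_def algebra_simps)

lemma mv3:
  fixes M :: "'a::comm_ring_1 ^ 3 ^ 3"
  shows "(M *v v) $ i = M $ i $ 1 * v $ 1 + M $ i $ 2 * v $ 2 + M $ i $ 3 * v $ 3"
  by (simp add: matrix_vector_mult_def sum_3)

context frobenius_field begin

section \<open>Subplane embeddings are induced by field homomorphisms\<close>

text \<open>The laws are required on the small field only, and the values may a priori lie anywhere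
  in the closure; \<open>F_hom_bij\<close> shows that they do not leave the small field.\<close>

definition F_hom :: "('a \<Rightarrow> 'a) \<Rightarrow> bool" where
  "F_hom a \<longleftrightarrow> a 0 = 0 \<and> a 1 = 1 \<and>
     (\<forall>x\<in>GFq q 1. \<forall>y\<in>GFq q 1. a (x + y) = a x + a y \<and> a (x * y) = a x * a y)"

lemma F_hom_nz:
  assumes "F_hom a" "x \<in> GFq q 1" "x \<noteq> 0"
  shows "a x \<noteq> 0"
proof -
  have "a (x * inverse x) = a x * a (inverse x)"
    using assms GFq_closed(8)[of x 1] by (simp only: F_hom_def)
  then show ?thesis
    using assms by (auto simp: F_hom_def)
qed

text \<open>Powers are preserved, so x^q = x passes to the image, and an injective map of a finite
  set into itself is onto.\<close>

lemma F_hom_bij: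
  assumes a: "F_hom a"
  shows "a ` GFq q 1 = GFq q 1"
proof -
  have pow: "a (x ^ n) = a x ^ n" if "x \<in> GFq q 1" for x n
    using a that by (induction n) (auto simp: F_hom_def GFq_closed)
  have diff: "a (x - y) = a x - a y" if "x \<in> GFq q 1" "y \<in> GFq q 1" for x y
  proof -
    have "a (x - y + y) = a (x - y) + a y"
      using a that GFq_closed(4)[of x 1 y] by (simp only: F_hom_def)
    then show ?thesis
      by simp
  qed
  have "a x \<in> GFq q 1" if "x \<in> GFq q 1" for x
    using pow[OF that, of q] that by (simp add: GFq_iff)
  then have "a ` GFq q 1 \<subseteq> GFq q 1"
    by blast
  moreover have "inj_on a (GFq q 1)"
  proof (rule inj_onI)
    fix x y assume xy: "x \<in> GFq q 1" "y \<in> GFq q 1" "a x = a y"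
    then have "a (x - y) = 0"
      by (simp add: diff)
    then show "x = y"
      using F_hom_nz[OF a, of "x - y"] xy GFq_closed(4)[of x 1 y] by auto
  qed
  ultimately show ?thesis
    using card_GFq(2)[of 1] by (intro endo_inj_surj) auto
qed

text \<open>The coordinate argument of the fundamental theorem. \<open>N\<close> fixes the points of
  the standard frame, so \<open>a\<close> can be read off on one axis, and its compatibility with
  sums and products comes from collinear triples that express them.\<close>

lemma frame_hom:
  fixes N :: "'a ^ 3 \<Rightarrow> 'a ^ 3"
  defines "R \<equiv> rat_vecs q 1 - {0}"
  assumes T: "\<And>u v w. u \<in> R \<Longrightarrow> v \<in> R \<Longrightarrow> w \<in> R \<Longrightarrow> tri u v w = 0 \<longleftrightarrow> tri (N u) (N v) (N w) = 0"
    and sc: "\<And>k v. k \<in> GFq q 1 \<Longrightarrow> k \<noteq> 0 \<Longrightarrow> v \<in> R \<Longrightarrow> N (k *s v) \<in> vec.span {N v}"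
    and e1: "N (vector [1, 0, 0]) $ 1 \<noteq> 0" "N (vector [1, 0, 0]) $ 2 = 0" "N (vector [1, 0, 0]) $ 3 = 0"
    and e2: "N (vector [0, 1, 0]) $ 1 = 0" "N (vector [0, 1, 0]) $ 2 \<noteq> 0" "N (vector [0, 1, 0]) $ 3 = 0"
    and e3: "N (vector [0, 0, 1]) $ 1 = 0" "N (vector [0, 0, 1]) $ 2 = 0" "N (vector [0, 0, 1]) $ 3 \<noteq> 0"
    and U: "N (vector [1, 1, 1]) = vector [1, 1, 1]"
  obtains a where "F_hom a" "\<And>v. v \<in> R \<Longrightarrow> N v \<in> vec.span {\<chi> i. a (v $ i)}"
proof -
  have RI: "vector [x, y, z] \<in> R \<longleftrightarrow> x \<in> GFq q 1 \<and> y \<in> GFq q 1 \<and> z \<in> GFq q 1 \<and> (x \<noteq> 0 \<or> y \<noteq> 0 \<or> z \<noteq> 0)" for x y z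
    unfolding R_def by (auto simp: axis_rat vec3_eq_iff simp del: One_nat_def)
  have F01: "(0 :: 'a) \<in> GFq q 1" "(1 :: 'a) \<in> GFq q 1"
    by (auto intro: GFq_closed)
  note R_simps = RI F01
  \<comment> \<open>\<open>a\<close> and \<open>b\<close> are the maps that \<open>N\<close> induces
    on the coordinates of two axes through (1,0,0).\<close>
  define a where "a x = N (vector [1, x, 0]) $ 2 / N (vector [1, x, 0]) $ 1" for x
  define b where "b x = N (vector [1, 0, x]) $ 3 / N (vector [1, 0, x]) $ 1" for x
  have f1: "N (vector [1, x, y]) $ 1 \<noteq> 0" if "x \<in> GFq q 1" "y \<in> GFq q 1" for x y
    using T[of "vector [0, 1, 0]" "vector [0, 0, 1]" "vector [1, x, y]"] e2 e3 that
    by (simp add: R_simps tri_def del: One_nat_def)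
  \<comment> \<open>(1,x,y) is collinear with (0,0,1) and (1,x,0), and for \<open>f4\<close> with
    (0,1,0) and (1,0,y), which fixes the ratios of its image.\<close>
  have f3: "N (vector [1, x, y]) $ 2 = a x * N (vector [1, x, y]) $ 1" if "x \<in> GFq q 1" "y \<in> GFq q 1" for x y
    using T[of "vector [0, 0, 1]" "vector [1, x, 0]" "vector [1, x, y]"] e3 that f1[OF that(1) F01(1)]
    by (simp add: R_simps tri_def a_def field_simps del: One_nat_def)
  have f4: "N (vector [1, x, y]) $ 3 = b y * N (vector [1, x, y]) $ 1" if "x \<in> GFq q 1" "y \<in> GFq q 1" for x y
    using T[of "vector [0, 1, 0]" "vector [1, 0, y]" "vector [1, x, y]"] e2 that f1[OF F01(1) that(2)]
    by (simp add: R_simps tri_def b_def field_simps del: One_nat_def)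
  \<comment> \<open>(1,x,x) is on the line of (1,0,0) and (1,1,1), which \<open>N\<close> maps into
    the line where the last two coordinates agree.\<close>
  have ab: "a x = b x" if "x \<in> GFq q 1" for x
    using T[of "vector [1, 0, 0]" "vector [1, 1, 1]" "vector [1, x, x]"] e1 U that f3[OF that that] f4[OF that that] f1[OF that that]
    by (simp add: R_simps tri_def del: One_nat_def)
  have n: "N (vector [1, x, y]) = N (vector [1, x, y]) $ 1 *s vector [1, a x, a y]" if "x \<in> GFq q 1" "y \<in> GFq q 1" for x y
    using f3[OF that] f4[OF that] ab[OF that(2)] by (simp add: vec3_eq_iff)
  have a0: "a 0 = 0"
    using e1 by (simp add: a_def)
  have a1: "a 1 = 1"
    using f3[OF F01(2) F01(2)] U by simp
  have m1: "N (vector [0, 1, z]) $ 1 = 0" if "z \<in> GFq q 1" for z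
    using T[of "vector [0, 1, 0]" "vector [0, 0, 1]" "vector [0, 1, z]"] e2 e3 that
    by (simp add: R_simps tri_def del: One_nat_def)
  have m2: "N (vector [0, 1, z]) $ 2 \<noteq> 0" if "z \<in> GFq q 1" for z
    using T[of "vector [1, 0, 0]" "vector [0, 0, 1]" "vector [0, 1, z]"] e1 e3 that
    by (simp add: R_simps tri_def del: One_nat_def)
  \<comment> \<open>(0,1,z) = (1,1,z) - (1,0,0) transfers \<open>a\<close> to the line where the
    first coordinate is 0.\<close>
  have m3: "N (vector [0, 1, z]) $ 3 = a z * N (vector [0, 1, z]) $ 2" if "z \<in> GFq q 1" for z
    using T[of "vector [1, 0, 0]" "vector [1, 1, z]" "vector [0, 1, z]"] e1 that a1
      f3[OF F01(2) that] f4[OF F01(2) that] f1[OF F01(2) that] ab[OF that]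
    by (simp add: R_simps tri_def del: One_nat_def)
  have m: "N (vector [0, 1, z]) = N (vector [0, 1, z]) $ 2 *s vector [0, 1, a z]" if "z \<in> GFq q 1" for z
    using m1[OF that] m3[OF that] by (simp add: vec3_eq_iff)
  \<comment> \<open>Collinear triple for the product: (1,x,xz) = (1,0,0) + x (0,1,z).\<close>
  have mult: "a (x * z) = a x * a z" if xz: "x \<in> GFq q 1" "z \<in> GFq q 1" for x z
  proof -
    have xzF: "x * z \<in> GFq q 1"
      using xz by (rule GFq_closed)
    have "tri (N (vector [1, 0, 0])) (N (vector [0, 1, z])) (N (vector [1, x, x * z])) = 0"
      using T[of "vector [1, 0, 0]" "vector [0, 1, z]" "vector [1, x, x * z]"] xz xzF
      by (simp add: R_simps tri_def del: One_nat_def)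
    then show ?thesis
      using e1 m3[OF xz(2)] f3[OF xz(1) xzF] f4[OF xz(1) xzF] ab[OF xzF] f1[OF xz(1) xzF] m2[OF xz(2)]
      by (simp add: tri_def)
  qed
  \<comment> \<open>Collinear triple for the sum: (1,x,x+y) = (1,0,y) + x (0,1,1).\<close>
  have add: "a (x + y) = a x + a y" if xy: "x \<in> GFq q 1" "y \<in> GFq q 1" for x y
  proof -
    have xyF: "x + y \<in> GFq q 1"
      using xy by (rule GFq_closed)
    have "tri (N (vector [1, 0, y])) (N (vector [0, 1, 1])) (N (vector [1, x, x + y])) = 0"
      using T[of "vector [1, 0, y]" "vector [0, 1, 1]" "vector [1, x, x + y]"] xy xyF
      by (simp add: R_simps tri_def del: One_nat_def)
    then have "N (vector [1, 0, y]) $ 1 * N (vector [0, 1, 1]) $ 2 * N (vector [1, x, x + y]) $ 1 * (a (x + y) - a x - a y) = 0"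
      using m1[OF F01(2)] m3[OF F01(2)] f3[OF xy(1) xyF] f4[OF xy(1) xyF] ab[OF xyF] f3[OF F01(1) xy(2)] f4[OF F01(1) xy(2)] ab[OF xy(2)]
      by (simp add: tri_def a0 a1 algebra_simps)
    then have "a (x + y) - a x - a y = 0"
      using f1[OF xy(1) xyF] m2[OF F01(2)] f1[OF F01(1) xy(2)] by (simp only: mult_eq_0_iff) simp
    then show ?thesis
      by (simp add: algebra_simps)
  qed
  have hom: "F_hom a"
    using a0 a1 mult add by (simp add: F_hom_def)
  have dv: "a (y / x) = a y / a x" if "x \<in> GFq q 1" "x \<noteq> 0" "y \<in> GFq q 1" for x y
  proof -
    have "a (x * (y / x)) = a x * a (y / x)"
      using that by (intro mult) (auto intro: GFq_closed)
    then show ?thesis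
      using that F_hom_nz[OF hom that(1,2)] by (simp add: field_simps)
  qed
  have "N v \<in> vec.span {\<chi> i. a (v $ i)}" if v: "v \<in> R" for v
  proof -
    have vF: "v $ 1 \<in> GFq q 1" "v $ 2 \<in> GFq q 1" "v $ 3 \<in> GFq q 1" "v \<noteq> 0"
      using v by (auto simp: R_def rat3_iff simp del: One_nat_def)
    have chi: "(\<chi> i. a (v $ i)) = vector [a (v $ 1), a (v $ 2), a (v $ 3)]"
      by (simp add: vec3_eq_iff)
    consider "v $ 1 \<noteq> 0" | "v $ 1 = 0" "v $ 2 \<noteq> 0" | "v $ 1 = 0" "v $ 2 = 0" "v $ 3 \<noteq> 0"
      using vF by (auto simp: vec3_eq_iff)
    then show ?thesis
    proof cases
      case 1
      define w where "w = (vector [1, v $ 2 / v $ 1, v $ 3 / v $ 1] :: 'a ^ 3)"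
      have dF: "v $ 2 / v $ 1 \<in> GFq q 1" "v $ 3 / v $ 1 \<in> GFq q 1"
        using vF by (auto intro: GFq_closed simp del: One_nat_def)
      have "v = v $ 1 *s w" "w \<in> R"
        using 1 dF by (auto simp: w_def vec3_eq_iff R_simps simp del: One_nat_def)
      then have "N v \<in> vec.span {N w}"
        using sc[of "v $ 1" w] 1 vF by simp
      then obtain k where "N v = k *s N w"
        using in_span1_iff by blast
      also have "N w = N w $ 1 *s vector [1, a (v $ 2 / v $ 1), a (v $ 3 / v $ 1)]"
        unfolding w_def by (rule n) (fact dF)+
      also have "vector [1, a (v $ 2 / v $ 1), a (v $ 3 / v $ 1)] = inverse (a (v $ 1)) *s (\<chi> i. a (v $ i))"
        using F_hom_nz[OF hom vF(1) 1] dv[OF vF(1) 1] vF unfolding chi by (simp add: vec3_eq_iff field_simps)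
      finally show ?thesis
        by (auto simp: in_span1_iff)
    next
      case 2
      define w where "w = (vector [0, 1, v $ 3 / v $ 2] :: 'a ^ 3)"
      have dF: "v $ 3 / v $ 2 \<in> GFq q 1"
        using vF by (auto intro: GFq_closed simp del: One_nat_def)
      have "v = v $ 2 *s w" "w \<in> R"
        using 2 dF by (auto simp: w_def vec3_eq_iff R_simps simp del: One_nat_def)
      then have "N v \<in> vec.span {N w}"
        using sc[of "v $ 2" w] 2 vF by simp
      then obtain k where "N v = k *s N w"
        using in_span1_iff by blast
      also have "N w = N w $ 2 *s vector [0, 1, a (v $ 3 / v $ 2)]"
        unfolding w_def by (rule m) (fact dF)+
      also have "vector [0, 1, a (v $ 3 / v $ 2)] = inverse (a (v $ 2)) *s (\<chi> i. a (v $ i))"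
        using F_hom_nz[OF hom vF(2) 2(2)] dv[OF vF(2) 2(2)] vF 2 a0 unfolding chi by (simp add: vec3_eq_iff field_simps)
      finally show ?thesis
        by (auto simp: in_span1_iff)
    next
      case 3
      define w where "w = (vector [0, 0, 1] :: 'a ^ 3)"
      have "v = v $ 3 *s w" "w \<in> R"
        using 3 by (auto simp: w_def vec3_eq_iff R_simps simp del: One_nat_def)
      then have "N v \<in> vec.span {N w}"
        using sc[of "v $ 3" w] 3 vF by simp
      then obtain k where "N v = k *s N w"
        using in_span1_iff by blast
      also have "N w = (N w $ 3 / a (v $ 3)) *s (\<chi> i. a (v $ i))"
        using F_hom_nz[OF hom vF(3) 3(3)] 3 a0 e3 unfolding chi w_def by (simp add: vec3_eq_iff)
      finally show ?thesis
        by (auto simp: in_span1_iff)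
    qed
  qed
  then show ?thesis
    using that hom by blast
qed

text \<open>A matrix moves the images of the frame points to the standard frame, which reduces the
  claim to \<open>frame_hom\<close>; \<open>M\<close> undoes this change.\<close>

lemma subplane_embedding:
  fixes N :: "'a ^ 3 \<Rightarrow> 'a ^ 3"
  defines "R \<equiv> rat_vecs q 1 - {0}"
  assumes T: "\<And>u v w. u \<in> R \<Longrightarrow> v \<in> R \<Longrightarrow> w \<in> R \<Longrightarrow> tri u v w = 0 \<longleftrightarrow> tri (N u) (N v) (N w) = 0"
    and sc: "\<And>k v. k \<in> GFq q 1 \<Longrightarrow> k \<noteq> 0 \<Longrightarrow> v \<in> R \<Longrightarrow> N (k *s v) \<in> vec.span {N v}"
    and rat: "\<And>v. v \<in> R \<Longrightarrow> N v \<in> rat_vecs q 3"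
  obtains M a where "\<And>i j. M $ i $ j \<in> GFq q 3" "det M \<noteq> 0" "F_hom a"
    "\<And>v. v \<in> R \<Longrightarrow> N v \<in> vec.span {M *v (\<chi> i. a (v $ i))}"
proof -
  have RI: "vector [x, y, z] \<in> R \<longleftrightarrow> x \<in> GFq q 1 \<and> y \<in> GFq q 1 \<and> z \<in> GFq q 1 \<and> (x \<noteq> 0 \<or> y \<noteq> 0 \<or> z \<noteq> 0)" for x y z
    unfolding R_def by (auto simp: axis_rat vec3_eq_iff simp del: One_nat_def)
  have F01: "(0 :: 'a) \<in> GFq q 1" "(1 :: 'a) \<in> GFq q 1"
    by (auto intro: GFq_closed)
  define e1 e2 e3 u where e: "e1 = (vector [1, 0, 0] :: 'a ^ 3)" "e2 = (vector [0, 1, 0] :: 'a ^ 3)"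
    "e3 = (vector [0, 0, 1] :: 'a ^ 3)" "u = (vector [1, 1, 1] :: 'a ^ 3)"
  have eR: "e1 \<in> R" "e2 \<in> R" "e3 \<in> R" "u \<in> R"
    by (auto simp: e RI F01 simp del: One_nat_def)
  define d where "d = tri (N e1) (N e2) (N e3)"
  \<comment> \<open>By Cramer's rule the coordinates of \<open>N u\<close> in the basis
    \<open>N e1\<close>, \<open>N e2\<close>, \<open>N e3\<close>. With the basis vectors scaled by
    them as columns, \<open>M\<close> sends (1,1,1) to \<open>N u\<close>.\<close>
  define \<alpha> \<beta> \<gamma> where "\<alpha> = tri (N u) (N e2) (N e3) / d" and "\<beta> = tri (N e1) (N u) (N e3) / d"
    and "\<gamma> = tri (N e1) (N e2) (N u) / d"
  have d: "d \<noteq> 0"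
    using T[OF eR(1,2,3)] by (simp add: d_def e tri_def)
  have nz: "\<alpha> \<noteq> 0" "\<beta> \<noteq> 0" "\<gamma> \<noteq> 0"
    using T[OF eR(4,2,3)] T[OF eR(1,4,3)] T[OF eR(1,2,4)] d
    by (simp_all add: \<alpha>_def \<beta>_def \<gamma>_def) (simp_all add: e tri_def)
  have triE: "tri (N x) (N y) (N z) \<in> GFq q 3" if "x \<in> R" "y \<in> R" "z \<in> R" for x y z
    using rat[OF that(1)] rat[OF that(2)] rat[OF that(3)] unfolding tri_def rat3_iff
    by (intro GFq_closed) auto
  have abcE: "\<alpha> \<in> GFq q 3" "\<beta> \<in> GFq q 3" "\<gamma> \<in> GFq q 3"
    unfolding \<alpha>_def \<beta>_def \<gamma>_def d_def using eR by (auto intro!: GFq_closed(6) triE)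
  define M :: "'a ^ 3 ^ 3" where "M = (\<chi> i j. if j = 1 then \<alpha> * N e1 $ i else if j = 2 then \<beta> * N e2 $ i else \<gamma> * N e3 $ i)"
  have Mi: "M $ i $ 1 = \<alpha> * N e1 $ i" "M $ i $ 2 = \<beta> * N e2 $ i" "M $ i $ 3 = \<gamma> * N e3 $ i" for i
    by (simp_all add: M_def)
  have ME: "M $ i $ j \<in> GFq q 3" for i j
    using rat[OF eR(1)] rat[OF eR(2)] rat[OF eR(3)] abcE by (auto simp: M_def rat_vecs_def intro!: GFq_closed)
  have detM: "det M = \<alpha> * \<beta> * \<gamma> * d"
    by (simp add: det_3 Mi d_def tri_def algebra_simps)
  have triM: "tri (M *v x) (M *v y) (M *v z) = det M * tri x y z" for x y z
    by (simp add: det_3 mv3 tri_def algebra_simps)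
  \<comment> \<open>The inverse of \<open>M\<close>, again by Cramer's rule.\<close>
  define S where "S w = (vector [tri w (N e2) (N e3) / (\<alpha> * d), tri (N e1) w (N e3) / (\<beta> * d),
      tri (N e1) (N e2) w / (\<gamma> * d)] :: 'a ^ 3)" for w
  have MS: "M *v S w = w" for w
  proof -
    have "d * w $ i = tri w (N e2) (N e3) * N e1 $ i + tri (N e1) w (N e3) * N e2 $ i + tri (N e1) (N e2) w * N e3 $ i" for i
      using exhaust_3[of i] by (auto simp: d_def tri_def algebra_simps)
    then have "(M *v S w) $ i = w $ i" for i
      using d nz by (simp add: mv3 Mi S_def field_simps)
    then show ?thesis
      by (simp add: vec_eq_iff)
  qed
  have SM: "S (c *s w) = c *s S w" for c w
    by (simp add: S_def vec3_eq_iff tri_def algebra_simps add_divide_distrib diff_divide_distrib)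
  have "F_hom a \<Longrightarrow> (\<And>v. v \<in> R \<Longrightarrow> S (N v) \<in> vec.span {\<chi> i. a (v $ i)}) \<Longrightarrow> thesis" for a
  proof -
    assume a: "F_hom a" and *: "\<And>v. v \<in> R \<Longrightarrow> S (N v) \<in> vec.span {\<chi> i. a (v $ i)}"
    have "N v \<in> vec.span {M *v (\<chi> i. a (v $ i))}" if vR: "v \<in> R" for v
    proof -
      obtain k where "S (N v) = k *s (\<chi> i. a (v $ i))"
        using *[OF vR] in_span1_iff by blast
      then have "N v = k *s (M *v (\<chi> i. a (v $ i)))"
        using MS[of "N v"] by (simp only: vector_scalar_commute)
      then show ?thesis
        using in_span1_iff by blast
    qed
    then show thesis
      using that[of M a] ME detM nz d a by simp
  qed
  moreover obtain a where "F_hom a" "\<And>v. v \<in> R \<Longrightarrow> S (N v) \<in> vec.span {\<chi> i. a (v $ i)}"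
    unfolding R_def
  proof (rule frame_hom[of "\<lambda>v. S (N v)"])
    fix x y z :: "'a ^ 3" assume xyz: "x \<in> rat_vecs q 1 - {0}" "y \<in> rat_vecs q 1 - {0}" "z \<in> rat_vecs q 1 - {0}"
    have "tri (N x) (N y) (N z) = det M * tri (S (N x)) (S (N y)) (S (N z))"
      using triM[of "S (N x)" "S (N y)" "S (N z)"] by (simp add: MS)
    then show "(tri x y z = 0) = (tri (S (N x)) (S (N y)) (S (N z)) = 0)"
      using T[of x y z] xyz detM nz d by (simp add: R_def)
  next
    fix k :: 'a and v :: "'a ^ 3" assume "k \<in> GFq q 1" "k \<noteq> 0" "v \<in> rat_vecs q 1 - {0}"
    then obtain c where "N (k *s v) = c *s N v"
      using sc[of k v] in_span1_iff unfolding R_def by blast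
    then show "S (N (k *s v)) \<in> vec.span {S (N v)}"
      using SM in_span1_iff by metis
  qed (use d nz in \<open>simp_all add: S_def vec3_eq_iff \<alpha>_def \<beta>_def \<gamma>_def tri_same flip: e d_def\<close>)
  ultimately show ?thesis
    by blast
qed

end

section \<open>Quadratic forms in three variables and their polar forms\<close>

definition polar :: "'a::field ^ 3 ^ 3 \<Rightarrow> 'a ^ 3 \<Rightarrow> 'a ^ 3 \<Rightarrow> 'a" where
  "polar A x y = (\<Sum>i\<in>UNIV. \<Sum>j\<in>UNIV. A $ i $ j * (x $ i * y $ j + y $ i * x $ j))"

lemma quad_form_add: "quad_form A (x + y) = quad_form A x + quad_form A y + polar A x y"
  by (simp add: quad_form_def polar_def algebra_simps sum.distrib)

lemma quad_form_scale: "quad_form A (c *s x) = c\<^sup>2 * quad_form A x"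
  by (simp add: quad_form_def sum_distrib_left algebra_simps power2_eq_square)

lemma polar_add: "polar A x (y + z) = polar A x y + polar A x z"
  by (simp add: polar_def algebra_simps sum.distrib)

lemma polar_scale: "polar A x (c *s y) = c * polar A x y"
  by (simp add: polar_def sum_distrib_left algebra_simps)

lemma polar_comm: "polar A x y = polar A y x"
  by (simp add: polar_def algebra_simps)

lemma polar_linear_left:
  "polar A (x + y) z = polar A x z + polar A y z" "polar A (c *s x) z = c * polar A x z"
  by (simp_all only: polar_comm[of A _ z] polar_add polar_scale)

lemma polar_self: "polar A x x = 2 * quad_form A x"
  by (simp add: polar_def quad_form_def sum_distrib_left algebra_simps)

lemma polar_diff: "polar A x (y - z) = polar A x y - polar A x z"
  by (simp add: polar_def algebra_simps sum.distrib sum_subtractf)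

context frobenius_field begin

section \<open>Conics over the small field\<close>

text \<open>For i > 0 there is a nonzero \<open>a\<close> with a^i different from 1, since x^i - 1
  has at most i < q - 1 roots; substituting ax for x multiplies the sum by a^i. For i = 0 the sum is
  q = 0.\<close>

lemma power_sum_zero:
  assumes "i < q - 1"
  shows "(\<Sum>x\<in>GFq q 1. x ^ i) = (0 :: 'a)"
proof (cases "i = 0")
  case True
  have "(of_nat q :: 'a) = 0"
    using q_power of_nat_CHAR[where 'a = 'a] by (auto simp: zero_power)
  then show ?thesis
    using True card_GFq(1)[of 1] by simp
next
  case False
  have "\<exists>a\<in>GFq q 1. (a :: 'a) \<noteq> 0 \<and> a ^ i \<noteq> 1"
  proof (rule ccontr)
    assume "\<not> ?thesis"
    then have sub: "GFq q 1 - {0} \<subseteq> {x :: 'a. poly (monom 1 i - 1) x = 0}"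
      by (auto simp: poly_monom)
    have "coeff (monom 1 i - 1 :: 'a poly) i = 1"
      using False by simp
    then have nz: "monom 1 i - 1 \<noteq> (0 :: 'a poly)"
      by (metis coeff_0 zero_neq_one)
    have "degree (monom 1 i - 1 :: 'a poly) \<le> i"
      by (intro degree_diff_le) (auto simp: degree_monom_le)
    then have "card {x :: 'a. poly (monom 1 i - 1) x = 0} \<le> i"
      using card_poly_roots_bound[OF nz] by linarith
    moreover have "card (GFq q 1 - {0 :: 'a}) \<le> card {x :: 'a. poly (monom 1 i - 1) x = 0}"
      using sub poly_roots_finite[OF nz] by (intro card_mono) auto
    moreover have "card (GFq q 1 - {0 :: 'a}) = q - 1"
      using card_GFq[of 1] GFq_closed(1)[of 1] by (simp add: card_Diff_singleton)
    ultimately show False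
      using assms by linarith
  qed
  then obtain a :: 'a where a: "a \<in> GFq q 1" "a \<noteq> 0" "a ^ i \<noteq> 1"
    by blast
  have "bij_betw (\<lambda>x. a * x) (GFq q 1) (GFq q 1)"
  proof (rule bij_betwI[where g = "\<lambda>x. x / a"])
    show "(\<lambda>x. a * x) \<in> GFq q 1 \<rightarrow> GFq q 1"
      using a(1) by (auto intro: GFq_closed)
    show "(\<lambda>x. x / a) \<in> GFq q 1 \<rightarrow> GFq q 1"
      using a(1) by (auto intro: GFq_closed)
  qed (use a in auto)
  then have "(\<Sum>x\<in>GFq q 1. (a * x) ^ i) = (\<Sum>x\<in>GFq q 1. x ^ i)"
    by (rule sum.reindex_bij_betw)
  then have "a ^ i * (\<Sum>x\<in>GFq q 1. x ^ i) = (\<Sum>x\<in>GFq q 1. x ^ i)"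
    by (simp add: power_mult_distrib sum_distrib_left)
  then show ?thesis
    using a(3) by simp
qed

text \<open>Each factor \<open>Q\<close> that is multiplied out raises the total degree by 2. When
  none is left, some exponent is below q - 1 and \<open>power_sum_zero\<close> applies. The case
  used is n = q - 1 without a monomial, where the bound reads 2 (q - 1) < 3 (q - 1).\<close>

lemma Chevalley_Warning_sum:
  fixes c1 c2 c3 c4 c5 c6 :: 'a
  defines "Q x y z \<equiv> c1 * x\<^sup>2 + c2 * y\<^sup>2 + c3 * z\<^sup>2 + c4 * (x * y) + c5 * (x * z) + c6 * (y * z)"
  assumes "2 * n + i + j + k < 3 * (q - 1)"
  shows "(\<Sum>x\<in>GFq q 1. \<Sum>y\<in>GFq q 1. \<Sum>z\<in>GFq q 1. Q x y z ^ n * (x ^ i * y ^ j * z ^ k)) = 0"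
  using assms(2)
proof (induction n arbitrary: i j k)
  case 0
  then have "i < q - 1 \<or> j < q - 1 \<or> k < q - 1"
    by linarith
  then have "(\<Sum>x\<in>GFq q 1. x ^ i) * (\<Sum>y\<in>GFq q 1. y ^ j) * (\<Sum>z\<in>GFq q 1. z ^ k) = (0 :: 'a)"
    using power_sum_zero by auto
  moreover have "(\<Sum>x\<in>GFq q 1. \<Sum>y\<in>GFq q 1. \<Sum>z\<in>GFq q 1. x ^ i * y ^ j * z ^ k)
      = (\<Sum>x\<in>GFq q 1. x ^ i) * (\<Sum>y\<in>GFq q 1. y ^ j) * (\<Sum>z\<in>GFq q 1. z ^ k :: 'a)"
    by (simp only: mult.assoc flip: sum_distrib_left sum_distrib_right)
  ultimately show ?case
    by simp
next
  case (Suc n)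
  define W where "W i j k = (\<Sum>x\<in>GFq q 1. \<Sum>y\<in>GFq q 1. \<Sum>z\<in>GFq q 1. Q x y z ^ n * (x ^ i * y ^ j * z ^ k))" for i j k
  have "Q x y z ^ Suc n * (x ^ i * y ^ j * z ^ k) =
      c1 * (Q x y z ^ n * (x ^ (i + 2) * y ^ j * z ^ k)) + c2 * (Q x y z ^ n * (x ^ i * y ^ (j + 2) * z ^ k))
    + c3 * (Q x y z ^ n * (x ^ i * y ^ j * z ^ (k + 2))) + c4 * (Q x y z ^ n * (x ^ (i + 1) * y ^ (j + 1) * z ^ k))
    + c5 * (Q x y z ^ n * (x ^ (i + 1) * y ^ j * z ^ (k + 1))) + c6 * (Q x y z ^ n * (x ^ i * y ^ (j + 1) * z ^ (k + 1)))"
    for x y z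
  proof -
    define P where "P = Q x y z ^ n"
    have "Q x y z ^ Suc n * (x ^ i * y ^ j * z ^ k) = Q x y z * (P * (x ^ i * y ^ j * z ^ k))"
      by (simp add: P_def)
    also have "\<dots> = c1 * (P * (x ^ (i + 2) * y ^ j * z ^ k)) + c2 * (P * (x ^ i * y ^ (j + 2) * z ^ k))
    + c3 * (P * (x ^ i * y ^ j * z ^ (k + 2))) + c4 * (P * (x ^ (i + 1) * y ^ (j + 1) * z ^ k))
    + c5 * (P * (x ^ (i + 1) * y ^ j * z ^ (k + 1))) + c6 * (P * (x ^ i * y ^ (j + 1) * z ^ (k + 1)))"
      unfolding Q_def by (simp add: algebra_simps power_add power2_eq_square)
    finally show ?thesis
      by (simp only: P_def)
  qed
  then have "(\<Sum>x\<in>GFq q 1. \<Sum>y\<in>GFq q 1. \<Sum>z\<in>GFq q 1. Q x y z ^ Suc n * (x ^ i * y ^ j * z ^ k)) =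
      c1 * W (i + 2) j k + c2 * W i (j + 2) k + c3 * W i j (k + 2) + c4 * W (i + 1) (j + 1) k
    + c5 * W (i + 1) j (k + 1) + c6 * W i (j + 1) (k + 1)"
    unfolding W_def by (simp only: sum.distrib sum_distrib_left)
  moreover have Wz: "W i' j' k' = 0" if "2 * n + i' + j' + k' < 3 * (q - 1)" for i' j' k'
    unfolding W_def by (rule Suc.IH[OF that])
  have "W (i + 2) j k = 0" "W i (j + 2) k = 0" "W i j (k + 2) = 0" "W (i + 1) (j + 1) k = 0"
    "W (i + 1) j (k + 1) = 0" "W i (j + 1) (k + 1) = 0"
    using Suc.prems by (auto intro!: Wz)
  ultimately show ?case
    by simp
qed

text \<open>If the origin were the only zero, Q^(q-1) would be 1 everywhere else and its sum over
  all q^3 vectors would be q^3 - 1 = -1, while \<open>Chevalley_Warning_sum\<close> makes it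
  0.\<close>

lemma ternary_form_isotropic:
  fixes A :: "'a ^ 3 ^ 3"
  assumes A: "\<And>i j. A $ i $ j \<in> GFq q 1"
  obtains v where "v \<in> rat_vecs q 1" "v \<noteq> 0" "quad_form A v = 0"
proof (rule ccontr)
  assume neg: "\<not> thesis"
  note witness = that
  define Q where "Q x y z = A $ 1 $ 1 * x\<^sup>2 + A $ 2 $ 2 * y\<^sup>2 + A $ 3 $ 3 * z\<^sup>2 + (A $ 1 $ 2 + A $ 2 $ 1) * (x * y)
     + (A $ 1 $ 3 + A $ 3 $ 1) * (x * z) + (A $ 2 $ 3 + A $ 3 $ 2) * (y * z)" for x y z
  have Q: "quad_form A (vector [x, y, z]) = Q x y z" for x y z
    by (simp add: quad_form_def sum_3 Q_def algebra_simps power2_eq_square)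
  have pw: "Q x y z ^ (q - 1) = 1 - (if x = 0 then if y = 0 then if z = 0 then 1 else 0 else 0 else 0)"
    if xyz: "x \<in> GFq q 1" "y \<in> GFq q 1" "z \<in> GFq q 1" for x y z
  proof (cases "x = 0 \<and> y = 0 \<and> z = 0")
    case True
    then show ?thesis
      using q_ge by (simp add: Q_def power_0_left)
  next
    case False
    then have "(vector [x, y, z] :: 'a ^ 3) \<noteq> 0" "(vector [x, y, z] :: 'a ^ 3) \<in> rat_vecs q 1"
      using xyz by (auto simp: vec3_eq_iff axis_rat)
    then have nz: "Q x y z \<noteq> 0"
      using neg witness[of "vector [x, y, z]"] unfolding Q by blast
    have "Q x y z \<in> GFq q 1"
      unfolding Q_def by (intro GFq_closed A xyz)
    then have "Q x y z ^ (q - 1) * Q x y z = Q x y z"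
      using q_pos(1) power_minus_mult[of q "Q x y z"] by (simp add: GFq_iff)
    then show ?thesis
      using nz False by auto
  qed
  have "(\<Sum>x\<in>GFq q 1. \<Sum>y\<in>GFq q 1. \<Sum>z\<in>GFq q 1. Q x y z ^ (q - 1)) = 0"
    using Chevalley_Warning_sum[of "q - 1" 0 0 0 "A $ 1 $ 1" "A $ 2 $ 2" "A $ 3 $ 3" "A $ 1 $ 2 + A $ 2 $ 1"
        "A $ 1 $ 3 + A $ 3 $ 1" "A $ 2 $ 3 + A $ 3 $ 2"] q_ge
    by (simp add: Q_def)
  moreover have "(\<Sum>x\<in>GFq q 1. \<Sum>y\<in>GFq q 1. \<Sum>z\<in>GFq q 1. Q x y z ^ (q - 1)) =
     (\<Sum>x\<in>GFq q 1. \<Sum>y\<in>GFq q 1. \<Sum>z\<in>GFq q 1. 1 - (if x = (0 :: 'a) then if y = (0 :: 'a) then if z = (0 :: 'a) then 1 else 0 else 0 else (0 :: 'a)))"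
    by (intro sum.cong refl pw)
  moreover have "(of_nat q :: 'a) = 0"
    using q_power of_nat_CHAR[where 'a = 'a] by (auto simp: zero_power)
  moreover have "(\<Sum>x\<in>GFq q 1. \<Sum>y\<in>GFq q 1. \<Sum>z\<in>GFq q 1. (if x = (0 :: 'a) then if y = (0 :: 'a) then if z = (0 :: 'a) then 1 else 0 else 0 else (0 :: 'a))) = 1"
  proof -
    have "(\<Sum>z\<in>GFq q 1. if x = 0 then if y = 0 then if z = (0 :: 'a) then 1 else 0 else 0 else (0 :: 'a)) =
        (if y = 0 then if x = 0 then 1 else 0 else 0)" for x y :: 'a
      using card_GFq(2)[of 1] GFq_closed(1)[of 1] by (simp add: sum.delta)
    then show ?thesis
      using card_GFq(2)[of 1] GFq_closed(1)[of 1] by (simp add: sum.delta)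
  qed
  ultimately have "(0 :: 'a) = - 1"
    using card_GFq(1)[of 1] by (simp add: sum_subtractf sum_negf)
  then show False
    by simp
qed

text \<open>A decomposition by the polar form, valid in characteristic two: a zero \<open>u\<close>
  of the form is completed to a hyperbolic pair \<open>u\<close>, \<open>y\<close>, and
  \<open>z\<close> is orthogonal to both. In this basis the form is x_1 x_3 + c x_2^2.\<close>

lemma nondegenerate_conic_param:
  fixes C :: "('a ^ 3) set set"
  assumes "nondegenerate_conic q C"
  obtains M where "\<And>i j. M $ i $ j \<in> GFq q 1" "det M \<noteq> 0" "C = param_conic q M"
proof -
  obtain A where A: "\<And>i j. A $ i $ j \<in> GFq q 1" "nondegenerate_form A"
    "C = {vec.span {v} | v. v \<in> rat_vecs q 1 \<and> v \<noteq> 0 \<and> quad_form A v = 0}"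
    using assms unfolding nondegenerate_conic_def by blast
  have QF: "quad_form A v \<in> GFq q 1" if "v \<in> rat_vecs q 1" for v
    unfolding quad_form_def using that A(1) by (auto simp: rat_vecs_def intro!: GFq_sum GFq_closed)
  have BF: "polar A u v \<in> GFq q 1" if "u \<in> rat_vecs q 1" "v \<in> rat_vecs q 1" for u v
    unfolding polar_def using that A(1) by (auto simp: rat_vecs_def intro!: GFq_sum GFq_closed)
  have nd: "x = 0" if "quad_form A x = 0" "\<And>y. polar A x y = 0" for x
    using A(2) that unfolding nondegenerate_form_def by (auto simp: quad_form_add)
  obtain u where u: "u \<in> rat_vecs q 1" "u \<noteq> 0" "quad_form A u = 0"
    using ternary_form_isotropic[OF A(1)] by blast
  have axis: "(vector [1, 0, 0] :: 'a ^ 3) \<in> rat_vecs q 1" "(vector [0, 1, 0] :: 'a ^ 3) \<in> rat_vecs q 1" "(vector [0, 0, 1] :: 'a ^ 3) \<in> rat_vecs q 1"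
    by (auto simp: axis_rat GFq_closed)
  have basis: "x = x $ 1 *s vector [1, 0, 0] + x $ 2 *s vector [0, 1, 0] + x $ 3 *s vector [0, 0, 1]" for x :: "'a ^ 3"
    by (simp add: vec3_eq_iff)
  \<comment> \<open>A zero of the form that is orthogonal to a basis would be a singular
    point.\<close>
  have "\<exists>w\<in>{vector [1, 0, 0], vector [0, 1, 0], vector [0, 0, 1]}. polar A u w \<noteq> 0"
  proof (rule ccontr)
    assume *: "\<not> ?thesis"
    have "polar A u y = 0" for y
      by (subst basis[of y]) (use * in \<open>simp add: polar_add polar_scale\<close>)
    then show False
      using nd u by blast
  qed
  then obtain w where w: "w \<in> rat_vecs q 1" "polar A u w \<noteq> 0"
    using axis by blast
  define y1 where "y1 = inverse (polar A u w) *s w"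
  \<comment> \<open>Since \<open>polar A u y1 = 1\<close> and \<open>u\<close> is a zero, adding a
    multiple of \<open>u\<close> to \<open>y1\<close> changes the value of the form by just that
    multiple; this choice makes it 0.\<close>
  define y where "y = y1 - quad_form A y1 *s u"
  have y1: "y1 \<in> rat_vecs q 1" "polar A u y1 = 1"
    using w BF[OF u(1) w(1)] by (auto simp: y1_def polar_scale intro: rat_vecs_scale GFq_closed)
  have uu: "polar A u u = 0"
    using u by (simp add: polar_self)
  have y: "y \<in> rat_vecs q 1" "polar A u y = 1"
    using y1 u QF uu by (auto simp: y_def polar_diff polar_scale intro: rat_vecs_scale rat_vecs_diff)
  have Qy: "quad_form A y = 0"
  proof -
    have *: "quad_form A (y1 + c *s u) = quad_form A y1 + c" for c
      using u y1 polar_comm[of A y1 u] by (simp add: quad_form_add quad_form_scale polar_scale)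
    have "y = y1 + (- quad_form A y1) *s u"
      by (simp add: y_def vec_eq_iff)
    then show ?thesis
      using *[of "- quad_form A y1"] by (simp only:) simp
  qed
  have yy: "polar A y y = 0" "polar A y u = 1"
    using Qy y polar_comm[of A y u] by (simp_all add: polar_self)
  have yu: "y \<notin> vec.span {u}"
    using y uu by (auto simp: in_span1_iff polar_scale)
  have "\<exists>w\<in>{vector [1, 0, 0], vector [0, 1, 0], vector [0, 0, 1]}. w \<notin> vec.span {u, y}"
  proof (rule ccontr)
    assume *: "\<not> ?thesis"
    have "x \<in> vec.span {u, y}" for x
      by (subst basis[of x]) (use * in \<open>auto intro!: vec.span_add vec.span_scale\<close>)
    then have "vec.span {u, y} = UNIV"
      by blast
    then show False
      using dim_span2[of u y] u yu vec_dim_card[where 'a = 'a and 'n = 3] by simp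
  qed
  then obtain w' where w': "w' \<in> rat_vecs q 1" "w' \<notin> vec.span {u, y}"
    using axis by blast
  \<comment> \<open>Removing the components along the hyperbolic pair makes \<open>z\<close>
    orthogonal to it.\<close>
  define z where "z = w' - (polar A y w' *s u + polar A u w' *s y)"
  have z: "z \<in> rat_vecs q 1" "polar A u z = 0" "polar A y z = 0"
    using w' u y yy uu BF[OF y(1) w'(1)] BF[OF u(1) w'(1)]
    by (auto simp: z_def polar_diff polar_add polar_scale intro!: rat_vecs_diff rat_vecs_add rat_vecs_scale)
  have zn: "z \<notin> vec.span {u, y}"
  proof
    assume "z \<in> vec.span {u, y}"
    then have "z + (polar A y w' *s u + polar A u w' *s y) \<in> vec.span {u, y}"
      by (intro vec.span_add vec.span_scale) (auto intro: vec.span_base)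
    then show False
      using w'(2) by (simp add: z_def)
  qed
  then have tr: "tri u y z \<noteq> 0"
    using tri_zeroD[of u y z] u(2) yu by blast
  define c where "c = quad_form A z"
  have cF: "c \<in> GFq q 1"
    using z QF by (simp add: c_def)
  define M :: "'a ^ 3 ^ 3" where "M = (\<chi> i j. if j = 1 then u $ i else if j = 2 then z $ i else y $ i)"
  have Mx: "M *v x = x $ 1 *s u + x $ 2 *s z + x $ 3 *s y" for x
    by (simp add: vec_eq_iff mv3 M_def algebra_simps)
  have detM: "det M \<noteq> 0"
  proof -
    have "det M = - tri u y z"
      by (simp add: det_3 M_def tri_def algebra_simps)
    then show ?thesis
      using tr by simp
  qed
  have surj: "\<exists>x. M *v x = v" for v
    using mv_surj[of M v] detM ker_iff_det[of M] by blast
  \<comment> \<open>Otherwise \<open>z\<close> would be singular. In characteristic two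
    \<open>z\<close> is orthogonal to every vector in any case, so only its value under the form can
    save nondegeneracy.\<close>
  have "c \<noteq> 0"
  proof
    assume "c = 0"
    then have zz: "polar A z z = 0" "quad_form A z = 0"
      by (simp_all add: polar_self c_def)
    have "polar A z v = 0" for v
    proof -
      obtain x :: "'a ^ 3" where "v = x $ 1 *s u + x $ 2 *s z + x $ 3 *s y"
        using surj[of v] Mx by metis
      then show ?thesis
        using zz z polar_comm[of A z u] polar_comm[of A z y] by (simp add: polar_add polar_scale)
    qed
    then have "z = 0"
      using nd zz by blast
    then show False
      using zn by (simp add: vec.span_zero)
  qed
  have QM: "quad_form A (M *v x) = x $ 1 * x $ 3 + c * (x $ 2)\<^sup>2" for x
    using u Qy z y polar_comm[of A z y]
    by (simp add: Mx quad_form_add quad_form_scale polar_linear_left polar_add polar_scale c_def algebra_simps)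
  \<comment> \<open>Scaling the first coordinate by -c turns x_1 x_3 + c x_2^2 into c (x_2^2 - x_1
    x_3), whose zeros \<open>ver\<close> parametrizes.\<close>
  define D :: "'a ^ 3 ^ 3" where "D = (\<chi> i j. if i = j then if i = 1 then - c else 1 else 0)"
  define N where "N = M ** D"
  have MF: "M $ i $ j \<in> GFq q 1" for i j
    using u y z by (auto simp: M_def rat_vecs_def)
  have DF: "D $ i $ j \<in> GFq q 1" for i j
    using cF by (auto simp: D_def GFq_closed)
  have Dv: "D *v x = vector [- c * x $ 1, x $ 2, x $ 3]" for x
    by (simp add: vec3_eq_iff mv3 D_def)
  have Nv: "N *v x = M *v (D *v x)" for x
    by (simp add: N_def matrix_vector_mul_assoc)
  have NF: "N $ i $ j \<in> GFq q 1" for i j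
    using MF DF by (auto simp: N_def matrix_matrix_mult_def intro!: GFq_sum GFq_closed)
  have detN: "det N \<noteq> 0"
    using detM \<open>c \<noteq> 0\<close> by (simp add: N_def det_mul) (simp add: det_3 D_def)
  have Nker: "N *v x = 0 \<Longrightarrow> x = 0" for x
    using detN ker_iff_det[of N] by blast
  have QN: "quad_form A (N *v x) = c * ((x $ 2)\<^sup>2 - x $ 1 * x $ 3)" for x
    by (simp add: Nv QM Dv algebra_simps)
  have "C = param_conic q N"
  proof (intro equalityI subsetI)
    fix P assume "P \<in> C"
    then obtain v where v: "P = vec.span {v}" "v \<in> rat_vecs q 1" "v \<noteq> 0" "quad_form A v = 0"
      using A(3) by blast
    obtain x where x: "v = N *v x"
      using mv_surj[of N v, OF Nker] by metis
    have "x \<in> rat_vecs q 1" "x \<noteq> 0" "(x $ 2)\<^sup>2 = x $ 1 * x $ 3"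
      using rat_vecs_mvD[of N 1 x, OF NF Nker] v QN[of x] \<open>c \<noteq> 0\<close> by (auto simp: x)
    then obtain s t k where st: "s \<in> GFq q 1" "t \<in> GFq q 1" "s \<noteq> 0 \<or> t \<noteq> 0" "k \<noteq> 0" "ver s t = k *s x"
      by (rule rat_param_conic_point)
    then have "P = vec.span {N *v ver s t}"
      using v(1) span1_scale[of k v] by (simp add: x vector_scalar_commute)
    then show "P \<in> param_conic q N"
      unfolding param_conic_def using st(1-3) by blast
  next
    fix P assume "P \<in> param_conic q N"
    then obtain s t where st: "P = vec.span {N *v ver s t}" "s \<in> GFq q 1" "t \<in> GFq q 1" "s \<noteq> 0 \<or> t \<noteq> 0"
      unfolding param_conic_def by blast
    then have "N *v ver s t \<in> rat_vecs q 1" "N *v ver s t \<noteq> 0" "quad_form A (N *v ver s t) = 0"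
      using rat_vecs_mv[of N 1 "ver s t", OF NF] ver_rat[of s 1 t] Nker[of "ver s t"]
      by (auto simp: ver_eq_0_iff QN power_mult_distrib)
    then show "P \<in> C"
      unfolding A(3) using st(1) by blast
  qed
  then show ?thesis
    using that NF detN by blast
qed

text \<open>On vectors the embedding is \<open>M\<close> after the coordinatewise homomorphism
  \<open>a\<close>. On a parametrized conic of PG(2,q), \<open>a\<close> changes the matrix
  entrywise and merely permutes the parameters, so it disappears from the set of points.\<close>

lemma Fq_conic_imp_param:
  fixes C :: "('a ^ 3) set set"
  assumes "Fq_conic q C"
  obtains M where "\<And>i j. M $ i $ j \<in> GFq q 3" "det M \<noteq> 0" "C = param_conic q M"
proof -
  obtain B :: "('a ^ 3) set set" and \<psi> and C0 :: "('a ^ 3) set set" where B: "Fq_subplane q B"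
    and \<psi>: "incidence_iso \<psi> (pg_points q 1 UNIV) (pg_lines q 1) B (induced_lines B (pg_lines q 3))"
    and C0: "nondegenerate_conic q C0" "C = \<psi> ` C0"
    using assms unfolding Fq_conic_def by blast
  define R :: "('a ^ 3) set" where "R = rat_vecs q 1 - {0}"
  have Bsub: "B \<subseteq> pg_points q 3 UNIV"
    using B by (simp add: Fq_subplane_def)
  have inj: "inj_on \<psi> (pg_points q 1 UNIV)" and im: "\<psi> ` pg_points q 1 UNIV = B"
    and lns: "(\<lambda>l. \<psi> ` l) ` pg_lines q 1 = induced_lines B (pg_lines q 3)"
    using \<psi> by (auto simp: incidence_iso_def bij_betw_def)
  have pt: "vec.span {v} \<in> pg_points q 1 UNIV" if "v \<in> R" for v
    using that by (auto simp: R_def intro: pg_pointsI)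
  have "\<exists>w. \<psi> (vec.span {v}) = vec.span {w} \<and> w \<in> rat_vecs q 3 \<and> w \<noteq> 0" if "v \<in> R" for v
  proof -
    have "\<psi> (vec.span {v}) \<in> pg_points q 3 UNIV"
      using pt[OF that] im Bsub by blast
    then show ?thesis
      by (elim pg_pointsE) blast
  qed
  then obtain N where N: "\<And>v. v \<in> R \<Longrightarrow> \<psi> (vec.span {v}) = vec.span {N v} \<and> N v \<in> rat_vecs q 3 \<and> N v \<noteq> 0"
    by metis
  have N1: "\<psi> (vec.span {v}) = vec.span {N v}" and N3: "N v \<in> rat_vecs q 3" and N0: "N v \<noteq> 0" if "v \<in> R" for v
    using N[OF that] by auto
  have Ninj: "vec.span {N u} = vec.span {N v} \<longleftrightarrow> vec.span {u} = vec.span {v}" if "u \<in> R" "v \<in> R" for u v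
    using inj_on_eq_iff[OF inj pt[OF that(1)] pt[OF that(2)]] N1 that by simp
  have NB: "vec.span {N v} \<in> B" if "v \<in> R" for v
    using N1[OF that] pt[OF that] im by blast
  have B3: "vec.span {N v} \<in> pg_points q 3 U \<longleftrightarrow> N v \<in> U" if "v \<in> R" "vec.subspace U" for v and U :: "('a ^ 3) set"
    using N3[OF that(1)] N0[OF that(1)] pg_points_span_mem[OF that(2)] by (auto intro: pg_pointsI)
  have T: "tri u v w = 0 \<longleftrightarrow> tri (N u) (N v) (N w) = 0" if R: "u \<in> R" "v \<in> R" "w \<in> R" for u v w
  proof (cases "v \<in> vec.span {u}")
    case True
    then have "vec.span {v} = vec.span {u}"
      using span1_eqI R by (auto simp: R_def)
    then have "vec.span {N v} = vec.span {N u}"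
      using Ninj R by blast
    then have "N v \<in> vec.span {N u}"
      using vec.span_base[of "N v" "{N v}"] by simp
    then show ?thesis
      using True tri_span1 by metis
  next
    case False
    have u0: "u \<noteq> 0"
      using R by (simp add: R_def)
    have ne: "vec.span {u} \<noteq> vec.span {v}"
      using False vec.span_base[of v "{v}"] by auto
    have Nne: "N v \<notin> vec.span {N u}"
      using ne Ninj[OF R(1,2)] span1_eqI[of "N v" "N u"] N0[OF R(2)] by auto
    have ratR: "u \<in> rat_vecs q 1" "v \<in> rat_vecs q 1" "w \<in> rat_vecs q 1" "w \<noteq> 0" "v \<noteq> 0"
      using R by (auto simp: R_def)
    show ?thesis
    proof
      assume "tri u v w = 0"
      then have wl: "w \<in> vec.span {u, v}"
        using tri_zeroD u0 False by blast
      define l where "l = pg_points q 1 (vec.span {u, v})"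
      have l: "l \<in> pg_lines q 1"
        using rat_lineI[OF ratR(1,2)] dim_span2[of u v] u0 False unfolding l_def pg_lines_def by blast
      have mem: "vec.span {u} \<in> l" "vec.span {v} \<in> l" "vec.span {w} \<in> l"
        unfolding l_def using ratR u0 wl by (auto intro!: pg_pointsI intro: vec.span_base)
      have "\<psi> ` l \<in> induced_lines B (pg_lines q 3)"
        using l lns by blast
      then obtain U where U: "rat_subspace q 3 U" "vec.dim U = 2" "\<psi> ` l = pg_points q 3 U \<inter> B"
        unfolding induced_lines_def pg_lines_def by blast
      have "vec.span {N u} \<in> \<psi> ` l" "vec.span {N v} \<in> \<psi> ` l" "vec.span {N w} \<in> \<psi> ` l"
        using mem N1 R by (metis imageI)+
      then have "N u \<in> U" "N v \<in> U" "N w \<in> U"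
        using U(3) B3 R subspace_rat[OF U(1)] by auto
      then show "tri (N u) (N v) (N w) = 0"
        by (rule tri_in_line[OF subspace_rat[OF U(1)] U(2)])
    next
      assume "tri (N u) (N v) (N w) = 0"
      then have wl: "N w \<in> vec.span {N u, N v}"
        using N0[OF R(1)] Nne by (rule tri_zeroD)
      define L where "L = pg_points q 3 (vec.span {N u, N v})"
      have L: "L \<in> pg_lines q 3"
        using rat_lineI[OF N3[OF R(1)] N3[OF R(2)]] dim_span2[of "N u" "N v"] N0[OF R(1)] Nne
        unfolding L_def pg_lines_def by blast
      have mem: "vec.span {N u} \<in> L \<inter> B" "vec.span {N v} \<in> L \<inter> B" "vec.span {N w} \<in> L \<inter> B"
        unfolding L_def using wl R B3 NB by (auto intro: vec.span_base)
      \<comment> \<open>Needed before counting, because \<open>card\<close> is 0 on infinite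
        sets.\<close>
      have "finite (L \<inter> B)"
        unfolding L_def using card_pg_line(2)[OF rat_lineI[OF N3[OF R(1)] N3[OF R(2)]]] dim_span2[of "N u" "N v"] N0[OF R(1)] Nne
        by auto
      moreover have "{vec.span {N u}, vec.span {N v}} \<subseteq> L \<inter> B"
        using mem by blast
      moreover have "card {vec.span {N u}, vec.span {N v}} = 2"
        using ne Ninj[OF R(1,2)] by simp
      ultimately have "card (L \<inter> B) \<ge> 2"
        using card_mono[of "L \<inter> B" "{vec.span {N u}, vec.span {N v}}"] by simp
      then have "L \<inter> B \<in> induced_lines B (pg_lines q 3)"
        unfolding induced_lines_def using L by blast
      then have "L \<inter> B \<in> (\<lambda>l. \<psi> ` l) ` pg_lines q 1"
        by (simp only: lns)
      then obtain l where l: "l \<in> pg_lines q 1" "\<psi> ` l = L \<inter> B"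
        by blast
      then obtain U where U: "rat_subspace q 1 U" "vec.dim U = 2" "l = pg_points q 1 U"
        unfolding pg_lines_def by blast
      have inU: "x \<in> U" if x: "x \<in> R" "vec.span {N x} \<in> L \<inter> B" for x
      proof -
        have "\<psi> (vec.span {x}) \<in> \<psi> ` l"
          using x by (simp only: l(2) N1)
        then obtain P where P: "P \<in> l" "\<psi> P = \<psi> (vec.span {x})"
          by auto
        have "P \<in> pg_points q 1 UNIV"
          using pg_lines_subset[OF l(1)] P(1) by (rule subsetD)
        then have "P = vec.span {x}"
          using inj_onD[OF inj P(2)] pt[OF x(1)] by simp
        then show ?thesis
          using P(1) U(3) pg_points_span_mem[OF subspace_rat[OF U(1)]] by simp
      qed
      show "tri u v w = 0"
        using inU[OF R(1) mem(1)] inU[OF R(2) mem(2)] inU[OF R(3) mem(3)]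
        by (rule tri_in_line[OF subspace_rat[OF U(1)] U(2)])
    qed
  qed
  have sc: "N (k *s v) \<in> vec.span {N v}" if kv: "k \<in> GFq q 1" "k \<noteq> 0" "v \<in> R" for k v
  proof -
    have "k *s v \<in> R"
      using kv by (auto simp: R_def intro: rat_vecs_scale)
    then have "vec.span {N (k *s v)} = vec.span {N v}"
      using Ninj[of "k *s v" v] kv span1_scale[of k v] by simp
    then show ?thesis
      using vec.span_base[of "N (k *s v)" "{N (k *s v)}"] by simp
  qed
  have "\<exists>(M :: 'a ^ 3 ^ 3) a. (\<forall>i j. M $ i $ j \<in> GFq q 3) \<and> det M \<noteq> 0 \<and> F_hom a \<and>
      (\<forall>v\<in>R. N v \<in> vec.span {M *v (\<chi> i. a (v $ i))})"
    by (rule subplane_embedding[of N, folded R_def, OF T sc N3]) blast+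
  then obtain M :: "'a ^ 3 ^ 3" and a where M: "\<And>i j. M $ i $ j \<in> GFq q 3" "det M \<noteq> 0" and a: "F_hom a"
    and Na: "\<And>v. v \<in> R \<Longrightarrow> N v \<in> vec.span {M *v (\<chi> i. a (v $ i))}"
    by blast
  obtain S :: "'a ^ 3 ^ 3" where S: "\<And>i j. S $ i $ j \<in> GFq q 1" "det S \<noteq> 0" "C0 = param_conic q S"
    by (rule nondegenerate_conic_param[OF C0(1)]) blast
  define aS :: "'a ^ 3 ^ 3" where "aS = (\<chi> i j. a (S $ i $ j))"
  have hom: "a (x + y) = a x + a y" "a (x * y) = a x * a y" if "x \<in> GFq q 1" "y \<in> GFq q 1" for x y
    using a that by (auto simp: F_hom_def)
  have hom_diff: "a (x - y) = a x - a y" if "x \<in> GFq q 1" "y \<in> GFq q 1" for x y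
    using hom(1)[of "x - y" y] that GFq_closed(4)[of x 1 y] by simp
  have aF: "a ` GFq q 1 = GFq q 1"
    by (rule F_hom_bij[OF a])
  have aSE: "aS $ i $ j \<in> GFq q 1" for i j
    using S(1) aF by (auto simp: aS_def)
  have "det aS = a (det S)"
    unfolding det_3 using S(1) by (simp add: aS_def hom hom_diff GFq_closed)
  moreover have "det S \<in> GFq q 1"
    unfolding det_3 using S(1) by (intro GFq_closed)
  ultimately have detaS: "det aS \<noteq> 0"
    using S(2) F_hom_nz[OF a] by simp
  have Sker: "S *v x = 0 \<Longrightarrow> x = 0" for x
    using S(2) ker_iff_det[of S] by blast
  have aSv: "(\<chi> i. a ((S *v x) $ i)) = aS *v (\<chi> i. a (x $ i))" if "x \<in> rat_vecs q 1" for x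
    using S(1) that by (simp add: vec_eq_iff mv3 aS_def hom GFq_closed rat3_iff)
  have aver: "(\<chi> i. a (ver s t $ i)) = ver (a s) (a t)" if "s \<in> GFq q 1" "t \<in> GFq q 1" for s t
    using that by (simp add: vec3_eq_iff hom power2_eq_square)
  have \<psi>_pt: "\<psi> (vec.span {S *v ver s t}) = vec.span {(M ** aS) *v ver (a s) (a t)}"
    if st: "s \<in> GFq q 1" "t \<in> GFq q 1" "s \<noteq> 0 \<or> t \<noteq> 0" for s t
  proof -
    have vr: "ver s t \<in> rat_vecs q 1" "ver s t \<noteq> 0"
      using ver_rat st by (auto simp: ver_eq_0_iff)
    then have SR: "S *v ver s t \<in> R"
      using rat_vecs_mv[of S 1, OF S(1)] Sker by (auto simp: R_def)
    have "N (S *v ver s t) \<in> vec.span {M *v (\<chi> i. a ((S *v ver s t) $ i))}"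
      by (rule Na[OF SR])
    also have "M *v (\<chi> i. a ((S *v ver s t) $ i)) = (M ** aS) *v ver (a s) (a t)"
      using aSv[OF vr(1)] aver[OF st(1,2)] by (simp add: matrix_vector_mul_assoc)
    finally show ?thesis
      using N1[OF SR] N0[OF SR] span1_eqI by metis
  qed
  have "C = param_conic q (M ** aS)"
  proof (intro equalityI subsetI)
    fix P assume "P \<in> C"
    then obtain s t where st: "P = \<psi> (vec.span {S *v ver s t})" "s \<in> GFq q 1" "t \<in> GFq q 1" "s \<noteq> 0 \<or> t \<noteq> 0"
      unfolding C0(2) S(3) param_conic_def by blast
    then have "P = vec.span {(M ** aS) *v ver (a s) (a t)}" "a s \<in> GFq q 1" "a t \<in> GFq q 1" "a s \<noteq> 0 \<or> a t \<noteq> 0"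
      using \<psi>_pt aF F_hom_nz[OF a] by auto
    then show "P \<in> param_conic q (M ** aS)"
      unfolding param_conic_def by blast
  next
    fix P assume "P \<in> param_conic q (M ** aS)"
    then obtain s' t' where st': "P = vec.span {(M ** aS) *v ver s' t'}" "s' \<in> GFq q 1" "t' \<in> GFq q 1" "s' \<noteq> 0 \<or> t' \<noteq> 0"
      unfolding param_conic_def by blast
    obtain s where s: "s \<in> GFq q 1" "s' = a s"
      using st'(2) aF by blast
    obtain t where t: "t \<in> GFq q 1" "t' = a t"
      using st'(3) aF by blast
    have "s \<noteq> 0 \<or> t \<noteq> 0"
      using st'(4) s t a by (auto simp: F_hom_def)
    then have "P = \<psi> (vec.span {S *v ver s t})" "vec.span {S *v ver s t} \<in> C0"
      using \<psi>_pt s t st' unfolding S(3) param_conic_def by auto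
    then show "P \<in> C"
      unfolding C0(2) by blast
  qed
  moreover have "(M ** aS) $ i $ j \<in> GFq q 3" for i j
    using M(1) GFq_1_subset[OF aSE] by (auto simp: matrix_matrix_mult_def intro!: GFq_sum GFq_closed)
  moreover have "det (M ** aS) \<noteq> 0"
    using M(2) detaS by (simp add: det_mul)
  ultimately show ?thesis
    using that by blast
qed

theorem Fq_conic_iff:
  fixes C :: "('a ^ 3) set set"
  shows "Fq_conic q C \<longleftrightarrow> (\<exists>M. (\<forall>i j. M $ i $ j \<in> GFq q 3) \<and> det M \<noteq> 0 \<and> C = param_conic q M)"
  using Fq_conic_imp_param[of C] Fq_conic_param ker_iff_det by metis

end

section \<open>Coordinates adapted to a regular spread\<close>

text \<open>
  On the hyperplane, \<open>c\<close> is the projection to \<open>g\<close> along its two conjugates. The maps are linear over the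
  algebraically closed field, so \<open>c1 v\<close> and \<open>c2 v\<close> are the conjugates of \<open>c v\<close> only if \<open>v\<close> is a vector over
  the field of order \<open>q\<close>.
\<close>

locale spread_coordinates = frobenius_field q K for q :: nat and K :: "'a::alg_closed_field itself" +
  fixes h :: "'a ^ 7" and g :: "('a ^ 7) set" and c c1 c2 :: "'a ^ 7 \<Rightarrow> 'a ^ 3"
  assumes c_add: "c (u + v) = c u + c v" "c1 (u + v) = c1 u + c1 v" "c2 (u + v) = c2 u + c2 v"
    and c_scale: "c (k *s v) = k *s c v" "c1 (k *s v) = k *s c1 v" "c2 (k *s v) = k *s c2 v"
    and c_first: "c v $ 1 = (\<Sum>i\<in>UNIV. h $ i * v $ i)" "c1 v $ 1 = c v $ 1" "c2 v $ 1 = c v $ 1"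
    and c_ker: "c v = 0 \<Longrightarrow> c1 v = 0 \<Longrightarrow> c2 v = 0 \<Longrightarrow> v = 0"
    and c_surj: "y $ 1 = x $ 1 \<Longrightarrow> z $ 1 = x $ 1 \<Longrightarrow> \<exists>v. c v = x \<and> c1 v = y \<and> c2 v = z"
    and c_frob: "c1 (frob q v) = frob q (c v)" "c2 (frob q v) = frob q (c1 v)" "c (frob q v) = frob q (c2 v)"
    and g_eq: "g = {v. c1 v = 0 \<and> c2 v = 0}"

text \<open>Frobenius fixes \<open>v0\<close> and cycles the pairs \<open>g1\<close>,
  \<open>g2\<close> and \<open>a1\<close>, \<open>a2\<close> and \<open>b1\<close>,
  \<open>b2\<close>, because \<open>g1\<close> and \<open>g2\<close> are defined over the cubic
  field. These seven vectors form a basis; each of the three maps takes the coordinate of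
  \<open>v0\<close> together with those of one pair.\<close>

lemma (in frobenius_field) spread_coordinates_exist:
  fixes h :: "'a ^ 7" and g :: "('a ^ 7) set"
  assumes h: "h \<in> rat_vecs q 1" "h \<noteq> 0" and g: "spread_line q h g"
  obtains c c1 c2 where "spread_coordinates q h g c c1 c2"
proof -
  define hd where "hd v = (\<Sum>i\<in>UNIV. h $ i * v $ i)" for v :: "'a ^ 7"
  have hd_add: "hd (u + v) = hd u + hd v" and hd_scale: "hd (k *s v) = k * hd v" for u v k
    by (simp_all add: hd_def algebra_simps sum.distrib sum_distrib_left)
  have hd_frob: "hd (frob q v) = hd v ^ q" for v
  proof -
    have "(h $ i) ^ q = h $ i" for i
      using h(1) by (metis rat_vecs_1 frob_nth)
    then show ?thesis
      by (simp add: hd_def q_sum power_mult_distrib)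
  qed
  have hyp: "hyperplane h = {v. hd v = 0}"
    by (simp add: hyperplane_def hd_def)
  obtain i0 where i0: "h $ i0 \<noteq> 0"
    using h(2) by (auto simp: vec_eq_iff)
  define v0 :: "'a ^ 7" where "v0 = (\<chi> i. if i = i0 then inverse (h $ i0) else 0)"
  have v0: "hd v0 = 1" "frob q v0 = v0"
  proof -
    have "hd v0 = (\<Sum>i\<in>UNIV. if i = i0 then 1 else 0)"
      unfolding hd_def using i0 by (intro sum.cong) (auto simp: v0_def)
    then show "hd v0 = 1"
      by simp
    have "inverse (h $ i0) \<in> GFq q 1"
      using h(1) by (auto simp: rat_vecs_def intro: GFq_closed)
    then have "v0 \<in> rat_vecs q 1"
      by (auto simp: v0_def rat_vecs_def intro: GFq_closed)
    then show "frob q v0 = v0"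
      by (simp only: rat_vecs_1)
  qed
  obtain g1 g2 where g12: "g1 \<in> rat_vecs q 3" "g2 \<in> rat_vecs q 3" "g = vec.span {g1, g2}"
    using g by (auto simp: spread_line_def elim: rat_lineE)
  define a1 a2 where "a1 = frob q g1" and "a2 = frob q g2"
  define b1 b2 where "b1 = frob q a1" and "b2 = frob q a2"
  have back1: "frob q b1 = g1" "frob q b2 = g2"
    using g12 by (simp_all add: rat_vecs_3 b1_def b2_def a1_def a2_def)
  have ga: "conj_space q g = vec.span {a1, a2}" "conj_space q (conj_space q g) = vec.span {b1, b2}"
    by (simp_all add: g12 conj_space_span a1_def a2_def b1_def b2_def)
  have hspan: "vec.span (g \<union> vec.span {a1, a2} \<union> vec.span {b1, b2}) = hyperplane h"
    using g by (simp add: spread_line_def flip: ga)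
  have hd0: "hd g1 = 0" "hd g2 = 0" "hd a1 = 0" "hd a2 = 0" "hd b1 = 0" "hd b2 = 0"
  proof -
    have "{g1, g2, a1, a2, b1, b2} \<subseteq> vec.span (g \<union> vec.span {a1, a2} \<union> vec.span {b1, b2})"
      by (auto simp: g12 intro!: vec.span_base)
    then show "hd g1 = 0" "hd g2 = 0" "hd a1 = 0" "hd a2 = 0" "hd b1 = 0" "hd b2 = 0"
      unfolding hspan hyp by auto
  qed
  define bs where "bs = [v0, g1, g2, a1, a2, b1, b2]"
  have "g \<union> vec.span {a1, a2} \<union> vec.span {b1, b2} \<subseteq> vec.span (set bs)"
    unfolding g12(3) bs_def by (intro Un_least vec.span_mono) auto
  then have hsub: "hyperplane h \<subseteq> vec.span (set bs)"
    unfolding hspan[symmetric] by (intro vec.span_minimal) auto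
  have span: "v \<in> vec.span (set bs)" for v
  proof -
    have "hd (v + (- hd v) *s v0) = 0"
      by (simp only: hd_add hd_scale v0) simp
    then have "v + (- hd v) *s v0 \<in> vec.span (set bs)"
      using hsub hyp by blast
    moreover have "hd v *s v0 \<in> vec.span (set bs)"
      by (intro vec.span_scale vec.span_base) (simp add: bs_def)
    ultimately have "v + (- hd v) *s v0 + hd v *s v0 \<in> vec.span (set bs)"
      by (rule vec.span_add)
    then show ?thesis
      by (simp add: vec_eq_iff)
  qed
  \<comment> \<open>Seven vectors that span a space of dimension 7 are distinct and
    independent.\<close>
  have "vec.dim (UNIV :: ('a ^ 7) set) \<le> card (set bs)"
    using span by (intro vec.dim_le_card) auto
  then have card: "card (set bs) = length bs"
    using card_length[of bs] vec_dim_card[where 'a = 'a and 'n = 7] by (simp add: bs_def)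
  then have dist: "distinct bs"
    by (rule card_distinct)
  have ind: "vec.independent (set bs)"
    using span card vec_dim_card[where 'a = 'a and 'n = 7]
    by (intro vec.card_le_dim_spanning[of _ UNIV]) (auto simp: bs_def)
  define rep where "rep v b = vec.representation (set bs) v b" for v b
  have rep_add: "rep (u + v) b = rep u b + rep v b" and rep_scale: "rep (k *s v) b = k * rep v b" for u v k b
    unfolding rep_def using vec.representation_add[OF ind span span] vec.representation_scale[OF ind span] by simp_all
  have rep_basis: "rep u v = (if v = u then 1 else 0)" if "u \<in> set bs" for u v
    unfolding rep_def using vec.representation_basis[OF ind that] by simp
  have rb: "rep v0 v0 = 1" "rep v0 g1 = 0" "rep v0 g2 = 0" "rep v0 a1 = 0" "rep v0 a2 = 0" "rep v0 b1 = 0" "rep v0 b2 = 0"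
    "rep g1 v0 = 0" "rep g1 g1 = 1" "rep g1 g2 = 0" "rep g1 a1 = 0" "rep g1 a2 = 0" "rep g1 b1 = 0" "rep g1 b2 = 0"
    "rep g2 v0 = 0" "rep g2 g1 = 0" "rep g2 g2 = 1" "rep g2 a1 = 0" "rep g2 a2 = 0" "rep g2 b1 = 0" "rep g2 b2 = 0"
    "rep a1 v0 = 0" "rep a1 g1 = 0" "rep a1 g2 = 0" "rep a1 a1 = 1" "rep a1 a2 = 0" "rep a1 b1 = 0" "rep a1 b2 = 0"
    "rep a2 v0 = 0" "rep a2 g1 = 0" "rep a2 g2 = 0" "rep a2 a1 = 0" "rep a2 a2 = 1" "rep a2 b1 = 0" "rep a2 b2 = 0"
    "rep b1 v0 = 0" "rep b1 g1 = 0" "rep b1 g2 = 0" "rep b1 a1 = 0" "rep b1 a2 = 0" "rep b1 b1 = 1" "rep b1 b2 = 0"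
    "rep b2 v0 = 0" "rep b2 g1 = 0" "rep b2 g2 = 0" "rep b2 a1 = 0" "rep b2 a2 = 0" "rep b2 b1 = 0" "rep b2 b2 = 1"
    using dist by (auto simp: bs_def rep_basis)
  define comb where "comb x0 x1 x2 y1 y2 z1 z2 =
      x0 *s v0 + x1 *s g1 + x2 *s g2 + y1 *s a1 + y2 *s a2 + z1 *s b1 + z2 *s b2" for x0 x1 x2 y1 y2 z1 z2
  have rep_comb: "rep (comb x0 x1 x2 y1 y2 z1 z2) v0 = x0" "rep (comb x0 x1 x2 y1 y2 z1 z2) g1 = x1"
    "rep (comb x0 x1 x2 y1 y2 z1 z2) g2 = x2" "rep (comb x0 x1 x2 y1 y2 z1 z2) a1 = y1"
    "rep (comb x0 x1 x2 y1 y2 z1 z2) a2 = y2" "rep (comb x0 x1 x2 y1 y2 z1 z2) b1 = z1"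
    "rep (comb x0 x1 x2 y1 y2 z1 z2) b2 = z2" for x0 x1 x2 y1 y2 z1 z2
    by (simp_all add: comb_def rep_add rep_scale rb)
  have hd_comb: "hd (comb x0 x1 x2 y1 y2 z1 z2) = x0" for x0 x1 x2 y1 y2 z1 z2
    by (simp add: comb_def hd_add hd_scale hd0 v0)
  have expand: "v = comb (rep v v0) (rep v g1) (rep v g2) (rep v a1) (rep v a2) (rep v b1) (rep v b2)" for v
  proof -
    have "v = (\<Sum>b\<in>set bs. rep v b *s b)"
      unfolding rep_def by (rule vec.sum_representation_eq[OF ind span, symmetric]) auto
    also have "\<dots> = (\<Sum>b\<leftarrow>bs. rep v b *s b)"
      using dist by (simp add: sum_list_distinct_conv_sum_set)
    finally show ?thesis
      by (simp add: bs_def comb_def add.assoc)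
  qed
  have hd_rep: "hd v = rep v v0" for v
    using hd_comb expand[of v] by metis
  have frob_comb: "frob q (comb x0 x1 x2 y1 y2 z1 z2) = comb (x0 ^ q) (z1 ^ q) (z2 ^ q) (x1 ^ q) (x2 ^ q) (y1 ^ q) (y2 ^ q)"
    for x0 x1 x2 y1 y2 z1 z2
    by (simp add: comb_def frob_add frob_scale v0 back1 flip: a1_def a2_def b1_def b2_def)
  have rep_frob: "rep (frob q v) v0 = rep v v0 ^ q" "rep (frob q v) g1 = rep v b1 ^ q" "rep (frob q v) g2 = rep v b2 ^ q"
    "rep (frob q v) a1 = rep v g1 ^ q" "rep (frob q v) a2 = rep v g2 ^ q"
    "rep (frob q v) b1 = rep v a1 ^ q" "rep (frob q v) b2 = rep v a2 ^ q" for v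
    by (subst expand[of v], simp only: frob_comb rep_comb)+
  define c c1 c2 where "c v = (vector [hd v, rep v g1, rep v g2] :: 'a ^ 3)"
    and "c1 v = (vector [hd v, rep v a1, rep v a2] :: 'a ^ 3)"
    and "c2 v = (vector [hd v, rep v b1, rep v b2] :: 'a ^ 3)" for v
  note cs = c_def c1_def c2_def
  have "spread_coordinates q h g c c1 c2"
  proof
    fix u v k
    show "c (u + v) = c u + c v" "c1 (u + v) = c1 u + c1 v" "c2 (u + v) = c2 u + c2 v"
      "c (k *s v) = k *s c v" "c1 (k *s v) = k *s c1 v" "c2 (k *s v) = k *s c2 v"
      by (simp_all add: cs vec3_eq_iff rep_add rep_scale hd_add hd_scale)
    show "c v $ 1 = (\<Sum>i\<in>UNIV. h $ i * v $ i)" "c1 v $ 1 = c v $ 1" "c2 v $ 1 = c v $ 1"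
      by (simp_all add: cs hd_def)
    show "c1 (frob q v) = frob q (c v)" "c2 (frob q v) = frob q (c1 v)" "c (frob q v) = frob q (c2 v)"
      by (simp_all add: cs vec3_eq_iff rep_frob hd_frob)
  next
    fix v assume "c v = 0" "c1 v = 0" "c2 v = 0"
    then have "v = comb 0 0 0 0 0 0 0"
      using expand[of v] hd_rep[of v] by (simp add: cs vec3_eq_iff)
    then show "v = 0"
      by (simp add: comb_def)
  next
    fix x y z :: "'a ^ 3" assume "y $ 1 = x $ 1" "z $ 1 = x $ 1"
    then show "\<exists>v. c v = x \<and> c1 v = y \<and> c2 v = z"
      by (intro exI[of _ "comb (x $ 1) (x $ 2) (x $ 3) (y $ 2) (y $ 3) (z $ 2) (z $ 3)"])
        (simp add: cs vec3_eq_iff rep_comb hd_comb)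
  next
    show "g = {v. c1 v = 0 \<and> c2 v = 0}"
    proof (intro equalityI subsetI)
      fix v assume "v \<in> g"
      then obtain x y where "v = x *s g1 + y *s g2"
        unfolding g12(3) span2_iff by blast
      then show "v \<in> {v. c1 v = 0 \<and> c2 v = 0}"
        by (simp add: cs vec3_eq_iff rep_add rep_scale rb hd_add hd_scale hd0)
    next
      fix v assume "v \<in> {v. c1 v = 0 \<and> c2 v = 0}"
      then have "v = comb 0 (rep v g1) (rep v g2) 0 0 0 0"
        using expand[of v] hd_rep[of v] by (simp add: cs vec3_eq_iff)
      then have "v = rep v g1 *s g1 + rep v g2 *s g2"
        by (simp add: comb_def)
      then show "v \<in> g"
        unfolding g12(3) span2_iff by blast
    qed
  qed
  then show ?thesis
    by (rule that)
qed

context spread_coordinates begin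

lemma c_0 [simp]: "c 0 = 0" "c1 0 = 0" "c2 0 = 0"
  using c_scale[of 0 0] by simp_all

lemma c_sum: "c (\<Sum>i\<in>A. f i) = (\<Sum>i\<in>A. c (f i))" "c1 (\<Sum>i\<in>A. f i) = (\<Sum>i\<in>A. c1 (f i))"
  "c2 (\<Sum>i\<in>A. f i) = (\<Sum>i\<in>A. c2 (f i))"
  by (induction A rule: infinite_finite_induct) (auto simp: c_add)

lemma c_diff: "c (u - v) = c u - c v" "c1 (u - v) = c1 u - c1 v" "c2 (u - v) = c2 u - c2 v"
  using c_add[of "u - v" v] by simp_all

lemma c_eqI: "c u = c v \<Longrightarrow> c1 u = c1 v \<Longrightarrow> c2 u = c2 v \<Longrightarrow> u = v"
  using c_ker[of "u - v"] by (simp add: c_diff)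

lemma hyperplane_iff: "v \<in> hyperplane h \<longleftrightarrow> c v $ 1 = 0"
  by (simp add: hyperplane_def c_first)

lemma c_image_span: "c ` vec.span {v} = vec.span {c v}"
  by (auto simp: vec.span_singleton c_scale image_image)

lemma conj_g: "conj_space q g = {v. c v = 0 \<and> c2 v = 0}"
proof (intro equalityI subsetI)
  fix v assume "v \<in> conj_space q g"
  then show "v \<in> {v. c v = 0 \<and> c2 v = 0}"
    by (auto simp: conj_space_def g_eq c_frob)
next
  fix v assume v: "v \<in> {v. c v = 0 \<and> c2 v = 0}"
  obtain u where u: "frob q u = v"
    using frob_surj by blast
  then have "u \<in> g"
    using v by (auto simp: g_eq c_frob)
  then show "v \<in> conj_space q g"
    using u by (auto simp: conj_space_def)
qed

lemma conj_conj_g: "conj_space q (conj_space q g) = {v. c v = 0 \<and> c1 v = 0}"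
proof (intro equalityI subsetI)
  fix v assume "v \<in> conj_space q (conj_space q g)"
  then show "v \<in> {v. c v = 0 \<and> c1 v = 0}"
    unfolding conj_g by (auto simp: conj_space_def c_frob)
next
  fix v assume v: "v \<in> {v. c v = 0 \<and> c1 v = 0}"
  obtain u where u: "frob q u = v"
    using frob_surj by blast
  then have "u \<in> conj_space q g"
    using v by (auto simp: conj_g c_frob)
  then show "v \<in> conj_space q (conj_space q g)"
    using u by (auto simp: conj_space_def)
qed

lemma rat_c: "v \<in> rat_vecs q 1 \<Longrightarrow> c1 v = frob q (c v)" "v \<in> rat_vecs q 1 \<Longrightarrow> c2 v = frob q (frob q (c v))"
  using c_frob[of v] by (simp_all only: rat_vecs_1)

lemma rat_c_3: "v \<in> rat_vecs q 1 \<Longrightarrow> c v \<in> rat_vecs q 3"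
  using c_frob[of v] rat_c[of v] by (simp only: rat_vecs_1 rat_vecs_3)

lemma rat_c_first: "v \<in> rat_vecs q 1 \<Longrightarrow> c v $ 1 \<in> GFq q 1"
proof -
  assume v: "v \<in> rat_vecs q 1"
  have "(c v $ 1) ^ q = frob q (c v) $ 1"
    by simp
  also have "\<dots> = c v $ 1"
    using rat_c(1)[OF v] c_first(2)[of v] by simp
  finally show ?thesis
    by (simp add: GFq_iff)
qed

lemma rat_c_inj: "u \<in> rat_vecs q 1 \<Longrightarrow> v \<in> rat_vecs q 1 \<Longrightarrow> c u = c v \<Longrightarrow> u = v"
  by (rule c_eqI) (simp_all add: rat_c)

text \<open>The values prescribed for the three maps are conjugates, and Frobenius cycles them, so
  the vector is fixed. The condition on the first coordinate comes from the maps sharing it.\<close>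

lemma lift_exists:
  assumes "x \<in> rat_vecs q 3" "x $ 1 \<in> GFq q 1"
  obtains v where "v \<in> rat_vecs q 1" "c v = x"
proof -
  have x1: "(x $ 1) ^ q = x $ 1"
    using assms(2) by (simp add: GFq_iff)
  then obtain v where v: "c v = x" "c1 v = frob q x" "c2 v = frob q (frob q x)"
    using c_surj[of "frob q x" x "frob q (frob q x)"] by auto
  have "frob q v = v"
    using assms(1) by (intro c_eqI) (simp_all add: c_frob v rat_vecs_3)
  then show ?thesis
    using that v by (simp only: rat_vecs_1)
qed

text \<open>The second and third conditions are the conjugates of the first. A vector over the small
  field that satisfies the first satisfies them too, so over that field this is the line of
  multiples of \<xi> over the cubic field.\<close>

definition plane :: "'a ^ 3 \<Rightarrow> ('a ^ 7) set" where
  "plane \<xi> = {v. c v \<in> vec.span {\<xi>} \<and> c1 v \<in> vec.span {frob q \<xi>} \<and> c2 v \<in> vec.span {frob q (frob q \<xi>)}}"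

definition dirs :: "('a ^ 3) set" where
  "dirs = {\<xi>. \<xi> \<in> rat_vecs q 3 \<and> \<xi> \<noteq> 0 \<and> \<xi> $ 1 = 0}"

lemma dir_vector:
  assumes "\<xi> \<in> dirs"
  obtains x where "x \<in> g" "x \<in> rat_vecs q 3" "x \<noteq> 0" "c x = \<xi>" "c1 x = 0" "c2 x = 0"
proof -
  obtain x where x: "c x = \<xi>" "c1 x = 0" "c2 x = 0"
    using c_surj[of 0 \<xi> 0] assms by (auto simp: dirs_def)
  have "frob q (frob q (frob q x)) = x"
    using assms by (intro c_eqI) (simp_all add: c_frob x dirs_def rat_vecs_3)
  moreover have "x \<noteq> 0"
    using x assms by (auto simp: dirs_def)
  ultimately show ?thesis
    using that[of x] x by (simp add: g_eq rat_vecs_3)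
qed

lemma plane_span:
  assumes "c x = \<xi>" "c1 x = 0" "c2 x = 0"
  shows "plane \<xi> = vec.span {x, frob q x, frob q (frob q x)}"
proof (intro equalityI subsetI)
  fix v assume "v \<in> plane \<xi>"
  then obtain k0 k1 k2 where k: "c v = k0 *s \<xi>" "c1 v = k1 *s frob q \<xi>" "c2 v = k2 *s frob q (frob q \<xi>)"
    by (auto simp: plane_def in_span1_iff)
  have "v = k0 *s x + k1 *s frob q x + k2 *s frob q (frob q x)"
    using assms k by (intro c_eqI) (simp_all add: c_add c_scale c_frob)
  then show "v \<in> vec.span {x, frob q x, frob q (frob q x)}"
    by (auto intro!: vec.span_add vec.span_scale intro: vec.span_base)
next
  fix v assume "v \<in> vec.span {x, frob q x, frob q (frob q x)}"
  then obtain k0 where "v - k0 *s x \<in> vec.span {frob q x, frob q (frob q x)}"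
    by (auto simp: vec.span_breakdown_eq)
  then obtain k1 k2 where "v - k0 *s x = k1 *s frob q x + k2 *s frob q (frob q x)"
    using span2_iff by blast
  then have "v = k0 *s x + (k1 *s frob q x + k2 *s frob q (frob q x))"
    by (simp add: algebra_simps)
  then show "v \<in> plane \<xi>"
    using assms by (auto simp: plane_def in_span1_iff c_add c_scale c_frob)
qed

lemma plane_subspace: "vec.subspace (plane \<xi>)"
  by (auto simp: plane_def vec.subspace_def c_add c_scale intro: vec.span_add vec.span_scale vec.span_zero)

lemma regular_spread_eq: "regular_spread q g = plane ` dirs"
proof (intro equalityI subsetI)
  have un: "vec.span (vec.span {x} \<union> vec.span {frob q x} \<union> vec.span {frob q (frob q x)})
      = vec.span {x, frob q x, frob q (frob q x)}" (is "vec.span ?A = vec.span ?B") for x :: "'a ^ 7"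
  proof -
    have "?A \<subseteq> vec.span ?B"
      by (intro Un_least vec.span_mono) auto
    moreover have "?B \<subseteq> vec.span ?A"
      by (auto intro!: vec.span_base)
    ultimately show ?thesis
      by (simp add: vec.span_eq)
  qed
  {
    fix \<pi> assume "\<pi> \<in> regular_spread q g"
    then obtain x where x: "x \<in> g" "x \<in> rat_vecs q 3" "x \<noteq> 0"
      "\<pi> = vec.span (vec.span {x} \<union> conj_space q (vec.span {x}) \<union> conj_space q (conj_space q (vec.span {x})))"
      by (auto simp: regular_spread_def elim!: pg_pointsE)
    have x0: "c1 x = 0" "c2 x = 0"
      using x(1) by (simp_all add: g_eq)
    have "frob q (frob q (frob q x)) = x"
      using x(2) by (simp add: rat_vecs_3)
    then have "frob q (frob q (frob q (c x))) = c x"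
      using c_frob by metis
    then have "c x \<in> dirs"
      using x x0 c_ker[of x] c_first(2)[of x] by (auto simp: dirs_def rat_vecs_3)
    moreover have "\<pi> = plane (c x)"
      using plane_span[OF refl x0] x(4) un[of x] by (simp add: conj_space_span)
    ultimately show "\<pi> \<in> plane ` dirs"
      by blast
  }
  {
    fix \<pi> assume "\<pi> \<in> plane ` dirs"
    then obtain \<xi> where \<xi>: "\<xi> \<in> dirs" "\<pi> = plane \<xi>"
      by blast
    then obtain x where x: "x \<in> g" "x \<in> rat_vecs q 3" "x \<noteq> 0" "c x = \<xi>" "c1 x = 0" "c2 x = 0"
      using dir_vector by blast
    have "vec.span {x} \<in> pg_points q 3 g"
      using x by (intro pg_pointsI)
    moreover have "\<pi> = vec.span (vec.span {x} \<union> conj_space q (vec.span {x}) \<union> conj_space q (conj_space q (vec.span {x})))"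
      using plane_span[OF x(4-6)] \<xi> un[of x] by (simp add: conj_space_span)
    ultimately show "\<pi> \<in> regular_spread q g"
      unfolding regular_spread_def by blast
  }
qed

lemma plane_c_image:
  assumes "\<xi> \<in> dirs"
  shows "c ` plane \<xi> = vec.span {\<xi>}"
proof (intro equalityI subsetI)
  fix y assume "y \<in> vec.span {\<xi>}"
  then obtain k where k: "y = k *s \<xi>"
    using in_span1_iff by blast
  obtain x where x: "c x = \<xi>" "c1 x = 0" "c2 x = 0"
    using dir_vector[OF assms] by blast
  have "k *s x \<in> plane \<xi>" "c (k *s x) = y"
    using x k by (auto simp: plane_def c_scale in_span1_iff vec.span_zero)
  then show "y \<in> c ` plane \<xi>"
    by blast
qed (auto simp: plane_def)

lemma plane_cong: "vec.span {\<xi>} = vec.span {\<eta>} \<Longrightarrow> plane \<xi> = plane \<eta>"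
proof -
  assume *: "vec.span {\<xi>} = vec.span {\<eta>}"
  then have 1: "vec.span {frob q \<xi>} = vec.span {frob q \<eta>}"
    using conj_space_span[of "{\<xi>}"] conj_space_span[of "{\<eta>}"] by simp
  then have "vec.span {frob q (frob q \<xi>)} = vec.span {frob q (frob q \<eta>)}"
    using conj_space_span[of "{frob q \<xi>}"] conj_space_span[of "{frob q \<eta>}"] by simp
  then show ?thesis
    using * 1 by (simp add: plane_def)
qed

lemma plane_subset_hyperplane: "\<xi> \<in> dirs \<Longrightarrow> plane \<xi> \<subseteq> hyperplane h"
  by (auto simp: plane_def hyperplane_iff dirs_def in_span1_iff)

lemma dim_plane:
  assumes "\<xi> \<in> dirs"
  shows "vec.dim (plane \<xi>) = 3"
proof -
  obtain x where x: "c x = \<xi>" "c1 x = 0" "c2 x = 0"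
    using dir_vector[OF assms] by blast
  have \<xi>0: "\<xi> \<noteq> 0"
    using assms by (simp add: dirs_def)
  have "x \<notin> vec.span {}"
    using x \<xi>0 by auto
  moreover have "frob q x \<notin> vec.span {x}"
  proof
    assume "frob q x \<in> vec.span {x}"
    then obtain k where "c1 (frob q x) = c1 (k *s x)"
      using in_span1_iff by metis
    then show False
      using x \<xi>0 by (simp add: c_frob c_scale)
  qed
  moreover have "frob q (frob q x) \<notin> vec.span {frob q x, x}"
  proof
    assume "frob q (frob q x) \<in> vec.span {frob q x, x}"
    then obtain k l where "c2 (frob q (frob q x)) = c2 (k *s frob q x + l *s x)"
      using span2_iff by metis
    then show False
      using x \<xi>0 by (simp add: c_frob c_scale c_add)
  qed
  ultimately have "vec.dim {frob q (frob q x), frob q x, x} = 3"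
    by (simp add: vec.dim_insert)
  then show ?thesis
    using plane_span[OF x] by (simp add: insert_commute)
qed

text \<open>For \<gamma> in the cubic but not in the small field, the rational lifts of \<xi>,
  \<gamma>\<xi> and \<gamma>^2 \<xi> span a rational subspace. It contains \<open>x\<close>, hence
  also the conjugates of \<open>x\<close>, and these span the plane.\<close>

lemma plane_rational:
  assumes "\<xi> \<in> dirs"
  shows "rat_subspace q 1 (plane \<xi>)"
proof -
  obtain x where x: "c x = \<xi>" "c1 x = 0" "c2 x = 0"
    using dir_vector[OF assms] by blast
  obtain \<gamma> :: 'a where \<gamma>: "\<gamma> \<in> GFq q 3" "\<gamma> \<notin> GFq q 1"
    using ex_GFq_diff by blast
  define \<gamma>1 \<gamma>2 where "\<gamma>1 = \<gamma> ^ q" and "\<gamma>2 = \<gamma>1 ^ q"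
  have \<gamma>3: "\<gamma>2 ^ q = \<gamma>"
    using \<gamma>(1) by (simp add: GFq_iff \<gamma>2_def \<gamma>1_def power3_eq_cube power_mult)
  have n1: "\<gamma>1 \<noteq> \<gamma>"
    using \<gamma>(2) by (simp add: GFq_iff \<gamma>1_def)
  have n2: "\<gamma>2 \<noteq> \<gamma>"
    using n1 \<gamma>3 by (metis \<gamma>1_def)
  define d where "d = (\<gamma> - \<gamma>1) * (\<gamma> - \<gamma>2)"
  have d: "d \<noteq> 0"
    using n1 n2 by (simp add: d_def)
  have \<xi>: "\<xi> \<in> rat_vecs q 3" "\<xi> $ 1 = 0"
    using assms by (simp_all add: dirs_def)
  have "k *s \<xi> \<in> rat_vecs q 3" "(k *s \<xi>) $ 1 \<in> GFq q 1" if "k \<in> GFq q 3" for k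
    using \<xi> that by (auto intro: rat_vecs_scale GFq_closed)
  then have ex: "\<exists>v. v \<in> rat_vecs q 1 \<and> c v = k *s \<xi>" if "k \<in> GFq q 3" for k
    using that lift_exists by metis
  obtain v0 where v0: "v0 \<in> rat_vecs q 1" "c v0 = \<xi>"
    using ex[of 1] GFq_closed(2)[of 3] by auto
  obtain v1 where v1: "v1 \<in> rat_vecs q 1" "c v1 = \<gamma> *s \<xi>"
    using ex[OF \<gamma>(1)] by blast
  obtain v2 where v2: "v2 \<in> rat_vecs q 1" "c v2 = \<gamma>\<^sup>2 *s \<xi>"
    using ex[of "\<gamma>\<^sup>2"] GFq_closed(9)[OF \<gamma>(1)] by blast
  define V where "V = vec.span {v0, v1, v2}"
  have Vr: "rat_subspace q 1 V"
    unfolding rat_subspace_def V_def using v0 v1 v2 by (intro exI[of _ "{v0, v1, v2}"]) simp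
  have pc: "(a\<^sup>2) ^ q = (a ^ q)\<^sup>2" for a :: 'a
    by (simp only: mult.commute flip: power_mult)
  have cc: "c1 v0 = frob q \<xi>" "c1 v1 = \<gamma>1 *s frob q \<xi>" "c1 v2 = \<gamma>1\<^sup>2 *s frob q \<xi>"
    "c2 v0 = frob q (frob q \<xi>)" "c2 v1 = \<gamma>2 *s frob q (frob q \<xi>)" "c2 v2 = \<gamma>2\<^sup>2 *s frob q (frob q \<xi>)"
    using v0 v1 v2 by (simp_all add: rat_c frob_scale \<gamma>1_def \<gamma>2_def pc)
  \<comment> \<open>The polynomial (X - \<gamma>1)(X - \<gamma>2) / d is 1 at \<gamma> and 0 at both
    conjugates. Combining the lifts with its coefficients therefore gives \<open>c\<close> the value
    \<xi> and kills \<open>c1\<close> and \<open>c2\<close>.\<close>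
  have "x = (1 / d) *s ((\<gamma>1 * \<gamma>2) *s v0 + (- (\<gamma>1 + \<gamma>2)) *s v1 + v2)"
  proof (rule c_eqI)
    have "(\<gamma>1 * \<gamma>2) + (- (\<gamma>1 + \<gamma>2)) * \<gamma> + \<gamma>\<^sup>2 = d"
      by (simp add: d_def algebra_simps power2_eq_square)
    then have "(1 / d) * ((\<gamma>1 * \<gamma>2) + (- (\<gamma>1 + \<gamma>2)) * \<gamma> + \<gamma>\<^sup>2) = 1"
      using d by simp
    moreover have "c ((1 / d) *s ((\<gamma>1 * \<gamma>2) *s v0 + (- (\<gamma>1 + \<gamma>2)) *s v1 + v2))
        = ((1 / d) * ((\<gamma>1 * \<gamma>2) + (- (\<gamma>1 + \<gamma>2)) * \<gamma> + \<gamma>\<^sup>2)) *s \<xi>"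
      by (simp only: c_add c_scale v0 v1 v2) (simp add: vec_eq_iff algebra_simps)
    ultimately show "c x = c ((1 / d) *s ((\<gamma>1 * \<gamma>2) *s v0 + (- (\<gamma>1 + \<gamma>2)) *s v1 + v2))"
      by (simp only: x) simp
    show "c1 x = c1 ((1 / d) *s ((\<gamma>1 * \<gamma>2) *s v0 + (- (\<gamma>1 + \<gamma>2)) *s v1 + v2))"
      by (simp only: c_add c_scale cc x) (simp add: vec_eq_iff algebra_simps power2_eq_square)
    show "c2 x = c2 ((1 / d) *s ((\<gamma>1 * \<gamma>2) *s v0 + (- (\<gamma>1 + \<gamma>2)) *s v1 + v2))"
      by (simp only: c_add c_scale cc x) (simp add: vec_eq_iff algebra_simps power2_eq_square)
  qed
  then have xV: "x \<in> V"
    unfolding V_def by (metis (no_types, lifting) vec.span_add vec.span_scale vec.span_base insertCI)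
  have "frob q x \<in> V"
    using frob_rat_subspace[OF Vr xV] .
  moreover from this have "frob q (frob q x) \<in> V"
    by (rule frob_rat_subspace[OF Vr])
  ultimately have "plane \<xi> \<subseteq> V"
    unfolding plane_span[OF x] using xV by (intro vec.span_minimal subspace_rat[OF Vr]) auto
  moreover have "V \<subseteq> plane \<xi>"
    unfolding V_def using v0 v1 v2 cc
    by (intro vec.span_minimal plane_subspace) (auto simp: plane_def in_span1_iff intro: exI[of _ 1])
  ultimately show ?thesis
    using Vr by simp
qed

section \<open>The Bruck-Bose isomorphism\<close>

lemma span_plane: "vec.span (plane \<xi>) = plane \<xi>"
  using plane_subspace[of \<xi>] by (simp only: vec.span_eq_iff)

lemma in_solid_iff: "u \<in> vec.span (insert v (plane \<xi>)) \<longleftrightarrow> (\<exists>k. u - k *s v \<in> plane \<xi>)"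
  by (simp add: vec.span_breakdown_eq span_plane)

lemma solidI:
  assumes v: "v \<in> rat_vecs q 1" "c v $ 1 \<noteq> 0" and \<xi>: "\<xi> \<in> dirs"
  shows "bb_solid q h g (vec.span (insert v (plane \<xi>)))"
proof -
  obtain B where B: "B \<subseteq> rat_vecs q 1" "plane \<xi> = vec.span B"
    using plane_rational[OF \<xi>] by (auto simp: rat_subspace_def)
  have vn: "v \<notin> plane \<xi>"
    using plane_subset_hyperplane[OF \<xi>] v by (auto simp: hyperplane_iff)
  have "vec.span (insert v (plane \<xi>)) = vec.span (insert v B)"
    unfolding B(2) vec.span_eq
    by (auto intro: vec.span_base vec.span_superset[THEN subsetD] vec.span_mono[THEN subsetD, of B])
  then have 1: "rat_subspace q 1 (vec.span (insert v (plane \<xi>)))"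
    unfolding rat_subspace_def using B v by (intro exI[of _ "insert v B"]) simp
  have "v \<notin> vec.span (plane \<xi>)"
    using vn by (simp add: span_plane)
  then have 2: "vec.dim (vec.span (insert v (plane \<xi>))) = 4"
    using dim_plane[OF \<xi>] by (simp add: vec.dim_insert)
  have 3: "\<not> vec.span (insert v (plane \<xi>)) \<subseteq> hyperplane h"
    using v vec.span_base[of v "insert v (plane \<xi>)"] by (auto simp: hyperplane_iff)
  have "plane \<xi> \<subseteq> vec.span (insert v (plane \<xi>))"
    by (auto intro: vec.span_base)
  then show ?thesis
    unfolding bb_solid_def using 1 2 3 \<xi> by (auto simp: regular_spread_eq)
qed

lemma normalize_rat:
  assumes "v \<in> rat_vecs q m" "v $ 1 \<noteq> 0"
  obtains w where "w \<in> rat_vecs q m" "w $ 1 = 1" "vec.span {w} = vec.span {v :: 'a ^ 3}"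
proof -
  have "inverse (v $ 1) \<in> GFq q m"
    using assms by (auto simp: rat_vecs_def intro: GFq_closed)
  then have "inverse (v $ 1) *s v \<in> rat_vecs q m"
    using assms by (intro rat_vecs_scale)
  then show ?thesis
    using that[of "inverse (v $ 1) *s v"] assms by (simp add: span1_scale)
qed

lemma normalize_affine:
  assumes "v \<in> rat_vecs q 1" "c v $ 1 \<noteq> 0"
  obtains w where "w \<in> rat_vecs q 1" "c w $ 1 = 1" "w = inverse (c v $ 1) *s v" "vec.span {w} = vec.span {v}"
proof -
  have "inverse (c v $ 1) *s v \<in> rat_vecs q 1"
    using assms rat_c_first[OF assms(1)] by (intro rat_vecs_scale GFq_closed)
  then show ?thesis
    using that[of "inverse (c v $ 1) *s v"] assms by (simp add: span1_scale c_scale)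
qed

lemma affine_points_eq: "affine_points q h = {vec.span {v} | v. v \<in> rat_vecs q 1 \<and> c v $ 1 = 1}"
proof (intro equalityI subsetI)
  fix P assume P: "P \<in> affine_points q h"
  then obtain v where v: "P = vec.span {v}" "v \<in> rat_vecs q 1"
    by (auto simp: affine_points_def elim!: pg_pointsE)
  have "c v $ 1 \<noteq> 0"
  proof
    assume "c v $ 1 = 0"
    then have "P \<subseteq> hyperplane h"
      using v by (auto simp: in_span1_iff hyperplane_iff c_scale)
    then show False
      using P by (simp add: affine_points_def)
  qed
  then show "P \<in> {vec.span {v} | v. v \<in> rat_vecs q 1 \<and> c v $ 1 = 1}"
    using normalize_affine[OF v(2)] v(1) by blast
next
  fix P assume "P \<in> {vec.span {v} | v. v \<in> rat_vecs q 1 \<and> c v $ 1 = 1}"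
  then obtain v where v: "P = vec.span {v}" "v \<in> rat_vecs q 1" "c v $ 1 = 1"
    by blast
  have "v \<noteq> 0"
    using v by auto
  moreover have "\<not> P \<subseteq> hyperplane h"
    using v vec.span_base[of v "{v}"] by (auto simp: hyperplane_iff)
  ultimately show "P \<in> affine_points q h"
    using v by (auto simp: affine_points_def intro: pg_pointsI)
qed

lemma solidE:
  assumes "bb_solid q h g T"
  obtains v \<xi> where "v \<in> rat_vecs q 1" "c v $ 1 = 1" "\<xi> \<in> dirs" "T = vec.span (insert v (plane \<xi>))"
proof -
  obtain \<xi> where \<xi>: "\<xi> \<in> dirs" "plane \<xi> \<subseteq> T"
    using assms by (auto simp: bb_solid_def regular_spread_eq)
  have sub: "vec.subspace T" and dim: "vec.dim T = 4"
    using assms by (auto simp: bb_solid_def intro: subspace_rat)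
  obtain B where B: "B \<subseteq> rat_vecs q 1" "T = vec.span B"
    using assms by (auto simp: bb_solid_def rat_subspace_def)
  have "vec.subspace (hyperplane h)"
    by (auto simp: vec.subspace_def hyperplane_iff c_add c_scale)
  then have "\<not> B \<subseteq> hyperplane h"
    using assms B vec.span_minimal unfolding bb_solid_def by metis
  then obtain u where "u \<in> B" "u \<notin> hyperplane h"
    by blast
  then have u: "u \<in> B" "c u $ 1 \<noteq> 0"
    by (simp_all add: hyperplane_iff)
  then obtain v where v: "v \<in> rat_vecs q 1" "c v $ 1 = 1" "v = inverse (c u $ 1) *s u"
    using normalize_affine[OF subsetD[OF B(1) u(1)] u(2)] by auto
  have "v \<in> T"
    unfolding v(3) B(2) using u by (intro vec.span_scale vec.span_base)
  then have "vec.span (insert v (plane \<xi>)) \<subseteq> T"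
    using \<xi> sub by (intro vec.span_minimal) auto
  moreover have "vec.dim (vec.span (insert v (plane \<xi>))) = 4"
    using solidI[OF v(1) _ \<xi>(1)] v(2) by (simp add: bb_solid_def)
  ultimately have "vec.span (insert v (plane \<xi>)) = T"
    using vec.subspace_dim_equal[OF vec.subspace_span sub] dim by simp
  then show ?thesis
    using that v \<xi> by blast
qed

lemma bb_points_cases:
  assumes "P \<in> bb_points q h g"
  obtains (affine) v where "P = vec.span {v}" "v \<in> rat_vecs q 1" "c v $ 1 = 1"
  | (plane) \<xi> where "P = plane \<xi>" "\<xi> \<in> dirs"
  using assms by (auto simp: bb_points_def affine_points_eq regular_spread_eq)

text \<open>A rational vector is determined by its value under \<open>c\<close>, so incidence can be
  tested in the plane. For an affine point both representatives have first coordinate 1, which makes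
  their difference a vector of direction \<xi>.\<close>

lemma solid_incidence:
  assumes v: "v \<in> rat_vecs q 1" "c v $ 1 = 1" and \<xi>: "\<xi> \<in> dirs" and P: "P \<in> bb_points q h g"
  shows "P \<subseteq> vec.span (insert v (plane \<xi>)) \<longleftrightarrow> c ` P \<subseteq> vec.span {c v, \<xi>}"
proof
  have "c u \<in> vec.span {c v, \<xi>}" if u: "u \<in> vec.span (insert v (plane \<xi>))" for u
  proof -
    obtain k where "u - k *s v \<in> plane \<xi>"
      using u in_solid_iff by blast
    then obtain l where "c u - k *s c v = l *s \<xi>"
      by (auto simp: plane_def in_span1_iff c_diff c_scale)
    then have "c u = k *s c v + l *s \<xi>"
      by (simp add: algebra_simps)
    then show ?thesis
      unfolding span2_iff by blast
  qed
  then show "P \<subseteq> vec.span (insert v (plane \<xi>)) \<Longrightarrow> c ` P \<subseteq> vec.span {c v, \<xi>}"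
    by blast
next
  assume sub: "c ` P \<subseteq> vec.span {c v, \<xi>}"
  have \<xi>1: "\<xi> $ 1 = 0"
    using \<xi> by (simp add: dirs_def)
  show "P \<subseteq> vec.span (insert v (plane \<xi>))"
    using P
  proof (cases rule: bb_points_cases)
    case (affine u)
    then have "c u \<in> vec.span {c v, \<xi>}"
      using sub vec.span_base[of u "{u}"] by auto
    then obtain a b where ab: "c u = a *s c v + b *s \<xi>"
      unfolding span2_iff by blast
    then have "c u $ 1 = a"
      using \<xi>1 v(2) by simp
    then have a: "a = 1"
      using affine(3) by simp
    have uv: "u - v \<in> rat_vecs q 1"
      using affine v by (intro rat_vecs_diff)
    have "c (u - v) = b *s \<xi>"
      using ab a by (simp add: c_diff)
    then have "u - 1 *s v \<in> plane \<xi>"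
      using rat_c[OF uv] by (auto simp: plane_def in_span1_iff frob_scale)
    then have "u \<in> vec.span (insert v (plane \<xi>))"
      using in_solid_iff by blast
    then show ?thesis
      unfolding affine(1) by (intro vec.span_minimal) auto
  next
    case (plane \<eta>)
    then have "\<eta> \<in> vec.span {c v, \<xi>}"
      using sub plane_c_image[OF plane(2)] vec.span_base[of \<eta> "{\<eta>}"] by auto
    then obtain a b where ab: "\<eta> = a *s c v + b *s \<xi>"
      unfolding span2_iff by blast
    then have "\<eta> $ 1 = a"
      using \<xi>1 v(2) by simp
    then have "\<eta> = b *s \<xi>"
      using plane(2) ab by (simp add: dirs_def)
    then have "vec.span {\<eta>} = vec.span {\<xi>}"
      using plane(2) by (intro span1_eqI) (auto simp: in_span1_iff dirs_def)
    then have "P = plane \<xi>"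
      using plane_cong plane(1) by blast
    then show ?thesis
      by (auto intro: vec.span_base)
  qed
qed

text \<open>Affine points have rational representatives with first coordinate 1, which
  \<open>c\<close> determines. Conversely, scaling the first coordinate of a point of the plane to 1
  brings it into the small field, where a lift exists.\<close>

lemma c_image_bij: "bij_betw (\<lambda>S. c ` S) (bb_points q h g) (pg_points q 3 UNIV)"
proof (rule bij_betwI')
  fix P Q assume P: "P \<in> bb_points q h g" and Q: "Q \<in> bb_points q h g"
  have mixed: "vec.span {c v} \<noteq> vec.span {\<xi>}" if "c v $ 1 = 1" "\<xi> \<in> dirs" for v \<xi>
  proof
    assume "vec.span {c v} = vec.span {\<xi>}"
    then have "c v \<in> vec.span {\<xi>}"
      using vec.span_base[of "c v" "{c v}"] by simp
    then show False
      using that by (auto simp: in_span1_iff dirs_def)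
  qed
  show "c ` P = c ` Q \<longleftrightarrow> P = Q"
  proof
    assume eq: "c ` P = c ` Q"
    show "P = Q"
      using P
    proof (cases rule: bb_points_cases)
      case (affine u)
      show ?thesis
        using Q
      proof (cases rule: bb_points_cases)
        case (affine v)
        have "vec.span {c u} = vec.span {c v}"
          using eq \<open>P = vec.span {u}\<close> affine(1) by (simp add: c_image_span)
        then have "c u \<in> vec.span {c v}"
          using vec.span_base[of "c u" "{c u}"] by simp
        then obtain k where k: "c u = k *s c v"
          using in_span1_iff by blast
        then have "k = 1"
          using affine(3) \<open>c u $ 1 = 1\<close> by simp
        then have "c u = c v"
          using k by simp
        then have "u = v"
          using rat_c_inj \<open>u \<in> rat_vecs q 1\<close> affine(2) by blast
        then show ?thesis
          using \<open>P = vec.span {u}\<close> affine(1) by simp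
      next
        case (plane \<xi>)
        then show ?thesis
          using eq affine mixed plane_c_image by (simp add: c_image_span)
      qed
    next
      case (plane \<xi>)
      show ?thesis
        using Q
      proof (cases rule: bb_points_cases)
        case (affine v)
        then show ?thesis
          using eq plane mixed[of v \<xi>] plane_c_image by (simp add: c_image_span)
      next
        case (plane \<eta>)
        then show ?thesis
          using eq \<open>P = plane \<xi>\<close> \<open>\<xi> \<in> dirs\<close> plane_c_image plane_cong[of \<xi> \<eta>] by simp
      qed
    qed
  qed simp
next
  fix P assume "P \<in> bb_points q h g"
  then show "c ` P \<in> pg_points q 3 UNIV"
  proof (cases rule: bb_points_cases)
    case (affine v)
    then show ?thesis
      using rat_c_3 by (auto simp: c_image_span intro!: pg_pointsI)
  next
    case (plane \<xi>)
    then show ?thesis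
      using plane_c_image[OF plane(2)] by (auto simp: dirs_def intro!: pg_pointsI)
  qed
next
  fix Q :: "('a ^ 3) set" assume "Q \<in> pg_points q 3 UNIV"
  then obtain x where x: "Q = vec.span {x}" "x \<in> rat_vecs q 3" "x \<noteq> 0"
    by (elim pg_pointsE)
  show "\<exists>P\<in>bb_points q h g. Q = c ` P"
  proof (cases "x $ 1 = 0")
    case True
    then have "x \<in> dirs"
      using x by (simp add: dirs_def)
    then show ?thesis
      using plane_c_image x by (auto simp: bb_points_def regular_spread_eq)
  next
    case False
    then obtain w where w: "w \<in> rat_vecs q 3" "w $ 1 = 1" "vec.span {w} = vec.span {x}"
      using normalize_rat x by blast
    then obtain v where v: "v \<in> rat_vecs q 1" "c v = w"
      using lift_exists[of w] GFq_closed(2)[of 1] by auto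
    then have "vec.span {v} \<in> bb_points q h g"
      using w by (auto simp: bb_points_def affine_points_eq)
    then show ?thesis
      using w v x by (intro bexI[of _ "vec.span {v}"]) (simp_all add: c_image_span)
  qed
qed

lemma pg_points_subset_iff:
  fixes U :: "('a ^ 'n) set"
  assumes "vec.subspace U"
  shows "pg_points q m U = {Q \<in> pg_points q m UNIV. Q \<subseteq> U}"
proof (intro equalityI subsetI)
  fix P assume "P \<in> pg_points q m U"
  then show "P \<in> {Q \<in> pg_points q m UNIV. Q \<subseteq> U}"
    using span_subset_iff[OF assms] by (auto elim!: pg_pointsE intro!: pg_pointsI)
next
  fix P assume "P \<in> {Q \<in> pg_points q m UNIV. Q \<subseteq> U}"
  then show "P \<in> pg_points q m U"
    using span_subset_iff[OF assms] by (auto elim!: pg_pointsE intro!: pg_pointsI)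
qed

lemma c_image_solid:
  assumes v: "v \<in> rat_vecs q 1" "c v $ 1 = 1" and \<xi>: "\<xi> \<in> dirs"
  shows "(\<lambda>S. c ` S) ` {P \<in> bb_points q h g. P \<subseteq> vec.span (insert v (plane \<xi>))} = pg_points q 3 (vec.span {c v, \<xi>})"
proof -
  have "(\<lambda>S. c ` S) ` {P \<in> bb_points q h g. P \<subseteq> vec.span (insert v (plane \<xi>))}
      = (\<lambda>S. c ` S) ` {P \<in> bb_points q h g. c ` P \<subseteq> vec.span {c v, \<xi>}}"
    using solid_incidence[OF v \<xi>] by (intro arg_cong[of _ _ "\<lambda>X. (\<lambda>S. c ` S) ` X"] Collect_cong) blast
  also have "\<dots> = {Q \<in> (\<lambda>S. c ` S) ` bb_points q h g. Q \<subseteq> vec.span {c v, \<xi>}}"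
    by blast
  also have "\<dots> = pg_points q 3 (vec.span {c v, \<xi>})"
    using c_image_bij pg_points_subset_iff[of "vec.span {c v, \<xi>}" 3] by (simp add: bij_betw_def)
  finally show ?thesis .
qed

lemma c_image_spread: "(\<lambda>S. c ` S) ` regular_spread q g = pg_points q 3 {x. x $ 1 = 0}"
proof (intro equalityI subsetI)
  fix P assume "P \<in> (\<lambda>S. c ` S) ` regular_spread q g"
  then obtain \<xi> where "\<xi> \<in> dirs" "P = c ` plane \<xi>"
    by (auto simp: regular_spread_eq)
  then show "P \<in> pg_points q 3 {x. x $ 1 = 0}"
    using plane_c_image by (auto simp: dirs_def intro!: pg_pointsI)
next
  fix P :: "('a ^ 3) set" assume "P \<in> pg_points q 3 {x. x $ 1 = 0}"
  then obtain x where x: "P = vec.span {x}" "x \<in> dirs"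
    by (auto simp: dirs_def elim!: pg_pointsE)
  then have "P = c ` plane x"
    using plane_c_image by simp
  then show "P \<in> (\<lambda>S. c ` S) ` regular_spread q g"
    using x by (auto simp: regular_spread_eq)
qed

lemma line_infinity: "rat_subspace q 3 {x :: 'a ^ 3. x $ 1 = 0}" "vec.dim {x :: 'a ^ 3. x $ 1 = 0} = 2"
proof -
  have eq: "{x :: 'a ^ 3. x $ 1 = 0} = vec.span {vector [0, 1, 0], vector [0, 0, 1]}"
  proof (intro equalityI subsetI)
    fix x :: "'a ^ 3" assume "x \<in> {x. x $ 1 = 0}"
    then have "x = x $ 2 *s vector [0, 1, 0] + x $ 3 *s vector [0, 0, 1]"
      by (simp add: vec3_eq_iff)
    then show "x \<in> vec.span {vector [0, 1, 0], vector [0, 0, 1]}"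
      unfolding span2_iff by blast
  next
    fix x :: "'a ^ 3" assume "x \<in> vec.span {vector [0, 1, 0], vector [0, 0, 1]}"
    then show "x \<in> {x. x $ 1 = 0}"
      unfolding span2_iff by auto
  qed
  show "rat_subspace q 3 {x :: 'a ^ 3. x $ 1 = 0}"
    unfolding eq by (intro rat_lineI) (auto simp: axis_rat GFq_closed)
  show "vec.dim {x :: 'a ^ 3. x $ 1 = 0} = 2"
    unfolding eq dim_span2 by (auto simp: in_span1_iff vec3_eq_iff)
qed

lemma bb_iso_c_image: "bb_iso q h g (\<lambda>S. c ` S)"
proof -
  have "(\<lambda>l. (\<lambda>S. c ` S) ` l) ` bb_lines q h g = pg_lines q 3"
  proof (intro equalityI subsetI)
    fix l assume "l \<in> (\<lambda>l. (\<lambda>S. c ` S) ` l) ` bb_lines q h g"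
    then consider "l = (\<lambda>S. c ` S) ` regular_spread q g"
      | T where "bb_solid q h g T" "l = (\<lambda>S. c ` S) ` {P \<in> bb_points q h g. P \<subseteq> T}"
      unfolding bb_lines_def by blast
    then show "l \<in> pg_lines q 3"
    proof cases
      case 1
      then show ?thesis
        unfolding pg_lines_def c_image_spread using line_infinity by blast
    next
      case 2
      obtain v \<xi> where v: "v \<in> rat_vecs q 1" "c v $ 1 = 1" "\<xi> \<in> dirs" "T = vec.span (insert v (plane \<xi>))"
        using solidE[OF 2(1)] by blast
      have "l = pg_points q 3 (vec.span {c v, \<xi>})"
        unfolding 2(2) v(4) by (rule c_image_solid[OF v(1-3)])
      moreover have "rat_subspace q 3 (vec.span {c v, \<xi>})"
        using v rat_c_3 by (intro rat_lineI) (auto simp: dirs_def)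
      moreover have "vec.dim (vec.span {c v, \<xi>}) = 2"
        unfolding dim_span2 using v by (auto simp: in_span1_iff dirs_def vec3_eq_iff)
      ultimately show ?thesis
        unfolding pg_lines_def by blast
    qed
  next
    fix l :: "('a ^ 3) set set" assume "l \<in> pg_lines q 3"
    then obtain U where U: "rat_subspace q 3 U" "vec.dim U = 2" "l = pg_points q 3 U"
      by (auto simp: pg_lines_def)
    obtain u w where uw: "u \<in> rat_vecs q 3" "w \<in> rat_vecs q 3" "U = vec.span {u, w}" "u \<noteq> 0" "w \<notin> vec.span {u}"
      using rat_lineE[OF U(1,2)] by blast
    show "l \<in> (\<lambda>l. (\<lambda>S. c ` S) ` l) ` bb_lines q h g"
    proof (cases "u $ 1 = 0 \<and> w $ 1 = 0")
      case True
      have "U \<subseteq> {x. x $ 1 = 0}"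
        unfolding uw(3) span2_iff using True by (auto simp: span2_iff)
      then have "U = {x. x $ 1 = 0}"
        using vec.subspace_dim_equal[OF subspace_rat[OF U(1)] subspace_rat[OF line_infinity(1)]] U(2) line_infinity(2) by simp
      then have "l = (\<lambda>S. c ` S) ` regular_spread q g"
        using c_image_spread U(3) by simp
      then show ?thesis
        unfolding bb_lines_def by blast
    next
      case False
      have "\<exists>x y. x \<in> rat_vecs q 3 \<and> y \<in> rat_vecs q 3 \<and> x \<in> U \<and> y \<in> U \<and> x $ 1 \<noteq> 0 \<and> y \<notin> vec.span {x}"
      proof (cases "u $ 1 = 0")
        case True
        have "u \<notin> vec.span {w}"
        proof
          assume "u \<in> vec.span {w}"
          then have "vec.span {u} = vec.span {w}"
            using uw(4) by (intro span1_eqI)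
          then show False
            using uw(5) vec.span_base[of w "{w}"] by simp
        qed
        then show ?thesis
          using True False uw by (intro exI[of _ w] exI[of _ u]) (auto intro: vec.span_base)
      next
        case False
        then show ?thesis
          using uw by (intro exI[of _ u] exI[of _ w]) (auto intro: vec.span_base)
      qed
      then obtain x y where xy: "x \<in> rat_vecs q 3" "y \<in> rat_vecs q 3" "x \<in> U" "y \<in> U" "x $ 1 \<noteq> 0" "y \<notin> vec.span {x}"
        by blast
      obtain x' where x': "x' \<in> rat_vecs q 3" "x' $ 1 = 1" "vec.span {x'} = vec.span {x}"
        using normalize_rat[OF xy(1,5)] by blast
      have x'U: "x' \<in> U"
        using x'(3) xy(3) span_subset_iff[OF subspace_rat[OF U(1)]] by metis
      \<comment> \<open>The point at infinity of the line \<open>U\<close>; it selects the spread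
        plane of the solid.\<close>
      define \<xi> where "\<xi> = y - y $ 1 *s x'"
      have yE: "y $ 1 \<in> GFq q 3"
        using xy(2) by (simp add: rat_vecs_def)
      have \<xi>U: "\<xi> \<in> U"
        unfolding \<xi>_def by (intro vec.subspace_diff vec.subspace_scale subspace_rat[OF U(1)] xy x'U)
      have "y \<noteq> y $ 1 *s x'"
        using xy(6) x'(3) in_span1_iff by metis
      then have \<xi>d: "\<xi> \<in> dirs"
        using x' xy yE by (auto simp: dirs_def \<xi>_def intro: rat_vecs_diff rat_vecs_scale)
      have "\<xi> \<noteq> a *s x'" for a
        using \<xi>d x'(2) by (auto simp: dirs_def)
      moreover have "x' \<noteq> 0"
        using x'(2) by auto
      ultimately have "x' \<noteq> 0" "\<xi> \<notin> vec.span {x'}"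
        by (auto simp only: in_span1_iff)
      then have U_eq: "U = vec.span {x', \<xi>}"
        using line_eq_span2[OF subspace_rat[OF U(1)] U(2) x'U \<xi>U] by simp
      obtain v where v: "v \<in> rat_vecs q 1" "c v = x'"
        using lift_exists[OF x'(1)] x'(2) GFq_closed(2)[of 1] by auto
      define T where "T = vec.span (insert v (plane \<xi>))"
      have "bb_solid q h g T"
        unfolding T_def using v x' \<xi>d by (intro solidI) auto
      moreover have "l = (\<lambda>S. c ` S) ` {P \<in> bb_points q h g. P \<subseteq> T}"
        unfolding T_def using c_image_solid[OF v(1) _ \<xi>d] v(2) x'(2) U(3) U_eq by simp
      ultimately show ?thesis
        unfolding bb_lines_def by blast
    qed
  qed
  then show ?thesis
    using c_image_bij by (simp add: bb_iso_def incidence_iso_def)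
qed

lemma bb_line_subset: "l \<in> bb_lines q h g \<Longrightarrow> l \<subseteq> bb_points q h g"
  by (auto simp: bb_lines_def bb_points_def)

lemma param_conic_subset:
  assumes "\<And>i j. M $ i $ j \<in> GFq q 3" "det M \<noteq> 0"
  shows "param_conic q M \<subseteq> pg_points q 3 (UNIV :: ('a ^ 3) set)"
proof
  fix P assume "P \<in> param_conic q M"
  then obtain s t where st: "P = vec.span {M *v ver s t}" "s \<in> GFq q 1" "t \<in> GFq q 1" "s \<noteq> 0 \<or> t \<noteq> 0"
    unfolding param_conic_def by blast
  have "M *v ver s t \<in> rat_vecs q 3"
    using rat_vecs_mv[OF assms(1) ver_rat[OF GFq_1_subset[OF st(2)] GFq_1_subset[OF st(3)]]] .
  moreover have "M *v ver s t \<noteq> 0"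
    using st(4) assms(2) ker_iff_det[of M] ver_eq_0_iff by metis
  ultimately show "P \<in> pg_points q 3 UNIV"
    using st by (auto intro: pg_pointsI)
qed

text \<open>\<open>\<phi>\<close> and the image under \<open>c\<close> have the same source, so the
  second after the inverse of the first is a collineation of the plane. It and its inverse preserve
  conics of subplanes, and \<open>Fq_conic_iff\<close> replaces the conic by a matrix.\<close>

lemma corresponds_iff:
  assumes "bb_iso q h g \<phi>"
  shows "corresponds_to_Fq_conic q h g \<phi> N \<longleftrightarrow>
    (\<exists>M. (\<forall>i j. M $ i $ j \<in> GFq q 3) \<and> det M \<noteq> 0 \<and>
      {P \<in> N. \<not> P \<subseteq> hyperplane h} = {P \<in> affine_points q h. c ` P \<in> param_conic q M})"
proof -
  define pts where "pts = (pg_points q 3 UNIV :: ('a ^ 3) set set)"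
  define \<phi>' where "\<phi>' = inv_into (bb_points q h g) \<phi>"
  define \<kappa> where "\<kappa> = (\<lambda>S. c ` S) \<circ> \<phi>'"
  have iso: "incidence_iso \<phi> (bb_points q h g) (bb_lines q h g) pts (pg_lines q 3)"
    and iso0: "incidence_iso (\<lambda>S. c ` S) (bb_points q h g) (bb_lines q h g) pts (pg_lines q 3)"
    using assms bb_iso_c_image by (auto simp: bb_iso_def pts_def)
  have iso': "incidence_iso \<phi>' pts (pg_lines q 3) (bb_points q h g) (bb_lines q h g)"
    unfolding \<phi>'_def by (rule incidence_iso_inv[OF iso bb_line_subset])
  have \<kappa>: "incidence_iso \<kappa> pts (pg_lines q 3) pts (pg_lines q 3)"
    unfolding \<kappa>_def by (rule incidence_iso_trans[OF iso' iso0])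
  have lsub: "\<And>l. l \<in> pg_lines q 3 \<Longrightarrow> l \<subseteq> pts"
    unfolding pts_def by (rule pg_lines_subset)
  define \<kappa>' where "\<kappa>' = inv_into pts \<kappa>"
  have \<kappa>': "incidence_iso \<kappa>' pts (pg_lines q 3) pts (pg_lines q 3)"
    unfolding \<kappa>'_def by (rule incidence_iso_inv[OF \<kappa> lsub])
  have bij: "bij_betw \<kappa> pts pts" "bij_betw \<phi> (bb_points q h g) pts"
    using \<kappa> iso by (auto simp: incidence_iso_def)
  have \<kappa>\<phi>: "\<kappa> (\<phi> P) = c ` P" if "P \<in> bb_points q h g" for P
    using that bij(2) by (simp add: \<kappa>_def \<phi>'_def bij_betw_def)
  have aff: "P \<in> bb_points q h g" if "P \<in> affine_points q h" for P
    using that by (simp add: bb_points_def)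
  have not_inf: "\<phi> P \<notin> \<phi> ` regular_spread q g" if P: "P \<in> affine_points q h" for P
  proof
    assume "\<phi> P \<in> \<phi> ` regular_spread q g"
    then obtain \<pi> where \<pi>: "\<pi> \<in> regular_spread q g" "\<phi> P = \<phi> \<pi>"
      by blast
    then have "P = \<pi>"
      using bij(2) aff[OF P] by (auto simp: bij_betw_def inj_on_def bb_points_def)
    then have "P \<subseteq> hyperplane h"
      using \<pi>(1) plane_subset_hyperplane by (auto simp: regular_spread_eq)
    then show False
      using P by (simp add: affine_points_def)
  qed
  have mem: "\<phi> P \<in> C - \<phi> ` regular_spread q g \<longleftrightarrow> c ` P \<in> \<kappa> ` C" if P: "P \<in> affine_points q h" and C: "C \<subseteq> pts" for P C
  proof -
    have "\<phi> P \<in> pts"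
      using bij(2) aff[OF P] by (auto simp: bij_betw_def)
    then have "\<kappa> (\<phi> P) \<in> \<kappa> ` C \<longleftrightarrow> \<phi> P \<in> C"
      using bij(1) C by (intro inj_on_image_mem_iff[of \<kappa> pts]) (auto simp: bij_betw_def)
    then show ?thesis
      using not_inf[OF P] \<kappa>\<phi>[OF aff[OF P]] by simp
  qed
  have conic_sub: "C \<subseteq> pts" if "Fq_conic q C" for C
    using that Fq_conic_iff[of C] param_conic_subset unfolding pts_def by blast
  show ?thesis
  proof
    assume "corresponds_to_Fq_conic q h g \<phi> N"
    then obtain C where C: "Fq_conic q C"
      "{P \<in> N. \<not> P \<subseteq> hyperplane h} = {P \<in> affine_points q h. \<phi> P \<in> C - \<phi> ` regular_spread q g}"
      unfolding corresponds_to_Fq_conic_def by blast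
    have "Fq_conic q (\<kappa> ` C)"
      using C(1) \<kappa> unfolding pts_def by (rule Fq_conic_image)
    then obtain M where M: "\<forall>i j. M $ i $ j \<in> GFq q 3" "det M \<noteq> 0" "\<kappa> ` C = param_conic q M"
      using Fq_conic_iff[of "\<kappa> ` C"] by blast
    have "{P \<in> N. \<not> P \<subseteq> hyperplane h} = {P \<in> affine_points q h. c ` P \<in> param_conic q M}"
    proof -
      have "c ` P \<in> param_conic q M \<longleftrightarrow> \<phi> P \<in> C - \<phi> ` regular_spread q g" if "P \<in> affine_points q h" for P
        using mem[OF that conic_sub[OF C(1)]] M(3) by (simp only:)
      then show ?thesis
        unfolding C(2) by (intro Collect_cong conj_cong refl) simp
    qed
    then show "\<exists>M. (\<forall>i j. M $ i $ j \<in> GFq q 3) \<and> det M \<noteq> 0 \<and>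
      {P \<in> N. \<not> P \<subseteq> hyperplane h} = {P \<in> affine_points q h. c ` P \<in> param_conic q M}"
      using M by blast
  next
    assume "\<exists>M. (\<forall>i j. M $ i $ j \<in> GFq q 3) \<and> det M \<noteq> 0 \<and>
      {P \<in> N. \<not> P \<subseteq> hyperplane h} = {P \<in> affine_points q h. c ` P \<in> param_conic q M}"
    then obtain M where M: "\<forall>i j. M $ i $ j \<in> GFq q 3" "det M \<noteq> 0"
      "{P \<in> N. \<not> P \<subseteq> hyperplane h} = {P \<in> affine_points q h. c ` P \<in> param_conic q M}"
      by blast
    have D: "Fq_conic q (param_conic q M)"
      using M(1,2) Fq_conic_iff[of "param_conic q M"] by blast
    define C where "C = \<kappa>' ` param_conic q M"
    have C: "Fq_conic q C"
      unfolding C_def using D \<kappa>' unfolding pts_def by (rule Fq_conic_image)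
    have "\<kappa> ` C = param_conic q M" (is ?eq)
      unfolding C_def \<kappa>'_def using bij(1) conic_sub[OF D] by (simp add: bij_betw_def image_inv_into_cancel)
    then have "{P \<in> N. \<not> P \<subseteq> hyperplane h} = {P \<in> affine_points q h. \<phi> P \<in> C - \<phi> ` regular_spread q g}"
    proof -
      have "c ` P \<in> param_conic q M \<longleftrightarrow> \<phi> P \<in> C - \<phi> ` regular_spread q g" if "P \<in> affine_points q h" for P
        using mem[OF that conic_sub[OF C]] \<open>?eq\<close> by (simp only:)
      then show ?thesis
        unfolding M(3) by (intro Collect_cong conj_cong refl)
    qed
    then show "corresponds_to_Fq_conic q h g \<phi> N"
      unfolding corresponds_to_Fq_conic_def using C by blast
  qed
qed

end

section \<open>Polynomials and the Frobenius map\<close>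

lemma proots_linear_prod:
  fixes A :: "'a::field multiset"
  assumes "l \<noteq> 0"
  shows "proots (smult l (\<Prod>x\<in>#A. [:- x, 1:])) = A"
proof -
  have "proots (\<Prod>x\<in>#A. [:- x, 1:]) = A"
  proof (induction A)
    case (add x A)
    have "(\<Prod>x\<in>#A. [:- x, 1 :: 'a:]) \<noteq> 0"
      by auto
    then have "proots ([:- x, 1:] * (\<Prod>x\<in>#A. [:- x, 1:])) = proots [:- x, 1:] + proots (\<Prod>x\<in>#A. [:- x, 1:])"
      by (intro proots_mult) auto
    then show ?case
      using add by (simp del: mult_pCons_left)
  qed simp
  then show ?thesis
    using assms by simp
qed

lemma degree_linear_prod: "degree (\<Prod>x\<in>#A. [:- x, 1 :: 'a::field:]) = size A"
  and lead_coeff_linear_prod: "lead_coeff (\<Prod>x\<in>#A. [:- x, 1 :: 'a::field:]) = 1"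
proof (induction A)
  case (add x A)
  have nz: "(\<Prod>x\<in>#A. [:- x, 1 :: 'a:]) \<noteq> 0"
    using add(2) by auto
  {
    case 1
    show ?case
      using nz add by (simp add: degree_mult_eq del: mult_pCons_left)
  next
    case 2
    show ?case
      using add by (simp add: lead_coeff_mult del: mult_pCons_left)
  }
qed auto

lemma factorization_proots:
  fixes p :: "'a::alg_closed_field poly"
  assumes "p \<noteq> 0"
  shows "p = smult (lead_coeff p) (\<Prod>x\<in>#proots p. [:- x, 1:])" "size (proots p) = degree p"
proof -
  obtain A where A: "size A = degree p" "p = smult (lead_coeff p) (\<Prod>x\<in>#A. [:- x, 1:])"
    using alg_closed_imp_factorization[OF assms] by blast
  have "proots p = A"
    using proots_linear_prod[of "lead_coeff p" A] assms A(2) by simp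
  then show "p = smult (lead_coeff p) (\<Prod>x\<in>#proots p. [:- x, 1:])" "size (proots p) = degree p"
    using A by simp_all
qed

lemma linear_prod_dvd:
  fixes p :: "'a::alg_closed_field poly"
  assumes "\<And>x. p \<noteq> 0 \<Longrightarrow> x \<in># Z \<Longrightarrow> count Z x \<le> order x p"
  shows "(\<Prod>x\<in>#Z. [:- x, 1:]) dvd p"
proof (cases "p = 0")
  case False
  then have "Z \<subseteq># proots p"
    using assms by (intro mset_subset_eqI) (metis count_proots not_in_iff zero_le)
  then obtain B where "proots p = Z + B"
    using mset_subset_eq_exists_conv by blast
  then have "p = (\<Prod>x\<in>#Z. [:- x, 1:]) * smult (lead_coeff p) (\<Prod>x\<in>#B. [:- x, 1:])"
    using factorization_proots(1)[OF False] by simp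
  then show ?thesis
    by (rule dvdI)
qed simp

lemma order_ge_2:
  fixes p :: "'a::field poly"
  assumes "p \<noteq> 0" "poly p x = 0" "poly (pderiv p) x = 0"
  shows "order x p \<ge> 2"
proof -
  obtain s where s: "p = [:- x, 1:] * s"
    using assms(2) poly_eq_0_iff_dvd by (metis dvdE)
  have "pderiv p = [:- x, 1:] * pderiv s + s * pderiv [:- x, 1:]"
    unfolding s by (rule pderiv_mult)
  then have "poly s x = 0"
    using assms(3) by (simp add: pderiv_pCons)
  then obtain t where "s = [:- x, 1:] * t"
    using poly_eq_0_iff_dvd by (metis dvdE)
  then have "p = [:- x, 1:] ^ 2 * t"
    using s by (simp only: power2_eq_square mult.assoc)
  then have "[:- x, 1:] ^ 2 dvd p"
    by (rule dvdI)
  then show ?thesis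
    using assms(1) order_divides[of x 2 p] by simp
qed

context frobenius_field begin

text \<open>The conjugate polynomial: its roots are the q-th powers of those of \<open>p\<close>,
  and \<open>fp p = p\<close> says that the coefficients lie in the small field.\<close>

definition fp :: "'a poly \<Rightarrow> 'a poly" where
  "fp p = map_poly (\<lambda>x. x ^ q) p"

lemma coeff_fp [simp]: "coeff (fp p) i = coeff p i ^ q"
  by (simp add: fp_def coeff_map_poly power_0_left)

lemma fp_mult: "fp (p * r) = fp p * fp r"
  by (rule poly_eqI) (simp add: coeff_mult q_sum power_mult_distrib)

lemma fp_smult: "fp (smult l p) = smult (l ^ q) (fp p)"
  by (rule poly_eqI) (simp add: power_mult_distrib)

lemma fp_1 [simp]: "fp 1 = 1"
  by (simp add: fp_def)

lemma fp_linear: "fp [:- x, 1:] = [:- (x ^ q), 1:]"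
  by (simp add: fp_def map_poly_pCons q_minus power_0_left)

lemma fp_linear_prod: "fp (\<Prod>x\<in>#A. [:- x, 1:]) = (\<Prod>x\<in>#image_mset (\<lambda>x. x ^ q) A. [:- x, 1:])"
  by (induction A) (simp_all add: fp_mult fp_linear del: mult_pCons_left)

lemma proots_fp: "proots (fp p) = image_mset (\<lambda>x. x ^ q) (proots p)"
proof (cases "p = 0")
  case False
  have "proots (fp p) = proots (smult (lead_coeff p ^ q) (\<Prod>x\<in>#image_mset (\<lambda>x. x ^ q) (proots p). [:- x, 1:]))"
    by (subst factorization_proots(1)[OF False]) (simp only: fp_smult fp_linear_prod)
  also have "\<dots> = image_mset (\<lambda>x. x ^ q) (proots p)"
    using False by (intro proots_linear_prod) simp
  finally show ?thesis .
qed (simp add: fp_def)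

lemma poly_map_pow:
  fixes p :: "'a poly"
  shows "poly (map_poly (\<lambda>x. x ^ (q ^ m)) p) (x ^ (q ^ m)) = poly p x ^ (q ^ m)"
proof -
  have "degree (map_poly (\<lambda>x. x ^ (q ^ m)) p) = degree p"
    by (intro degree_map_poly) auto
  then show ?thesis
    by (simp add: poly_altdef pow_sum coeff_map_poly power_0_left power_mult_distrib flip: power_mult)
      (simp add: mult.commute)
qed

text \<open>The polynomial and its m-fold conjugate agree at the q elements of the small field, more
  than their degree.\<close>

lemma interpolate_GFq:
  fixes p :: "'a poly"
  assumes "degree p < q" "\<And>x. x \<in> GFq q 1 \<Longrightarrow> poly p x \<in> GFq q m"
  shows "coeff p i \<in> GFq q m"
proof -
  define p' where "p' = map_poly (\<lambda>x. x ^ (q ^ m)) p"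
  have "p' = p"
  proof (rule poly_eqI_degree[of "GFq q 1"])
    fix x :: 'a assume x: "x \<in> GFq q 1"
    then have "x ^ (q ^ m) = x"
      using GFq_1_subset[OF x, of m] by (simp add: GFq_iff)
    then show "poly p' x = poly p x"
      using poly_map_pow[of m p x] assms(2)[OF x] by (simp add: p'_def GFq_iff)
  next
    have "degree p' = degree p"
      unfolding p'_def by (intro degree_map_poly) auto
    then show "degree p' < card (GFq q 1 :: 'a set)"
      using assms(1) card_GFq(1)[of 1] by simp
  qed (use assms(1) card_GFq(1)[of 1] in simp)
  then have "coeff p' i = coeff p i"
    by simp
  then show ?thesis
    by (simp add: p'_def coeff_map_poly power_0_left GFq_iff)
qed

section \<open>Rational curves\<close>

definition curve :: "nat \<Rightarrow> (nat \<Rightarrow> 'a ^ 'n) \<Rightarrow> 'a \<Rightarrow> 'a ^ 'n" where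
  "curve r b x = (\<Sum>i\<le>r. x ^ i *s b i)"

lemma nrc_point_curve: "nrc_point r b x = vec.span {curve r b x}"
  by (simp add: nrc_point_def curve_def)

lemma frame_rat: "nrc_frame q r b \<Longrightarrow> i \<le> r \<Longrightarrow> b i \<in> rat_vecs q 1"
  by (simp add: nrc_frame_def)

lemma frame_independent:
  fixes b :: "nat \<Rightarrow> 'a ^ 'n"
  assumes "nrc_frame q r b" "(\<Sum>i\<le>r. k i *s b i) = 0" "i \<le> r"
  shows "k i = 0"
proof -
  have inj: "inj_on b {..r}" and ind: "vec.independent (b ` {..r})"
    using assms(1) by (auto simp: nrc_frame_def)
  define u where "u v = k (the_inv_into {..r} b v)" for v
  have "(\<Sum>v\<in>b ` {..r}. u v *s v) = (\<Sum>i\<le>r. k i *s b i)"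
    using inj by (subst sum.reindex) (auto simp: u_def the_inv_into_f_f intro!: sum.cong)
  then have "(\<Sum>v\<in>b ` {..r}. u v *s v) = 0"
    using assms(2) by simp
  then have "u (b i) = 0"
    using vec.independentD[OF ind, of "b ` {..r}" u "b i"] assms(3) by auto
  then show ?thesis
    using inj assms(3) by (simp add: u_def the_inv_into_f_f)
qed

lemma frameI:
  fixes b :: "nat \<Rightarrow> 'a ^ 'n"
  assumes "\<And>i. i \<le> r \<Longrightarrow> b i \<in> rat_vecs q 1"
    and ind: "\<And>k i. (\<Sum>i\<le>r. k i *s b i) = 0 \<Longrightarrow> i \<le> r \<Longrightarrow> k i = 0"
  shows "nrc_frame q r b"
proof -
  have inj: "inj_on b {..r}"
  proof (rule inj_onI, rule ccontr)
    fix i j assume ij: "i \<in> {..r}" "j \<in> {..r}" "b i = b j" "i \<noteq> j"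
    define k where "k l = (if l = i then 1 else if l = j then - 1 else (0 :: 'a))" for l
    have "(\<Sum>l\<le>r. k l *s b l) = (\<Sum>l\<in>{i, j}. k l *s b l)"
      using ij by (intro sum.mono_neutral_right) (auto simp: k_def)
    also have "\<dots> = 0"
      using ij by (simp add: k_def)
    finally have "k i = 0"
      using ind ij by blast
    then show False
      by (simp add: k_def)
  qed
  moreover have "vec.independent (b ` {..r})"
  proof (rule vec.independent_if_scalars_zero)
    fix u v assume u: "(\<Sum>v\<in>b ` {..r}. u v *s v) = 0" and v: "v \<in> b ` {..r}"
    have "(\<Sum>i\<le>r. u (b i) *s b i) = 0"
      using u inj by (simp add: sum.reindex)
    then show "u v = 0"
      using ind[of "\<lambda>i. u (b i)"] v by auto
  qed simp
  ultimately show ?thesis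
    using assms(1) by (simp add: nrc_frame_def)
qed

lemma curve_nonzero:
  fixes b :: "nat \<Rightarrow> 'a ^ 'n"
  assumes "nrc_frame q r b"
  shows "curve r b x \<noteq> 0"
  using frame_independent[OF assms, of "\<lambda>i. x ^ i" 0] by (auto simp: curve_def)

lemma frame_nonzero:
  fixes b :: "nat \<Rightarrow> 'a ^ 'n"
  shows "nrc_frame q r b \<Longrightarrow> i \<le> r \<Longrightarrow> b i \<noteq> 0"
proof
  assume *: "nrc_frame q r b" "i \<le> r" "b i = 0"
  then have "(\<Sum>l\<le>r. (if l = i then 1 else 0) *s b l) = 0"
    by (intro sum.neutral) auto
  then have "(if i = i then 1 else 0) = (0 :: 'a)"
    using frame_independent[OF *(1), of "\<lambda>l. if l = i then 1 else 0"] *(2) by blast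
  then show False
    by simp
qed

lemma frob_curve:
  fixes b :: "nat \<Rightarrow> 'a ^ 'n"
  shows "(\<And>i. i \<le> r \<Longrightarrow> b i \<in> rat_vecs q 1) \<Longrightarrow> frob q (curve r b x) = curve r b (x ^ q)"
  unfolding curve_def frob_sum frob_scale
  by (intro sum.cong refl) (simp add: rat_vecs_1 mult.commute flip: power_mult)

lemma curve_rat:
  fixes b :: "nat \<Rightarrow> 'a ^ 'n"
  shows "(\<And>i. i \<le> r \<Longrightarrow> b i \<in> rat_vecs q 1) \<Longrightarrow> x \<in> GFq q m \<Longrightarrow> curve r b x \<in> rat_vecs q m"
  unfolding curve_def using rat_vecs_mono[of 1 m] by (intro rat_vecs_sum rat_vecs_scale GFq_closed) auto

end

section \<open>Weights\<close>

context spread_coordinates begin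

definition nzc :: "'a ^ 7 \<Rightarrow> nat" where
  "nzc v = (if c v \<noteq> 0 then 1 else 0) + (if c1 v \<noteq> 0 then 1 else 0) + (if c2 v \<noteq> 0 then 1 else 0)"

lemma nzc_scale: "k \<noteq> 0 \<Longrightarrow> nzc (k *s v) = nzc v"
  by (simp add: nzc_def c_scale)

lemma nzc_pos: "v \<noteq> 0 \<Longrightarrow> nzc v > 0"
  using c_ker[of v] by (auto simp: nzc_def)

lemma nzc_frob: "nzc (frob q v) = nzc v"
  by (simp add: nzc_def c_frob)

lemma rat_vecs_6: "v \<in> rat_vecs q 6 \<longleftrightarrow> frob q (frob q (frob q (frob q (frob q (frob q v))))) = (v :: 'a ^ 'n)"
proof -
  have "6 = Suc (Suc (Suc (Suc (Suc (Suc 0)))))"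
    by simp
  then have "(frob q ^^ 6) v = frob q (frob q (frob q (frob q (frob q (frob q v)))))"
    by (simp only: funpow.simps o_apply id_apply)
  then show ?thesis
    by (simp only: rat_vecs_iff)
qed

text \<open>Six is a multiple of three, so six Frobenius steps bring every component back to its own
  map; the components are as rational as the vector.\<close>

lemma component_rat:
  assumes v: "v \<in> rat_vecs q 6" "c v $ 1 = 0"
  obtains u0 u1 u2 where "u0 \<in> rat_vecs q 6" "u1 \<in> rat_vecs q 6" "u2 \<in> rat_vecs q 6"
    "c u0 = c v" "c1 u0 = 0" "c2 u0 = 0" "c u1 = 0" "c1 u1 = c1 v" "c2 u1 = 0"
    "c u2 = 0" "c1 u2 = 0" "c2 u2 = c2 v" "v = u0 + u1 + u2"
proof -
  have first: "c1 v $ 1 = 0" "c2 v $ 1 = 0"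
    using c_first v by simp_all
  obtain u0 where u0: "c u0 = c v" "c1 u0 = 0" "c2 u0 = 0"
    using c_surj[of 0 "c v" 0] v by auto
  obtain u1 where u1: "c u1 = 0" "c1 u1 = c1 v" "c2 u1 = 0"
    using c_surj[of "c1 v" 0 0] first by auto
  obtain u2 where u2: "c u2 = 0" "c1 u2 = 0" "c2 u2 = c2 v"
    using c_surj[of 0 0 "c2 v"] first by auto
  have f6: "frob q (frob q (frob q (frob q (frob q (frob q v))))) = v"
    using v(1) by (simp only: rat_vecs_6)
  have "c (frob q (frob q (frob q (frob q (frob q (frob q v)))))) = c v"
    "c1 (frob q (frob q (frob q (frob q (frob q (frob q v)))))) = c1 v"
    "c2 (frob q (frob q (frob q (frob q (frob q (frob q v)))))) = c2 v"
    by (simp_all only: f6)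
  then have ff: "frob q (frob q (frob q (frob q (frob q (frob q (c v)))))) = c v"
    "frob q (frob q (frob q (frob q (frob q (frob q (c1 v)))))) = c1 v"
    "frob q (frob q (frob q (frob q (frob q (frob q (c2 v)))))) = c2 v"
    by (simp_all only: c_frob)
  have "u0 \<in> rat_vecs q 6" "u1 \<in> rat_vecs q 6" "u2 \<in> rat_vecs q 6"
    unfolding rat_vecs_6 using ff by (auto intro!: c_eqI simp: c_frob u0 u1 u2)
  moreover have "v = u0 + u1 + u2"
    by (rule c_eqI) (simp_all add: c_add u0 u1 u2)
  ultimately show ?thesis
    using that u0 u1 u2 by blast
qed

lemma transversals_eq:
  "transversals q g = {{v. c1 v = 0 \<and> c2 v = 0}, {v. c v = 0 \<and> c2 v = 0}, {v. c v = 0 \<and> c1 v = 0}}"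
  unfolding transversals_def by (subst conj_conj_g, subst conj_g, subst g_eq) simp

lemma on_transversal_iff: "(\<exists>t\<in>transversals q g. vec.span {v} \<subseteq> t) \<longleftrightarrow> nzc v \<le> 1"
proof -
  have *: "vec.span {v} \<subseteq> {v. c1 v = 0 \<and> c2 v = 0} \<longleftrightarrow> c1 v = 0 \<and> c2 v = 0"
    "vec.span {v} \<subseteq> {v. c v = 0 \<and> c2 v = 0} \<longleftrightarrow> c v = 0 \<and> c2 v = 0"
    "vec.span {v} \<subseteq> {v. c v = 0 \<and> c1 v = 0} \<longleftrightarrow> c v = 0 \<and> c1 v = 0"
    by - (rule span_subset_iff[THEN trans], simp add: vec.subspace_def c_add c_scale, simp)+
  show ?thesis
    unfolding transversals_eq by (auto simp: * nzc_def)
qed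

text \<open>A vector on a line meeting two transversals is a sum of vectors on them, so the map
  belonging to the third transversal kills it. Conversely, its two nonzero components span such a
  line.\<close>

lemma weight_two_iff:
  assumes v: "v \<in> rat_vecs q 6" "c v $ 1 = 0" "nzc v > 1"
  shows "(\<exists>l. rat_subspace q 6 l \<and> vec.dim l = 2 \<and> vec.span {v} \<subseteq> l \<and>
            (\<exists>t\<in>transversals q g. \<exists>t'\<in>transversals q g. t \<noteq> t' \<and>
               pg_points q 6 (l \<inter> t) \<noteq> {} \<and> pg_points q 6 (l \<inter> t') \<noteq> {})) \<longleftrightarrow> nzc v = 2"
    (is "?L \<longleftrightarrow> _")
proof
  assume ?L
  then obtain l t t' where l: "rat_subspace q 6 l" "vec.dim l = 2" "vec.span {v} \<subseteq> l"
    and t: "t \<in> transversals q g" "t' \<in> transversals q g" "t \<noteq> t'"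
    and p: "pg_points q 6 (l \<inter> t) \<noteq> {}" "pg_points q 6 (l \<inter> t') \<noteq> {}"
    by blast
  obtain w where w: "w \<in> l" "w \<in> t" "w \<noteq> 0"
    using p(1) by (auto elim!: pg_pointsE)
  obtain w' where w': "w' \<in> l" "w' \<in> t'" "w' \<noteq> 0"
    using p(2) by (auto elim!: pg_pointsE)
  have "w' \<notin> vec.span {w}"
  proof
    assume "w' \<in> vec.span {w}"
    then obtain k where k: "w' = k *s w"
      using in_span1_iff by blast
    \<comment> \<open>Distinct transversal lines meet only in 0.\<close>
    have "c w' = 0 \<and> c1 w' = 0 \<and> c2 w' = 0"
      using t w(2) w'(2) unfolding transversals_eq k by (auto simp: c_scale)
    then show False
      using c_ker w'(3) by blast
  qed
  then have "l = vec.span {w, w'}"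
    using l w w' by (intro line_eq_span2) (auto intro: subspace_rat)
  moreover have "v \<in> l"
    using l(3) vec.span_base[of v "{v}"] by blast
  ultimately obtain a b where ab: "v = a *s w + b *s w'"
    using span2_iff by blast
  have "c v = 0 \<or> c1 v = 0 \<or> c2 v = 0"
    using t w(2) w'(2) unfolding transversals_eq ab by (auto simp: c_scale c_add)
  then show "nzc v = 2"
    using v(3) by (auto simp: nzc_def split: if_splits)
next
  assume two: "nzc v = 2"
  obtain u0 u1 u2 where u: "u0 \<in> rat_vecs q 6" "u1 \<in> rat_vecs q 6" "u2 \<in> rat_vecs q 6"
    "c u0 = c v" "c1 u0 = 0" "c2 u0 = 0" "c u1 = 0" "c1 u1 = c1 v" "c2 u1 = 0"
    "c u2 = 0" "c1 u2 = 0" "c2 u2 = c2 v" "v = u0 + u1 + u2"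
    using component_rat[OF v(1,2)] by blast
  have main: ?L if w: "w \<in> rat_vecs q 6" "w' \<in> rat_vecs q 6" "w \<in> t" "w' \<in> t'" "t \<in> transversals q g"
    "t' \<in> transversals q g" "t \<noteq> t'" "w \<noteq> 0" "w' \<notin> vec.span {w}" "v = w + w'" for w w' t t'
  proof -
    define l where "l = vec.span {w, w'}"
    have in_l: "w \<in> l" "w' \<in> l"
      by (auto simp: l_def intro: vec.span_base)
    have "w' \<noteq> 0"
      using w(9) by (auto intro: vec.span_zero)
    then have "vec.span {w} \<in> pg_points q 6 (l \<inter> t)" "vec.span {w'} \<in> pg_points q 6 (l \<inter> t')"
      using w in_l by (auto intro!: pg_pointsI)
    moreover have "vec.span {v} \<subseteq> l"
      using in_l w(10) unfolding l_def by (intro vec.span_minimal) (auto intro: vec.span_add)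
    moreover have "rat_subspace q 6 l" "vec.dim l = 2"
      unfolding l_def using rat_lineI[OF w(1,2)] dim_span2[of w w'] w by auto
    ultimately show ?L
      using w(5-7) by blast
  qed
  have out: "w' \<notin> vec.span {w}" if "f w = 0" "f w' \<noteq> 0" "f = c \<or> f = c1 \<or> f = c2" for w w' f
    using that by (auto simp: in_span1_iff c_scale)
  define t0 t1 t2 where t: "t0 = {v. c1 v = 0 \<and> c2 v = 0}" "t1 = {v. c v = 0 \<and> c2 v = 0}" "t2 = {v. c v = 0 \<and> c1 v = 0}"
  have tt: "t0 \<in> transversals q g" "t1 \<in> transversals q g" "t2 \<in> transversals q g"
    by (simp_all add: transversals_eq t)
  have ut: "u0 \<in> t0" "u1 \<in> t1" "u2 \<in> t2"
    by (simp_all add: t u)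
  consider "c v = 0" "c1 v \<noteq> 0" "c2 v \<noteq> 0" | "c v \<noteq> 0" "c1 v = 0" "c2 v \<noteq> 0" | "c v \<noteq> 0" "c1 v \<noteq> 0" "c2 v = 0"
    using two by (auto simp: nzc_def split: if_splits)
  then show ?L
  proof cases
    case 1
    have "u0 = 0"
      using u 1 by (intro c_ker) simp_all
    moreover have "u1 \<notin> t2"
      using u 1 by (simp add: t)
    then have "t1 \<noteq> t2"
      using ut by blast
    moreover have "u1 \<noteq> 0"
      using u(8) 1(2) by force
    moreover have "u2 \<notin> vec.span {u1}"
      using out[of c2 u1 u2] u(9,12) 1(3) by simp
    ultimately show ?thesis
      using main[OF u(2,3) ut(2,3) tt(2,3)] u(13) by simp
  next
    case 2
    have "u1 = 0"
      using u 2 by (intro c_ker) simp_all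
    moreover have "u0 \<notin> t2"
      using u 2 by (simp add: t)
    then have "t0 \<noteq> t2"
      using ut by blast
    moreover have "u0 \<noteq> 0"
      using u(4) 2(1) by force
    moreover have "u2 \<notin> vec.span {u0}"
      using out[of c2 u0 u2] u(6,12) 2(3) by simp
    ultimately show ?thesis
      using main[OF u(1,3) ut(1,3) tt(1,3)] u(13) by simp
  next
    case 3
    have "u2 = 0"
      using u 3 by (intro c_ker) simp_all
    moreover have "u0 \<notin> t1"
      using u 3 by (simp add: t)
    then have "t0 \<noteq> t1"
      using ut by blast
    moreover have "u0 \<noteq> 0"
      using u(4) 3(1) by force
    moreover have "u1 \<notin> vec.span {u0}"
      using out[of c1 u0 u1] u(5,8) 3(2) by simp
    ultimately show ?thesis
      using main[OF u(1,2) ut(1,2) tt(1,2)] u(13) by simp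
  qed
qed

lemma weight_eq:
  assumes v: "v \<in> rat_vecs q 6" "c v $ 1 = 0" "v \<noteq> 0"
  shows "weight q g (vec.span {v}) = nzc v"
proof (cases "nzc v \<le> 1")
  case True
  then show ?thesis
    using on_transversal_iff[of v] nzc_pos[OF v(3)] by (simp add: weight_def)
next
  case False
  then have gt: "nzc v > 1"
    by simp
  have "nzc v \<le> 3"
    by (simp add: nzc_def)
  then show ?thesis
    unfolding weight_def weight_two_iff[OF v(1,2) gt] using on_transversal_iff[of v] False by auto
qed

lemma weight_infinite_point:
  assumes "vec.span {v} \<in> pg_points q 6 (hyperplane h)"
  shows "weight q g (vec.span {v}) = nzc v"
proof -
  obtain w where w: "vec.span {v} = vec.span {w}" "w \<in> hyperplane h" "w \<in> rat_vecs q 6" "w \<noteq> 0"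
    using assms by (elim pg_pointsE)
  obtain k where "k \<noteq> 0" "w = k *s v"
    using span1_eq_iff[OF w(4), of v] w(1) by metis
  then show ?thesis
    using weight_eq[OF w(3)] w nzc_scale[of k v] by (simp add: hyperplane_iff)
qed

lemma poly_nrc_poly: "poly (nrc_poly r b h) x = c (curve r b x) $ 1"
  by (simp add: nrc_poly_def poly_sum poly_monom curve_def c_sum c_scale c_first mult.commute)

lemma coeff_nrc_poly: "coeff (nrc_poly r b h) k = (if k \<le> r then c (b k) $ 1 else 0)"
  by (simp add: nrc_poly_def coeff_sum c_first)

lemma degree_nrc_poly: "degree (nrc_poly r b h) \<le> r"
  by (rule degree_le) (simp add: coeff_nrc_poly)

lemma fp_nrc_poly:
  assumes "\<And>i. i \<le> r \<Longrightarrow> b i \<in> rat_vecs q 1"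
  shows "fp (nrc_poly r b h) = nrc_poly r b h"
  using rat_c_first[OF assms] by (intro poly_eqI) (auto simp: coeff_nrc_poly GFq_iff)

lemma proots_nrc_poly_q:
  assumes "\<And>i. i \<le> r \<Longrightarrow> b i \<in> rat_vecs q 1"
  shows "image_mset (\<lambda>x. x ^ q) (proots (nrc_poly r b h)) = proots (nrc_poly r b h)"
  by (rule trans[OF proots_fp[symmetric]]) (simp only: fp_nrc_poly[OF assms])

lemma rat_nzc: "v \<in> rat_vecs q 1 \<Longrightarrow> v \<noteq> 0 \<Longrightarrow> nzc v = 3"
  using c_ker[of v] by (auto simp: nzc_def rat_c)

text \<open>With a rational frame, conjugating a point of the curve raises its parameter to the
  power q. Hence \<open>c1\<close> and \<open>c2\<close> at a parameter are conjugates of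
  \<open>c\<close> at earlier parameters of its Frobenius orbit.\<close>

lemma c12_curve:
  assumes "\<And>i. i \<le> r \<Longrightarrow> b i \<in> rat_vecs q 1"
  shows "c1 (curve r b (x ^ q)) = frob q (c (curve r b x))" "c2 (curve r b (x ^ q)) = frob q (c1 (curve r b x))"
    "c (curve r b (x ^ q)) = frob q (c2 (curve r b x))"
  using frob_curve[OF assms, where x = x] c_frob[of "curve r b x"] by simp_all

lemma filter_shift:
  assumes "image_mset s A = A" "\<And>x. P (s x) \<longleftrightarrow> Q x"
  shows "size (filter_mset P A) = size (filter_mset Q A)"
proof -
  have "filter_mset P A = filter_mset P (image_mset s A)"
    by (simp only: assms(1))
  also have "\<dots> = image_mset s (filter_mset Q A)"
    using assms(2) by (simp add: filter_mset_image_mset)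
  finally show ?thesis
    by simp
qed

text \<open>The multiset of roots is invariant under x -> x^q, and this substitution carries
  \<open>c\<close> to \<open>c1\<close> and \<open>c1\<close> to \<open>c2\<close>.\<close>

lemma component_counts:
  fixes r b
  defines "A \<equiv> proots (nrc_poly r b h)"
  assumes b: "\<And>i. i \<le> r \<Longrightarrow> b i \<in> rat_vecs q 1"
  shows "size {#x \<in># A. c1 (curve r b x) \<noteq> 0#} = size {#x \<in># A. c (curve r b x) \<noteq> 0#}"
    "size {#x \<in># A. c2 (curve r b x) \<noteq> 0#} = size {#x \<in># A. c (curve r b x) \<noteq> 0#}"
proof -
  have A: "image_mset (\<lambda>x. x ^ q) A = A"
    unfolding A_def by (rule proots_nrc_poly_q[OF b])
  show 1: "size {#x \<in># A. c1 (curve r b x) \<noteq> 0#} = size {#x \<in># A. c (curve r b x) \<noteq> 0#}"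
    by (rule filter_shift[OF A]) (simp add: c12_curve[OF b])
  have "size {#x \<in># A. c2 (curve r b x) \<noteq> 0#} = size {#x \<in># A. c1 (curve r b x) \<noteq> 0#}"
    by (rule filter_shift[OF A]) (simp add: c12_curve[OF b])
  then show "size {#x \<in># A. c2 (curve r b x) \<noteq> 0#} = size {#x \<in># A. c (curve r b x) \<noteq> 0#}"
    using 1 by simp
qed

lemma sum_nzc:
  fixes f :: "'a \<Rightarrow> 'a ^ 7"
  shows
  "(\<Sum>x\<in>#A. nzc (f x)) = size {#x \<in># A. c (f x) \<noteq> 0#} + size {#x \<in># A. c1 (f x) \<noteq> 0#} + size {#x \<in># A. c2 (f x) \<noteq> 0#}"
  by (induction A) (auto simp: nzc_def)

text \<open>The weight counts the maps that do not vanish, and the three maps contribute equally.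
  The parameter infinity belongs to a rational point, at which none of them vanishes.\<close>

lemma weight_sum:
  assumes b: "nrc_frame q r b" and a: "nrc_poly r b h \<noteq> 0"
    and P: "\<And>P. P \<in># nrc_at_infinity r b h \<Longrightarrow> P \<in> pg_points q 6 (hyperplane h)"
  shows "(\<Sum>P\<in>#nrc_at_infinity r b h. weight q g P) =
    3 * (size {#x \<in># proots (nrc_poly r b h). c (curve r b x) \<noteq> 0#} + (r - degree (nrc_poly r b h)))"
proof -
  define A where "A = proots (nrc_poly r b h)"
  define n where "n = r - degree (nrc_poly r b h)"
  have br: "\<And>i. i \<le> r \<Longrightarrow> b i \<in> rat_vecs q 1"
    using frame_rat[OF b] .
  have inf: "nrc_at_infinity r b h = image_mset (nrc_point r b) A + replicate_mset n (vec.span {b r})"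
    by (simp add: nrc_at_infinity_def A_def n_def)
  have "weight q g (nrc_point r b x) = nzc (curve r b x)" if "x \<in># A" for x
    using P[of "nrc_point r b x"] that weight_infinite_point[of "curve r b x"] by (simp add: inf nrc_point_curve)
  then have "(\<Sum>P\<in>#image_mset (nrc_point r b) A. weight q g P) = (\<Sum>x\<in>#A. nzc (curve r b x))"
    by (simp add: image_mset.compositionality comp_def cong: image_mset_cong)
  also have "\<dots> = 3 * size {#x \<in># A. c (curve r b x) \<noteq> 0#}"
    unfolding sum_nzc A_def using component_counts[OF br] by simp
  finally have 1: "(\<Sum>P\<in>#image_mset (nrc_point r b) A. weight q g P) = 3 * size {#x \<in># A. c (curve r b x) \<noteq> 0#}" .
  have 2: "(\<Sum>P\<in>#replicate_mset n (vec.span {b r}). weight q g P) = 3 * n"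
  proof (cases "n = 0")
    case False
    then have "vec.span {b r} \<in> pg_points q 6 (hyperplane h)"
      using P by (simp add: inf)
    then have "weight q g (vec.span {b r}) = 3"
      using weight_infinite_point rat_nzc[OF br frame_nonzero[OF b]] by simp
    then show ?thesis
      by (simp add: sum_mset_replicate_mset)
  qed simp
  show ?thesis
    unfolding inf using 1 2 by (simp add: A_def n_def)
qed

end

section \<open>From 3-special curves to conics\<close>

lemma pderiv_sum_poly: "pderiv (\<Sum>i\<in>A. f i) = (\<Sum>i\<in>A. pderiv (f i))"
  by (induction A rule: infinite_finite_induct) (auto simp: pderiv_add)

lemma count_image_mset_injective: "inj f \<Longrightarrow> count (image_mset f M) (f x) = count M x"
  by (induction M) (auto simp: inj_eq)

context spread_coordinates begin

definition coord_poly :: "nat \<Rightarrow> (nat \<Rightarrow> 'a ^ 7) \<Rightarrow> 3 \<Rightarrow> 'a poly" where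
  "coord_poly r b j = (\<Sum>i\<le>r. monom (c (b i) $ j) i)"

lemma poly_coord_poly: "poly (coord_poly r b j) x = c (curve r b x) $ j"
  by (simp add: coord_poly_def poly_sum poly_monom curve_def c_sum c_scale mult.commute)

lemma coeff_coord_poly: "coeff (coord_poly r b j) k = (if k \<le> r then c (b k) $ j else 0)"
  by (simp add: coord_poly_def coeff_sum)

lemma degree_coord_poly: "degree (coord_poly r b j) \<le> r"
  by (rule degree_le) (simp add: coeff_coord_poly)

lemma coord_poly_1: "coord_poly r b 1 = nrc_poly r b h"
  by (rule poly_eqI) (simp add: coeff_coord_poly coeff_nrc_poly)

lemma poly_pderiv_coord_poly:
  "poly (pderiv (coord_poly r b j)) x = c (\<Sum>i\<le>r. (of_nat i * x ^ (i - 1)) *s b i) $ j"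
  by (simp add: coord_poly_def pderiv_sum_poly pderiv_monom poly_sum poly_monom c_sum c_scale algebra_simps)

text \<open>Some map is nonzero at \<open>z\<close>; going back along Frobenius at most twice turns
  this map into \<open>c\<close>, while multiplicity and weight stay the same.\<close>

lemma conjugate_root:
  assumes b: "nrc_frame q r b" and z: "z \<in># proots (nrc_poly r b h)"
  obtains y where "y \<in># proots (nrc_poly r b h)" "c (curve r b y) \<noteq> 0"
    "nzc (curve r b y) = nzc (curve r b z)" "count (proots (nrc_poly r b h)) y = count (proots (nrc_poly r b h)) z"
    "z = y \<or> z = y ^ q \<or> z = (y ^ q) ^ q"
proof -
  define A where "A = proots (nrc_poly r b h)"
  have br: "\<And>i. i \<le> r \<Longrightarrow> b i \<in> rat_vecs q 1"
    using frame_rat[OF b] .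
  have inj: "inj (\<lambda>x :: 'a. x ^ q)"
    by (simp add: inj_def q_inj)
  have count: "count A (y ^ q) = count A y" for y
    using count_image_mset_injective[OF inj, of A y] proots_nrc_poly_q[OF br] by (simp add: A_def)
  have nzc: "nzc (curve r b (y ^ q)) = nzc (curve r b y)" for y
    using frob_curve[OF br, where x = y] nzc_frob[of "curve r b y"] by simp
  have mem: "y \<in># A \<longleftrightarrow> y ^ q \<in># A" for y
    using count[of y] by (simp only: flip: count_greater_zero_iff)
  obtain y0 where y0: "y0 ^ q = z"
    using q_surj by blast
  obtain y1 where y1: "y1 ^ q = y0"
    using q_surj by blast
  have "curve r b z \<noteq> 0"
    by (rule curve_nonzero[OF b])
  then consider "c (curve r b z) \<noteq> 0" | "c1 (curve r b z) \<noteq> 0" | "c2 (curve r b z) \<noteq> 0"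
    using c_ker by blast
  then show ?thesis
  proof cases
    case 1
    then show ?thesis
      using that[of z] z by simp
  next
    case 2
    then have "c (curve r b y0) \<noteq> 0"
      using c12_curve(1)[OF br, where x = y0] y0 by auto
    then show ?thesis
      using that[of y0] z y0 mem[of y0] count[of y0] nzc[of y0] by (simp add: A_def)
  next
    case 3
    then have "c1 (curve r b y0) \<noteq> 0"
      using c12_curve(2)[OF br, where x = y0] y0 by auto
    then have "c (curve r b y1) \<noteq> 0"
      using c12_curve(1)[OF br, where x = y1] y1 by auto
    then show ?thesis
      using that[of y1] z y0 y1 mem[of y0] count[of y0] nzc[of y0] mem[of y1] count[of y1] nzc[of y1] by (simp add: A_def)
  qed
qed

text \<open>By \<open>sz\<close>, \<open>c\<close> is nonzero at two points at infinity only. A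
  multiple root where \<open>c\<close> vanishes has a conjugate \<open>y\<close> of the same
  multiplicity where it does not, so \<open>y\<close> fills both places and every root is conjugate
  to \<open>y\<close>. All weights are then equal, in fact 1, and the sum 6 means six roots.\<close>

lemma double_root:
  assumes b: "nrc_frame q r b" and a: "nrc_poly r b h \<noteq> 0" and r: "r \<le> 6"
    and sz: "size {#x \<in># proots (nrc_poly r b h). c (curve r b x) \<noteq> 0#} + (r - degree (nrc_poly r b h)) = 2"
    and x: "c (curve r b x) = 0" "count (proots (nrc_poly r b h)) x \<ge> 2"
  shows "count (proots (nrc_poly r b h)) x = 2" "r = 6"
    "\<exists>t\<in>transversals q g. nrc_point r b x \<subseteq> t \<and> (\<forall>v\<in>t. c v = 0)"
proof -
  define A where "A = proots (nrc_poly r b h)"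
  define nz where "nz = {#x \<in># A. c (curve r b x) \<noteq> 0#}"
  have br: "\<And>i. i \<le> r \<Longrightarrow> b i \<in> rat_vecs q 1"
    using frame_rat[OF b] .
  have sz': "size nz + (r - degree (nrc_poly r b h)) = 2"
    using sz by (simp add: nz_def A_def)
  have xA: "x \<in># A"
    using x(2) by (simp add: A_def flip: count_greater_zero_iff)
  obtain y where y: "y \<in># A" "c (curve r b y) \<noteq> 0" "nzc (curve r b y) = nzc (curve r b x)" "count A y = count A x"
    by (rule conjugate_root[OF b xA[unfolded A_def]]) (auto simp: A_def)
  have cnt: "count nz y = count A y"
    using y(2) by (simp add: nz_def)
  have "count nz y \<le> size nz"
    by (rule count_le_size)
  then have sz2: "size nz = 2" "count nz y = 2"
    using sz' cnt y(4) x(2) by (auto simp: A_def)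
  then have "replicate_mset 2 y \<subseteq># nz"
    by (simp flip: count_le_replicate_mset_subset_eq)
  then obtain B where B: "nz = replicate_mset 2 y + B"
    using mset_subset_eq_exists_conv by blast
  then have "B = {#}"
    using sz2 by simp
  then have only_y: "z = y" if "z \<in># A" "c (curve r b z) \<noteq> 0" for z
  proof -
    have "z \<in># nz"
      using that by (simp add: nz_def)
    then show ?thesis
      using B \<open>B = {#}\<close> by simp
  qed
  show "count (proots (nrc_poly r b h)) x = 2"
    using sz2 cnt y(4) by (simp add: A_def)
  have same: "nzc (curve r b z) = nzc (curve r b x)" if zA: "z \<in># A" for z
  proof -
    obtain w where w: "w \<in># A" "c (curve r b w) \<noteq> 0" "nzc (curve r b w) = nzc (curve r b z)"
      by (rule conjugate_root[OF b zA[unfolded A_def]]) (auto simp: A_def)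
    then show ?thesis
      using only_y[of w] y(3) by simp
  qed
  \<comment> \<open>If both were nonzero, the preimages of \<open>x\<close> under one and two
    Frobenius steps would both be \<open>y\<close>. Then \<open>x\<close> would be \<open>y\<close>
    as well, although \<open>c\<close> vanishes at \<open>x\<close>.\<close>
  have one: "c1 (curve r b x) = 0 \<or> c2 (curve r b x) = 0"
  proof (rule ccontr)
    assume "\<not> ?thesis"
    then have n12: "c1 (curve r b x) \<noteq> 0" "c2 (curve r b x) \<noteq> 0"
      by auto
    have inj: "inj (\<lambda>x :: 'a. x ^ q)"
      by (simp add: inj_def q_inj)
    have mem: "y \<in># A" if "y ^ q \<in># A" for y
      using count_image_mset_injective[OF inj, of A y] proots_nrc_poly_q[OF br] that by (simp add: A_def flip: count_greater_zero_iff)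
    obtain y0 where y0: "y0 ^ q = x"
      using q_surj by blast
    obtain y1 where y1: "y1 ^ q = y0"
      using q_surj by blast
    have "c (curve r b y0) \<noteq> 0"
      using c12_curve(1)[OF br, where x = y0] y0 n12 by auto
    moreover have "c1 (curve r b y0) \<noteq> 0"
      using c12_curve(2)[OF br, where x = y0] y0 n12 by auto
    then have "c (curve r b y1) \<noteq> 0"
      using c12_curve(1)[OF br, where x = y1] y1 by auto
    moreover have "y0 \<in># A" "y1 \<in># A"
      using mem[of y0] mem[of y1] xA y0 y1 by auto
    ultimately have "y0 = y1"
      using only_y by metis
    then have "x = y0"
      using y0 y1 by simp
    then show False
      using \<open>c (curve r b y0) \<noteq> 0\<close> x(1) by simp
  qed
  have "curve r b x \<noteq> 0"
    by (rule curve_nonzero[OF b])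
  then have nzc1: "nzc (curve r b x) = 1"
    using nzc_pos[of "curve r b x"] one x(1) by (auto simp: nzc_def)
  have "(\<Sum>z\<in>#A. nzc (curve r b z)) = (\<Sum>z\<in>#A. 1)"
    by (rule arg_cong[of _ _ sum_mset], rule image_mset_cong) (simp add: same nzc1)
  moreover have "(\<Sum>z\<in>#A. nzc (curve r b z)) = 6"
    unfolding sum_nzc using component_counts[OF br] sz2(1) by (simp add: nz_def A_def)
  ultimately have "size A = 6"
    by simp
  then have "degree (nrc_poly r b h) = 6"
    using factorization_proots(2)[OF a] by (simp add: A_def)
  then show "r = 6"
    using degree_nrc_poly[of r b] r by simp
  show "\<exists>t\<in>transversals q g. nrc_point r b x \<subseteq> t \<and> (\<forall>v\<in>t. c v = 0)"
  proof (cases "c1 (curve r b x) = 0")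
    case True
    have "vec.span {curve r b x} \<subseteq> {v. c v = 0 \<and> c1 v = 0}"
      using True x(1) by (auto simp: in_span1_iff c_scale)
    then show ?thesis
      unfolding transversals_eq nrc_point_curve by blast
  next
    case False
    then have "vec.span {curve r b x} \<subseteq> {v. c v = 0 \<and> c2 v = 0}"
      using one x(1) by (auto simp: in_span1_iff c_scale)
    then show ?thesis
      unfolding transversals_eq nrc_point_curve by blast
  qed
qed

text \<open>The relation \<open>w\<close> puts all \<open>c (b i)\<close> on one line of the plane.
  Subtracting multiples of the affine vector \<open>b i0\<close> leaves vectors at infinity whose
  direction is the point \<xi> of that line at infinity, so \<open>b i0\<close> and the spread plane
  of \<xi> span the solid.\<close>

lemma collinear_in_solid:
  fixes w :: "'a ^ 3"
  assumes b: "\<And>i. i \<le> r \<Longrightarrow> b i \<in> rat_vecs q 1" and w: "w \<noteq> 0"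
    and col: "\<And>i. i \<le> r \<Longrightarrow> w $ 1 * c (b i) $ 1 + w $ 2 * c (b i) $ 2 + w $ 3 * c (b i) $ 3 = 0"
    and i0: "i0 \<le> r" "c (b i0) $ 1 \<noteq> 0"
  obtains T \<xi> where "\<xi> \<in> dirs" "bb_solid q h g T" "\<And>i. i \<le> r \<Longrightarrow> b i \<in> T" "\<And>u. u \<in> T \<Longrightarrow> c u $ 1 = 0 \<Longrightarrow> u \<in> plane \<xi>"
proof -
  define v where "v = b i0"
  have v: "v \<in> rat_vecs q 1" "c v $ 1 \<noteq> 0"
    using b i0 by (auto simp: v_def)
  define e where "e i = b i - (c (b i) $ 1 / c v $ 1) *s v" for i
  have eF: "e i \<in> rat_vecs q 1" if "i \<le> r" for i
    unfolding e_def using b[OF that] v rat_c_first by (intro rat_vecs_diff rat_vecs_scale GFq_closed) auto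
  have e1: "c (e i) $ 1 = 0" for i
    using v(2) by (simp add: e_def c_diff c_scale)
  have ew: "w $ 2 * c (e i) $ 2 + w $ 3 * c (e i) $ 3 = 0" if "i \<le> r" for i
  proof -
    have "w $ 1 * c (e i) $ 1 + w $ 2 * c (e i) $ 2 + w $ 3 * c (e i) $ 3 =
      (w $ 1 * c (b i) $ 1 + w $ 2 * c (b i) $ 2 + w $ 3 * c (b i) $ 3) -
      (c (b i) $ 1 / c v $ 1) * (w $ 1 * c v $ 1 + w $ 2 * c v $ 2 + w $ 3 * c v $ 3)"
      by (simp add: e_def c_diff c_scale algebra_simps)
    also have "\<dots> = 0"
      using col[OF that] col[OF i0(1)] by (simp add: v_def)
    finally show ?thesis
      using e1 by simp
  qed
  have w23: "w $ 2 \<noteq> 0 \<or> w $ 3 \<noteq> 0"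
  proof (rule ccontr)
    assume *: "\<not> ?thesis"
    then have "w $ 1 = 0"
      using col[OF i0(1)] i0(2) by simp
    then show False
      using * w by (simp add: vec3_eq_iff)
  qed
  have "\<exists>\<xi>\<in>dirs. \<forall>i\<le>r. c (e i) \<in> vec.span {\<xi>}"
  proof (cases "\<forall>i\<le>r. c (e i) = 0")
    case True
    \<comment> \<open>All \<open>b i\<close> are multiples of \<open>v\<close> here, so any
      direction will do.\<close>
    have "(vector [0, 1, 0] :: 'a ^ 3) \<in> dirs"
      by (simp add: dirs_def axis_rat GFq_closed vec3_eq_iff)
    then show ?thesis
      using True vec.span_zero by (metis)
  next
    case False
    then obtain j where j: "j \<le> r" "c (e j) \<noteq> 0"
      by blast
    define \<xi> where "\<xi> = c (e j)"
    have "\<xi> \<in> dirs"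
      using j rat_c_3[OF eF[OF j(1)]] e1 by (simp add: dirs_def \<xi>_def)
    moreover have "c (e i) \<in> vec.span {\<xi>}" if "i \<le> r" for i
    proof (cases "w $ 2 = 0")
      case True
      then have "c (e i) $ 3 = 0" "\<xi> $ 3 = 0"
        using ew[OF that] ew[OF j(1)] w23 by (auto simp: \<xi>_def)
      moreover from this have "\<xi> $ 2 \<noteq> 0"
        using j(2) e1[of j] by (auto simp: vec3_eq_iff \<xi>_def)
      ultimately have "c (e i) = (c (e i) $ 2 / \<xi> $ 2) *s \<xi>"
        using e1 by (simp add: vec3_eq_iff \<xi>_def)
      then show ?thesis
        using in_span1_iff by blast
    next
      case False
      have 2: "c (e i) $ 2 = - (w $ 3 / w $ 2) * c (e i) $ 3" if "i \<le> r" for i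
      proof -
        have "w $ 2 * c (e i) $ 2 = - (w $ 3 * c (e i) $ 3)"
          using ew[OF that] by (simp add: eq_neg_iff_add_eq_0)
        then show ?thesis
          using False by (simp add: field_simps)
      qed
      have "\<xi> $ 3 \<noteq> 0"
        using j(2) e1[of j] 2[OF j(1)] by (auto simp: vec3_eq_iff \<xi>_def)
      then have "c (e i) = (c (e i) $ 3 / \<xi> $ 3) *s \<xi>"
        using e1 2[OF that] 2[OF j(1)] by (simp add: vec3_eq_iff \<xi>_def)
      then show ?thesis
        using in_span1_iff by blast
    qed
    ultimately show ?thesis
      by blast
  qed
  then obtain \<xi> where \<xi>: "\<xi> \<in> dirs" "\<And>i. i \<le> r \<Longrightarrow> c (e i) \<in> vec.span {\<xi>}"
    by blast
  define T where "T = vec.span (insert v (plane \<xi>))"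
  have "bb_solid q h g T"
    unfolding T_def by (rule solidI[OF v \<xi>(1)])
  moreover have "b i \<in> T" if ir: "i \<le> r" for i
  proof -
    obtain k where k: "c (e i) = k *s \<xi>"
      using \<xi>(2)[OF ir] in_span1_iff by blast
    have "e i \<in> plane \<xi>"
      using rat_c[OF eF[OF ir]] by (auto simp: plane_def in_span1_iff k frob_scale)
    then show ?thesis
      unfolding T_def in_solid_iff e_def by blast
  qed
  moreover have "u \<in> plane \<xi>" if u: "u \<in> T" "c u $ 1 = 0" for u
  proof -
    obtain k where k: "u - k *s v \<in> plane \<xi>"
      using u(1) in_solid_iff unfolding T_def by blast
    then have "c (u - k *s v) $ 1 = 0"
      using plane_subset_hyperplane[OF \<xi>(1)] hyperplane_iff by blast
    then have "k = 0"
      using u(2) v(2) by (simp add: c_diff c_scale)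
    then show ?thesis
      using k by simp
  qed
  ultimately show ?thesis
    using that \<xi>(1) by blast
qed

lemma frame_curve_in_subspace:
  assumes "vec.subspace T" "\<And>i. i \<le> r \<Longrightarrow> b i \<in> T"
  shows "curve r b x \<in> T"
  unfolding curve_def using assms by (intro vec.subspace_sum vec.subspace_scale) auto

lemma sum_mset_odd: "(\<And>x. x \<in># A \<Longrightarrow> odd (f x)) \<Longrightarrow> even (\<Sum>x\<in>#A. f x :: nat) \<longleftrightarrow> even (size A)"
  by (induction A) auto

text \<open>\<open>D\<close> collects the parameters at which \<open>c\<close> vanishes. At a simple
  one the coordinates vanish. At a double one the tangent is a transversal on which \<open>c\<close>
  is 0, so their derivatives vanish too; \<open>double_root\<close> excludes higher
  multiplicity.\<close>

lemma special_curve_factorization: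
  assumes b: "nrc_frame q r b" and N: "N = nrc_points q r b" and r: "r \<le> 6" and nN: "\<not> \<Union>N \<subseteq> hyperplane h"
    and w6: "(\<Sum>P\<in>#nrc_at_infinity r b h. weight q g P) = 6"
    and good: "\<And>P. P \<in># nrc_at_infinity r b h \<Longrightarrow> good_point q h g P"
    and tang: "\<not> (r = 6 \<and> improper_tangent q h g r N)"
  obtains D f where "\<And>j. coord_poly r b j = D * f j" "\<And>j. degree (f j) \<le> 2" "degree D + 2 = r" "lead_coeff D = 1"
    "\<And>x. x \<in> GFq q 1 \<Longrightarrow> poly D x \<noteq> 0 \<and> poly D x \<in> GFq q 3" "nrc_poly r b h \<noteq> 0"
proof -
  define a where "a = nrc_poly r b h"
  define A where "A = proots a"
  have br: "\<And>i. i \<le> r \<Longrightarrow> b i \<in> rat_vecs q 1"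
    using frame_rat[OF b] .
  have a0: "a \<noteq> 0"
  proof
    assume "a = 0"
    then have "c (curve r b x) $ 1 = 0" "c (b r) $ 1 = 0" for x
      using poly_nrc_poly[of r b x] coeff_nrc_poly[of r b r] by (simp_all add: a_def)
    then have "\<Union>N \<subseteq> hyperplane h"
      unfolding N nrc_points_def nrc_point_curve by (auto simp: in_span1_iff hyperplane_iff c_scale)
    then show False
      using nN by simp
  qed
  \<comment> \<open>Dividing by 3 leaves 2 for the points where \<open>c\<close> is nonzero, so
    \<open>D\<close> gets degree r - 2.\<close>
  have "6 = 3 * (size {#x \<in># proots (nrc_poly r b h). c (curve r b x) \<noteq> 0#} + (r - degree (nrc_poly r b h)))"
    using weight_sum[OF b a0[unfolded a_def]] w6 good by (simp add: good_point_def)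
  then have sz: "size {#x \<in># proots (nrc_poly r b h). c (curve r b x) \<noteq> 0#} + (r - degree (nrc_poly r b h)) = 2"
    by simp
  define Z where "Z = {#x \<in># A. c (curve r b x) = 0#}"
  have "size Z + size {#x \<in># A. c (curve r b x) \<noteq> 0#} = size A"
    unfolding Z_def by (metis multiset_partition size_union)
  moreover have "size A = degree a"
    using factorization_proots(2)[OF a0] by (simp add: A_def)
  moreover have "degree a \<le> r"
    using degree_nrc_poly by (simp add: a_def)
  ultimately have sZ: "size Z + 2 = r"
    using sz by (simp add: A_def a_def)
  define D where "D = (\<Prod>x\<in>#Z. [:- x, 1:])"
  have "D dvd coord_poly r b j" for j
    unfolding D_def
  proof (rule linear_prod_dvd)
    fix x assume P0: "coord_poly r b j \<noteq> 0" and xZ: "x \<in># Z"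
    have x0: "c (curve r b x) = 0" and xA: "x \<in># A"
      using xZ by (auto simp: Z_def)
    have Px: "poly (coord_poly r b j) x = 0"
      using x0 by (simp add: poly_coord_poly)
    then have o1: "order x (coord_poly r b j) \<ge> 1"
      using P0 order_root[of "coord_poly r b j" x] by (simp add: Suc_le_eq flip: neq0_conv)
    have cZ: "count Z x = count A x"
      using x0 by (simp add: Z_def)
    show "count Z x \<le> order x (coord_poly r b j)"
    proof (cases "count A x \<ge> 2")
      case True
      note dr = double_root[OF b a0[unfolded a_def] r sz x0 True[unfolded A_def a_def]]
      obtain t where t: "t \<in> transversals q g" "nrc_point r b x \<subseteq> t" "\<And>v. v \<in> t \<Longrightarrow> c v = 0"
        using dr(3) by blast
      have "nrc_tangent r b x = t"
      proof (rule ccontr)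
        assume "nrc_tangent r b x \<noteq> t"
        then have "improper_tangent q h g r N"
          unfolding improper_tangent_def using b N True t(1,2) by (auto simp: A_def a_def)
        then show False
          using tang dr(2) by simp
      qed
      moreover have "(\<Sum>i\<le>r. (of_nat i * x ^ (i - 1)) *s b i) \<in> nrc_tangent r b x"
        unfolding nrc_tangent_def by (intro vec.span_base) simp
      ultimately have "c (\<Sum>i\<le>r. (of_nat i * x ^ (i - 1)) *s b i) = 0"
        using t(3) by blast
      then have "poly (pderiv (coord_poly r b j)) x = 0"
        unfolding poly_pderiv_coord_poly by simp
      then show ?thesis
        using order_ge_2[OF P0 Px] dr(1) cZ by (simp add: A_def a_def)
    next
      case False
      then show ?thesis
        using cZ o1 by linarith
    qed
  qed
  then have "\<exists>f. coord_poly r b j = D * f" for j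
    by (auto elim: dvdE)
  then obtain f where f: "\<And>j. coord_poly r b j = D * f j"
    by metis
  have D: "degree D = size Z" "lead_coeff D = 1"
    unfolding D_def by (rule degree_linear_prod, rule lead_coeff_linear_prod)
  have D0: "D \<noteq> 0"
    using D(2) by auto
  have "degree (f j) \<le> 2" for j
  proof (cases "f j = 0")
    case False
    then have "degree (coord_poly r b j) = degree D + degree (f j)"
      unfolding f by (intro degree_mult_eq D0)
    then show ?thesis
      using degree_coord_poly[of r b j] D(1) sZ by linarith
  qed simp
  moreover have "poly D x \<noteq> 0 \<and> poly D x \<in> GFq q 3" if x: "x \<in> GFq q 1" for x
  proof
    have D_eval: "poly D y = (\<Prod>z\<in>#Z. y - z)" for y
      by (simp add: D_def poly_prod_mset image_mset.compositionality comp_def)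
    have "curve r b x \<in> rat_vecs q 1"
      by (rule curve_rat[OF br x])
    then have "nzc (curve r b x) = 3"
      using rat_nzc curve_nonzero[OF b] by blast
    then have "c (curve r b x) \<noteq> 0"
      by (auto simp: nzc_def split: if_splits)
    then have "x \<notin># Z"
      by (simp add: Z_def)
    then show "poly D x \<noteq> 0"
      unfolding D_eval by (auto simp: prod_mset_zero_iff)
    have AA: "image_mset (\<lambda>x. x ^ q) A = A"
      unfolding A_def a_def by (rule proots_nrc_poly_q[OF br])
    \<comment> \<open>Three Frobenius steps bring \<open>c\<close> back to itself and so permute the
      roots of \<open>D\<close>. This puts the values of \<open>D\<close> at rational parameters
      into the cubic field.\<close>
    have A3: "image_mset (\<lambda>x. ((x ^ q) ^ q) ^ q) A = A"
    proof -
      have "image_mset (\<lambda>x. ((x ^ q) ^ q) ^ q) A = image_mset (\<lambda>x. x ^ q) (image_mset (\<lambda>x. x ^ q) (image_mset (\<lambda>x. x ^ q) A))"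
        by (simp add: image_mset.compositionality comp_def)
      then show ?thesis
        by (simp only: AA)
    qed
    have "c (curve r b (((z ^ q) ^ q) ^ q)) = 0 \<longleftrightarrow> c (curve r b z) = 0" for z
      by (simp only: c12_curve[OF br] frob_eq_0)
    then have "image_mset (\<lambda>x. ((x ^ q) ^ q) ^ q) Z = {#x \<in># image_mset (\<lambda>x. ((x ^ q) ^ q) ^ q) A. c (curve r b x) = 0#}"
      unfolding Z_def by (simp add: filter_mset_image_mset)
    then have Z3: "image_mset (\<lambda>x. ((x ^ q) ^ q) ^ q) Z = Z"
      by (simp only: A3 Z_def)
    have xq: "x ^ q = x"
      using x by (simp add: GFq_iff)
    have pm: "(\<Prod>z\<in>#Y. x - z) ^ q = (\<Prod>z\<in>#image_mset (\<lambda>x. x ^ q) Y. x - z)" for Y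
      by (induction Y) (simp_all add: power_mult_distrib q_diff xq)
    have "((poly D x ^ q) ^ q) ^ q = (\<Prod>z\<in>#image_mset (\<lambda>x. ((x ^ q) ^ q) ^ q) Z. x - z)"
      unfolding D_eval pm by (simp add: image_mset.compositionality comp_def)
    also have "\<dots> = poly D x"
      unfolding Z3 D_eval ..
    finally show "poly D x \<in> GFq q 3"
      by (simp add: GFq_iff power3_eq_cube power_mult)
  qed
  ultimately show ?thesis
    using that[of D f] f D sZ a0 by (simp add: a_def)
qed

lemma three_special_imp_param:
  assumes r: "r \<le> 6" and sp: "three_special q h g r N"
    and no_solid: "\<not> (r = 2 \<and> lies_in_bb_solid q h g N)"
    and tang: "\<not> (r = 6 \<and> improper_tangent q h g r N)"
  shows "\<exists>M. (\<forall>i j. M $ i $ j \<in> GFq q 3) \<and> det M \<noteq> 0 \<and>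
      {P \<in> N. \<not> P \<subseteq> hyperplane h} = {P \<in> affine_points q h. c ` P \<in> param_conic q M}"
proof -
  obtain b where b: "nrc_frame q r b" and N: "N = nrc_points q r b"
    and w6: "(\<Sum>P\<in>#nrc_at_infinity r b h. weight q g P) = 6"
    and good: "\<And>P. P \<in># nrc_at_infinity r b h \<Longrightarrow> good_point q h g P"
    and nN: "\<not> \<Union>N \<subseteq> hyperplane h"
    using sp unfolding three_special_def by blast
  have br: "\<And>i. i \<le> r \<Longrightarrow> b i \<in> rat_vecs q 1"
    using frame_rat[OF b] .
  obtain D f where f: "\<And>j. coord_poly r b j = D * f j" and degf: "\<And>j. degree (f j) \<le> 2"
    and degD: "degree D + 2 = r" and lcD: "lead_coeff D = 1"
    and DF: "\<And>x. x \<in> GFq q 1 \<Longrightarrow> poly D x \<noteq> 0 \<and> poly D x \<in> GFq q 3" and a0: "nrc_poly r b h \<noteq> 0"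
    using special_curve_factorization[OF b N r nN w6 good tang] by blast
  \<comment> \<open>Row \<open>j\<close> holds the coefficients of \<open>f j\<close>, so that
    \<open>M *v ver 1 x\<close> evaluates the three quotients at \<open>x\<close>.\<close>
  define M :: "'a ^ 3 ^ 3" where "M = (\<chi> j k. if k = 1 then coeff (f j) 0 else if k = 2 then coeff (f j) 1 else coeff (f j) 2)"
  have Mj: "M $ j $ 1 = coeff (f j) 0" "M $ j $ 2 = coeff (f j) 1" "M $ j $ 3 = coeff (f j) 2" for j
    by (simp_all add: M_def)
  have pf: "poly (f j) x = coeff (f j) 0 + coeff (f j) 1 * x + coeff (f j) 2 * x\<^sup>2" for j x
  proof -
    have "poly (f j) x = (\<Sum>i\<le>2. coeff (f j) i * x ^ i)"
      unfolding poly_altdef using degf[of j] by (intro sum.mono_neutral_left) (auto simp: coeff_eq_0)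
    then show ?thesis
      by (simp add: eval_nat_numeral One_nat_def)
  qed
  have Mver: "(M *v ver 1 x) $ j = poly (f j) x" for x j
    by (simp add: mv3 Mj pf)
  have cur: "c (curve r b x) = poly D x *s (M *v ver 1 x)" for x
    by (simp add: vec_eq_iff Mver f flip: poly_coord_poly)
  have top: "c (b r) = M *v ver 0 1"
  proof -
    have "coeff (D * f j) r = coeff (f j) 2" for j
    proof (cases "degree (f j) = 2")
      case True
      then show ?thesis
        using coeff_mult_degree_sum[of D "f j"] degD lcD by simp
    next
      case False
      then have lt: "degree (f j) < 2"
        using degf[of j] by linarith
      have "degree (D * f j) \<le> degree D + degree (f j)"
        by (rule degree_mult_le)
      then show ?thesis
        using lt degD by (simp add: coeff_eq_0)
    qed
    then show ?thesis
      using coeff_coord_poly[of r b _ r] by (simp add: vec_eq_iff mv3 Mj f)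
  qed
  \<comment> \<open>At the rational parameters the values are quotients of elements of the cubic
    field, and q of them suffice for a quadratic polynomial.\<close>
  have "coeff (f j) i \<in> GFq q 3" for i j
  proof (rule interpolate_GFq)
    show "degree (f j) < q"
      using degf[of j] q_ge by linarith
    fix x :: 'a assume x: "x \<in> GFq q 1"
    have "c (curve r b x) $ j \<in> GFq q 3"
      using rat_c_3[OF curve_rat[OF br x]] by (simp add: rat_vecs_def)
    moreover have "poly (f j) x = c (curve r b x) $ j / poly D x"
      using DF[OF x] by (simp add: f flip: poly_coord_poly)
    ultimately show "poly (f j) x \<in> GFq q 3"
      using DF[OF x] by (simp add: GFq_closed)
  qed
  then have ME: "\<forall>i j. M $ i $ j \<in> GFq q 3"
    by (simp add: M_def)
  \<comment> \<open>Dependent rows put the curve into a solid, whose dimension gives r <= 3. The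
    case r = 2 is excluded by hypothesis, and r = 3 by the parity of the weights.\<close>
  have detM: "det M \<noteq> 0"
  proof
    assume "det M = 0"
    then have "det (transpose M) = 0"
      by (simp add: det_transpose)
    then obtain w where w: "w \<noteq> 0" "transpose M *v w = 0"
      using ker_iff_det[of "transpose M"] by blast
    have wM: "w $ 1 * M $ 1 $ k + w $ 2 * M $ 2 $ k + w $ 3 * M $ 3 $ k = 0" for k
    proof -
      have "(transpose M *v w) $ k = 0"
        using w(2) by simp
      then show ?thesis
        by (simp add: mv3 transpose_def mult.commute)
    qed
    have col: "w $ 1 * c (b i) $ 1 + w $ 2 * c (b i) $ 2 + w $ 3 * c (b i) $ 3 = 0" if "i \<le> r" for i
    proof -
      define s where "s = smult (w $ 1) (f 1) + smult (w $ 2) (f 2) + smult (w $ 3) (f 3)"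
      have "coeff s k = 0" for k
      proof -
        consider "k = 0" | "k = 1" | "k = 2" | "k > 2"
          by linarith
        then show ?thesis
        proof cases
          case 4
          then have "coeff (f j) k = 0" for j
            using degf[of j] by (intro coeff_eq_0) linarith
          then show ?thesis
            by (simp add: s_def)
        qed (use wM[of 1] wM[of 2] wM[of 3] in \<open>simp_all add: s_def Mj\<close>)
      qed
      then have "s = 0"
        by (simp add: poly_eq_iff)
      moreover have "D * s = smult (w $ 1) (coord_poly r b 1) + smult (w $ 2) (coord_poly r b 2) + smult (w $ 3) (coord_poly r b 3)"
        by (simp add: s_def f algebra_simps)
      ultimately have "coeff (smult (w $ 1) (coord_poly r b 1) + smult (w $ 2) (coord_poly r b 2) + smult (w $ 3) (coord_poly r b 3)) i = 0"
        by (metis coeff_0 mult_zero_right)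
      then show ?thesis
        using that by (simp add: coeff_coord_poly)
    qed
    have "\<exists>i\<le>r. c (b i) $ 1 \<noteq> 0"
    proof (rule ccontr)
      assume "\<not> ?thesis"
      then have "nrc_poly r b h = 0"
        by (intro poly_eqI) (auto simp: coeff_nrc_poly)
      then show False
        using a0 by simp
    qed
    then obtain i0 where i0: "i0 \<le> r" "c (b i0) $ 1 \<noteq> 0"
      by blast
    obtain T \<xi> where T: "\<xi> \<in> dirs" "bb_solid q h g T" "\<And>i. i \<le> r \<Longrightarrow> b i \<in> T" "\<And>u. u \<in> T \<Longrightarrow> c u $ 1 = 0 \<Longrightarrow> u \<in> plane \<xi>"
      by (rule collinear_in_solid[where r = r and b = b, OF br w(1) col i0]) auto
    have Tsub: "vec.subspace T" and Tdim: "vec.dim T = 4"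
      using T(2) by (auto simp: bb_solid_def intro: subspace_rat)
    have curT: "curve r b x \<in> T" for x
      by (rule frame_curve_in_subspace[OF Tsub T(3)])
    have "card (b ` {..r}) \<le> vec.dim T"
      using b T(3) by (intro vec.independent_card_le_dim) (auto simp: nrc_frame_def)
    moreover have "card (b ` {..r}) = r + 1"
      using b by (simp add: nrc_frame_def card_image)
    ultimately have "r \<le> 3"
      using Tdim by linarith
    moreover have "r \<noteq> 2"
    proof
      assume "r = 2"
      have "\<Union>N \<subseteq> T"
        unfolding N nrc_points_def nrc_point_curve using curT T(3)[of r] Tsub
        by (auto simp: in_span1_iff intro!: vec.subspace_scale[OF Tsub])
      then show False
        using no_solid \<open>r = 2\<close> T(2) by (auto simp: lies_in_bb_solid_def)
    qed
    ultimately have r3: "r = 3"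
      using degD by linarith
    \<comment> \<open>In a spread plane a good point has weight times orbit size 3, so the weight
      divides 3.\<close>
    have odd: "odd (weight q g P)" if P: "P \<in># nrc_at_infinity r b h" for P
    proof -
      have "\<exists>u\<in>T. P = vec.span {u}"
        using P curT T(3)[of r] unfolding nrc_at_infinity_def by (auto simp: nrc_point_curve split: if_splits)
      then obtain u where u: "u \<in> T" "P = vec.span {u}"
        by blast
      have Pg: "P \<in> pg_points q 6 (hyperplane h)" "weight q g P * orbit_size q P = 3 * spread_index q g P"
        using good[OF P] by (auto simp: good_point_def)
      have "vec.subspace (hyperplane h)"
        by (auto simp: vec.subspace_def hyperplane_iff c_add c_scale)
      then have "u \<in> hyperplane h"
        using pg_points_span_mem[of "hyperplane h" u] Pg(1) u(2) by blast
      then have "u \<in> plane \<xi>"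
        using T(4)[OF u(1)] by (simp add: hyperplane_iff)
      then have "P \<subseteq> plane \<xi>"
        unfolding u(2) using span_subset_iff[OF plane_subspace] by blast
      then have "spread_index q g P = 1"
        using T(1) by (auto simp: spread_index_def regular_spread_eq)
      then have "weight q g P * orbit_size q P = 3"
        using Pg(2) by simp
      then have "weight q g P dvd 3"
        by (metis dvd_triv_left)
      then show ?thesis
        using dvd_trans[of 2 "weight q g P" 3] by auto
    qed
    have "size (nrc_at_infinity r b h) = 3"
      using factorization_proots(2)[OF a0] degree_nrc_poly[of r b] r3 by (simp add: nrc_at_infinity_def)
    then show False
      using sum_mset_odd[of "nrc_at_infinity r b h" "weight q g", OF odd] w6 by simp
  qed
  have Mker: "M *v v = 0 \<Longrightarrow> v = 0" for v
    using detM ker_iff_det[of M] by blast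
  have F01: "(0 :: 'a) \<in> GFq q 1" "(1 :: 'a) \<in> GFq q 1"
    by (auto intro: GFq_closed)
  have img: "c ` vec.span {curve r b x} = vec.span {M *v ver 1 x}" if "x \<in> GFq q 1" for x
    using DF[OF that] by (simp add: c_image_span cur span1_scale)
  have img_top: "c ` vec.span {b r} = vec.span {M *v ver 0 1}"
    by (simp add: c_image_span top)
  have aff: "P \<in> affine_points q h" if "P \<in> N" "\<not> P \<subseteq> hyperplane h" for P
    using that br curve_rat[OF br] curve_nonzero[OF b] frame_nonzero[OF b, of r] unfolding N nrc_points_def nrc_point_curve affine_points_def
    by (auto intro!: pg_pointsI)
  have "{P \<in> N. \<not> P \<subseteq> hyperplane h} = {P \<in> affine_points q h. c ` P \<in> param_conic q M}"
  proof (intro equalityI subsetI)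
    fix P assume P: "P \<in> {P \<in> N. \<not> P \<subseteq> hyperplane h}"
    then have "(\<exists>x\<in>GFq q 1. P = vec.span {curve r b x}) \<or> P = vec.span {b r}"
      unfolding N nrc_points_def nrc_point_curve by blast
    then have "c ` P \<in> param_conic q M"
    proof
      assume "\<exists>x\<in>GFq q 1. P = vec.span {curve r b x}"
      then obtain x where "x \<in> GFq q 1" "c ` P = vec.span {M *v ver 1 x}"
        using img by blast
      then show ?thesis
        unfolding param_conic_def using F01 by (intro CollectI exI[of _ 1] exI[of _ x]) simp
    next
      assume "P = vec.span {b r}"
      then show ?thesis
        unfolding param_conic_def using F01 img_top by (intro CollectI exI[of _ 0] exI[of _ 1]) simp
    qed
    then show "P \<in> {P \<in> affine_points q h. c ` P \<in> param_conic q M}"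
      using aff P by blast
  next
    fix P assume "P \<in> {P \<in> affine_points q h. c ` P \<in> param_conic q M}"
    then have Pa: "P \<in> affine_points q h" and Pc: "c ` P \<in> param_conic q M"
      by auto
    obtain s t where st: "c ` P = vec.span {M *v ver s t}" "s \<in> GFq q 1" "t \<in> GFq q 1" "s \<noteq> 0 \<or> t \<noteq> 0"
      using Pc unfolding param_conic_def by blast
    have "\<exists>Q\<in>N. c ` Q = c ` P"
    proof (cases "s = 0")
      case True
      then have "t \<noteq> 0"
        using st(4) by simp
      have "ver s t = t\<^sup>2 *s ver 0 1"
        using True by (simp add: vec3_eq_iff)
      then have "c ` P = c ` vec.span {b r}"
        using \<open>t \<noteq> 0\<close> st(1) by (simp add: img_top vector_scalar_commute span1_scale)
      moreover have "vec.span {b r} \<in> N"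
        by (simp add: N nrc_points_def)
      ultimately show ?thesis
        by (intro bexI[of _ "vec.span {b r}"]) simp_all
    next
      case False
      define x where "x = t / s"
      have x: "x \<in> GFq q 1"
        unfolding x_def by (intro GFq_closed st)
      have "ver s t = s\<^sup>2 *s ver 1 x"
        using False by (simp add: vec3_eq_iff x_def power2_eq_square)
      then have "c ` P = c ` vec.span {curve r b x}"
        using False st(1) by (simp add: img[OF x] vector_scalar_commute span1_scale)
      moreover have "vec.span {curve r b x} \<in> N"
        using x by (simp add: N nrc_points_def nrc_point_curve)
      ultimately show ?thesis
        by (intro bexI[of _ "vec.span {curve r b x}"]) simp_all
    qed
    then obtain Q where Q: "Q \<in> N" "c ` Q = c ` P"
      by blast
    obtain v where v: "P = vec.span {v}" "c v $ 1 = 1"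
      using Pa by (auto simp: affine_points_eq)
    have "\<not> Q \<subseteq> hyperplane h"
    proof
      assume "Q \<subseteq> hyperplane h"
      then have "\<And>y. y \<in> c ` Q \<Longrightarrow> y $ 1 = 0"
        using hyperplane_iff by auto
      moreover have "c v \<in> c ` Q"
        unfolding Q(2) v(1) by (intro imageI vec.span_base) simp
      ultimately show False
        using v(2) by fastforce
    qed
    then have Qa: "Q \<in> affine_points q h"
      using aff Q(1) by blast
    have "Q = P"
      using c_image_bij Q(2) Qa Pa by (auto simp: bij_betw_def inj_on_def bb_points_def)
    then show "P \<in> {P \<in> N. \<not> P \<subseteq> hyperplane h}"
      using Q(1) \<open>\<not> Q \<subseteq> hyperplane h\<close> by simp
  qed
  then show ?thesis
    using ME detM by blast
qed

end

section \<open>Normal rational curves with many common points\<close>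

context frobenius_field begin

lemma curve_coeffs:
  fixes b :: "nat \<Rightarrow> 'a ^ 'n"
  shows "(\<Sum>i\<in>I. k i *s curve r b (x i)) + l *s b r
    = (\<Sum>m\<le>r. ((\<Sum>i\<in>I. k i * x i ^ m) + (if m = r then l else 0)) *s b m)"
proof -
  have "(\<Sum>i\<in>I. k i *s curve r b (x i)) = (\<Sum>i\<in>I. \<Sum>m\<le>r. (k i * x i ^ m) *s b m)"
    by (simp add: curve_def vec_eq_iff sum_distrib_left mult.assoc)
  also have "\<dots> = (\<Sum>m\<le>r. \<Sum>i\<in>I. (k i * x i ^ m) *s b m)"
    by (rule sum.swap)
  also have "\<dots> = (\<Sum>m\<le>r. (\<Sum>i\<in>I. k i * x i ^ m) *s b m)"
    by (simp add: vec_eq_iff sum_distrib_right)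
  moreover have "l *s b r = (\<Sum>m\<le>r. (if m = r then l else 0) *s b m)"
  proof -
    have "(\<Sum>m\<le>r. (if m = r then l else 0) *s b m) = (\<Sum>m\<le>r. if m = r then l *s b m else 0)"
      by (intro sum.cong) auto
    then show ?thesis
      by simp
  qed
  ultimately show ?thesis
    by (simp add: vector_sadd_rdistrib sum.distrib)
qed

text \<open>A relation between the points annihilates, at the parameters, every polynomial of degree
  below r; the top coefficient is left to the point at infinity. Testing with the product that
  vanishes at all parameters but one isolates a coefficient.\<close>

lemma curve_independent:
  fixes b :: "nat \<Rightarrow> 'a ^ 'n"
  assumes b: "nrc_frame q r b" and I: "finite I" "inj_on x I" "card I \<le> r"
    and 0: "(\<Sum>i\<in>I. k i *s curve r b (x i)) + l *s b r = 0"
  shows "\<And>i. i \<in> I \<Longrightarrow> k i = 0" "l = 0"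
proof -
  have co: "(\<Sum>i\<in>I. k i * x i ^ m) + (if m = r then l else 0) = 0" if "m \<le> r" for m
    using 0 unfolding curve_coeffs
    by (rule frame_independent[OF b, where k = "\<lambda>m. (\<Sum>i\<in>I. k i * x i ^ m) + (if m = r then l else 0)"]) (rule that)
  have main: "(\<Sum>i\<in>I. k i * poly p (x i)) = 0" if p: "degree p < r" for p
  proof -
    have "(\<Sum>i\<in>I. k i * poly p (x i)) = (\<Sum>i\<in>I. \<Sum>m<r. coeff p m * (k i * x i ^ m))"
    proof (rule sum.cong[OF refl])
      fix i
      have "poly p (x i) = (\<Sum>m<r. coeff p m * x i ^ m)"
        unfolding poly_altdef using p by (intro sum.mono_neutral_left) (auto simp: coeff_eq_0)
      then show "k i * poly p (x i) = (\<Sum>m<r. coeff p m * (k i * x i ^ m))"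
        by (simp add: sum_distrib_left algebra_simps)
    qed
    also have "\<dots> = (\<Sum>m<r. coeff p m * (\<Sum>i\<in>I. k i * x i ^ m))"
      by (subst sum.swap) (simp add: sum_distrib_left)
    also have "\<dots> = 0"
    proof (rule sum.neutral, rule ballI)
      fix m assume "m \<in> {..<r}"
      then show "coeff p m * (\<Sum>i\<in>I. k i * x i ^ m) = 0"
        using co[of m] by simp
    qed
    finally show ?thesis .
  qed
  show k0: "k i = 0" if i: "i \<in> I" for i
  proof -
    define p where "p = (\<Prod>j\<in>I - {i}. [:- x j, 1:])"
    have "degree p \<le> (\<Sum>j\<in>I - {i}. 1)"
      unfolding p_def using I(1) by (intro order_trans[OF degree_prod_sum_le] sum_mono) auto
    moreover have "card (I - {i}) < card I"
      using I(1) i by (intro psubset_card_mono) auto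
    ultimately have "degree p < r"
      using I(3) by simp
    then have "(\<Sum>l\<in>I. k l * poly p (x l)) = 0"
      by (rule main)
    moreover have "(\<Sum>l\<in>I. k l * poly p (x l)) = (\<Sum>l\<in>{i}. k l * poly p (x l))"
    proof (rule sum.mono_neutral_right)
      show "\<forall>l\<in>I - {i}. k l * poly p (x l) = 0"
        using I(1) by (auto simp: p_def poly_prod)
    qed (use I i in auto)
    moreover have "poly p (x i) \<noteq> 0"
      using I(1,2) i by (auto simp: p_def poly_prod inj_on_def)
    ultimately show ?thesis
      by simp
  qed
  then have "l *s b r = 0"
    using 0 by simp
  then show "l = 0"
    using frame_nonzero[OF b, of r] by simp
qed

text \<open>Interpolation with one degree more than the nodes allow: the top coefficient acts as a
  value at infinity. Subtracting that multiple of the monic polynomial vanishing at the nodes leaves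
  the ordinary case.\<close>

lemma Lagrange_poly:
  fixes p :: "'a poly"
  assumes I: "finite I" "inj_on x I" and deg: "degree p \<le> card I"
  shows "poly p z = coeff p (card I) * (\<Prod>i\<in>I. z - x i) + (\<Sum>i\<in>I. (\<Prod>j\<in>I - {i}. (z - x j) / (x i - x j)) * poly p (x i))"
proof (cases "I = {}")
  case True
  then have "degree p = 0"
    using deg by simp
  then show ?thesis
    using True by (auto elim!: degree_eq_zeroE)
next
  case False
  define r where "r = card I"
  have r: "r > 0"
    using False I by (simp add: r_def card_gt_0_iff)
  define W where "W = (\<Prod>i\<in>I. [:- x i, 1:])"
  have W: "degree W = r" "coeff W r = 1"
  proof -
    show 1: "degree W = r"
      unfolding W_def by (subst degree_prod_eq_sum_degree) (auto simp: r_def)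
    have "lead_coeff W = 1"
      unfolding W_def by (subst lead_coeff_prod) simp
    then show "coeff W r = 1"
      using 1 by simp
  qed
  define L where "L i = smult (poly p (x i) / (\<Prod>j\<in>I - {i}. x i - x j)) (\<Prod>j\<in>I - {i}. [:- x j, 1:])" for i
  have degL: "degree (L i) < r" if "i \<in> I" for i
  proof -
    have "degree (L i) \<le> degree (\<Prod>j\<in>I - {i}. [:- x j, 1:])"
      unfolding L_def by (rule degree_smult_le)
    also have "\<dots> = card (I - {i})"
      by (subst degree_prod_eq_sum_degree) auto
    also have "\<dots> < r"
      using that I(1) r by (simp add: r_def card_Diff_singleton One_nat_def)
    finally show ?thesis .
  qed
  have "p - smult (coeff p r) W = (\<Sum>i\<in>I. L i)"
  proof (rule poly_eqI_degree[of "x ` I"])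
    show "card (x ` I) > degree (p - smult (coeff p r) W)"
    proof -
      have "degree (p - smult (coeff p r) W) \<le> r"
        using deg W(1) by (intro degree_diff_le) (auto simp: r_def intro: order_trans[OF degree_smult_le])
      moreover have "coeff (p - smult (coeff p r) W) r = 0"
        using W(2) by simp
      ultimately have "degree (p - smult (coeff p r) W) < r"
        using r by (metis degree_0 leading_coeff_0_iff le_neq_implies_less)
      then show ?thesis
        using I by (simp add: card_image r_def)
    qed
    have "degree (\<Sum>i\<in>I. L i) < r"
      by (rule degree_sum_less) (use degL r in auto)
    then show "card (x ` I) > degree (\<Sum>i\<in>I. L i)"
      using I by (simp add: card_image r_def)
  next
    fix y assume "y \<in> x ` I"
    then obtain i where i: "i \<in> I" "y = x i"
      by blast
    have "poly W y = 0"
      using i I(1) by (auto simp: W_def poly_prod)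
    moreover have "poly (\<Sum>l\<in>I. L l) y = poly (L i) y"
    proof -
      have "(\<Sum>l\<in>I. poly (L l) y) = (\<Sum>l\<in>{i}. poly (L l) y)"
      proof (rule sum.mono_neutral_right)
        show "\<forall>l\<in>I - {i}. poly (L l) y = 0"
          using i I(1) by (auto simp: L_def poly_prod)
      qed (use i I in auto)
      then show ?thesis
        by (simp add: poly_sum)
    qed
    moreover have "poly (L i) y = poly p y"
      using i I by (auto simp: L_def poly_prod inj_on_def)
    ultimately show "poly (p - smult (coeff p r) W) y = poly (\<Sum>i\<in>I. L i) y"
      by simp
  qed
  then have "p = smult (coeff p r) W + (\<Sum>i\<in>I. L i)"
    by (simp add: algebra_simps)
  then have "poly p z = coeff p r * poly W z + (\<Sum>i\<in>I. poly (L i) z)"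
    by (metis poly_add poly_smult poly_sum)
  then show ?thesis
    by (simp add: W_def L_def poly_prod r_def prod_dividef mult.commute)
qed

lemma curve_Lagrange:
  fixes b :: "nat \<Rightarrow> 'a ^ 'n"
  assumes I: "finite I" "inj_on x I" "card I = r"
  shows "curve r b z = (\<Prod>i\<in>I. z - x i) *s b r + (\<Sum>i\<in>I. (\<Prod>j\<in>I - {i}. (z - x j) / (x i - x j)) *s curve r b (x i))"
proof -
  have "curve r b z $ m = ((\<Prod>i\<in>I. z - x i) *s b r + (\<Sum>i\<in>I. (\<Prod>j\<in>I - {i}. (z - x j) / (x i - x j)) *s curve r b (x i))) $ m" for m
  proof -
    define p where "p = (\<Sum>i\<le>r. monom (b i $ m) i)"
    have p: "poly p y = curve r b y $ m" for y
      by (simp add: p_def poly_sum poly_monom curve_def mult.commute)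
    have "coeff p r = b r $ m"
      by (simp add: p_def coeff_sum)
    moreover have "degree p \<le> r"
      unfolding p_def by (intro degree_sum_le) (auto intro: order_trans[OF degree_monom_le])
    ultimately show ?thesis
      using Lagrange_poly[OF I(1,2), of p z] I(3) by (simp add: p mult.commute)
  qed
  then show ?thesis
    by (simp add: vec_eq_iff)
qed

text \<open>Together with infinity there are d + 2 common points. They are dependent on the curve of
  degree \<open>d\<close>, by interpolation, but independent on a curve of dimension r > d.\<close>

lemma common_points_degree_le:
  fixes b b' :: "nat \<Rightarrow> 'a ^ 'n"
  assumes b: "nrc_frame q r b" and inf: "b' d = l *s b r"
    and I: "finite I" "inj_on x I" "inj_on y I" "card I = d + 1"
    and pts: "\<And>i. i \<in> I \<Longrightarrow> m i \<noteq> 0 \<and> curve d b' (y i) = m i *s curve r b (x i)"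
  shows "r \<le> d"
proof (rule ccontr)
  assume "\<not> r \<le> d"
  then have dr: "card I \<le> r"
    using I(4) by simp
  obtain u where u: "u \<in> I"
    using I by fastforce
  define J where "J = I - {u}"
  have J: "finite J" "inj_on y J" "card J = d" "u \<notin> J" "I = insert u J"
    using I u by (auto simp: J_def card_Diff_singleton intro: inj_on_subset)
  define w where "w i = (\<Prod>j\<in>J - {i}. (y u - y j) / (y i - y j))" for i
  have "curve d b' (y u) = (\<Prod>i\<in>J. y u - y i) *s b' d + (\<Sum>i\<in>J. w i *s curve d b' (y i))"
    unfolding w_def by (rule curve_Lagrange[OF J(1-3)])
  moreover have "(\<Sum>i\<in>J. w i *s curve d b' (y i)) = (\<Sum>i\<in>J. (w i * m i) *s curve r b (x i))"
    using pts J(5) by (intro sum.cong) auto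
  ultimately have eq: "m u *s curve r b (x u) = (\<Prod>i\<in>J. y u - y i) *s (l *s b r) + (\<Sum>i\<in>J. (w i * m i) *s curve r b (x i))"
    using pts[OF u] inf by simp
  define k where "k i = (if i = u then m u else - (w i * m i))" for i
  have "(\<Sum>i\<in>I. k i *s curve r b (x i)) + (- ((\<Prod>i\<in>J. y u - y i) * l)) *s b r = 0"
  proof -
    have "(\<Sum>i\<in>J. k i *s curve r b (x i)) = (\<Sum>i\<in>J. - ((w i * m i) *s curve r b (x i)))"
      using J(4) by (intro sum.cong) (auto simp: k_def vec_eq_iff)
    then show ?thesis
      unfolding J(5) using J(1,4) by (simp add: k_def eq sum_negf vec_eq_iff)
  qed
  then have "k u = 0"
    using curve_independent(1)[OF b I(1,2) dr] u by blast
  then show False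
    using pts[OF u] by (simp add: k_def)
qed

text \<open>Each of two spare points \<open>u\<close>, \<open>v\<close> is expressed in both
  parametrizations by the same r points and the point at infinity. Comparing coefficients shows that
  \<open>y\<close> is an affine function of \<open>x\<close>, of slope \<open>R\<close>;
  interpolation extends this to all parameters.\<close>

lemma common_points_projectivity:
  fixes b b' :: "nat \<Rightarrow> 'a ^ 'n"
  assumes b: "nrc_frame q r b" and inf: "b' r = l *s b r" "l \<noteq> 0"
    and I: "finite I" "inj_on x I" "inj_on y I" "card I = r + 2"
    and pts: "\<And>i. i \<in> I \<Longrightarrow> m i \<noteq> 0 \<and> curve r b' (y i) = m i *s curve r b (x i)"
    and F: "\<And>i. i \<in> I \<Longrightarrow> x i \<in> GFq q 1 \<and> y i \<in> GFq q 1"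
  obtains \<rho> \<tau> k where "\<rho> \<in> GFq q 1" "\<tau> \<in> GFq q 1" "\<rho> \<noteq> 0" "k \<noteq> 0"
    "\<And>z. curve r b' (\<rho> * z + \<tau>) = k *s curve r b z"
proof -
  obtain u where u: "u \<in> I"
    using I(4) by fastforce
  then have "card (I - {u}) = r + 1"
    using I by (simp add: card_Diff_singleton)
  then have "I - {u} \<noteq> {}"
    by (metis card.empty add_is_0 one_neq_zero)
  then obtain v where "v \<in> I - {u}"
    by blast
  then have uv: "u \<in> I" "v \<in> I" "u \<noteq> v"
    using u by auto
  define J where "J = I - {u, v}"
  have JI: "J \<subseteq> I"
    by (auto simp: J_def)
  have J: "finite J" "inj_on y J" "inj_on x J" "card J = r" "u \<notin> J" "v \<notin> J"
    using I uv JI by (auto simp: J_def card_Diff_subset intro: inj_on_subset)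
  define W W' where "W i = (\<Prod>j\<in>J - {i}. x i - x j)" and "W' i = (\<Prod>j\<in>J - {i}. y i - y j)" for i
  have W0: "W i \<noteq> 0" "W' i \<noteq> 0" if "i \<in> J" for i
    unfolding W_def W'_def using J that by (auto simp: inj_on_def)
  define R where "R = (y u - y v) / (x u - x v)"
  have xuv: "x u \<noteq> x v" "y u \<noteq> y v"
    using I(2,3) uv by (auto simp: inj_on_def)
  have R0: "R \<noteq> 0"
    using xuv by (simp add: R_def)
  \<comment> \<open>Comparing the coefficients at node \<open>i\<close> and at infinity eliminates
    \<open>m t\<close>. The factors \<open>l * W' i\<close> and \<open>m i * W i\<close> do not
    depend on \<open>t\<close>, so the two choices of \<open>t\<close> can be subtracted.\<close>
  have rel: "(y t - y i) * (l * W' i) = (m i * W i) * (x t - x i)" if t: "t \<in> {u, v}" and i: "i \<in> J" for t i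
  proof -
    have tI: "t \<in> I" "t \<notin> J"
      using t uv J by auto
    have nx: "x t - x j \<noteq> 0" and ny: "y t - y j \<noteq> 0" if jJ: "j \<in> J" for j
    proof -
      have "t \<noteq> j" "j \<in> I"
        using tI(2) jJ JI by auto
      then show "x t - x j \<noteq> 0" "y t - y j \<noteq> 0"
        using inj_on_eq_iff[OF I(2) tI(1), of j] inj_on_eq_iff[OF I(3) tI(1), of j] by auto
    qed
    define w w' where "w i = (\<Prod>j\<in>J - {i}. (x t - x j) / (x i - x j))" and "w' i = (\<Prod>j\<in>J - {i}. (y t - y j) / (y i - y j))" for i
    have e1: "curve r b (x t) = (\<Prod>i\<in>J. x t - x i) *s b r + (\<Sum>i\<in>J. w i *s curve r b (x i))"
      unfolding w_def by (rule curve_Lagrange[OF J(1,3,4)])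
    have "curve r b' (y t) = (\<Prod>i\<in>J. y t - y i) *s b' r + (\<Sum>i\<in>J. w' i *s curve r b' (y i))"
      unfolding w'_def by (rule curve_Lagrange[OF J(1,2,4)])
    moreover have "(\<Sum>i\<in>J. w' i *s curve r b' (y i)) = (\<Sum>i\<in>J. (w' i * m i) *s curve r b (x i))"
      using pts JI by (intro sum.cong) auto
    ultimately have e2: "m t *s curve r b (x t) = ((\<Prod>i\<in>J. y t - y i) * l) *s b r + (\<Sum>i\<in>J. (w' i * m i) *s curve r b (x i))"
      using pts[OF tI(1)] inf by simp
    have "(\<Sum>i\<in>J. (w' i * m i - m t * w i) *s curve r b (x i)) + ((\<Prod>i\<in>J. y t - y i) * l - m t * (\<Prod>i\<in>J. x t - x i)) *s b r
      = (((\<Prod>i\<in>J. y t - y i) * l) *s b r + (\<Sum>i\<in>J. (w' i * m i) *s curve r b (x i)))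
      - m t *s ((\<Prod>i\<in>J. x t - x i) *s b r + (\<Sum>i\<in>J. w i *s curve r b (x i)))"
      by (simp add: vec_eq_iff sum_distrib_left sum_subtractf left_diff_distrib algebra_simps)
    also have "\<dots> = 0"
      using e1 e2 by simp
    finally have z: "(\<Sum>i\<in>J. (w' i * m i - m t * w i) *s curve r b (x i)) + ((\<Prod>i\<in>J. y t - y i) * l - m t * (\<Prod>i\<in>J. x t - x i)) *s b r = 0" .
    have "card J \<le> r"
      using J by simp
    note ind = curve_independent[OF b J(1,3) this z]
    have 1: "(\<Prod>i\<in>J. y t - y i) * l = m t * (\<Prod>i\<in>J. x t - x i)"
      using ind(2) by simp
    have 2: "w' i * m i = m t * w i"
      using ind(1)[OF i] by simp
    define p p' where "p = (\<Prod>j\<in>J - {i}. x t - x j)" and "p' = (\<Prod>j\<in>J - {i}. y t - y j)"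
    have P: "(\<Prod>i\<in>J. x t - x i) = (x t - x i) * p" "(\<Prod>i\<in>J. y t - y i) = (y t - y i) * p'"
      unfolding p_def p'_def by (rule prod.remove[OF J(1) i])+
    have ww: "w i = p / W i" "w' i = p' / W' i"
      by (simp_all add: w_def w'_def p_def p'_def W_def W'_def prod_dividef)
    have p0: "p \<noteq> 0" "p' \<noteq> 0"
      using nx ny J(1) by (auto simp: p_def p'_def)
    have mt: "m t \<noteq> 0"
      using pts[OF tI(1)] by simp
    have 2: "p' * m i * W i = m t * p * W' i"
      using 2 W0[OF i] by (simp add: ww field_simps)
    have "(y t - y i) * (l * W' i) * (p' * (m t * p)) = ((y t - y i) * p' * l) * (m t * p * W' i)"
      by (simp add: algebra_simps)
    also have "\<dots> = (m t * ((x t - x i) * p)) * (p' * m i * W i)"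
      using 1 2 by (simp only: P)
    also have "\<dots> = (m i * W i) * (x t - x i) * (p' * (m t * p))"
      by (simp add: algebra_simps)
    finally show ?thesis
      using p0 mt by simp
  qed
  have Rrel: "m i * W i = R * (l * W' i)" if i: "i \<in> J" for i
  proof -
    have "(y u - y v) * (l * W' i) = (y u - y i) * (l * W' i) - (y v - y i) * (l * W' i)"
      by (simp add: algebra_simps)
    also have "\<dots> = (m i * W i) * (x u - x i) - (m i * W i) * (x v - x i)"
      using rel[OF _ i, of u] rel[OF _ i, of v] by simp
    finally have "(y u - y v) * (l * W' i) = (m i * W i) * (x u - x v)"
      by (simp add: algebra_simps)
    then show ?thesis
      using xuv by (simp add: R_def field_simps)
  qed
  define T where "T = y u - R * x u"
  have yx: "y i = R * x i + T" if i: "i \<in> J" for i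
  proof -
    have "(y u - y i) * (l * W' i) = (R * (l * W' i)) * (x u - x i)"
      using rel[OF insertI1 i] by (simp only: Rrel[OF i])
    then have "(y u - y i) * (l * W' i) = (R * (x u - x i)) * (l * W' i)"
      by (simp only: mult_ac)
    then have "y u - y i = R * (x u - x i)"
      using inf(2) W0[OF i] by simp
    then show ?thesis
      by (simp add: T_def algebra_simps)
  qed
  have "curve r b' (R * z + T) = (R ^ r * l) *s curve r b z" for z
  proof -
    have d: "(R * z + T) - y i = R * (z - x i)" if "i \<in> J" for i
      using yx[OF that] by (simp add: algebra_simps)
    have e1: "curve r b z = (\<Prod>i\<in>J. z - x i) *s b r + (\<Sum>i\<in>J. (\<Prod>j\<in>J - {i}. (z - x j) / (x i - x j)) *s curve r b (x i))"
      by (rule curve_Lagrange[OF J(1,3,4)])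
    have "(\<Prod>i\<in>J. (R * z + T) - y i) = (\<Prod>i\<in>J. R * (z - x i))"
      by (intro prod.cong refl d)
    then have P: "(\<Prod>i\<in>J. (R * z + T) - y i) = R ^ r * (\<Prod>i\<in>J. z - x i)"
      using J(4) by (simp add: prod.distrib)
    have S: "(\<Prod>j\<in>J - {i}. ((R * z + T) - y j) / (y i - y j)) * m i = R ^ r * l * (\<Prod>j\<in>J - {i}. (z - x j) / (x i - x j))"
      if i: "i \<in> J" for i
    proof -
      have "card (J - {i}) = r - 1"
        using J i by (simp add: card_Diff_singleton)
      moreover have "(\<Prod>j\<in>J - {i}. (R * z + T) - y j) = (\<Prod>j\<in>J - {i}. R * (z - x j))"
        by (intro prod.cong refl d) auto
      ultimately have n: "(\<Prod>j\<in>J - {i}. (R * z + T) - y j) = R ^ (r - 1) * (\<Prod>j\<in>J - {i}. z - x j)"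
        by (simp add: prod.distrib)
      have rp: "R ^ r = R ^ (r - 1) * R"
        using J i by (metis card_gt_0_iff empty_iff power_minus_mult)
      have mi: "m i = R * (l * W' i) / W i"
        using Rrel[OF i] W0[OF i] by (simp add: field_simps)
      show ?thesis
        using W0[OF i] by (simp add: prod_dividef n rp mi flip: W_def W'_def)
    qed
    have "curve r b' (R * z + T) = (\<Prod>i\<in>J. (R * z + T) - y i) *s b' r +
        (\<Sum>i\<in>J. (\<Prod>j\<in>J - {i}. ((R * z + T) - y j) / (y i - y j)) *s curve r b' (y i))"
      by (rule curve_Lagrange[OF J(1,2,4)])
    also have "(\<Sum>i\<in>J. (\<Prod>j\<in>J - {i}. ((R * z + T) - y j) / (y i - y j)) *s curve r b' (y i))
      = (\<Sum>i\<in>J. (R ^ r * l * (\<Prod>j\<in>J - {i}. (z - x j) / (x i - x j))) *s curve r b (x i))"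
    proof (rule sum.cong[OF refl])
      fix i assume i: "i \<in> J"
      then have "curve r b' (y i) = m i *s curve r b (x i)"
        using pts JI by blast
      then show "(\<Prod>j\<in>J - {i}. ((R * z + T) - y j) / (y i - y j)) *s curve r b' (y i)
        = (R ^ r * l * (\<Prod>j\<in>J - {i}. (z - x j) / (x i - x j))) *s curve r b (x i)"
        by (simp add: S[OF i])
    qed
    finally show ?thesis
      unfolding P e1 inf(1) by (simp add: vec_eq_iff sum_distrib_left algebra_simps)
  qed
  moreover have "R \<in> GFq q 1" "T \<in> GFq q 1"
    unfolding T_def R_def using F uv by (auto intro!: GFq_closed)
  ultimately show ?thesis
    using that[of R T "R ^ r * l"] R0 inf(2) by simp
qed

text \<open>The binomial theorem gives the new frame. It is triangular over the old one with ones on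
  the diagonal, hence independent by strong induction.\<close>

lemma translate_frame:
  fixes b :: "nat \<Rightarrow> 'a ^ 'n"
  assumes b: "nrc_frame q r b" and x0: "x0 \<in> GFq q 1"
  obtains b1 where "nrc_frame q r b1" "b1 r = b r" "\<And>z. curve r b1 z = curve r b (z + x0)"
proof -
  define b1 where "b1 k = (\<Sum>i\<le>r. (of_nat (i choose k) * x0 ^ (i - k)) *s b i)" for k
  have "nrc_frame q r b1"
  proof (rule frameI)
    fix k
    show "b1 k \<in> rat_vecs q 1"
      unfolding b1_def using x0 frame_rat[OF b] by (auto intro!: rat_vecs_sum rat_vecs_scale GFq_closed GFq_of_nat)
  next
    fix k and i assume 0: "(\<Sum>l\<le>r. k l *s b1 l) = 0" and "i \<le> r"
    have "(\<Sum>l\<le>r. k l *s b1 l) = (\<Sum>l\<le>r. \<Sum>i\<le>r. (k l * (of_nat (i choose l) * x0 ^ (i - l))) *s b i)"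
      by (simp add: b1_def vec_eq_iff sum_distrib_left mult.assoc)
    also have "\<dots> = (\<Sum>i\<le>r. \<Sum>l\<le>r. (k l * (of_nat (i choose l) * x0 ^ (i - l))) *s b i)"
      by (rule sum.swap)
    also have "\<dots> = (\<Sum>i\<le>r. (\<Sum>l\<le>r. k l * (of_nat (i choose l) * x0 ^ (i - l))) *s b i)"
      by (simp add: vec_eq_iff sum_distrib_right)
    finally have "(\<Sum>i\<le>r. (\<Sum>l\<le>r. k l * (of_nat (i choose l) * x0 ^ (i - l))) *s b i) = 0"
      using 0 by simp
    then have co: "(\<Sum>l\<le>r. k l * (of_nat (i choose l) * x0 ^ (i - l))) = 0" if "i \<le> r" for i
      by (rule frame_independent[OF b, where k = "\<lambda>i. \<Sum>l\<le>r. k l * (of_nat (i choose l) * x0 ^ (i - l))"]) (rule that)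
    show "k i = 0"
      using \<open>i \<le> r\<close>
    proof (induction i rule: less_induct)
      case (less i)
      have "(\<Sum>l\<le>r. k l * (of_nat (i choose l) * x0 ^ (i - l))) = (\<Sum>l\<in>{i}. k l * (of_nat (i choose l) * x0 ^ (i - l)))"
      proof (rule sum.mono_neutral_right)
        show "\<forall>l\<in>{..r} - {i}. k l * (of_nat (i choose l) * x0 ^ (i - l)) = 0"
        proof
          fix l assume l: "l \<in> {..r} - {i}"
          then have "l < i \<or> i < l"
            by auto
          then show "k l * (of_nat (i choose l) * x0 ^ (i - l)) = 0"
            using less.IH[of l] less.prems by (auto simp: binomial_eq_0)
        qed
      qed (use less.prems in auto)
      then show ?case
        using co[OF less.prems] by simp
    qed
  qed
  moreover have "b1 r = b r"
  proof -
    have "b1 r = (\<Sum>i\<in>{r}. (of_nat (i choose r) * x0 ^ (i - r)) *s b i)"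
      unfolding b1_def by (rule sum.mono_neutral_right) (auto simp: binomial_eq_0)
    then show ?thesis
      by simp
  qed
  moreover have "curve r b1 z = curve r b (z + x0)" for z
  proof -
    have "curve r b1 z = (\<Sum>l\<le>r. \<Sum>i\<le>r. (z ^ l * (of_nat (i choose l) * x0 ^ (i - l))) *s b i)"
      by (simp add: curve_def b1_def vec_eq_iff sum_distrib_left mult.assoc)
    also have "\<dots> = (\<Sum>i\<le>r. \<Sum>l\<le>r. (z ^ l * (of_nat (i choose l) * x0 ^ (i - l))) *s b i)"
      by (rule sum.swap)
    also have "\<dots> = (\<Sum>i\<le>r. (z + x0) ^ i *s b i)"
    proof (rule sum.cong[OF refl])
      fix i assume i: "i \<in> {..r}"
      have "(\<Sum>l\<le>r. z ^ l * (of_nat (i choose l) * x0 ^ (i - l))) = (\<Sum>l\<le>i. z ^ l * (of_nat (i choose l) * x0 ^ (i - l)))"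
        using i by (intro sum.mono_neutral_right) (auto simp: not_le binomial_eq_0)
      also have "\<dots> = (z + x0) ^ i"
        by (simp only: binomial_ring mult_ac)
      finally have "(\<Sum>l\<le>r. z ^ l * (of_nat (i choose l) * x0 ^ (i - l))) *s b i = (z + x0) ^ i *s b i"
        by simp
      then show "(\<Sum>l\<le>r. (z ^ l * (of_nat (i choose l) * x0 ^ (i - l))) *s b i) = (z + x0) ^ i *s b i"
        by (simp add: vec_eq_iff sum_distrib_right)
    qed
    finally show ?thesis
      by (simp add: curve_def)
  qed
  ultimately show ?thesis
    by (rule that)
qed

lemma reverse_frame:
  fixes b :: "nat \<Rightarrow> 'a ^ 'n"
  assumes b: "nrc_frame q r b"
  shows "nrc_frame q r (\<lambda>i. b (r - i))" "z \<noteq> 0 \<Longrightarrow> curve r (\<lambda>i. b (r - i)) z = z ^ r *s curve r b (inverse z)"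
proof -
  have bij: "bij_betw (\<lambda>i. r - i) {..r} {..r}"
    by (rule bij_betwI[where g = "\<lambda>i. r - i"]) auto
  show "nrc_frame q r (\<lambda>i. b (r - i))"
  proof (rule frameI)
    fix k and i assume 0: "(\<Sum>l\<le>r. k l *s b (r - l)) = 0" and i: "i \<le> r"
    have "(\<Sum>l\<le>r. k (r - l) *s b l) = (\<Sum>l\<le>r. k (r - (r - l)) *s b (r - l))"
      by (rule sum.reindex_bij_betw[OF bij, symmetric])
    also have "\<dots> = 0"
      using 0 by simp
    finally have "k (r - (r - i)) = 0"
      by (rule frame_independent[OF b, where k = "\<lambda>l. k (r - l)"]) simp
    then show "k i = 0"
      using i by simp
  qed (use frame_rat[OF b] in auto)
  show "curve r (\<lambda>i. b (r - i)) z = z ^ r *s curve r b (inverse z)" if z: "z \<noteq> 0"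
  proof -
    have "curve r (\<lambda>i. b (r - i)) z = (\<Sum>l\<le>r. z ^ (r - l) *s b (r - (r - l)))"
      unfolding curve_def by (rule sum.reindex_bij_betw[OF bij, symmetric])
    also have "\<dots> = (\<Sum>l\<le>r. (z ^ r * inverse z ^ l) *s b l)"
    proof (rule sum.cong[OF refl])
      fix l assume "l \<in> {..r}"
      then have l: "l \<le> r"
        by simp
      then have "z ^ r = z ^ (r - l) * z ^ l"
        by (simp flip: power_add)
      then have "z ^ (r - l) = z ^ r * inverse z ^ l"
        using z by (simp add: power_inverse)
      then show "z ^ (r - l) *s b (r - (r - l)) = (z ^ r * inverse z ^ l) *s b l"
        using l by simp
    qed
    also have "\<dots> = z ^ r *s curve r b (inverse z)"
      by (simp add: curve_def vec_eq_iff sum_distrib_left mult.assoc)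
    finally show ?thesis .
  qed
qed

lemma curve_0: "curve r b 0 = b 0" for b :: "nat \<Rightarrow> 'a ^ 'n"
proof -
  have "curve r b 0 = (\<Sum>i\<in>{0}. 0 ^ i *s b i)"
    unfolding curve_def by (rule sum.mono_neutral_right) (auto simp: power_0_left)
  then show ?thesis
    by simp
qed

lemma nrc_points_curve: "nrc_points q r b = insert (vec.span {b r}) ((\<lambda>x. vec.span {curve r b x}) ` GFq q 1)"
  for b :: "nat \<Rightarrow> 'a ^ 'n"
  by (auto simp: nrc_points_def nrc_point_curve)

text \<open>Translation moves the parameter of the point to 0, and reversing the frame exchanges 0
  and infinity.\<close>

lemma reparametrize:
  fixes b :: "nat \<Rightarrow> 'a ^ 'n"
  assumes b: "nrc_frame q r b" and P: "P \<in> nrc_points q r b"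
  obtains b' where "nrc_frame q r b'" "nrc_points q r b' = nrc_points q r b" "vec.span {b' r} = P"
proof (cases "P = vec.span {b r}")
  case True
  then show ?thesis
    using that[of b] b by simp
next
  case False
  then obtain x0 where x0: "x0 \<in> GFq q 1" "P = vec.span {curve r b x0}"
    using P by (auto simp: nrc_points_curve)
  obtain b1 where b1: "nrc_frame q r b1" "b1 r = b r" "\<And>z. curve r b1 z = curve r b (z + x0)"
    using translate_frame[OF b x0(1)] by blast
  define b2 where "b2 i = b1 (r - i)" for i
  have b2: "nrc_frame q r b2" "\<And>z. z \<noteq> 0 \<Longrightarrow> curve r b2 z = z ^ r *s curve r b1 (inverse z)"
    unfolding b2_def by (rule reverse_frame(1)[OF b1(1)], rule reverse_frame(2)[OF b1(1)])
  have ends: "b2 r = curve r b x0" "curve r b2 0 = b r"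
    using curve_0[of r b1] curve_0[of r b2] b1 by (simp_all add: b2_def)
  have pt: "vec.span {curve r b2 z} = vec.span {curve r b (inverse z + x0)}" if "z \<noteq> 0" for z
    using b2(2)[OF that] that b1(3) by (simp add: span1_scale)
  have "nrc_points q r b2 = nrc_points q r b"
  proof (intro equalityI subsetI)
    fix Q assume "Q \<in> nrc_points q r b2"
    then consider "Q = vec.span {b2 r}" | z where "z \<in> GFq q 1" "Q = vec.span {curve r b2 z}"
      by (auto simp: nrc_points_curve)
    then show "Q \<in> nrc_points q r b"
    proof cases
      case 1
      then show ?thesis
        using x0 P ends by simp
    next
      case 2
      show ?thesis
      proof (cases "z = 0")
        case True
        then show ?thesis
          using 2 ends by (simp add: nrc_points_curve)
      next
        case False
        have "inverse z + x0 \<in> GFq q 1"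
          using 2 x0 by (intro GFq_closed)
        then show ?thesis
          using pt[OF False] 2 by (simp add: nrc_points_curve)
      qed
    qed
  next
    fix Q assume "Q \<in> nrc_points q r b"
    then consider "Q = vec.span {b r}" | z where "z \<in> GFq q 1" "Q = vec.span {curve r b z}"
      by (auto simp: nrc_points_curve)
    then show "Q \<in> nrc_points q r b2"
    proof cases
      case 1
      then have "Q = vec.span {curve r b2 0}"
        using ends by simp
      then show ?thesis
        using GFq_closed(1)[of 1] by (auto simp: nrc_points_curve)
    next
      case 2
      show ?thesis
      proof (cases "z = x0")
        case True
        then show ?thesis
          using 2 ends by (simp add: nrc_points_curve)
      next
        case False
        define y where "y = inverse (z - x0)"
        have y: "y \<in> GFq q 1" "y \<noteq> 0" "inverse y + x0 = z"
          using 2 x0 False by (auto simp: y_def intro: GFq_closed)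
        then have "Q = vec.span {curve r b2 y}"
          using pt[OF y(2)] 2 by simp
        then show ?thesis
          using y by (simp add: nrc_points_curve)
      qed
    qed
  qed
  then show ?thesis
    using that[of b2] b2(1) ends x0 by simp
qed

text \<open>One common point is moved to infinity on both curves. Of the other d + 2, already d + 1
  force r <= d, the symmetric argument gives d <= r, and r + 2 of them determine the
  parametrization.\<close>

lemma nrc_points_eqI:
  fixes b b' :: "nat \<Rightarrow> 'a ^ 'n"
  assumes b: "nrc_frame q r b" and b': "nrc_frame q d b'"
    and S: "finite S" "S \<subseteq> nrc_points q r b" "S \<subseteq> nrc_points q d b'" "d + 3 \<le> card S"
  shows "r = d" "nrc_points q r b = nrc_points q d b'"
proof -
  have "S \<noteq> {}"
    using S(4) by auto
  then obtain P0 where P0: "P0 \<in> S"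
    by blast
  obtain B where B: "nrc_frame q r B" "nrc_points q r B = nrc_points q r b" "vec.span {B r} = P0"
    using reparametrize[OF b, of P0] S P0 by blast
  obtain B' where B': "nrc_frame q d B'" "nrc_points q d B' = nrc_points q d b'" "vec.span {B' d} = P0"
    using reparametrize[OF b', of P0] S P0 by blast
  obtain l where l: "l \<noteq> 0" "B' d = l *s B r"
    using span1_eq_iff[of "B' d" "B r"] frame_nonzero[OF B'(1), of d] B(3) B'(3) by auto
  define S' where "S' = S - {P0}"
  have S': "finite S'" "d + 2 \<le> card S'"
    using S P0 by (auto simp: S'_def card_Diff_singleton)
  have "\<exists>x. x \<in> GFq q 1 \<and> P = vec.span {curve r B x}" if "P \<in> S'" for P
    using that S(2) B(2,3) by (auto simp: S'_def nrc_points_curve)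
  then obtain x where x: "\<And>P. P \<in> S' \<Longrightarrow> x P \<in> GFq q 1 \<and> P = vec.span {curve r B (x P)}"
    by metis
  have "\<exists>y. y \<in> GFq q 1 \<and> P = vec.span {curve d B' y}" if "P \<in> S'" for P
    using that S(3) B'(2,3) by (auto simp: S'_def nrc_points_curve)
  then obtain y where y: "\<And>P. P \<in> S' \<Longrightarrow> y P \<in> GFq q 1 \<and> P = vec.span {curve d B' (y P)}"
    by metis
  have xinj: "inj_on x S'"
    using x by (metis inj_onI)
  have yinj: "inj_on y S'"
    using y by (metis inj_onI)
  have "\<exists>m. m \<noteq> 0 \<and> curve d B' (y P) = m *s curve r B (x P)" if "P \<in> S'" for P
    using span1_eq_iff[of "curve d B' (y P)" "curve r B (x P)"] curve_nonzero[OF B'(1)] x[OF that] y[OF that] by simp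
  then obtain m where m: "\<And>P. P \<in> S' \<Longrightarrow> m P \<noteq> 0 \<and> curve d B' (y P) = m P *s curve r B (x P)"
    by metis
  have le1: "r \<le> d"
  proof -
    obtain I where I: "I \<subseteq> S'" "card I = d + 1"
      using obtain_subset_with_card_n[of "d + 1" S'] S' by auto
    show ?thesis
    proof (rule common_points_degree_le[where b = B and b' = B' and l = l and I = I and x = x and y = y and m = m])
      show "nrc_frame q r B" "B' d = l *s B r"
        using B(1) l(2) by simp_all
      show "finite I" "inj_on x I" "inj_on y I" "card I = d + 1"
        using I S' xinj yinj by (auto intro: finite_subset inj_on_subset)
      show "m i \<noteq> 0 \<and> curve d B' (y i) = m i *s curve r B (x i)" if "i \<in> I" for i
        using m I that by blast
    qed
  qed
  have le2: "d \<le> r"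
  proof -
    obtain I where I: "I \<subseteq> S'" "card I = r + 1"
      using obtain_subset_with_card_n[of "r + 1" S'] S' le1 by auto
    show ?thesis
    proof (rule common_points_degree_le[where b = B' and b' = B and l = "inverse l" and I = I and x = y and y = x
          and m = "\<lambda>i. inverse (m i)"])
      show "nrc_frame q d B'"
        by (rule B'(1))
      show "B r = inverse l *s B' d"
        using l by simp
      show "finite I" "inj_on y I" "inj_on x I" "card I = r + 1"
        using I S' xinj yinj by (auto intro: finite_subset inj_on_subset)
      show "inverse (m i) \<noteq> 0 \<and> curve r B (x i) = inverse (m i) *s curve d B' (y i)" if "i \<in> I" for i
        using m[of i] I that by auto
    qed
  qed
  show rd: "r = d"
    using le1 le2 by simp
  have "r + 2 \<le> card S'"
    using S'(2) rd by simp
  then obtain I where I: "I \<subseteq> S'" "card I = r + 2"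
    by (rule obtain_subset_with_card_n)
  obtain \<rho> \<tau> k where \<rho>: "\<rho> \<in> GFq q 1" "\<tau> \<in> GFq q 1" "\<rho> \<noteq> 0" "k \<noteq> 0"
    and eq: "\<And>z. curve r B' (\<rho> * z + \<tau>) = k *s curve r B z"
  proof (rule common_points_projectivity[where b = B and b' = B' and l = l and I = I and x = x and y = y and m = m and r = r])
    show "nrc_frame q r B"
      by (rule B(1))
    show "B' r = l *s B r" "l \<noteq> 0"
      using l rd by simp_all
    show "finite I" "inj_on x I" "inj_on y I" "card I = r + 2"
      using I S' xinj yinj by (auto intro: finite_subset inj_on_subset)
    show "m i \<noteq> 0 \<and> curve r B' (y i) = m i *s curve r B (x i)" if "i \<in> I" for i
      using m I that rd by blast
    show "x i \<in> GFq q 1 \<and> y i \<in> GFq q 1" if "i \<in> I" for i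
      using x y I that by blast
  qed blast
  have pt: "vec.span {curve r B' (\<rho> * z + \<tau>)} = vec.span {curve r B z}" for z
    using eq \<rho>(4) by (simp add: span1_scale)
  have "(\<lambda>x. vec.span {curve r B' x}) ` GFq q 1 = (\<lambda>x. vec.span {curve r B x}) ` GFq q 1"
  proof (intro equalityI subsetI)
    fix Q assume "Q \<in> (\<lambda>x. vec.span {curve r B' x}) ` GFq q 1"
    then obtain w where w: "w \<in> GFq q 1" "Q = vec.span {curve r B' w}"
      by blast
    define z where "z = (w - \<tau>) / \<rho>"
    have "z \<in> GFq q 1"
      unfolding z_def using w \<rho> by (intro GFq_closed)
    moreover have "w = \<rho> * z + \<tau>"
      using \<rho> by (simp add: z_def)
    ultimately show "Q \<in> (\<lambda>x. vec.span {curve r B x}) ` GFq q 1"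
      using w pt[of z] by blast
  next
    fix Q assume "Q \<in> (\<lambda>x. vec.span {curve r B x}) ` GFq q 1"
    then obtain z where z: "z \<in> GFq q 1" "Q = vec.span {curve r B z}"
      by blast
    moreover have "\<rho> * z + \<tau> \<in> GFq q 1"
      using z \<rho> by (intro GFq_closed)
    ultimately show "Q \<in> (\<lambda>x. vec.span {curve r B' x}) ` GFq q 1"
      using pt[of z] by blast
  qed
  then have "nrc_points q r B = nrc_points q r B'"
    using B(3) B'(3) rd by (simp add: nrc_points_curve)
  then show "nrc_points q r b = nrc_points q d b'"
    using B(2) B'(2) rd by simp
qed

section \<open>Cofactors of a quadratic polynomial\<close>

abbreviation lin :: "'a \<Rightarrow> 'a poly" where
  "lin x \<equiv> [:- x, 1:]"

lemma degree_cofactor_le: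
  fixes f p :: "'a poly"
  assumes "degree (f * p) \<le> n + degree f" "f \<noteq> 0"
  shows "degree p \<le> n"
  using assms by (cases "p = 0") (auto simp: degree_mult_eq)

lemma interpolate_one:
  fixes p g :: "'a poly"
  assumes "poly g x \<noteq> 0"
  obtains k p' where "p = smult k g + lin x * p'" 
proof -
  define k where "k = poly p x / poly g x"
  have "poly (p - smult k g) x = 0"
    using assms by (simp add: k_def)
  then obtain p' where "p - smult k g = lin x * p'"
    using poly_eq_0_iff_dvd by (metis dvdE)
  then have "p = smult k g + lin x * p'"
    by (simp add: algebra_simps)
  then show ?thesis
    by (rule that)
qed

lemma mult_const_poly: "p * [:k:] = smult k p" "[:k:] * p = smult k p" for p :: "'a poly"
  by simp_all

text \<open>The nodes are treated one after the other, the second on the quotient left by the first,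
  so that they may coincide.\<close>

lemma interpolate_two:
  fixes p g :: "'a poly"
  assumes "poly g x \<noteq> 0" "poly g y \<noteq> 0"
  obtains Q p' where "degree Q \<le> 1" "p = g * Q + (lin x * lin y) * p'"
proof -
  obtain k p1 where 1: "p = smult k g + lin x * p1"
    using interpolate_one[OF assms(1)] by blast
  obtain l p2 where 2: "p1 = smult l g + lin y * p2"
    using interpolate_one[OF assms(2)] by blast
  define Q where "Q = [:k:] + smult l (lin x)"
  have "degree Q \<le> 1"
    unfolding Q_def by (intro degree_add_le) (auto intro: order_trans[OF degree_smult_le])
  moreover have "p = g * Q + (lin x * lin y) * p2"
  proof -
    have gQ: "g * Q = smult k g + smult l (lin x * g)"
      by (simp only: Q_def distrib_left mult_const_poly mult_smult_right mult.commute[of g "lin x"])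
    show ?thesis
      unfolding 1 2 gQ by (simp only: distrib_left mult_smult_right add.assoc mult.assoc)
  qed
  ultimately show ?thesis
    by (rule that)
qed

text \<open>
  The spanning condition makes the coefficient vectors of the curve with factor \<open>G\<close> independent, and
  the cardinality condition leaves enough parameters at which that curve is affine.
\<close>

definition cofactor :: "'a \<Rightarrow> 'a \<Rightarrow> 'a poly \<Rightarrow> bool" where
  "cofactor x y G \<longleftrightarrow> lead_coeff G = 1 \<and> fp (lin x * lin y * G) = lin x * lin y * G \<and>
     poly G x \<noteq> 0 \<and> poly G y \<noteq> 0 \<and>
     (\<forall>z. poly G z = 0 \<longrightarrow> z \<in> {x ^ q, (x ^ q) ^ q, y ^ q, (y ^ q) ^ q}) \<and>
     card {z \<in> GFq q 1. z = x \<or> z = y} + degree G \<le> 4 \<and>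
     (\<forall>p. degree p \<le> degree G + 2 \<longrightarrow>
        (\<exists>Q0 Q1 Q2. degree Q0 \<le> 2 \<and> degree Q1 \<le> 2 \<and> degree Q2 \<le> 2 \<and>
           p = G * Q0 + fp G * Q1 + fp (fp G) * Q2))"

lemma cofactor_commute: "cofactor x y G \<longleftrightarrow> cofactor y x G"
proof -
  have "{z \<in> GFq q 1. z = x \<or> z = y} = {z \<in> GFq q 1. z = y \<or> z = x}"
    by blast
  moreover have "{x ^ q, (x ^ q) ^ q, y ^ q, (y ^ q) ^ q} = {y ^ q, (y ^ q) ^ q, x ^ q, (x ^ q) ^ q}"
    by blast
  ultimately show ?thesis
    unfolding cofactor_def by (simp only: mult.commute[of "lin x"] conj_ac)
qed

text \<open>Frobenius permutes the two roots, so the quadratic polynomial is already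
  rational.\<close>

lemma cofactor_rational:
  assumes "lin (x ^ q) * lin (y ^ q) = lin x * lin y"
  shows "cofactor x y 1"
  unfolding cofactor_def
proof (intro conjI allI impI)
  show "fp (lin x * lin y * 1) = lin x * lin y * 1"
    using assms by (simp only: mult_1_right fp_mult fp_linear)
  have "card {z \<in> GFq q 1. z = x \<or> z = y} \<le> card {x, y}"
    by (intro card_mono) auto
  also have "\<dots> \<le> 2"
    by (simp add: card_insert_if)
  finally show "card {z \<in> GFq q 1. z = x \<or> z = y} + degree (1 :: 'a poly) \<le> 4"
    by simp
  fix p :: "'a poly" assume "degree p \<le> degree (1 :: 'a poly) + 2"
  then show "\<exists>Q0 Q1 Q2. degree Q0 \<le> 2 \<and> degree Q1 \<le> 2 \<and> degree Q2 \<le> 2 \<and> p = 1 * Q0 + fp 1 * Q1 + fp (fp 1) * Q2"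
    by (intro exI[of _ p] exI[of _ 0]) simp
qed auto

lemma degree_lin_mult: "p \<noteq> 0 \<Longrightarrow> degree (lin x * p) = degree p + 1"
  by (subst degree_mult_eq) auto

lemma degree_lin_cofactor_le:
  assumes "degree (lin x * p) \<le> n + 1"
  shows "degree p \<le> n"
proof (cases "p = 0")
  case False
  then show ?thesis
    using assms by (simp only: degree_lin_mult[OF False] add_le_cancel_right)
qed simp

lemma lead_coeff_lin_mult: "lead_coeff (lin x * p) = lead_coeff p"
  by (subst lead_coeff_mult) simp

lemma degree_lin2: "degree (lin x * lin y) = 2"
  by (subst degree_lin_mult) auto

lemma poly_lin2_eq_0: "poly (lin x * lin y) z = 0 \<longleftrightarrow> z = x \<or> z = y"
  by (subst poly_mult) simp

text \<open>Only the two conjugates of \<open>y\<close> are missing from a rational polynomial.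
  \<open>G\<close> and its conjugates are the products of two of three linear factors; the value at
  \<open>y\<close> is split off with \<open>G\<close>, then the value at \<open>y1\<close> with
  \<open>lin y2\<close>.\<close>

lemma cofactor_half_rational:
  assumes x: "x ^ q = x" and y: "y ^ q \<noteq> y" "((y ^ q) ^ q) ^ q = y"
  shows "cofactor x y (lin (y ^ q) * lin ((y ^ q) ^ q))"
proof -
  define y1 y2 where "y1 = y ^ q" and "y2 = y1 ^ q"
  have y3: "y2 ^ q = y"
    using y by (simp add: y1_def y2_def)
  have ne: "y1 \<noteq> y" "y2 \<noteq> y1" "y2 \<noteq> y"
    using y(1) y3 q_inj by (auto simp: y1_def y2_def)
  have xne: "x \<noteq> y1" "x \<noteq> y2"
    using x y3 ne by (auto simp: y1_def y2_def)
  define G where "G = lin y1 * lin y2"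
  have fG: "fp G = lin y2 * lin y" "fp (fp G) = lin y * lin y1"
    using y3 by (simp_all only: G_def fp_mult fp_linear flip: y1_def y2_def)
  have degG: "degree G = 2"
    unfolding G_def by (rule degree_lin2)
  have "cofactor x y G"
    unfolding cofactor_def
  proof (intro conjI allI impI)
    show "lead_coeff G = 1"
      unfolding G_def by (subst lead_coeff_lin_mult) simp
    show "fp (lin x * lin y * G) = lin x * lin y * G"
      unfolding fp_mult fG fp_linear x by (simp only: G_def mult_ac flip: y1_def)
    show "poly G x \<noteq> 0" "poly G y \<noteq> 0"
      using ne xne by (auto simp only: G_def poly_lin2_eq_0)
    fix z assume "poly G z = 0"
    then show "z \<in> {x ^ q, (x ^ q) ^ q, y ^ q, (y ^ q) ^ q}"
      by (auto simp only: G_def poly_lin2_eq_0 y1_def y2_def)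
  next
    have "y \<notin> GFq q 1"
      using y(1) by (simp add: GFq_iff)
    then have "{z \<in> GFq q 1. z = x \<or> z = y} \<subseteq> {x}"
      by auto
    then have "card {z \<in> GFq q 1. z = x \<or> z = y} \<le> 1"
      using card_mono[of "{x}" "{z \<in> GFq q 1. z = x \<or> z = y}"] by simp
    then show "card {z \<in> GFq q 1. z = x \<or> z = y} + degree G \<le> 4"
      using degG by simp
  next
    fix p :: "'a poly" assume p: "degree p \<le> degree G + 2"
    obtain k p2 where 1: "p = smult k G + lin y * p2"
      using interpolate_one[of G y p] ne by (auto simp only: G_def poly_lin2_eq_0)
    have "degree (lin y * p2) = degree (p - smult k G)"
      by (simp add: 1)
    also have "\<dots> \<le> 3 + 1"
      using p degG by (intro degree_diff_le) (auto intro: order_trans[OF degree_smult_le])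
    finally have d2: "degree p2 \<le> 3"
      by (rule degree_lin_cofactor_le)
    obtain l p3 where 2: "p2 = smult l (lin y2) + lin y1 * p3"
      using interpolate_one[of "lin y2" y1 p2] ne by auto
    have "degree (lin y1 * p3) = degree (p2 - smult l (lin y2))"
      by (simp add: 2)
    also have "\<dots> \<le> 2 + 1"
      using d2 by (intro degree_diff_le) (auto intro: order_trans[OF degree_smult_le])
    finally have d3: "degree p3 \<le> 2"
      by (rule degree_lin_cofactor_le)
    have "p = G * [:k:] + fp G * [:l:] + fp (fp G) * p3"
      unfolding 1 2 fG(2) unfolding fG(1) by (simp only: mult_const_poly distrib_left mult_smult_right add.assoc mult_ac)
    then show "\<exists>Q0 Q1 Q2. degree Q0 \<le> 2 \<and> degree Q1 \<le> 2 \<and> degree Q2 \<le> 2 \<and> p = G * Q0 + fp G * Q1 + fp (fp G) * Q2"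
      using d3 by (intro exI[of _ "[:k:]"] exI[of _ "[:l:]"] exI[of _ p3]) simp
  qed
  then show ?thesis
    by (simp add: G_def y1_def y2_def)
qed

text \<open>The roots are two of three conjugates, and the factor of the third one completes a
  rational polynomial.\<close>

lemma cofactor_conjugate:
  assumes x: "x ^ q \<noteq> x" "((x ^ q) ^ q) ^ q = x"
  shows "cofactor x (x ^ q) (lin ((x ^ q) ^ q))"
proof -
  define x1 x2 where "x1 = x ^ q" and "x2 = x1 ^ q"
  have x3: "x2 ^ q = x"
    using x by (simp add: x1_def x2_def)
  have ne: "x1 \<noteq> x" "x2 \<noteq> x1" "x2 \<noteq> x"
    using x(1) x3 q_inj by (auto simp: x1_def x2_def)
  have fG: "fp (lin x2) = lin x" "fp (fp (lin x2)) = lin x1"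
    using x3 by (simp_all only: fp_linear flip: x1_def)
  have "cofactor x x1 (lin x2)"
    unfolding cofactor_def
  proof (intro conjI allI impI)
    have l1: "fp (lin x) = lin x1" "fp (lin x1) = lin x2"
      by (simp_all only: fp_linear x1_def x2_def)
    show "fp (lin x * lin x1 * lin x2) = lin x * lin x1 * lin x2"
      unfolding fp_mult fG(1) l1 by (simp only: mult_ac)
    show "poly (lin x2) x \<noteq> 0" "poly (lin x2) x1 \<noteq> 0"
      using ne by auto
    fix z assume "poly (lin x2) z = 0"
    then show "z \<in> {x ^ q, (x ^ q) ^ q, x1 ^ q, (x1 ^ q) ^ q}"
      by (auto simp: x1_def x2_def)
  next
    have "x \<notin> GFq q 1" "x1 \<notin> GFq q 1"
      using ne by (auto simp: GFq_iff x1_def x2_def)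
    then have e: "{z \<in> GFq q 1. z = x \<or> z = x1} = {}"
      by auto
    show "card {z \<in> GFq q 1. z = x \<or> z = x1} + degree (lin x2) \<le> 4"
      unfolding e by simp
  next
    fix p :: "'a poly" assume p: "degree p \<le> degree (lin x2) + 2"
    obtain k p2 where 1: "p = smult k (lin x) + lin x2 * p2"
      using interpolate_one[of "lin x" x2 p] ne by auto
    have "degree (lin x2 * p2) = degree (p - smult k (lin x))"
      by (simp add: 1)
    also have "\<dots> \<le> 2 + 1"
      using p by (intro degree_diff_le) (auto intro: order_trans[OF degree_smult_le])
    finally have d2: "degree p2 \<le> 2"
      by (rule degree_lin_cofactor_le)
    have "p = lin x2 * p2 + fp (lin x2) * [:k:] + fp (fp (lin x2)) * 0"
      unfolding 1 fG(2) unfolding fG(1) by (simp only: mult_const_poly mult_zero_right add_0_left add_0_right add_ac)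
    then show "\<exists>Q0 Q1 Q2. degree Q0 \<le> 2 \<and> degree Q1 \<le> 2 \<and> degree Q2 \<le> 2 \<and> p = lin x2 * Q0 + fp (lin x2) * Q1 + fp (fp (lin x2)) * Q2"
      using d2 by (intro exI[of _ p2] exI[of _ "[:k:]"] exI[of _ 0]) simp
  qed simp
  then show ?thesis
    by (simp add: x1_def x2_def)
qed

text \<open>Nothing cancels: \<open>G\<close> is the product of both conjugates of the quadratic.
  Reduction modulo the quadratic by means of \<open>G\<close>, then modulo its conjugate
  \<open>f1\<close> by means of \<open>f2\<close>, leaves a last factor of degree at most 2. Equal
  roots are included, as for a conic touching the line at infinity.\<close>

lemma cofactor_generic:
  assumes n: "x ^ q \<noteq> x" "y ^ q \<noteq> y" "x ^ q \<noteq> y" "y ^ q \<noteq> x"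
    and z: "((x ^ q) ^ q) ^ q = x \<and> ((y ^ q) ^ q) ^ q = y \<or> ((x ^ q) ^ q) ^ q = y \<and> ((y ^ q) ^ q) ^ q = x"
  shows "cofactor x y (lin (x ^ q) * lin (y ^ q) * (lin ((x ^ q) ^ q) * lin ((y ^ q) ^ q)))"
proof -
  define x1 x2 y1 y2 where "x1 = x ^ q" and "x2 = x1 ^ q" and "y1 = y ^ q" and "y2 = y1 ^ q"
  note defs = x1_def x2_def y1_def y2_def
  have z3: "x2 ^ q = x \<and> y2 ^ q = y \<or> x2 ^ q = y \<and> y2 ^ q = x"
    using z by (simp add: defs)
  have ne0: "x1 \<noteq> x" "y1 \<noteq> y" "x1 \<noteq> y" "y1 \<noteq> x"
    using n by (simp_all add: defs)
  have ne1: "x2 \<noteq> x1" "y2 \<noteq> y1" "x2 \<noteq> y1" "y2 \<noteq> x1"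
    using ne0 q_inj by (auto simp: defs)
  have ne2: "x2 \<noteq> x" "y2 \<noteq> y" "x2 \<noteq> y" "y2 \<noteq> x"
    using z3 ne0 by (auto simp: x1_def y1_def)
  define f f1 f2 where "f = lin x * lin y" and "f1 = lin x1 * lin y1" and "f2 = lin x2 * lin y2"
  have ff: "fp f = f1" "fp f1 = f2" "fp f2 = f"
  proof -
    show "fp f = f1" "fp f1 = f2"
      by (simp_all only: f_def f1_def f2_def fp_mult fp_linear defs)
    have "fp f2 = lin (x2 ^ q) * lin (y2 ^ q)"
      by (simp only: f2_def fp_mult fp_linear)
    then show "fp f2 = f"
      using z3 by (auto simp only: f_def mult.commute)
  qed
  have nz: "f \<noteq> 0" "f1 \<noteq> 0" "f2 \<noteq> 0"
    by (auto simp: f_def f1_def f2_def)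
  have deg: "degree f = 2" "degree f1 = 2" "degree f2 = 2"
    unfolding f_def f1_def f2_def by (rule degree_lin2)+
  define G where "G = f1 * f2"
  have fG: "fp G = f2 * f" "fp (fp G) = f * f1"
    by (simp_all only: G_def fp_mult ff)
  have degG: "degree G = 4"
    unfolding G_def by (simp add: degree_mult_eq nz deg)
  have pG: "poly f1 x \<noteq> 0" "poly f1 y \<noteq> 0" "poly f2 x \<noteq> 0" "poly f2 y \<noteq> 0" "poly f2 x1 \<noteq> 0" "poly f2 y1 \<noteq> 0"
    using ne0 ne1 ne2 by (auto simp only: f1_def f2_def poly_lin2_eq_0)
  have "cofactor x y G"
    unfolding cofactor_def
  proof (intro conjI allI impI)
    show "lead_coeff G = 1"
      by (simp add: G_def f1_def f2_def lead_coeff_mult del: mult_pCons_left mult_pCons_right)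
    show "fp (lin x * lin y * G) = lin x * lin y * G"
      unfolding f_def[symmetric] G_def fp_mult ff by (simp only: mult_ac)
    show "poly G x \<noteq> 0" "poly G y \<noteq> 0"
      using pG by (simp_all add: G_def)
    fix z assume "poly G z = 0"
    then show "z \<in> {x ^ q, (x ^ q) ^ q, y ^ q, (y ^ q) ^ q}"
      by (auto simp only: G_def f1_def f2_def poly_mult[of "lin u * lin v" for u v] mult_eq_0_iff poly_lin2_eq_0 defs)
  next
    have "x \<notin> GFq q 1" "y \<notin> GFq q 1"
      using n by (simp_all add: GFq_iff)
    then have e: "{z \<in> GFq q 1. z = x \<or> z = y} = {}"
      by auto
    show "card {z \<in> GFq q 1. z = x \<or> z = y} + degree G \<le> 4"
      unfolding e using degG by simp
  next
    fix p :: "'a poly" assume p: "degree p \<le> degree G + 2"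
    have "poly G x \<noteq> 0" "poly G y \<noteq> 0"
      using pG by (simp_all add: G_def)
    then obtain Q0 p2 where 1: "degree Q0 \<le> 1" "p = G * Q0 + f * p2"
      unfolding f_def by (rule interpolate_two)
    have "degree (f * p2) = degree (p - G * Q0)"
      by (simp add: 1(2))
    also have "\<dots> \<le> 6"
      using p degG 1(1) by (intro degree_diff_le) (auto intro: order_trans[OF degree_mult_le])
    finally have d2: "degree p2 \<le> 4"
      using deg nz by - (rule degree_cofactor_le[of f], simp_all)
    obtain Q1 p3 where 2: "degree Q1 \<le> 1" "p2 = f2 * Q1 + f1 * p3"
      unfolding f1_def using pG(5,6) by (rule interpolate_two)
    have "degree (f1 * p3) = degree (p2 - f2 * Q1)"
      by (simp add: 2(2))
    also have "\<dots> \<le> 4"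
      using d2 deg 2(1) by (intro degree_diff_le) (auto intro: order_trans[OF degree_mult_le])
    finally have d3: "degree p3 \<le> 2"
      using deg nz by - (rule degree_cofactor_le[of f1], simp_all)
    have "p = G * Q0 + fp G * Q1 + fp (fp G) * p3"
      unfolding 1(2) 2(2) fG(2) unfolding fG(1) by (simp add: algebra_simps)
    then show "\<exists>Q0 Q1 Q2. degree Q0 \<le> 2 \<and> degree Q1 \<le> 2 \<and> degree Q2 \<le> 2 \<and> p = G * Q0 + fp G * Q1 + fp (fp G) * Q2"
      using 1(1) 2(1) d3 by (intro exI[of _ Q0] exI[of _ Q1] exI[of _ p3]) simp
  qed
  then show ?thesis
    by (simp only: G_def f1_def f2_def defs)
qed

lemma cofactor_exists:
  assumes z: "((x ^ q) ^ q) ^ q = x \<and> ((y ^ q) ^ q) ^ q = y \<or> ((x ^ q) ^ q) ^ q = y \<and> ((y ^ q) ^ q) ^ q = x"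
  shows "\<exists>G. cofactor x y G"
proof -
  consider (rat) "x ^ q = x \<and> y ^ q = y \<or> x ^ q = y \<and> y ^ q = x"
    | (hx) "x ^ q = x" "y ^ q \<noteq> y" | (hy) "y ^ q = y" "x ^ q \<noteq> x"
    | (cx) "x ^ q = y" "y ^ q \<noteq> x" "x ^ q \<noteq> x" | (cy) "y ^ q = x" "x ^ q \<noteq> y" "y ^ q \<noteq> y"
    | (gen) "x ^ q \<noteq> x" "y ^ q \<noteq> y" "x ^ q \<noteq> y" "y ^ q \<noteq> x"
    by blast
  then show ?thesis
  proof cases
    case rat
    then have "lin (x ^ q) * lin (y ^ q) = lin x * lin y"
      by (auto simp only: mult.commute)
    then show ?thesis
      using cofactor_rational by blast
  next
    case hx
    then have "((y ^ q) ^ q) ^ q = y"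
      using z by auto
    then show ?thesis
      using cofactor_half_rational hx by blast
  next
    case hy
    then have "((x ^ q) ^ q) ^ q = x"
      using z by auto
    then show ?thesis
      using cofactor_half_rational[of y x] hy cofactor_commute by blast
  next
    case cx
    \<comment> \<open>If the roots were exchanged, x^(q^3) = y = x^q, and cancelling one Frobenius
      step would give y^q = x.\<close>
    have "((x ^ q) ^ q) ^ q = x"
      using z cx q_inj[of "y ^ q" x] by auto
    then show ?thesis
      using cofactor_conjugate[of x] cx by blast
  next
    case cy
    have "((y ^ q) ^ q) ^ q = y"
      using z cy q_inj[of "x ^ q" y] by auto
    then show ?thesis
      using cofactor_conjugate[of y] cy cofactor_commute by blast
  next
    case gen
    then show ?thesis
      using cofactor_generic[OF gen z] by blast
  qed
qed

section \<open>The curve of a conic\<close>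

lemma GFq_3_iff: "x \<in> GFq q 3 \<longleftrightarrow> ((x ^ q) ^ q) ^ q = (x :: 'a)"
  by (simp add: GFq_iff power3_eq_cube mult.assoc flip: power_mult)

lemma fp_add: "fp (p + r) = fp p + fp r"
  by (rule poly_eqI) (simp add: q_add)

lemma frob_in_span1: "frob q u \<in> vec.span {frob q w} \<longleftrightarrow> u \<in> vec.span {w :: 'a ^ 'n}"
proof
  assume "frob q u \<in> vec.span {frob q w}"
  then obtain k where k: "frob q u = k *s frob q w"
    by (auto simp: in_span1_iff)
  obtain l where "l ^ q = k"
    using q_surj by blast
  then have "frob q u = frob q (l *s w)"
    using k by (simp add: frob_scale)
  then show "u \<in> vec.span {w}"
    unfolding frob_inj by (auto simp: in_span1_iff)
qed (auto simp: in_span1_iff frob_scale)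

text \<open>Three Frobenius steps fix the sum and the product of the roots and so permute the
  roots.\<close>

lemma conjugate_roots_GFq_3:
  assumes "lin x * lin y = [:a, b, 1:]" "a \<in> GFq q 3" "b \<in> GFq q 3"
  shows "((x ^ q) ^ q) ^ q = x \<and> ((y ^ q) ^ q) ^ q = y \<or> ((x ^ q) ^ q) ^ q = y \<and> ((y ^ q) ^ q) ^ q = x"
proof -
  define x' y' where "x' = ((x ^ q) ^ q) ^ q" and "y' = ((y ^ q) ^ q) ^ q"
  have ab: "a = x * y" "b = - (x + y)"
    using assms(1) by (simp_all add: algebra_simps)
  have "- (x' + y') = - (x + y)"
    using assms(3) unfolding GFq_3_iff ab x'_def y'_def by (simp add: q_minus q_add q_diff)
  then have s: "x' + y' = x + y"
    by (simp only: neg_equal_iff_equal)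
  have p: "x' * y' = x * y"
    using assms(2) unfolding GFq_3_iff ab x'_def y'_def by (simp add: power_mult_distrib)
  have "(x' - x) * (x' - y) = x' * x' - x' * (x + y) + x * y"
    by (simp add: algebra_simps)
  also have "\<dots> = 0"
    unfolding s[symmetric] p[symmetric] by (simp add: algebra_simps)
  finally have "x' = x \<or> x' = y"
    by simp
  then have "x' = x \<and> y' = y \<or> x' = y \<and> y' = x"
    using s by auto
  then show ?thesis
    by (simp only: x'_def y'_def)
qed

lemma card_frobenius_orbit:
  fixes x :: 'a
  assumes n: "n > 0" "x ^ (q ^ n) = x" and min: "\<And>m. 0 < m \<Longrightarrow> m < n \<Longrightarrow> x ^ (q ^ m) \<noteq> x"
  shows "card (range (\<lambda>k. x ^ (q ^ k))) = n"
proof -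
  have shift: "x ^ (q ^ (i + j)) = (x ^ (q ^ i)) ^ (q ^ j)" for i j
    by (simp add: power_add flip: power_mult)
  have per: "x ^ (q ^ (n * j)) = x" for j
    by (induction j) (simp_all add: shift n)
  have "x ^ (q ^ k) = x ^ (q ^ (k mod n))" for k
    using shift[of "n * (k div n)" "k mod n"] per by simp
  then have "range (\<lambda>k. x ^ (q ^ k)) = (\<lambda>k. x ^ (q ^ k)) ` {..<n}"
    using n(1) by (auto intro!: image_eqI[where x = "_ mod n"])
  moreover have "inj_on (\<lambda>k. x ^ (q ^ k)) {..<n}"
  proof (rule linorder_inj_onI)
    fix i j assume ij: "i < j" "i \<in> {..<n}" "j \<in> {..<n}"
    then have "x ^ (q ^ j) = (x ^ (q ^ (j - i))) ^ (q ^ i)"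
      using shift[of "j - i" i] by simp
    then show "x ^ (q ^ i) \<noteq> x ^ (q ^ j)"
      using min[of "j - i"] ij by (simp add: pow_inj less_imp_diff_less)
  qed auto
  ultimately show ?thesis
    by (simp add: card_image)
qed

lemma param_conic_reparametrize:
  fixes M S :: "'a ^ 3 ^ 3"
  assumes \<theta>: "\<theta> \<in> GFq q 1" and S: "\<And>s t. S *v ver s t = ver t (s + \<theta> * t)"
  shows "param_conic q (M ** S) = param_conic q M"
proof (intro equalityI subsetI)
  fix P assume "P \<in> param_conic q (M ** S)"
  then obtain s t where "s \<in> GFq q 1" "t \<in> GFq q 1" "s \<noteq> 0 \<or> t \<noteq> 0" "P = vec.span {(M ** S) *v ver s t}"
    by (auto simp: param_conic_def)
  then have "P = vec.span {M *v ver t (s + \<theta> * t)} \<and> t \<in> GFq q 1 \<and> s + \<theta> * t \<in> GFq q 1 \<and> (t \<noteq> 0 \<or> s + \<theta> * t \<noteq> 0)"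
    using \<theta> by (auto simp: S GFq_closed simp flip: matrix_vector_mul_assoc)
  then show "P \<in> param_conic q M"
    unfolding param_conic_def by blast
next
  fix P assume "P \<in> param_conic q M"
  then obtain s t where st: "s \<in> GFq q 1" "t \<in> GFq q 1" "s \<noteq> 0 \<or> t \<noteq> 0" "P = vec.span {M *v ver s t}"
    by (auto simp: param_conic_def)
  then have "P = vec.span {(M ** S) *v ver (t - \<theta> * s) s}"
    by (simp add: S flip: matrix_vector_mul_assoc)
  moreover have "t - \<theta> * s \<in> GFq q 1" "t - \<theta> * s \<noteq> 0 \<or> s \<noteq> 0"
    using st \<theta> by (auto intro!: GFq_closed)
  ultimately show "P \<in> param_conic q (M ** S)"
    unfolding param_conic_def using st by blast
qed

text \<open>The entry 1 makes the point with parameter infinity affine and the first coordinate a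
  monic quadratic polynomial. Where the entry is 0, the parameters are moved by (s, t) -> (t, s +
  \<theta> t) first.\<close>

lemma normalize_conic:
  fixes M :: "'a ^ 3 ^ 3"
  assumes M: "\<And>i j. M $ i $ j \<in> GFq q 3" and det: "det M \<noteq> 0"
  obtains M' where "\<And>i j. M' $ i $ j \<in> GFq q 3" "det M' \<noteq> 0" "M' $ 1 $ 3 = 1" "param_conic q M' = param_conic q M"
proof -
  obtain L :: "'a ^ 3 ^ 3" where L: "\<And>i j. L $ i $ j \<in> GFq q 3" "det L \<noteq> 0" "L $ 1 $ 3 \<noteq> 0" "param_conic q L = param_conic q M"
  proof (cases "M $ 1 $ 3 = 0")
    case False
    then show ?thesis
      using that[of M] M det by simp
  next
    case True
    \<comment> \<open>The new corner entry is the first coordinate of the conic at the parameter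
      \<theta>. It is now of degree at most 1 and not zero, so 0 or 1 is not a root.\<close>
    define \<theta> :: 'a where "\<theta> = (if M $ 1 $ 1 \<noteq> 0 then 0 else 1)"
    have \<theta>: "\<theta> \<in> GFq q 1"
      by (simp add: \<theta>_def GFq_closed)
    have "M $ 1 $ 1 \<noteq> 0 \<or> M $ 1 $ 2 \<noteq> 0"
      using det True by (auto simp: det_3)
    then have n: "M $ 1 $ 1 + M $ 1 $ 2 * \<theta> \<noteq> 0"
      by (auto simp: \<theta>_def)
    define S :: "'a ^ 3 ^ 3" where "S = vector [vector [0, 0, 1], vector [0, 1, \<theta>], vector [1, 2 * \<theta>, \<theta>\<^sup>2]]"
    have S: "S *v ver s t = ver t (s + \<theta> * t)" for s t
      by (simp add: vec3_eq_iff mv3 S_def power2_eq_square algebra_simps)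
    have SE: "S $ i $ j \<in> GFq q 3" for i j
    proof -
      have "\<forall>i j. S $ i $ j \<in> GFq q 3"
        unfolding forall_3 using GFq_1_subset[OF \<theta>] by (simp add: S_def GFq_closed GFq_numeral)
      then show ?thesis
        by blast
    qed
    show ?thesis
    proof (rule that[of "M ** S"])
      show "(M ** S) $ i $ j \<in> GFq q 3" for i j
        using M SE by (simp add: matrix_matrix_mult_def GFq_sum GFq_closed)
      have "det S = - 1"
        by (simp add: det_3 S_def)
      then show "det (M ** S) \<noteq> 0"
        using det by (simp add: det_mul)
      show "(M ** S) $ 1 $ 3 \<noteq> 0"
        using n True by (simp add: matrix_matrix_mult_def sum_3 S_def)
      show "param_conic q (M ** S) = param_conic q M"
        by (rule param_conic_reparametrize[OF \<theta> S])
    qed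
  qed
  define l where "l = inverse (L $ 1 $ 3)"
  have l: "l \<noteq> 0" "l \<in> GFq q 3"
    using L by (simp_all add: l_def GFq_closed)
  define M' :: "'a ^ 3 ^ 3" where "M' = (\<chi> i j. l * L $ i $ j)"
  have mv: "M' *v v = l *s (L *v v)" for v
    by (simp add: vec_eq_iff mv3 M'_def algebra_simps)
  show ?thesis
  proof (rule that[of M'])
    show "M' $ i $ j \<in> GFq q 3" for i j
      using l L by (simp add: M'_def GFq_closed)
    have "\<forall>v. L *v v = 0 \<longrightarrow> v = 0"
      using L(2) by (simp add: ker_iff_det)
    then have "\<forall>v. M' *v v = 0 \<longrightarrow> v = 0"
      using l by (simp add: mv)
    then show "det M' \<noteq> 0"
      by (simp add: ker_iff_det)
    show "M' $ 1 $ 3 = 1"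
      using L by (simp add: M'_def l_def)
    show "param_conic q M' = param_conic q M"
      using L(4) l by (simp add: param_conic_def mv span1_scale)
  qed
qed

end

context spread_coordinates begin

lemma frob_in_plane:
  assumes "\<xi> \<in> dirs"
  shows "frob q v \<in> plane \<xi> \<longleftrightarrow> v \<in> plane \<xi>"
proof -
  have "\<xi> = frob q (frob q (frob q \<xi>))"
    using assms by (simp add: dirs_def rat_vecs_3)
  then have "c (frob q v) \<in> vec.span {\<xi>} \<longleftrightarrow> c2 v \<in> vec.span {frob q (frob q \<xi>)}"
    by (metis c_frob(3) frob_in_span1)
  then show ?thesis
    by (auto simp: plane_def c_frob(1,2) frob_in_span1)
qed

lemma spread_index_span:
  "spread_index q g (vec.span {v}) = (if \<exists>\<xi>\<in>dirs. v \<in> plane \<xi> then 1 else 2)"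
  by (simp add: spread_index_def regular_spread_eq span_subset_iff[OF plane_subspace])

end

text \<open>\<alpha> and \<beta> are the parameters of the points of the conic on the line at
  infinity; \<open>G\<close> is the factor that makes the first coordinate rational.\<close>

locale normalized_conic = spread_coordinates +
  fixes M :: "'a ^ 3 ^ 3" and \<alpha> \<beta> :: 'a and G :: "'a poly"
  assumes M_rat: "M $ i $ j \<in> GFq q 3" and M_det: "det M \<noteq> 0" and M_13: "M $ 1 $ 3 = 1"
    and M_roots: "[:M $ 1 $ 1, M $ 1 $ 2, M $ 1 $ 3:] = lin \<alpha> * lin \<beta>"
    and G: "cofactor \<alpha> \<beta> G"
begin

definition f :: "3 \<Rightarrow> 'a poly" where
  "f j = [:M $ j $ 1, M $ j $ 2, M $ j $ 3:]"

definition d :: nat where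
  "d = degree G + 2"

lemma poly_f: "poly (f j) x = (M *v ver 1 x) $ j"
  by (simp add: f_def mv3 power2_eq_square algebra_simps)

lemma degree_f: "degree (f j) \<le> 2"
  unfolding f_def by (rule degree_le) (auto simp: coeff_pCons split: nat.split)

lemma f_1: "f 1 = lin \<alpha> * lin \<beta>"
  by (simp only: f_def M_roots)

lemma f_1_nonzero: "f 1 \<noteq> 0"
  unfolding f_1 by simp

lemma M_ker: "M *v v = 0 \<longleftrightarrow> v = 0"
  using ker_iff_det[of M] M_det by auto

lemma M_ver_nonzero: "M *v ver 1 x \<noteq> 0"
  by (simp add: M_ker ver_eq_0_iff)

lemma M_ver_span:
  assumes "M *v ver 1 y \<in> vec.span {M *v ver 1 x}"
  shows "y = x"
proof -
  obtain k where "M *v ver 1 y = k *s (M *v ver 1 x)"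
    using assms by (auto simp: in_span1_iff)
  then have "M *v (ver 1 y - k *s ver 1 x) = 0"
    by (simp add: matrix_vector_mult_diff_distrib vector_scalar_commute)
  then have "ver 1 y = k *s ver 1 x"
    by (simp add: M_ker)
  then show ?thesis
    by (simp add: vec3_eq_iff)
qed

lemma G_nonzero: "G \<noteq> 0"
  using G by (auto simp: cofactor_def)

lemma G_roots: "poly G \<alpha> \<noteq> 0" "poly G \<beta> \<noteq> 0"
  "poly G z = 0 \<Longrightarrow> z \<in> {\<alpha> ^ q, (\<alpha> ^ q) ^ q, \<beta> ^ q, (\<beta> ^ q) ^ q}"
  using G unfolding cofactor_def by blast+

lemma fp_G_f_1: "fp (G * f 1) = G * f 1"
  using G unfolding cofactor_def f_1 by (simp only: mult.commute)

lemma conj_\<alpha>\<beta>: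
  "((\<alpha> ^ q) ^ q) ^ q = \<alpha> \<and> ((\<beta> ^ q) ^ q) ^ q = \<beta> \<or> ((\<alpha> ^ q) ^ q) ^ q = \<beta> \<and> ((\<beta> ^ q) ^ q) ^ q = \<alpha>"
  by (rule conjugate_roots_GFq_3[OF _ M_rat[of 1 1] M_rat[of 1 2]]) (simp only: M_roots[symmetric] M_13)

lemma coeff_f_rat: "coeff (f j) i \<in> GFq q 3"
  using M_rat by (auto simp: f_def coeff_pCons GFq_closed split: nat.split)

lemma fp_fp_fp_f: "fp (fp (fp (f j))) = f j"
  using coeff_f_rat[of j] by (intro poly_eqI) (simp add: GFq_3_iff)

lemma fp_fp_fp_G: "fp (fp (fp G)) = G"
proof -
  have "fp (fp (fp (G * f 1))) = G * f 1"
    by (simp only: fp_G_f_1)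
  then have "fp (fp (fp G)) * f 1 = G * f 1"
    by (simp only: fp_mult fp_fp_fp_f)
  then show ?thesis
    using f_1_nonzero by simp
qed

lemma coeff_G_f_rat: "(\<chi> j. coeff (G * f j) i) \<in> rat_vecs q 3" "coeff (G * f 1) i \<in> GFq q 1"
proof -
  have "fp (fp (fp (G * f j))) = G * f j" for j
    by (simp only: fp_mult fp_fp_fp_G fp_fp_fp_f)
  then have "((coeff (G * f j) i ^ q) ^ q) ^ q = coeff (G * f j) i" for j
    by (metis coeff_fp)
  then show "(\<chi> j. coeff (G * f j) i) \<in> rat_vecs q 3"
    by (simp add: rat_vecs_def GFq_3_iff)
  have "coeff (G * f 1) i ^ q = coeff (G * f 1) i"
    using fp_G_f_1 by (metis coeff_fp)
  then show "coeff (G * f 1) i \<in> GFq q 1"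
    by (simp add: GFq_iff)
qed

text \<open>The choice is unique by \<open>rat_c_inj\<close>: the rational vector over the degree i
  coefficients of the curve with coordinates \<open>G * f j\<close>.\<close>

definition B :: "nat \<Rightarrow> 'a ^ 7" where
  "B i = (SOME v. v \<in> rat_vecs q 1 \<and> c v = (\<chi> j. coeff (G * f j) i))"

lemma B_rat: "B i \<in> rat_vecs q 1" and c_B: "c (B i) = (\<chi> j. coeff (G * f j) i)"
proof -
  have "(\<chi> j. coeff (G * f j) i) $ 1 \<in> GFq q 1"
    using coeff_G_f_rat(2) by simp
  then have "\<exists>v. v \<in> rat_vecs q 1 \<and> c v = (\<chi> j. coeff (G * f j) i)"
    using lift_exists[OF coeff_G_f_rat(1)] by blast
  then have "B i \<in> rat_vecs q 1 \<and> c (B i) = (\<chi> j. coeff (G * f j) i)"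
    unfolding B_def by (rule someI_ex)
  then show "B i \<in> rat_vecs q 1" "c (B i) = (\<chi> j. coeff (G * f j) i)"
    by auto
qed

lemma coord_poly_B: "coord_poly d B j = G * f j"
proof (rule poly_eqI)
  fix i
  have "degree (G * f j) \<le> d"
    unfolding d_def using degree_f[of j] by (intro order_trans[OF degree_mult_le]) simp
  then show "coeff (coord_poly d B j) i = coeff (G * f j) i"
    by (simp add: coeff_coord_poly c_B coeff_eq_0)
qed

lemma c_curve_B: "c (curve d B x) = poly G x *s (M *v ver 1 x)"
  by (simp add: vec_eq_iff poly_f flip: poly_coord_poly coord_poly_B) (simp add: coord_poly_B poly_f)

lemma c_curve_B_eq_0: "c (curve d B x) = 0 \<longleftrightarrow> poly G x = 0"
  by (simp add: c_curve_B M_ver_nonzero)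

lemma nrc_poly_B: "nrc_poly d B h = G * f 1"
  by (simp only: coord_poly_B flip: coord_poly_1)

lemma nrc_poly_B_nonzero: "nrc_poly d B h \<noteq> 0"
  using G_nonzero f_1_nonzero by (simp add: nrc_poly_B)

lemma c_B_d: "c (B d) = M *v ver 0 1"
proof -
  have "lead_coeff G = 1"
    using G by (simp add: cofactor_def)
  then have "coeff (G * f j) d = M $ j $ 3" for j
    by (simp add: f_def d_def coeff_eq_0 numeral_2_eq_2)
  then show ?thesis
    by (simp add: c_B vec_eq_iff mv3)
qed

lemma quadratic_f_combination:
  assumes "degree Q \<le> 2"
  obtains a :: "'a ^ 3" where "Q = smult (a $ 1) (f 1) + smult (a $ 2) (f 2) + smult (a $ 3) (f 3)"
proof -
  have "\<forall>v. transpose M *v v = 0 \<longrightarrow> v = 0"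
    unfolding ker_iff_det det_transpose by (rule M_det)
  then have "transpose M *v v = 0 \<Longrightarrow> v = 0" for v
    by blast
  note mv_surj[OF this]
  then obtain a :: "'a ^ 3" where a: "transpose M *v a = vector [coeff Q 0, coeff Q 1, coeff Q 2]"
    by blast
  have "Q = smult (a $ 1) (f 1) + smult (a $ 2) (f 2) + smult (a $ 3) (f 3)"
  proof (rule poly_eqI)
    fix i :: nat
    consider "i = 0" | "i = 1" | "i = 2" | "i > 2"
      by linarith
    then show "coeff Q i = coeff (smult (a $ 1) (f 1) + smult (a $ 2) (f 2) + smult (a $ 3) (f 3)) i"
    proof cases
      case 1
      then show ?thesis
        using arg_cong[OF a, of "\<lambda>v. v $ 1"] by (simp add: mv3 transpose_def f_def algebra_simps del: transpose_matrix_vector)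
    next
      case 2
      then show ?thesis
        using arg_cong[OF a, of "\<lambda>v. v $ 2"] by (simp add: mv3 transpose_def f_def One_nat_def algebra_simps del: transpose_matrix_vector)
    next
      case 3
      then show ?thesis
        using arg_cong[OF a, of "\<lambda>v. v $ 3"] by (simp add: mv3 transpose_def f_def numeral_2_eq_2 algebra_simps del: transpose_matrix_vector)
    next
      case 4
      then have "coeff Q i = 0" "coeff (f j) i = 0" for j
        using assms degree_f[of j] by (auto intro!: coeff_eq_0)
      then show ?thesis
        by simp
    qed
  qed
  then show ?thesis
    by (rule that)
qed

lemma quadratic_fp_preimage:
  assumes "degree Q \<le> 2"
  obtains Q' where "degree Q' \<le> 2" "fp Q' = Q"
proof -
  have "\<forall>i. \<exists>y. y ^ q = coeff Q i"
    using q_surj by blast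
  then obtain y where y: "\<And>i. y i ^ q = coeff Q i"
    by metis
  have 0: "coeff [:y 0, y 1, y 2:] i = 0" if "i > 2" for i
    using that by (auto simp: coeff_pCons split: nat.split)
  have "fp [:y 0, y 1, y 2:] = Q"
  proof (rule poly_eqI)
    fix i :: nat
    consider "i = 0" | "i = 1" | "i = 2" | "i > 2"
      by linarith
    then show "coeff (fp [:y 0, y 1, y 2:]) i = coeff Q i"
    proof cases
      case 4
      then show ?thesis
        using assms 0[of i] by (simp add: coeff_eq_0 del: coeff_pCons)
    qed (simp_all add: y One_nat_def[symmetric] coeff_pCons split: nat.split)
  qed
  moreover have "degree [:y 0, y 1, y 2:] \<le> 2"
    using 0 by (intro degree_le) blast
  ultimately show ?thesis
    using that by blast
qed

text \<open>A dependency is a linear functional on polynomials of degree at most \<open>d\<close>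
  that kills \<open>G * f j\<close> and its conjugates. The \<open>f j\<close> span the quadratic
  polynomials, so by the spanning condition in \<open>cofactor\<close> it kills every
  monomial.\<close>

lemma B_frame: "nrc_frame q d B"
proof (rule frameI)
  show "B i \<in> rat_vecs q 1" for i
    by (rule B_rat)
next
  fix k and i assume 0: "(\<Sum>i\<le>d. k i *s B i) = 0" and i: "i \<le> d"
  define L where "L p = (\<Sum>i\<le>d. k i * coeff p i)" for p
  have L_add: "L (p + r) = L p + L r" for p r
    by (simp add: L_def sum.distrib algebra_simps)
  have L_smult: "L (smult l p) = l * L p" for l p
    by (simp add: L_def sum_distrib_left algebra_simps)
  have "(\<Sum>i\<le>d. k i *s c (B i)) = 0" "(\<Sum>i\<le>d. k i *s c1 (B i)) = 0" "(\<Sum>i\<le>d. k i *s c2 (B i)) = 0"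
    using arg_cong[OF 0, of c] arg_cong[OF 0, of c1] arg_cong[OF 0, of c2] by (simp_all add: c_sum c_scale)
  then have "(\<Sum>i\<le>d. k i *s c (B i)) $ j = 0" "(\<Sum>i\<le>d. k i *s frob q (c (B i))) $ j = 0"
    "(\<Sum>i\<le>d. k i *s frob q (frob q (c (B i)))) $ j = 0" for j
    using rat_c[OF B_rat] by simp_all
  then have Lf: "L (G * f j) = 0" "L (fp (G * f j)) = 0" "L (fp (fp (G * f j))) = 0" for j
    by (simp_all add: L_def c_B)
  have LQ: "L (G * Q) = 0" "L (fp (G * Q)) = 0" "L (fp (fp (G * Q))) = 0" if dQ: "degree Q \<le> 2" for Q
  proof -
    obtain a :: "'a ^ 3" where "Q = smult (a $ 1) (f 1) + smult (a $ 2) (f 2) + smult (a $ 3) (f 3)"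
      using quadratic_f_combination[OF dQ] by blast
    then have Q: "G * Q = smult (a $ 1) (G * f 1) + smult (a $ 2) (G * f 2) + smult (a $ 3) (G * f 3)"
      by (simp only: distrib_left mult_smult_right)
    show "L (G * Q) = 0" "L (fp (G * Q)) = 0" "L (fp (fp (G * Q))) = 0"
      unfolding Q by (simp_all only: fp_add fp_smult L_add L_smult Lf mult_zero_right add_0_right)
  qed
  obtain Q0 Q1 Q2 where Q: "degree Q0 \<le> 2" "degree Q1 \<le> 2" "degree Q2 \<le> 2"
    "monom 1 i = G * Q0 + fp G * Q1 + fp (fp G) * Q2"
  proof -
    have "degree (monom 1 i :: 'a poly) \<le> degree G + 2"
      using i by (simp add: degree_monom_eq d_def)
    then show ?thesis
      using G that unfolding cofactor_def by blast
  qed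
  \<comment> \<open>The multipliers are conjugated back, because \<open>L\<close> is known to vanish
    on conjugates of whole products \<open>G * Q\<close>.\<close>
  obtain R1 where R1: "degree R1 \<le> 2" "fp R1 = Q1"
    using quadratic_fp_preimage[OF Q(2)] by blast
  obtain R2' where R2': "degree R2' \<le> 2" "fp R2' = Q2"
    using quadratic_fp_preimage[OF Q(3)] by blast
  obtain R2 where R2: "degree R2 \<le> 2" "fp R2 = R2'"
    using quadratic_fp_preimage[OF R2'(1)] by blast
  have "monom 1 i = G * Q0 + fp (G * R1) + fp (fp (G * R2))"
    unfolding Q(4) by (simp only: fp_mult R1 R2 R2')
  then have "L (monom 1 i) = 0"
    using LQ(1)[OF Q(1)] LQ(2)[OF R1(1)] LQ(3)[OF R2(1)] by (simp only: L_add add_0_right)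
  moreover have "L (monom 1 i) = k i"
  proof -
    have "L (monom 1 i) = (\<Sum>l\<in>{i}. k l * coeff (monom 1 i) l)"
      unfolding L_def using i by (intro sum.mono_neutral_right) auto
    then show ?thesis
      by simp
  qed
  ultimately show "k i = 0"
    by simp
qed

lemma curve_B_inj: "vec.span {curve d B x} = vec.span {curve d B y} \<longleftrightarrow> x = y"
proof
  assume "vec.span {curve d B x} = vec.span {curve d B y}"
  then obtain k where "curve d B x = k *s curve d B y"
    using span1_eq_iff[OF curve_nonzero[OF B_frame]] by blast
  then have "(\<Sum>i\<le>d. (x ^ i - k * y ^ i) *s B i) = 0"
    by (simp add: curve_def vec_eq_iff sum_subtractf sum_distrib_left algebra_simps)
  then have "x ^ i - k * y ^ i = 0" if "i \<le> d" for i
    by (rule frame_independent[OF B_frame, where k = "\<lambda>i. x ^ i - k * y ^ i"]) (rule that)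
  from this[of 0] this[of 1] show "x = y"
    by (simp add: d_def)
qed simp

lemma curve_B_not_infinity: "vec.span {curve d B x} \<noteq> vec.span {B d}"
proof
  assume "vec.span {curve d B x} = vec.span {B d}"
  then obtain k where k: "curve d B x = k *s B d"
    using span1_eq_iff[OF curve_nonzero[OF B_frame]] by blast
  have "(\<Sum>i\<le>d. (if i = d then k else 0) *s B i) = (\<Sum>i\<in>{d}. (if i = d then k else 0) *s B i)"
    by (rule sum.mono_neutral_right) auto
  then have "(\<Sum>i\<le>d. (x ^ i - (if i = d then k else 0)) *s B i) = 0"
    using k by (simp add: curve_def vec_eq_iff sum_subtractf left_diff_distrib)
  then have "x ^ 0 - (if 0 = d then k else 0) = 0"
    by (rule frame_independent[OF B_frame, where k = "\<lambda>i. x ^ i - (if i = d then k else 0)"]) simp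
  then show False
    by (simp add: d_def)
qed

text \<open>The point with parameter infinity and those with rational parameters other than \<alpha>
  and \<beta> are affine and lie on both curves. The cardinality condition in
  \<open>cofactor\<close> gives at least q + deg G - 3 of them, and q >= 8 makes this d + 3.\<close>

lemma curve_B_eq:
  assumes b: "nrc_frame q r b"
    and eq: "{P \<in> nrc_points q r b. \<not> P \<subseteq> hyperplane h} = {P \<in> affine_points q h. c ` P \<in> param_conic q M}"
  shows "r = d" "nrc_points q r b = nrc_points q d B"
proof -
  have onN: "vec.span {v} \<in> nrc_points q r b"
    if v: "v \<in> rat_vecs q 1" "c v = k *s (M *v ver s t)" "c v $ 1 \<noteq> 0" and st: "s \<in> GFq q 1" "t \<in> GFq q 1" "s \<noteq> 0 \<or> t \<noteq> 0"
    for v k s t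
  proof -
    have "k \<noteq> 0" "v \<noteq> 0"
      using v by auto
    then have "c ` vec.span {v} \<in> param_conic q M"
      using st by (auto simp: c_image_span v(2) span1_scale param_conic_def)
    moreover have "vec.span {v} \<in> affine_points q h"
      using v \<open>v \<noteq> 0\<close> vec.span_base[of v "{v}"] by (auto simp: affine_points_def hyperplane_iff intro: pg_pointsI)
    ultimately show ?thesis
      using eq by blast
  qed
  define A where "A = {x \<in> GFq q 1. x \<noteq> \<alpha> \<and> x \<noteq> \<beta>}"
  define S where "S = insert (vec.span {B d}) ((\<lambda>x. vec.span {curve d B x}) ` A)"
  have finA: "finite A"
    using card_GFq(2)[of 1] by (simp add: A_def)
  have "card A + 4 \<ge> q + degree G"
  proof -
    have "GFq q 1 = A \<union> {z \<in> GFq q 1. z = \<alpha> \<or> z = \<beta>}" "A \<inter> {z \<in> GFq q 1. z = \<alpha> \<or> z = \<beta>} = {}"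
      by (auto simp: A_def)
    then have "q = card A + card {z \<in> GFq q 1. z = \<alpha> \<or> z = \<beta>}"
      using card_GFq[of 1] finA card_Un_disjoint[of A "{z \<in> GFq q 1. z = \<alpha> \<or> z = \<beta>}"] by simp
    then show ?thesis
      using G by (simp add: cofactor_def)
  qed
  moreover have "card S = card A + 1"
  proof -
    have "inj_on (\<lambda>x. vec.span {curve d B x}) A"
      by (rule inj_onI) (simp add: curve_B_inj)
    moreover have "vec.span {B d} \<notin> (\<lambda>x. vec.span {curve d B x}) ` A"
      using curve_B_not_infinity by blast
    ultimately show ?thesis
      using finA by (simp add: S_def card_image)
  qed
  ultimately have S: "d + 3 \<le> card S"
    using q_ge by (simp add: d_def)
  have "vec.span {B d} \<in> nrc_points q r b"
    by (rule onN[of "B d" 1 0 1]) (simp_all add: B_rat c_B_d GFq_closed mv3 M_13)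
  moreover have "vec.span {curve d B x} \<in> nrc_points q r b" if "x \<in> A" for x
  proof (rule onN)
    have x: "x \<in> GFq q 1" "x \<noteq> \<alpha>" "x \<noteq> \<beta>"
      using that by (auto simp: A_def)
    show "curve d B x \<in> rat_vecs q 1"
      using x(1) by (rule curve_rat[OF B_rat])
    show "c (curve d B x) = poly G x *s (M *v ver 1 x)"
      by (rule c_curve_B)
    have xq: "x = x ^ q"
      using x(1) by (simp add: GFq_iff)
    \<comment> \<open>A rational root of \<open>G\<close> would be a conjugate of \<alpha> or
      \<beta> and, being fixed by Frobenius, equal to it.\<close>
    have "poly G x \<noteq> 0"
    proof
      assume "poly G x = 0"
      then have "x = \<alpha> ^ q \<or> x = (\<alpha> ^ q) ^ q \<or> x = \<beta> ^ q \<or> x = (\<beta> ^ q) ^ q"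
        using G_roots(3) by blast
      then show False
        using xq x q_inj by metis
    qed
    moreover have "poly (f 1) x \<noteq> 0"
      using x by (simp only: f_1 poly_lin2_eq_0) simp
    ultimately show "c (curve d B x) $ 1 \<noteq> 0"
      by (simp add: c_curve_B poly_f)
    show "1 \<in> (GFq q 1 :: 'a set)" "x \<in> GFq q 1" "(1 :: 'a) \<noteq> 0 \<or> x \<noteq> 0"
      using x by (auto simp: GFq_closed)
  qed
  ultimately have "S \<subseteq> nrc_points q r b"
    by (auto simp: S_def)
  moreover have "S \<subseteq> nrc_points q d B"
    by (auto simp: S_def A_def nrc_points_curve)
  moreover have "finite S"
    using finA by (simp add: S_def)
  ultimately show "r = d" "nrc_points q r b = nrc_points q d B"
    using nrc_points_eqI[OF b B_frame _ _ _ S] by blast+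
qed

section \<open>Points at infinity of the curve of a conic\<close>

lemma proots_B: "proots (nrc_poly d B h) = proots G + {#\<alpha>, \<beta>#}"
proof -
  have "f 1 = (\<Prod>x\<in>#{#\<alpha>, \<beta>#}. lin x)"
    by (simp only: f_1 image_mset_add_mset image_mset_empty prod_mset.add_mset prod_mset_empty mult_1_right)
  then have "proots (f 1) = {#\<alpha>, \<beta>#}"
    using proots_linear_prod[of 1 "{#\<alpha>, \<beta>#}"] by (simp only: smult_1_left one_neq_zero not_False_eq_True)
  then show ?thesis
    using G_nonzero f_1_nonzero by (simp add: nrc_poly_B proots_mult)
qed

lemma degree_B: "degree (nrc_poly d B h) = d"
proof -
  have "degree (f 1) = 2"
    unfolding f_1 by (rule degree_lin2)
  then show ?thesis
    using G_nonzero f_1_nonzero unfolding nrc_poly_B by (simp add: degree_mult_eq d_def)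
qed

lemma nrc_at_infinity_B: "nrc_at_infinity d B h = image_mset (\<lambda>x. vec.span {curve d B x}) (proots G + {#\<alpha>, \<beta>#})"
proof -
  have "nrc_point d B = (\<lambda>x. vec.span {curve d B x})"
    by (simp add: fun_eq_iff nrc_point_curve)
  then show ?thesis
    by (simp only: nrc_at_infinity_def degree_B proots_B) simp
qed

lemma infinite_point_B:
  assumes "P \<in># nrc_at_infinity d B h"
  obtains x where "P = vec.span {curve d B x}" "x \<in> {\<alpha>, \<alpha> ^ q, (\<alpha> ^ q) ^ q, \<beta>, \<beta> ^ q, (\<beta> ^ q) ^ q}"
    "c (curve d B x) $ 1 = 0"
proof -
  obtain x where x: "x \<in># proots G + {#\<alpha>, \<beta>#}" "P = vec.span {curve d B x}"
    using assms unfolding nrc_at_infinity_B by auto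
  then consider "poly G x = 0" | "x = \<alpha>" | "x = \<beta>"
    using G_nonzero by auto
  then have "x \<in> {\<alpha>, \<alpha> ^ q, (\<alpha> ^ q) ^ q, \<beta>, \<beta> ^ q, (\<beta> ^ q) ^ q}"
    using G_roots(3)[of x] by cases auto
  moreover have "x \<in># proots (nrc_poly d B h)"
    using x by (simp add: proots_B)
  then have "c (curve d B x) $ 1 = 0"
    using nrc_poly_B_nonzero by (simp add: poly_nrc_poly)
  ultimately show ?thesis
    using that x by blast
qed

lemma root_rational: "\<alpha> \<in> GFq q 6" "\<beta> \<in> GFq q 6"
proof -
  have e: "q ^ 6 = q ^ 3 * q ^ 3"
    by (simp flip: power_add)
  have cube: "x ^ (q ^ 3) = ((x ^ q) ^ q) ^ q" for x :: 'a
    by (simp add: power3_eq_cube mult.assoc flip: power_mult)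
  show "\<alpha> \<in> GFq q 6" "\<beta> \<in> GFq q 6"
    unfolding GFq_iff e power_mult cube using conj_\<alpha>\<beta> by auto
qed

lemma infinite_point_rational:
  assumes "P \<in># nrc_at_infinity d B h"
  shows "P \<in> pg_points q 6 (hyperplane h)"
proof -
  obtain x where x: "P = vec.span {curve d B x}" "x \<in> {\<alpha>, \<alpha> ^ q, (\<alpha> ^ q) ^ q, \<beta>, \<beta> ^ q, (\<beta> ^ q) ^ q}" "c (curve d B x) $ 1 = 0"
    using infinite_point_B[OF assms] by blast
  have "x \<in> GFq q 6"
    using x(2) root_rational GFq_closed(9) by blast
  then have "curve d B x \<in> rat_vecs q 6"
    by (rule curve_rat[OF rat_vecs_mono[OF one_dvd B_rat]])
  then show ?thesis
    using x curve_nonzero[OF B_frame] by (auto simp: hyperplane_iff intro!: pg_pointsI)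
qed

text \<open>\<open>c\<close> vanishes at the roots of \<open>G\<close> and at neither \<alpha> nor
  \<beta>, so \<open>weight_sum\<close> gives 3 times 2.\<close>

lemma weights_B: "(\<Sum>P\<in>#nrc_at_infinity d B h. weight q g P) = 6"
proof -
  have "{#x \<in># proots G. c (curve d B x) \<noteq> 0#} = {#}"
    using G_nonzero by (simp add: c_curve_B_eq_0)
  then have "size {#x \<in># proots (nrc_poly d B h). c (curve d B x) \<noteq> 0#} = 2"
    by (simp add: proots_B c_curve_B_eq_0 G_roots)
  then show ?thesis
    using weight_sum[OF B_frame nrc_poly_B_nonzero infinite_point_rational] by (simp add: degree_B)
qed

lemma frob_curve_B: "frob q (curve d B x) = curve d B (x ^ q)"
  by (rule frob_curve[OF B_rat])

lemma orbit_size_B: "orbit_size q (vec.span {curve d B x}) = card (range (\<lambda>k. x ^ (q ^ k)))"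
proof -
  have "(conj_space q ^^ k) (vec.span {curve d B x}) = vec.span {curve d B (x ^ (q ^ k))}" for k
    by (induction k) (simp_all add: conj_space_span frob_curve_B mult.commute flip: power_mult)
  then have "range (\<lambda>k. (conj_space q ^^ k) (vec.span {curve d B x})) = (\<lambda>x. vec.span {curve d B x}) ` range (\<lambda>k. x ^ (q ^ k))"
    by (simp add: image_image)
  moreover have "inj_on (\<lambda>x. vec.span {curve d B x}) A" for A
    by (rule inj_onI) (simp add: curve_B_inj)
  ultimately show ?thesis
    unfolding orbit_size_def by (simp only: card_image)
qed

text \<open>Goodness expressed in the parameter, whose Frobenius orbit has the size of that of the
  point. It is invariant under Frobenius, so only \<alpha> and \<beta> have to be examined.\<close>

definition good_parameter :: "'a \<Rightarrow> bool" where
  "good_parameter x \<longleftrightarrow> nzc (curve d B x) * card (range (\<lambda>k. x ^ (q ^ k)))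
     = 3 * spread_index q g (vec.span {curve d B x})"

lemma good_parameter_frob: "good_parameter (x ^ q) \<longleftrightarrow> good_parameter x"
proof -
  have "range (\<lambda>k. (x ^ q) ^ (q ^ k)) = (\<lambda>y. y ^ q) ` range (\<lambda>k. x ^ (q ^ k))"
    by (simp add: image_image mult.commute flip: power_mult)
  moreover have "card ((\<lambda>y. y ^ q) ` A) = card A" for A :: "'a set"
    using q_inj by (intro card_image inj_onI) blast
  moreover have "spread_index q g (vec.span {curve d B (x ^ q)}) = spread_index q g (vec.span {curve d B x})"
    by (simp add: spread_index_span frob_in_plane flip: frob_curve_B)
  moreover have "nzc (curve d B (x ^ q)) = nzc (curve d B x)"
    by (simp add: nzc_frob flip: frob_curve_B)
  ultimately show ?thesis
    by (simp add: good_parameter_def)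
qed

lemma poly_G_f_1_frob: "poly (G * f 1) (x ^ q) = 0 \<longleftrightarrow> poly (G * f 1) x = 0"
proof -
  have "poly (G * f 1) (x ^ q) = poly (fp (G * f 1)) (x ^ q)"
    by (simp only: fp_G_f_1)
  also have "\<dots> = poly (G * f 1) x ^ q"
    using poly_map_pow[of 1 "G * f 1" x] by (simp add: fp_def)
  finally show ?thesis
    by simp
qed

lemma poly_G_preimage:
  assumes "poly (G * f 1) w = 0"
  shows "poly G w \<noteq> 0 \<longleftrightarrow> w = \<alpha> \<or> w = \<beta>"
proof -
  have "poly (f 1) w = 0 \<longleftrightarrow> w = \<alpha> \<or> w = \<beta>"
    by (simp only: f_1 poly_lin2_eq_0)
  then show ?thesis
    using assms G_roots(1,2) by auto
qed

text \<open>Among the parameters at infinity \<open>c\<close> is nonzero only at \<alpha> and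
  \<beta>. At \<open>x\<close>, the maps \<open>c1\<close> and \<open>c2\<close> are conjugates of
  \<open>c\<close> at the preimages of \<open>x\<close> under one and two Frobenius steps.\<close>

lemma nzc_B:
  assumes x: "x = \<alpha> \<or> x = \<beta>"
  shows "nzc (curve d B x) = 1 + (if \<alpha> ^ q = x \<or> \<beta> ^ q = x then 1 else 0)
    + (if (\<alpha> ^ q) ^ q = x \<or> (\<beta> ^ q) ^ q = x then 1 else 0)"
proof -
  obtain w u where w: "w ^ q = x" and u: "u ^ q = w"
    using q_surj by metis
  have "poly (G * f 1) x = 0"
    using x poly_lin2_eq_0 by (auto simp only: poly_mult f_1 mult_eq_0_iff)
  then have pw: "poly (G * f 1) w = 0"
    using poly_G_f_1_frob[of w] w by simp
  then have pu: "poly (G * f 1) u = 0"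
    using poly_G_f_1_frob[of u] u by simp
  have "c (curve d B x) \<noteq> 0"
    using x G_roots by (auto simp: c_curve_B_eq_0)
  moreover have "c1 (curve d B x) \<noteq> 0 \<longleftrightarrow> w = \<alpha> \<or> w = \<beta>"
    using c12_curve(1)[where b = B and r = d and x = w, OF B_rat] poly_G_preimage[OF pw] by (simp add: w c_curve_B_eq_0)
  moreover have "c2 (curve d B x) \<noteq> 0 \<longleftrightarrow> u = \<alpha> \<or> u = \<beta>"
    using c12_curve(2)[where b = B and r = d and x = w, OF B_rat] c12_curve(1)[where b = B and r = d and x = u, OF B_rat] poly_G_preimage[OF pu]
    by (simp add: w u c_curve_B_eq_0)
  moreover have "\<alpha> ^ q = x \<or> \<beta> ^ q = x \<longleftrightarrow> w = \<alpha> \<or> w = \<beta>"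
    using w q_inj by metis
  moreover have "(\<alpha> ^ q) ^ q = x \<or> (\<beta> ^ q) ^ q = x \<longleftrightarrow> u = \<alpha> \<or> u = \<beta>"
    using w u q_inj by metis
  ultimately show ?thesis
    by (simp add: nzc_def)
qed

lemma plane_direction:
  assumes x: "poly G x \<noteq> 0" and \<xi>: "\<xi> \<in> dirs" "curve d B x \<in> plane \<xi>"
  obtains k where "k \<noteq> 0" "\<xi> = k *s (M *v ver 1 x)"
proof -
  have "c (curve d B x) \<in> vec.span {\<xi>}" "c (curve d B x) \<noteq> 0"
    using \<xi> x by (simp_all add: plane_def c_curve_B_eq_0)
  then have "vec.span {\<xi>} = vec.span {M *v ver 1 x}"
    using span1_eqI[of "c (curve d B x)" \<xi>] span1_scale[OF x, of "M *v ver 1 x"] by (simp add: c_curve_B)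
  then show ?thesis
    using span1_eq_iff[of \<xi> "M *v ver 1 x"] \<xi>(1) that by (auto simp: dirs_def)
qed

text \<open>A spread plane has one direction, and conjugating back shows that the point of the conic
  with parameter \<open>w\<close> is this direction as well; different parameters give different
  points.\<close>

lemma plane_conjugate:
  assumes x: "poly G x \<noteq> 0" and \<xi>: "\<xi> \<in> dirs" "curve d B x \<in> plane \<xi>" and w: "poly G w \<noteq> 0" "w ^ q = x \<or> (w ^ q) ^ q = x"
  shows "w = x"
proof -
  obtain k where k: "k \<noteq> 0" "\<xi> = k *s (M *v ver 1 x)"
    using plane_direction[OF x \<xi>] by blast
  have "c (curve d B w) \<in> vec.span {\<xi>}"
    using w(2)
  proof
    assume "w ^ q = x"
    then have "frob q (c (curve d B w)) \<in> vec.span {frob q \<xi>}"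
      using \<xi>(2) c12_curve(1)[where b = B and r = d and x = w, OF B_rat] by (simp add: plane_def)
    then show ?thesis
      by (simp add: frob_in_span1)
  next
    assume "(w ^ q) ^ q = x"
    then have "frob q (frob q (c (curve d B w))) \<in> vec.span {frob q (frob q \<xi>)}"
      using \<xi>(2) c12_curve(2)[where b = B and r = d and x = "w ^ q", OF B_rat] c12_curve(1)[where b = B and r = d and x = w, OF B_rat] by (simp add: plane_def)
    then show ?thesis
      by (simp add: frob_in_span1)
  qed
  then have "poly G w *s (M *v ver 1 w) \<in> vec.span {M *v ver 1 x}"
    using k by (simp add: c_curve_B span1_scale)
  then have "inverse (poly G w) *s (poly G w *s (M *v ver 1 w)) \<in> vec.span {M *v ver 1 x}"
    by (rule vec.span_scale)
  then show ?thesis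
    using w(1) by (intro M_ver_span) simp
qed

text \<open>The direction is defined over the cubic field, so three Frobenius steps fix the point of
  the conic and with it its parameter.\<close>

lemma plane_parameter_rational:
  assumes x: "poly G x \<noteq> 0" and \<xi>: "\<xi> \<in> dirs" "curve d B x \<in> plane \<xi>"
  shows "((x ^ q) ^ q) ^ q = x"
proof -
  obtain k where k: "k \<noteq> 0" "\<xi> = k *s (M *v ver 1 x)"
    using plane_direction[OF x \<xi>] by blast
  have "frob q (ver 1 y) = ver 1 (y ^ q)" for y :: 'a
    by (simp add: vec3_eq_iff mult.commute flip: power_mult)
  then have "(frob q ^^ 3) (ver 1 x) = ver 1 (((x ^ q) ^ q) ^ q)"
    by (simp add: numeral_3_eq_3)
  then have fr: "(frob q ^^ 3) (M *v ver 1 x) = M *v ver 1 (((x ^ q) ^ q) ^ q)"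
    using pow_mv[of M 3 "ver 1 x"] M_rat by simp
  have "\<xi> = (frob q ^^ 3) \<xi>"
    using \<xi>(1) by (simp add: dirs_def rat_vecs_iff)
  also have "\<dots> = ((k ^ q) ^ q) ^ q *s (frob q ^^ 3) (M *v ver 1 x)"
    unfolding k(2) by (simp add: numeral_3_eq_3 frob_scale)
  finally have "vec.span {M *v ver 1 x} = vec.span {M *v ver 1 (((x ^ q) ^ q) ^ q)}"
    using k by (simp add: fr) (metis k(1) power_not_zero span1_scale)
  then show ?thesis
    by (intro M_ver_span) (metis singletonI vec.span_base)
qed

text \<open>The direction is the point of the conic with parameter \<open>x\<close>, at infinity
  because the first coordinate vanishes there. For rational \<open>x\<close> the values of
  \<open>c1\<close> and \<open>c2\<close> are the conjugates of that of \<open>c\<close>; for weight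
  1 they are 0.\<close>

lemma spread_index_B:
  assumes x: "x = \<alpha> \<or> x = \<beta>" "x \<in> GFq q 3" and z: "x ^ q = x \<or> nzc (curve d B x) = 1"
  shows "spread_index q g (vec.span {curve d B x}) = 1"
proof -
  define \<xi> where "\<xi> = M *v ver 1 x"
  have G0: "poly G x \<noteq> 0"
    using x G_roots by auto
  have "poly (f 1) x = 0"
    using x by (auto simp only: f_1 poly_lin2_eq_0)
  then have \<xi>: "\<xi> \<in> dirs"
    using x(2) M_ver_nonzero rat_vecs_mv[of M 3 "ver 1 x"] M_rat
    by (auto simp: dirs_def \<xi>_def poly_f ver_rat GFq_closed)
  have c: "c (curve d B x) \<in> vec.span {\<xi>}"
    by (simp add: c_curve_B \<xi>_def vec.span_base vec.span_scale)
  have "curve d B x \<in> plane \<xi>"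
    using z
  proof
    assume xq: "x ^ q = x"
    then have "c1 (curve d B x) = frob q (c (curve d B x))" "c2 (curve d B x) = frob q (frob q (c (curve d B x)))"
      using c12_curve(1,2)[where b = B and r = d and x = x, OF B_rat] by simp_all
    then show ?thesis
      using c by (simp add: plane_def frob_in_span1)
  next
    assume "nzc (curve d B x) = 1"
    then have "c1 (curve d B x) = 0" "c2 (curve d B x) = 0"
      using G0 by (auto simp: nzc_def c_curve_B_eq_0 split: if_splits)
    then show ?thesis
      using c by (simp add: plane_def vec.span_zero)
  qed
  then show ?thesis
    using \<xi> by (auto simp: spread_index_span)
qed

text \<open>Weight, orbit size and spread index are 3, 1, 1 for rational \<open>x\<close>. For cubic
  \<open>x\<close> they are 1, 3, 1, or 2, 3, 2 if \<open>y\<close> is a conjugate of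
  \<open>x\<close> other than \<open>x\<close>. If three Frobenius steps exchange distinct roots,
  they are 3, 2, 2 for \<open>x\<close> in the field of order q^2 and 1, 6, 2 otherwise.\<close>

lemma good_parameter_root:
  assumes xy: "x = \<alpha> \<and> y = \<beta> \<or> x = \<beta> \<and> y = \<alpha>"
  shows "good_parameter x"
proof -
  have x: "x = \<alpha> \<or> x = \<beta>"
    using xy by auto
  have G0: "poly G x \<noteq> 0" "poly G y \<noteq> 0"
    using xy G_roots by auto
  have nz: "nzc (curve d B x) = 1 + (if x ^ q = x \<or> y ^ q = x then 1 else 0)
      + (if (x ^ q) ^ q = x \<or> (y ^ q) ^ q = x then 1 else 0)"
    using nzc_B[OF x] xy by auto
  have it: "x ^ (q ^ 0) = x" "x ^ (q ^ 1) = x ^ q" "x ^ (q ^ 2) = (x ^ q) ^ q" "x ^ (q ^ 3) = ((x ^ q) ^ q) ^ q"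
    "x ^ (q ^ 4) = (((x ^ q) ^ q) ^ q) ^ q" "x ^ (q ^ 5) = ((((x ^ q) ^ q) ^ q) ^ q) ^ q"
    "x ^ (q ^ 6) = (((((x ^ q) ^ q) ^ q) ^ q) ^ q) ^ q"
    by (simp_all add: eval_nat_numeral One_nat_def mult.assoc flip: power_mult)
  consider (fixed) "x ^ q = x" | (cubic) "x ^ q \<noteq> x" "((x ^ q) ^ q) ^ q = x"
    | (swap) "((x ^ q) ^ q) ^ q \<noteq> x" "((x ^ q) ^ q) ^ q = y" "((y ^ q) ^ q) ^ q = x"
    using conj_\<alpha>\<beta> xy by metis
  then show ?thesis
  proof cases
    case fixed
    have "card (range (\<lambda>k. x ^ (q ^ k))) = 1"
      by (rule card_frobenius_orbit) (use fixed in \<open>auto simp: it\<close>)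
    moreover have "spread_index q g (vec.span {curve d B x}) = 1"
      using fixed x by (intro spread_index_B) (auto simp: GFq_3_iff)
    ultimately show ?thesis
      using fixed by (simp add: good_parameter_def nz)
  next
    case cubic
    have x2: "(x ^ q) ^ q \<noteq> x"
      using cubic by metis
    have "card (range (\<lambda>k. x ^ (q ^ k))) = 3"
    proof (rule card_frobenius_orbit)
      fix m :: nat assume "0 < m" "m < 3"
      then have "m = 1 \<or> m = 2"
        by linarith
      then show "x ^ (q ^ m) \<noteq> x"
        using cubic x2 it by auto
    qed (use cubic it in auto)
    moreover have "nzc (curve d B x) = spread_index q g (vec.span {curve d B x})"
    proof (cases "y ^ q = x \<or> (y ^ q) ^ q = x")
      case True
      have "\<not> (y ^ q = x \<and> (y ^ q) ^ q = x)"
        using cubic by auto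
      then have "nzc (curve d B x) = 2"
        using True cubic(1) x2 unfolding nz by auto
      moreover have "\<not> (\<exists>\<xi>\<in>dirs. curve d B x \<in> plane \<xi>)"
      proof
        assume "\<exists>\<xi>\<in>dirs. curve d B x \<in> plane \<xi>"
        then have "y = x"
          using plane_conjugate[OF G0(1) _ _ G0(2) True] by blast
        then show False
          using True cubic(1) x2 by blast
      qed
      ultimately show ?thesis
        by (simp add: spread_index_span)
    next
      case False
      then have 1: "nzc (curve d B x) = 1"
        using cubic(1) x2 unfolding nz by auto
      moreover have "spread_index q g (vec.span {curve d B x}) = 1"
        using 1 x cubic by (intro spread_index_B) (auto simp: GFq_3_iff)
      ultimately show ?thesis
        by simp
    qed
    ultimately show ?thesis
      by (simp add: good_parameter_def)
  next
    case swap
    have x1: "x ^ q \<noteq> x"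
      using swap(1) by metis
    have "\<not> (\<exists>\<xi>\<in>dirs. curve d B x \<in> plane \<xi>)"
      using plane_parameter_rational[OF G0(1)] swap(1) by blast
    then have s: "spread_index q g (vec.span {curve d B x}) = 2"
      by (simp add: spread_index_span)
    show ?thesis
    proof (cases "(x ^ q) ^ q = x")
      case True
      have "card (range (\<lambda>k. x ^ (q ^ k))) = 2"
      proof (rule card_frobenius_orbit)
        fix m :: nat assume "0 < m" "m < 2"
        then have "m = 1"
          by linarith
        then show "x ^ (q ^ m) \<noteq> x"
          using x1 by simp
      qed (use True it in auto)
      moreover have "y ^ q = x"
        using True swap by metis
      ultimately show ?thesis
        using True s by (simp add: good_parameter_def nz)
    next
      case False
      have six: "(((((x ^ q) ^ q) ^ q) ^ q) ^ q) ^ q = x"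
        using swap by simp
      have y1: "y ^ q \<noteq> x"
        using False six swap by metis
      have y2: "(y ^ q) ^ q \<noteq> x"
        using x1 six swap by metis
      have "card (range (\<lambda>k. x ^ (q ^ k))) = 6"
      proof (rule card_frobenius_orbit)
        fix m :: nat assume "0 < m" "m < 6"
        then have "m = 1 \<or> m = 2 \<or> m = 3 \<or> m = 4 \<or> m = 5"
          by linarith
        then show "x ^ (q ^ m) \<noteq> x"
          using x1 False swap(1,2) y1 y2 it by auto
      qed (use six it in auto)
      moreover have "nzc (curve d B x) = 1"
        using x1 False y1 y2 unfolding nz by auto
      ultimately show ?thesis
        using s by (simp add: good_parameter_def)
    qed
  qed
qed

lemma good_points_B:
  assumes P: "P \<in># nrc_at_infinity d B h"
  shows "good_point q h g P"
proof -
  obtain x where x: "P = vec.span {curve d B x}" "x \<in> {\<alpha>, \<alpha> ^ q, (\<alpha> ^ q) ^ q, \<beta>, \<beta> ^ q, (\<beta> ^ q) ^ q}"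
    using infinite_point_B[OF P] by blast
  have "good_parameter \<alpha>" "good_parameter \<beta>"
    using good_parameter_root by blast+
  then have "good_parameter x"
    using x(2) good_parameter_frob by auto
  moreover have "weight q g P = nzc (curve d B x)"
    using infinite_point_rational[OF P] weight_infinite_point x(1) by simp
  ultimately show ?thesis
    using infinite_point_rational[OF P] by (simp add: good_point_def good_parameter_def orbit_size_B x(1))
qed

lemma three_special_B: "three_special q h g d (nrc_points q d B)"
proof -
  have "B d \<notin> hyperplane h"
    by (simp add: hyperplane_iff c_B_d mv3 M_13)
  moreover have "B d \<in> \<Union> (nrc_points q d B)"
    by (auto simp: nrc_points_curve vec.span_base)
  ultimately show ?thesis
    unfolding three_special_def using B_frame weights_B good_points_B by blast
qed

end

text \<open>The first coordinate of the normalized conic splits over the closure, and a cofactor of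
  its roots gives a 3-special curve, which \<open>curve_B_eq\<close> identifies with the given
  one.\<close>

lemma (in spread_coordinates) param_imp_three_special:
  assumes N: "is_nrc q r N"
    and M: "\<And>i j. M $ i $ j \<in> GFq q 3" "det M \<noteq> 0"
      "{P \<in> N. \<not> P \<subseteq> hyperplane h} = {P \<in> affine_points q h. c ` P \<in> param_conic q M}"
  shows "three_special q h g r N"
proof -
  obtain M' :: "'a ^ 3 ^ 3" where M': "\<And>i j. M' $ i $ j \<in> GFq q 3" "det M' \<noteq> 0" "M' $ 1 $ 3 = 1" "param_conic q M' = param_conic q M"
    using normalize_conic[OF M(1,2)] by blast
  define p where "p = [:M' $ 1 $ 1, M' $ 1 $ 2, M' $ 1 $ 3:]"
  have p: "p \<noteq> 0" "degree p = 2" "lead_coeff p = 1"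
    by (simp_all add: p_def M')
  then have "size (proots p) = 2"
    using factorization_proots(2)[OF p(1)] by simp
  then obtain \<alpha> A where A: "proots p = add_mset \<alpha> A"
    using size_eq_Suc_imp_eq_union[of "proots p" 1] by auto
  then have "size A = 1"
    using \<open>size (proots p) = 2\<close> by simp
  then obtain \<beta> where "proots p = {#\<alpha>, \<beta>#}"
    using A size_1_singleton_mset by blast
  then have ab: "p = lin \<alpha> * lin \<beta>"
    using factorization_proots(1)[OF p(1)] p(3)
    by (simp only: image_mset_add_mset image_mset_empty prod_mset.add_mset prod_mset_empty mult_1_right smult_1_left)
  have "lin \<alpha> * lin \<beta> = [:M' $ 1 $ 1, M' $ 1 $ 2, 1:]"
    by (simp only: p_def M'(3) flip: ab)
  then have "\<exists>G. cofactor \<alpha> \<beta> G"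
    using M'(1) by (intro cofactor_exists conjugate_roots_GFq_3)
  then obtain G where cof: "cofactor \<alpha> \<beta> G"
    by blast
  interpret normalized_conic q K h g c c1 c2 M' \<alpha> \<beta> G
  proof unfold_locales
    show "M' $ i $ j \<in> GFq q 3" for i j
      by (rule M'(1))
    show "[:M' $ 1 $ 1, M' $ 1 $ 2, M' $ 1 $ 3:] = lin \<alpha> * lin \<beta>"
      by (simp only: p_def flip: ab)
  qed (rule M' cof)+
  obtain b where b: "nrc_frame q r b" "N = nrc_points q r b"
    using N by (auto simp: is_nrc_def)
  have "r = d" "nrc_points q r b = nrc_points q d B"
    using curve_B_eq[OF b(1)] M(3) by (simp_all add: b(2) M'(4))
  then show ?thesis
    using three_special_B b(2) by simp
qed

theorem theorem1p2:
  fixes h :: "'a::alg_closed_field ^ 7"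
    and g :: "('a ^ 7) set"
    and \<phi> :: "('a ^ 7) set \<Rightarrow> ('a ^ 3) set"
    and N :: "('a ^ 7) set set"
    and p e q r :: nat
  assumes "prime p" and "CHAR('a) = p" and "e > 0" and "q = p ^ e" and "q \<ge> 8"
    and "h \<in> rat_vecs q 1" and "h \<noteq> 0"
    and "spread_line q h g"
    and "bb_iso q h g \<phi>"
    and "r \<le> 6" and "is_nrc q r N"
  shows "(corresponds_to_Fq_conic q h g \<phi> N \<longrightarrow> three_special q h g r N) \<and>
         (three_special q h g r N \<and>
            \<not> (r = 2 \<and> lies_in_bb_solid q h g N) \<and>
            \<not> (r = 6 \<and> improper_tangent q h g r N)
          \<longrightarrow> corresponds_to_Fq_conic q h g \<phi> N)"
proof -
  interpret frobenius_field q "TYPE('a)"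
  proof
    show "prime CHAR('a)"
      by (simp only: assms)
    show "8 \<le> q"
      by (rule assms)
    show "\<exists>e>0. q = CHAR('a) ^ e"
      by (rule exI[of _ e]) (simp only: assms simp_thms)
  qed
  obtain c c1 c2 where "spread_coordinates q h g c c1 c2"
    using spread_coordinates_exist[OF assms(6,7,8)] by blast
  then interpret spread_coordinates q "TYPE('a)" h g c c1 c2 .
  show ?thesis
    unfolding corresponds_iff[OF assms(9)]
  proof (intro conjI impI)
    assume "\<exists>M. (\<forall>i j. M $ i $ j \<in> GFq q 3) \<and> det M \<noteq> 0 \<and>
      {P \<in> N. \<not> P \<subseteq> hyperplane h} = {P \<in> affine_points q h. c ` P \<in> param_conic q M}"
    then obtain M where "\<And>i j. M $ i $ j \<in> GFq q 3" "det M \<noteq> 0"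
      "{P \<in> N. \<not> P \<subseteq> hyperplane h} = {P \<in> affine_points q h. c ` P \<in> param_conic q M}"
      by blast
    then show "three_special q h g r N"
      by (rule param_imp_three_special[OF assms(11)])
  next
    assume "three_special q h g r N \<and> \<not> (r = 2 \<and> lies_in_bb_solid q h g N) \<and> \<not> (r = 6 \<and> improper_tangent q h g r N)"
    then show "\<exists>M. (\<forall>i j. M $ i $ j \<in> GFq q 3) \<and> det M \<noteq> 0 \<and>
      {P \<in> N. \<not> P \<subseteq> hyperplane h} = {P \<in> affine_points q h. c ` P \<in> param_conic q M}"
      by (intro three_special_imp_param[OF assms(10)]) simp_all
  qed
qed

end
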